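(* Let $F\subset\mathbb{R}^3$ be a foam with $0\in F$, let $R>0$ be such that every edge of $F$ meets $\partial D_R(0)$ transversally, and let $D_R(0)=F\cap B_R(0)$. Then for any smooth vector field $X$ of $\mathbb{R}^3$ defined on $B_R(0)$ (smooth up to the boundary sphere), $$\int_{D_R(0)}\operatorname{div} X_F\, dA=\int_{\partial D_R(0)}\langle X,\nu_F\rangle\, dL,$$ where $$\int_{\partial D_R(0)}\langle X,\nu_F\rangle\, dL:=\sum_{i=1}^{f_R}\int_{F_i\cap\partial B_R(0)}\langle X,\nu_i^R\rangle\, dL_i .$$
   Context: A foam is a cell decomposition of Euclidean space $\mathbb{R}^3$ into a finite or infinite number of properly embedded, connected three-dimensional chambers (cells), not assumed compact or homeomorphic to a ball, which satisfies the Plateau rules: (1) the interfaces (faces) between neighbouring chambers are smooth orientable embedded surfaces of constant mean curvature; (2) the faces meet in threes, at equal angles $2\pi/3$, along smooth curves called edges; (3) the edges meet four at a time at isolated points called vertices, where the angle between any pair of edges is $\arccos(-1/3)$. The foam is identified with the union $F\subset\mathbb{R}^3$ of its faces, edges and vertices. $B_R(0)$ is the open Euclidean ball of radius $R$ centered at $0$, and $\partial D_R(0)=F\cap\{x\in\mathbb{R}^3: |x|=R\}$. The extrinsic disc $D_R(0)$ is composed of a finite number $f_R$ of faces $F_1,\dots,F_{f_R}$ (the pieces of faces of $F$ lying in the ball, each a smooth surface with boundary), a finite number of edges and a finite number of vertices. For a unit normal field $n_i$ of $F_i$, the tangential part of $X$ on $F_i$ is $X_{F_i}:=X-\langle X,n_i\rangle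 n_i$, and $X_F$ is defined away from the edges and vertices by $X_F(x)=X_{F_i}(x)$ for $x\in F_i$. The left-hand integral means $\int_{D_R(0)}\operatorname{div}X_F\,dA:=\sum_{i=1}^{f_R}\int_{F_i}\operatorname{div}X_{F_i}\,dA_i$, with $\operatorname{div}$ the intrinsic divergence on the surface $F_i$ and $dA_i$ its area element. $\nu_i^R$ is the outward unit conormal (tangent to $F_i$, normal to the boundary curve) of $F_i$ along $F_i\cap\partial B_R(0)$, with the convention $\nu_i^R=0$ if $F_i\cap\partial B_R(0)=\emptyset$; $dL_i$ is arc length. *)

theory Defs
  imports "HOL-Analysis.Analysis"
begin

section \<open>Smooth maps\<close>

(* Meaningful for open U only. *)
fun Ck_on :: "nat \<Rightarrow> ('a::real_normed_vector \<Rightarrow> 'b::real_normed_vector) \<Rightarrow> 'a set \<Rightarrow> bool" where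
  "Ck_on 0 f U \<longleftrightarrow> continuous_on U f"
| "Ck_on (Suc k) f U \<longleftrightarrow>
     (\<forall>x\<in>U. f differentiable (at x)) \<and> (\<forall>v. Ck_on k (\<lambda>x. frechet_derivative f (at x) v) U)"

definition smooth_on :: "('a::real_normed_vector \<Rightarrow> 'b::real_normed_vector) \<Rightarrow> 'a set \<Rightarrow> bool" where
  "smooth_on f U \<longleftrightarrow> (\<forall>k. Ck_on k f U)"

(* Smoothness on a set that need not be open, such as a closed ball. *)
definition smooth_upto :: "('a::real_normed_vector \<Rightarrow> 'b::real_normed_vector) \<Rightarrow> 'a set \<Rightarrow> bool" where
  "smooth_upto f A \<longleftrightarrow> (\<exists>U g. open U \<and> A \<subseteq> U \<and> smooth_on g U \<and> (\<forall>x\<in>A. g x = f x))"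

section \<open>Embedded surfaces with boundary and corners\<close>

definition half_plane :: "(real^2) set" where
  "half_plane = {u. 0 \<le> u $ 1}"

definition quadrant :: "(real^2) set" where
  "quadrant = {u. 0 \<le> u $ 1 \<and> 0 \<le> u $ 2}"

(* \<phi> is a C^1 immersion of W whose restriction to W \<inter> M is a homeomorphism onto a relatively
   open part of S; M is the plane, the half plane or the quadrant. *)
definition local_param ::
  "(real^2) set \<Rightarrow> (real^3) set \<Rightarrow> (real^2) set \<Rightarrow> (real^2 \<Rightarrow> real^3) \<Rightarrow> bool" where
  "local_param M S W \<phi> \<longleftrightarrow>
     open W \<and> Ck_on 1 \<phi> W \<and> (\<forall>u\<in>W. inj (frechet_derivative \<phi> (at u))) \<and>
     (\<exists>U \<psi>. open U \<and> homeomorphism (W \<inter> M) (S \<inter> U) \<phi> \<psi>)"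

definition regular_points :: "(real^3) set \<Rightarrow> (real^3) set" where
  "regular_points S = {p. \<exists>W \<phi>. local_param UNIV S W \<phi> \<and> smooth_on \<phi> W \<and> p \<in> \<phi> ` W}"

definition boundary_point :: "(real^3) set \<Rightarrow> real^3 \<Rightarrow> bool" where
  "boundary_point S p \<longleftrightarrow>
     (\<exists>W \<phi>. local_param half_plane S W \<phi> \<and> smooth_on \<phi> W \<and> 0 \<in> W \<and> \<phi> 0 = p)"

(* At a corner only C^1 is required: the faces of a foam are in general not better than
   C^(1,\<alpha>) at its vertices. *)
definition corner_point :: "(real^3) set \<Rightarrow> real^3 \<Rightarrow> bool" where
  "corner_point S p \<longleftrightarrow> (\<exists>W \<phi>. local_param quadrant S W \<phi> \<and> 0 \<in> W \<and> \<phi> 0 = p)"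

definition surface_with_boundary :: "(real^3) set \<Rightarrow> bool" where
  "surface_with_boundary S \<longleftrightarrow> (\<forall>p\<in>S. p \<in> regular_points S \<or> boundary_point S p)"

definition surface_with_corners :: "(real^3) set \<Rightarrow> bool" where
  "surface_with_corners S \<longleftrightarrow>
     (\<forall>p\<in>S. p \<in> regular_points S \<or> boundary_point S p \<or> corner_point S p)"

definition surface_boundary :: "(real^3) set \<Rightarrow> (real^3) set" where
  "surface_boundary S = S - regular_points S"

section \<open>Tangent spaces, conormals and divergence\<close>

(* One-sided velocities of curves in S issuing from p: a half plane at a boundary point of a
   surface, a sector at a corner. *)
definition tangent_cone :: "(real^3) set \<Rightarrow> real^3 \<Rightarrow> (real^3) set" where
  "tangent_cone S p =
     {v. \<exists>\<gamma> \<epsilon>. 0 < (\<epsilon>::real) \<and> \<gamma> 0 = p \<and> \<gamma> ` {0..<\<epsilon>} \<subseteq> S \<and>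
          (\<gamma> has_vector_derivative v) (at 0 within {0..})}"

definition tangent_space :: "(real^3) set \<Rightarrow> real^3 \<Rightarrow> (real^3) set" where
  "tangent_space S p = span (tangent_cone S p)"

definition transversal_at :: "(real^3) set \<Rightarrow> (real^3) set \<Rightarrow> real^3 \<Rightarrow> bool" where
  "transversal_at A B p \<longleftrightarrow> {a + b |a b. a \<in> tangent_space A p \<and> b \<in> tangent_space B p} = UNIV"

definition unit_normal_field :: "(real^3) set \<Rightarrow> (real^3 \<Rightarrow> real^3) \<Rightarrow> bool" where
  "unit_normal_field S n \<longleftrightarrow> continuous_on S n \<and>
     (\<forall>p\<in>S. norm (n p) = 1 \<and> (\<forall>v\<in>tangent_space S p. n p \<bullet> v = 0))"

definition is_outward_conormal :: "(real^3) set \<Rightarrow> real^3 \<Rightarrow> real^3 \<Rightarrow> bool" where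
  "is_outward_conormal S p \<nu> \<longleftrightarrow>
     \<nu> \<in> tangent_space S p \<and> norm \<nu> = 1 \<and>
     (\<forall>v\<in>tangent_space (surface_boundary S) p. \<nu> \<bullet> v = 0) \<and> - \<nu> \<in> tangent_cone S p"

(* Zero where there is no conormal, that is, at corners and at interior points of S. *)
definition outward_conormal :: "(real^3) set \<Rightarrow> real^3 \<Rightarrow> real^3" where
  "outward_conormal S p =
     (if \<exists>!\<nu>. is_outward_conormal S p \<nu> then THE \<nu>. is_outward_conormal S p \<nu> else 0)"

definition tangential_part :: "(real^3 \<Rightarrow> real^3) \<Rightarrow> (real^3 \<Rightarrow> real^3) \<Rightarrow> real^3 \<Rightarrow> real^3" where
  "tangential_part n X p = X p - (X p \<bullet> n p) *\<^sub>R n p"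

(* The sum of <D_e Y, e> over an orthonormal basis e of the tangent plane. For tangential Y the
   tangential part of D_e Y is the Levi-Civita derivative, so this is the intrinsic divergence.
   The derivative within S is determined only on the tangent plane, and only its values there
   are used. *)
definition surface_div :: "(real^3) set \<Rightarrow> (real^3 \<Rightarrow> real^3) \<Rightarrow> real^3 \<Rightarrow> real" where
  "surface_div S Y p =
     (let L = frechet_derivative Y (at p within S);
          B = (SOME B. pairwise orthogonal B \<and> (\<forall>e\<in>B. norm e = 1) \<and> span B = tangent_space S p)
      in \<Sum>e\<in>B. L e \<bullet> e)"

definition mean_curvature :: "(real^3) set \<Rightarrow> (real^3 \<Rightarrow> real^3) \<Rightarrow> real^3 \<Rightarrow> real" where
  "mean_curvature S n p = - surface_div S n p / 2"

section \<open>Area and arc length\<close>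

definition area_density :: "(real^2 \<Rightarrow> real^3) \<Rightarrow> real^2 \<Rightarrow> real" where
  "area_density \<phi> u =
     norm (cross3 (frechet_derivative \<phi> (at u) (axis 1 1)) (frechet_derivative \<phi> (at u) (axis 2 1)))"

definition is_area_measure :: "(real^3) set \<Rightarrow> (real^3) measure \<Rightarrow> bool" where
  "is_area_measure S \<mu> \<longleftrightarrow>
     sets \<mu> = sets borel \<and> emeasure \<mu> (- regular_points S) = 0 \<and>
     (\<forall>W \<phi>. local_param UNIV S W \<phi> \<and> smooth_on \<phi> W \<longrightarrow>
        (\<forall>B\<in>sets borel. B \<subseteq> \<phi> ` W \<longrightarrow>
           emeasure \<mu> B = (\<integral>\<^sup>+u\<in>W \<inter> \<phi> -` B. ennreal (area_density \<phi> u) \<partial>lborel)))"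

(* If S is a Borel set, there is exactly one such measure: countably many parametrizations
   cover the regular points. *)
definition area_measure :: "(real^3) set \<Rightarrow> (real^3) measure" where
  "area_measure S = (SOME \<mu>. is_area_measure S \<mu>)"

(* The boundary has no area. It is left out because the integrand need not make sense at corners. *)
definition surface_integral :: "(real^3) set \<Rightarrow> (real^3 \<Rightarrow> real) \<Rightarrow> real" where
  "surface_integral S f = (LINT x:regular_points S|area_measure S. f x)"

definition curve_param :: "(real^3) set \<Rightarrow> real set \<Rightarrow> (real \<Rightarrow> real^3) \<Rightarrow> bool" where
  "curve_param C W \<gamma> \<longleftrightarrow>
     open W \<and> smooth_on \<gamma> W \<and> (\<forall>t\<in>W. vector_derivative \<gamma> (at t) \<noteq> 0) \<and>
     (\<exists>U \<psi>. open U \<and> homeomorphism W (C \<inter> U) \<gamma> \<psi>)"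

definition curve_points :: "(real^3) set \<Rightarrow> (real^3) set" where
  "curve_points C = {p. \<exists>W \<gamma>. curve_param C W \<gamma> \<and> p \<in> \<gamma> ` W}"

definition is_arc_length_measure :: "(real^3) set \<Rightarrow> (real^3) measure \<Rightarrow> bool" where
  "is_arc_length_measure C \<mu> \<longleftrightarrow>
     sets \<mu> = sets borel \<and> emeasure \<mu> (- curve_points C) = 0 \<and>
     (\<forall>W \<gamma>. curve_param C W \<gamma> \<longrightarrow>
        (\<forall>B\<in>sets borel. B \<subseteq> \<gamma> ` W \<longrightarrow>
           emeasure \<mu> B = (\<integral>\<^sup>+t\<in>W \<inter> \<gamma> -` B. ennreal (norm (vector_derivative \<gamma> (at t))) \<partial>lborel)))"

definition arc_length_measure :: "(real^3) set \<Rightarrow> (real^3) measure" where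
  "arc_length_measure C = (SOME \<mu>. is_arc_length_measure C \<mu>)"

section \<open>Foams\<close>

definition angle :: "real^3 \<Rightarrow> real^3 \<Rightarrow> real" where
  "angle u v = arccos (u \<bullet> v / (norm u * norm v))"

(* Near an edge point F consists of three smooth sheets S 0, S 1, S 2 with common boundary curve
   \<Gamma>; the angle between two sheets is the angle between their conormals. *)
definition edge_points :: "(real^3) set \<Rightarrow> (real^3) set" where
  "edge_points F =
     {p. \<exists>U \<Gamma>. \<exists>S :: nat \<Rightarrow> (real^3) set.
        open U \<and> p \<in> U \<and> p \<in> \<Gamma> \<and> F \<inter> U = (\<Union>k<3. S k) \<and>
        (\<forall>k<3. surface_with_boundary (S k) \<and> surface_boundary (S k) = \<Gamma>) \<and>
        (\<forall>j<3. \<forall>k<3. j \<noteq> k \<longrightarrow> S j \<inter> S k = \<Gamma> \<and>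
           (\<forall>q\<in>\<Gamma>. angle (outward_conormal (S j) q) (outward_conormal (S k) q) = 2 * pi / 3))}"

(* Near a vertex F consists of six sectors, one for each pair of the four edges issuing from it. *)
definition vertices :: "(real^3) set \<Rightarrow> (real^3) set" where
  "vertices F =
     {v. \<exists>U. \<exists>\<gamma> :: nat \<Rightarrow> real \<Rightarrow> real^3. \<exists>S :: nat \<Rightarrow> nat \<Rightarrow> (real^3) set.
        open U \<and> v \<in> U \<and>
        (\<forall>i<4. \<gamma> i 0 = v \<and> Ck_on 1 (\<gamma> i) {-1<..<1} \<and> inj_on (\<gamma> i) {0..<1} \<and>
           (\<forall>t\<in>{0..<1}. vector_derivative (\<gamma> i) (at t) \<noteq> 0) \<and> \<gamma> i ` {0<..<1} \<subseteq> edge_points F) \<and>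
        (\<forall>i<4. \<forall>j<4. i \<noteq> j \<longrightarrow>
           angle (vector_derivative (\<gamma> i) (at 0)) (vector_derivative (\<gamma> j) (at 0)) = arccos (- 1 / 3)) \<and>
        F \<inter> U = (\<Union>j<4. \<Union>i<j. S i j) \<and>
        (\<forall>j<4. \<forall>i<j. surface_with_corners (S i j) \<and>
           surface_boundary (S i j) = \<gamma> i ` {0..<1} \<union> \<gamma> j ` {0..<1}) \<and>
        (\<forall>j<4. \<forall>i<j. \<forall>l<4. \<forall>k<l. (i, j) \<noteq> (k, l) \<longrightarrow>
           S i j \<inter> S k l = {v} \<union> (\<Union>m\<in>{i, j} \<inter> {k, l}. \<gamma> m ` {0..<1}))}"

(* Faces and edges are taken without their boundary. *)
definition faces :: "(real^3) set \<Rightarrow> (real^3) set set" where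
  "faces F = components (regular_points F)"

definition edges :: "(real^3) set \<Rightarrow> (real^3) set set" where
  "edges F = components (edge_points F)"

definition chambers :: "(real^3) set \<Rightarrow> (real^3) set set" where
  "chambers F = components (- F)"

definition foam :: "(real^3) set \<Rightarrow> bool" where
  "foam F \<longleftrightarrow>
     closed F \<and> F = regular_points F \<union> edge_points F \<union> vertices F \<and>
     (\<forall>f\<in>faces F.
        (\<exists>n. unit_normal_field f n \<and> (\<exists>H. \<forall>p\<in>f. mean_curvature f n p = H)) \<and>
        (\<exists>C\<in>chambers F. \<exists>C'\<in>chambers F. C \<noteq> C' \<and> f \<subseteq> frontier C \<inter> frontier C'))"

(* The surfaces F_1, F_2, ... that make up the part of F in the ball, with their boundary. *)
definition disc_faces :: "(real^3) set \<Rightarrow> real \<Rightarrow> (real^3) set set" where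
  "disc_faces F R = closure ` components (\<Union> (faces F) \<inter> ball 0 R)"

end

theory Submission
  imports Defs
begin

text \<open>
The identity is the sum over the pieces $S$ of the disc of the divergence theorem
$\int_S \mathrm{div}\, X_S = \int_{\partial S} \langle X, \nu_S\rangle$. In a chart
$\mathrm{div}\, X_S$ times the area density is an ordinary divergence, because the mixed partial
derivatives of the chart cancel; this settles fields supported near a regular point or a smooth
boundary point, and a partition of unity settles fields vanishing near the corners. The corners are
finite in number, and they are removed by cut-offs at scale $\epsilon$: the gradient $1/\epsilon$
is integrated over a region of area $O(\epsilon^2)$, while the normal part of $X$ only contributes
through the mean curvature, which is constant and hence bounded.

Inside the ball, $\partial S$ consists of edge points and of countably many other points, which
carry no arc length. Near an edge point exactly three distinct pieces meet, with a common boundary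
curve, and their conormals, unit vectors at mutual angles $2\pi/3$, sum to zero. So the fluxes
through the edges cancel and only the part of $\partial S$ on the sphere remains.
\<close>

section \<open>Maps of class C1\<close>

text \<open>Two features of the definitions shape the proof. Area and arc length are chosen by
  \<open>SOME\<close> from conditions on smooth parametrizations, while a corner comes with a C1
  chart only. Hence compatibility under change of variables is proved for all C1 charts: it yields
  both the existence of the measures and the O(\<epsilon>^2) bound for the area near a corner.
  Secondly, whether a point is regular, a boundary point or a corner is decided by a first-order
  invariant, its tangent cone: a plane, a half plane, or a sector that contains no line. The same
  invariant separates the pieces at an edge: a piece is a surface with corners, so its tangent cone
  lies in a plane, and it cannot contain two sheets that meet at the angle 2\<pi>/3. Without this
  the three sheets could belong to fewer than three pieces, and the conormals of the pieces would
  not be those of the sheets. Curvature enters since a C1 corner chart gives no bound on second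
  derivatives; the trace of the second fundamental form is the only second-order quantity of the
  surface that is bounded.\<close>

definition C1_on :: "('a::real_normed_vector \<Rightarrow> 'b::real_normed_vector) \<Rightarrow> 'a set \<Rightarrow> bool" where
  "C1_on f U \<longleftrightarrow> Ck_on 1 f U"

lemma C1_on_iff:
  "C1_on f U \<longleftrightarrow> (\<forall>x\<in>U. f differentiable (at x)) \<and>
     (\<forall>v. continuous_on U (\<lambda>x. frechet_derivative f (at x) v))"
  by (simp only: C1_on_def One_nat_def Ck_on.simps)

lemma C1_onI:
  assumes "\<And>x. x \<in> U \<Longrightarrow> (f has_derivative f' x) (at x)"
    and "\<And>v. continuous_on U (\<lambda>x. f' x v)"
  shows "C1_on f U"
proof -
  have eq: "frechet_derivative f (at x) = f' x" if "x \<in> U" for x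
    using frechet_derivative_at[OF assms(1)[OF that]] by simp
  show ?thesis
    unfolding C1_on_iff
    using assms eq by (auto simp: differentiable_def cong: continuous_on_cong)
qed

lemma C1_on_has_derivative:
  "C1_on f U \<Longrightarrow> x \<in> U \<Longrightarrow> (f has_derivative frechet_derivative f (at x)) (at x)"
  unfolding C1_on_iff frechet_derivative_works by blast

lemma C1_on_continuous: "C1_on f U \<Longrightarrow> continuous_on U f"
  by (meson C1_on_has_derivative continuous_at_imp_continuous_on has_derivative_continuous)

lemma C1_on_continuous_deriv: "C1_on f U \<Longrightarrow> continuous_on U (\<lambda>x. frechet_derivative f (at x) v)"
  unfolding C1_on_iff by blast

lemma Ck_on_subset: "Ck_on k f U \<Longrightarrow> V \<subseteq> U \<Longrightarrow> Ck_on k f V"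
  by (induction k arbitrary: f) (auto intro: continuous_on_subset)

lemma smooth_on_C1: "smooth_on f U \<Longrightarrow> C1_on f U"
  by (simp add: smooth_on_def C1_on_def)

lemma C1_on_subset: "C1_on f U \<Longrightarrow> V \<subseteq> U \<Longrightarrow> C1_on f V"
  unfolding C1_on_def by (rule Ck_on_subset)

lemma smooth_on_subset: "smooth_on f U \<Longrightarrow> V \<subseteq> U \<Longrightarrow> smooth_on f V"
  by (auto simp: smooth_on_def intro: Ck_on_subset)

lemma smooth_on_frechet_derivative:
  "smooth_on f U \<Longrightarrow> smooth_on (\<lambda>x. frechet_derivative f (at x) v) U"
  unfolding smooth_on_def by (metis Ck_on.simps(2))

text \<open>The derivative at a point of an open set sees only the values in that set, so agreement
  on \<open>U\<close> passes to all derivatives.\<close>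

lemma Ck_on_cong:
  assumes "open U" "\<And>x. x \<in> U \<Longrightarrow> f x = g x" "Ck_on k f U"
  shows "Ck_on k g U"
  using assms(2,3)
proof (induction k arbitrary: f g)
  case 0
  then show ?case by (simp cong: continuous_on_cong)
next
  case (Suc k)
  have d: "(g has_derivative frechet_derivative f (at x)) (at x)" if "x \<in> U" for x
    using has_derivative_transform_within_open[OF _ assms(1) that Suc.prems(1)] Suc.prems(2) that
    by (auto simp: frechet_derivative_works)
  then have "frechet_derivative f (at x) = frechet_derivative g (at x)" if "x \<in> U" for x
    using frechet_derivative_at[OF d[OF that]] that by simp
  then have "Ck_on k (\<lambda>x. frechet_derivative g (at x) v) U" for v
    using Suc.IH[of "\<lambda>x. frechet_derivative f (at x) v" "\<lambda>x. frechet_derivative g (at x) v"] Suc.prems(2)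
    by simp
  with d show ?case by (auto simp: differentiable_def)
qed

text \<open>A derivative of \<open>f\<close> after an affine map is again a function of this form,
  with \<open>f\<close> replaced by a directional derivative, so the induction closes without a
  chain rule of higher order. The two uses are translations of charts and restrictions of plane
  charts to a coordinate line.\<close>

lemma Ck_on_affine:
  assumes "bounded_linear \<iota>" "open U" "Ck_on k f U"
  shows "Ck_on k (\<lambda>x. f (c + \<iota> x)) ((\<lambda>x. c + \<iota> x) -` U)"
  using assms(3)
proof (induction k arbitrary: f)
  case 0
  have "continuous_on ((\<lambda>x. c + \<iota> x) -` U) (\<lambda>x. c + \<iota> x)"
    by (rule continuous_on_add[OF continuous_on_const linear_continuous_on[OF assms(1)]])
  with 0 show ?case
    using continuous_on_compose2[of U f "(\<lambda>x. c + \<iota> x) -` U" "\<lambda>x. c + \<iota> x"] by auto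
next
  case (Suc k)
  let ?g = "\<lambda>x. c + \<iota> x" and ?V = "(\<lambda>x. c + \<iota> x) -` U"
  have opn: "open ?V"
    by (rule open_vimage[OF assms(2) continuous_on_add[OF continuous_on_const linear_continuous_on[OF assms(1)]]])
  have d: "((\<lambda>x. f (?g x)) has_derivative (\<lambda>v. frechet_derivative f (at (?g x)) (\<iota> v))) (at x)"
    if "x \<in> ?V" for x
  proof -
    have "(?g has_derivative \<iota>) (at x)"
      using bounded_linear_imp_has_derivative[OF assms(1)]
      by (auto intro!: derivative_eq_intros)
    moreover have "(f has_derivative frechet_derivative f (at (?g x))) (at (?g x))"
      using Suc.prems that by (auto simp: frechet_derivative_works)
    ultimately show ?thesis
      using diff_chain_at by (fastforce simp: o_def)
  qed
  have "Ck_on k (\<lambda>x. frechet_derivative (\<lambda>x. f (?g x)) (at x) v) ?V" for v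
  proof (rule Ck_on_cong[OF opn])
    show "Ck_on k (\<lambda>x. frechet_derivative f (at (?g x)) (\<iota> v)) ?V"
      using Suc.IH[of "\<lambda>y. frechet_derivative f (at y) (\<iota> v)"] Suc.prems by simp
  qed (use frechet_derivative_at[OF d] in metis)
  with d show ?case by (auto simp: differentiable_def)
qed

lemma smooth_on_affine:
  "bounded_linear \<iota> \<Longrightarrow> open U \<Longrightarrow> smooth_on f U \<Longrightarrow>
    smooth_on (\<lambda>x. f (c + \<iota> x)) ((\<lambda>x. c + \<iota> x) -` U)"
  by (auto simp: smooth_on_def intro: Ck_on_affine)

section \<open>Products, composites and quotients of C1 maps\<close>

lemma C1_on_bilinear:
  assumes "bounded_bilinear mul" "C1_on f U" "C1_on g U"
  shows "C1_on (\<lambda>x. mul (f x) (g x)) U"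
proof -
  interpret bounded_bilinear mul by fact
  show ?thesis
  proof (rule C1_onI)
    show "((\<lambda>x. mul (f x) (g x)) has_derivative
        (\<lambda>v. mul (f x) (frechet_derivative g (at x) v) + mul (frechet_derivative f (at x) v) (g x))) (at x)"
      if "x \<in> U" for x
      using C1_on_has_derivative[OF assms(2) that] C1_on_has_derivative[OF assms(3) that]
      by (rule FDERIV)
    show "continuous_on U (\<lambda>x. mul (f x) (frechet_derivative g (at x) v)
         + mul (frechet_derivative f (at x) v) (g x))" for v
      by (intro continuous_intros continuous_on assms C1_on_continuous C1_on_continuous_deriv)
  qed
qed

text \<open>\<open>C1_on\<close> gives continuity of the derivative for each fixed direction. In a
  composite the direction varies with the point; expanding it in the basis reduces this case to the
  fixed directions.\<close>

lemma frechet_expand: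
  fixes f :: "'a::euclidean_space \<Rightarrow> 'b::real_normed_vector"
  assumes "C1_on f U" "x \<in> U"
  shows "frechet_derivative f (at x) v = (\<Sum>b\<in>Basis. (v \<bullet> b) *\<^sub>R frechet_derivative f (at x) b)"
proof -
  have "linear (frechet_derivative f (at x))"
    using C1_on_has_derivative[OF assms] has_derivative_linear by blast
  then have "frechet_derivative f (at x) (\<Sum>b\<in>Basis. (v \<bullet> b) *\<^sub>R b) = (\<Sum>b\<in>Basis. (v \<bullet> b) *\<^sub>R frechet_derivative f (at x) b)"
    by (simp add: linear_sum linear_cmul)
  then show ?thesis by (simp add: euclidean_representation)
qed

lemma C1_on_compose:
  fixes g :: "'b::euclidean_space \<Rightarrow> 'c::real_normed_vector"
  assumes f: "C1_on f U" and g: "C1_on g V" and "f ` U \<subseteq> V"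
  shows "C1_on (\<lambda>x. g (f x)) U"
proof (rule C1_onI)
  show "((\<lambda>x. g (f x)) has_derivative
     (\<lambda>v. \<Sum>b\<in>Basis. (frechet_derivative f (at x) v \<bullet> b) *\<^sub>R frechet_derivative g (at (f x)) b)) (at x)"
    if "x \<in> U" for x
  proof -
    have fx: "f x \<in> V" using that assms by auto
    have "((\<lambda>x. g (f x)) has_derivative (\<lambda>v. frechet_derivative g (at (f x)) (frechet_derivative f (at x) v))) (at x)"
      using diff_chain_at[OF C1_on_has_derivative[OF f that] C1_on_has_derivative[OF g fx]]
      by (simp add: o_def)
    then show ?thesis by (subst (asm) frechet_expand[OF g fx])
  qed
  show "continuous_on U (\<lambda>x. \<Sum>b\<in>Basis. (frechet_derivative f (at x) v \<bullet> b) *\<^sub>R frechet_derivative g (at (f x)) b)" for v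
    by (intro continuous_intros C1_on_continuous_deriv[OF f]
        continuous_on_compose2[OF C1_on_continuous_deriv[OF g] C1_on_continuous[OF f]] assms)
qed

lemma C1_on_const: "C1_on (\<lambda>x. c) U"
  by (rule C1_onI[of _ _ "\<lambda>_ _. 0"]) auto

lemma C1_on_linear: "bounded_linear f \<Longrightarrow> C1_on f U"
  by (rule C1_onI[of _ _ "\<lambda>_. f"]) (auto intro: bounded_linear_imp_has_derivative)

lemma C1_on_add:
  assumes "C1_on f U" "C1_on g U" shows "C1_on (\<lambda>x. f x + g x) U"
  by (rule C1_onI[OF has_derivative_add[OF C1_on_has_derivative[OF assms(1)] C1_on_has_derivative[OF assms(2)]]])
     (auto intro!: continuous_intros C1_on_continuous_deriv assms)

lemma C1_on_minus:
  assumes "C1_on f U" shows "C1_on (\<lambda>x. - f x) U"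
  by (rule C1_onI[OF has_derivative_minus[OF C1_on_has_derivative[OF assms(1)]]])
     (auto intro!: continuous_intros C1_on_continuous_deriv assms)

lemma C1_on_diff:
  assumes "C1_on f U" "C1_on g U" shows "C1_on (\<lambda>x. f x - g x) U"
  using C1_on_add[OF assms(1) C1_on_minus[OF assms(2)]] by simp

lemma C1_on_sum:
  assumes "\<And>i. i \<in> I \<Longrightarrow> C1_on (f i) U" shows "C1_on (\<lambda>x. \<Sum>i\<in>I. f i x) U"
  using assms by (induction I rule: infinite_finite_induct) (auto intro: C1_on_const C1_on_add)

lemmas C1_on_scaleR = C1_on_bilinear[OF bounded_bilinear_scaleR]
lemmas C1_on_inner = C1_on_bilinear[OF bounded_bilinear_inner]

lemma C1_on_inverse_norm:
  fixes f :: "'a::real_normed_vector \<Rightarrow> 'b::euclidean_space"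
  assumes "C1_on f U" "\<And>x. x \<in> U \<Longrightarrow> f x \<noteq> 0"
  shows "C1_on (\<lambda>x. inverse (norm (f x))) U"
proof -
  have "C1_on (\<lambda>y::'b. inverse (norm y)) (- {0})"
  proof (rule C1_onI)
    show "((\<lambda>y::'b. inverse (norm y)) has_derivative (\<lambda>h. - (inverse (norm x) * (sgn x \<bullet> h) * inverse (norm x)))) (at x)"
      if "x \<in> - {0}" for x
      using has_derivative_compose[OF has_derivative_norm has_derivative_inverse', of x] that
      by (auto simp: inner_commute)
    show "continuous_on (- {0}) (\<lambda>x::'b. - (inverse (norm x) * (sgn x \<bullet> v) * inverse (norm x)))" for v
      by (auto intro!: continuous_intros)
  qed
  from C1_on_compose[OF assms(1) this] show ?thesis using assms(2) by (metis (no_types, lifting) ComplI image_subsetI singletonD)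
qed

lemma C1_on_inverse:
  fixes f :: "'a::real_normed_vector \<Rightarrow> real"
  assumes "C1_on f U" "\<And>x. x \<in> U \<Longrightarrow> f x \<noteq> 0"
  shows "C1_on (\<lambda>x. inverse (f x)) U"
proof -
  have "C1_on (\<lambda>y::real. inverse y) (- {0})"
  proof (rule C1_onI)
    show "((\<lambda>y::real. inverse y) has_derivative (\<lambda>h. - (inverse x * h * inverse x))) (at x)"
      if "x \<in> - {0}" for x
      using that by (auto intro!: derivative_eq_intros)
    show "continuous_on (- {0}) (\<lambda>x::real. - (inverse x * v * inverse x))" for v
      by (auto intro!: continuous_intros)
  qed
  from C1_on_compose[OF assms(1) this] show ?thesis using assms(2) by (metis (no_types, lifting) ComplI image_subsetI singletonD)
qed

lemma bounded_bilinear_cross3: "bounded_bilinear cross3"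
  using bilinear_cross bilinear_conv_bounded_bilinear by blast

lemmas C1_on_cross3 = C1_on_bilinear[OF bounded_bilinear_cross3]

section \<open>Charts\<close>

text \<open>One notion for parameter domains of every dimension and for any model set
  \<open>M\<close>: curves, plane pieces, half planes, quadrants, and the boundary line of the half
  plane, for which the plane chart itself serves as a chart of a curve.\<close>

definition C1_chart ::
  "'a::euclidean_space set \<Rightarrow> 'b::euclidean_space set \<Rightarrow> 'a set \<Rightarrow> ('a \<Rightarrow> 'b) \<Rightarrow> bool" where
  "C1_chart M S W \<phi> \<longleftrightarrow>
     open W \<and> C1_on \<phi> W \<and> (\<forall>u\<in>W. inj (frechet_derivative \<phi> (at u))) \<and>
     (\<exists>U \<psi>. open U \<and> homeomorphism (W \<inter> M) (S \<inter> U) \<phi> \<psi>)"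

lemma local_param_iff: "local_param M S W \<phi> \<longleftrightarrow> C1_chart M S W \<phi>"
  by (simp add: local_param_def C1_chart_def C1_on_def)

lemma curve_param_C1_chart:
  assumes "curve_param C W \<gamma>"
  shows "C1_chart UNIV C W \<gamma>"
proof -
  from assms have W: "open W" and sm: "smooth_on \<gamma> W"
    and v: "\<And>t. t \<in> W \<Longrightarrow> vector_derivative \<gamma> (at t) \<noteq> 0"
    and h: "\<exists>U \<psi>. open U \<and> homeomorphism W (C \<inter> U) \<gamma> \<psi>"
    unfolding curve_param_def by auto
  have "inj (frechet_derivative \<gamma> (at t))" if "t \<in> W" for t
  proof -
    have d: "(\<gamma> has_derivative frechet_derivative \<gamma> (at t)) (at t)"
      using C1_on_has_derivative[OF smooth_on_C1[OF sm] that] .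
    then have "(\<gamma> has_vector_derivative vector_derivative \<gamma> (at t)) (at t)"
      by (meson differentiableI vector_derivative_works)
    then have "frechet_derivative \<gamma> (at t) = (\<lambda>x. x *\<^sub>R vector_derivative \<gamma> (at t))"
      using frechet_derivative_at unfolding has_vector_derivative_def by metis
    then show ?thesis using v[OF that] by (auto intro: injI)
  qed
  with W sm h show ?thesis
    unfolding C1_chart_def by (auto intro: smooth_on_C1)
qed

lemma C1_chart_open: "C1_chart M S W \<phi> \<Longrightarrow> open W"
  by (simp add: C1_chart_def)

lemma C1_chart_C1: "C1_chart M S W \<phi> \<Longrightarrow> C1_on \<phi> W"
  by (simp add: C1_chart_def)

lemma C1_chart_continuous: "C1_chart M S W \<phi> \<Longrightarrow> continuous_on W \<phi>"
  by (simp add: C1_chart_def C1_on_continuous)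

lemma C1_chart_deriv:
  assumes "C1_chart M S W \<phi>" "u \<in> W"
  shows "(\<phi> has_derivative frechet_derivative \<phi> (at u)) (at u)"
    "inj (frechet_derivative \<phi> (at u))" "linear (frechet_derivative \<phi> (at u))"
proof -
  show d: "(\<phi> has_derivative frechet_derivative \<phi> (at u)) (at u)"
    using assms C1_on_has_derivative by (auto simp: C1_chart_def)
  show "inj (frechet_derivative \<phi> (at u))"
    using assms by (auto simp: C1_chart_def)
  show "linear (frechet_derivative \<phi> (at u))"
    using d has_derivative_linear by blast
qed

lemma C1_chartE:
  assumes "C1_chart M S W \<phi>"
  obtains U \<psi> where "open U" "\<And>u. u \<in> W \<Longrightarrow> u \<in> M \<Longrightarrow> \<phi> u \<in> S \<and> \<phi> u \<in> U \<and> \<psi> (\<phi> u) = u"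
    "\<And>q. q \<in> S \<Longrightarrow> q \<in> U \<Longrightarrow> \<psi> q \<in> W \<and> \<psi> q \<in> M \<and> \<phi> (\<psi> q) = q"
    "continuous_on (S \<inter> U) \<psi>"
proof -
  obtain U \<psi> where "open U" "homeomorphism (W \<inter> M) (S \<inter> U) \<phi> \<psi>"
    using assms unfolding C1_chart_def by blast
  then show ?thesis
    unfolding homeomorphism_def by (intro that[of U \<psi>]) (auto simp: set_eq_iff image_iff | blast)+
qed

lemma C1_chartI:
  assumes "open W" "C1_on \<phi> W" "\<And>u. u \<in> W \<Longrightarrow> inj (frechet_derivative \<phi> (at u))" "open U"
    and "\<And>u. u \<in> W \<Longrightarrow> u \<in> M \<Longrightarrow> \<phi> u \<in> S \<and> \<phi> u \<in> U \<and> \<psi> (\<phi> u) = u"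
    and "\<And>q. q \<in> S \<Longrightarrow> q \<in> U \<Longrightarrow> \<psi> q \<in> W \<and> \<psi> q \<in> M \<and> \<phi> (\<psi> q) = q"
    and "continuous_on (S \<inter> U) \<psi>"
  shows "C1_chart M S W \<phi>"
proof -
  have "continuous_on (W \<inter> M) \<phi>"
    using C1_on_continuous[OF assms(2)] continuous_on_subset by blast
  then have "homeomorphism (W \<inter> M) (S \<inter> U) \<phi> \<psi>"
    unfolding homeomorphism_def using assms(5-7)
    by (auto simp: image_iff) (metis IntI)+
  with assms(1-4) show ?thesis unfolding C1_chart_def by blast
qed

lemma C1_chart_inj: "C1_chart M S W \<phi> \<Longrightarrow> inj_on \<phi> (W \<inter> M)"
  by (erule C1_chartE) (metis IntE inj_onI)

lemma C1_chart_image_openin: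
  assumes "C1_chart M S W \<phi>"
  obtains U where "open U" "\<phi> ` (W \<inter> M) = S \<inter> U"
  using assms unfolding C1_chart_def homeomorphism_def by metis

lemma C1_chart_cong: "W \<inter> M = W \<inter> M' \<Longrightarrow> C1_chart M S W \<phi> \<longleftrightarrow> C1_chart M' S W \<phi>"
  by (simp add: C1_chart_def)

text \<open>The image of the smaller domain is still relatively open, since it is the preimage of
  \<open>W'\<close> under the continuous inverse.\<close>

lemma C1_chart_restrict:
  assumes "C1_chart M S W \<phi>" "open W'" "W' \<subseteq> W"
  shows "C1_chart M S W' \<phi>"
proof -
  obtain U \<psi> where U: "open U" and 1: "\<And>u. u \<in> W \<Longrightarrow> u \<in> M \<Longrightarrow> \<phi> u \<in> S \<and> \<phi> u \<in> U \<and> \<psi> (\<phi> u) = u"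
    and 2: "\<And>q. q \<in> S \<Longrightarrow> q \<in> U \<Longrightarrow> \<psi> q \<in> W \<and> \<psi> q \<in> M \<and> \<phi> (\<psi> q) = q"
    and 3: "continuous_on (S \<inter> U) \<psi>"
    using C1_chartE[OF assms(1)] by metis
  obtain T where T: "open T" "T \<inter> (S \<inter> U) = \<psi> -` W' \<inter> (S \<inter> U)"
    using 3 assms(2) unfolding continuous_on_open_invariant by blast
  show ?thesis
  proof (rule C1_chartI)
    show "open (U \<inter> T)" using U T by auto
    show "C1_on \<phi> W'" "\<And>u. u \<in> W' \<Longrightarrow> inj (frechet_derivative \<phi> (at u))"
      using assms C1_on_subset unfolding C1_chart_def by blast+
    show "continuous_on (S \<inter> (U \<inter> T)) \<psi>"
      by (rule continuous_on_subset[OF 3]) auto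
    show "\<phi> u \<in> S \<and> \<phi> u \<in> U \<inter> T \<and> \<psi> (\<phi> u) = u" if "u \<in> W'" "u \<in> M" for u
      using 1[of u] that T assms(3) by (fastforce simp: set_eq_iff)
    show "\<psi> q \<in> W' \<and> \<psi> q \<in> M \<and> \<phi> (\<psi> q) = q" if "q \<in> S" "q \<in> U \<inter> T" for q
      using 2[of q] that T by (fastforce simp: set_eq_iff)
  qed fact
qed

text \<open>Charts pass between sets that agree on an open set. Every comparison of a foam with its
  pieces, faces or sheets rests on this.\<close>

lemma C1_chart_localize:
  assumes "C1_chart M S W \<phi>" "open V" "S \<inter> V = S' \<inter> V"
  shows "C1_chart M S' (W \<inter> \<phi> -` V) \<phi>"
proof -
  have opn: "open (W \<inter> \<phi> -` V)"
    by (rule continuous_open_preimage[OF C1_chart_continuous[OF assms(1)] C1_chart_open[OF assms(1)] assms(2)])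
  from C1_chart_restrict[OF assms(1) this]
  have *: "C1_chart M S (W \<inter> \<phi> -` V) \<phi>" by auto
  obtain U \<psi> where U: "open U" and 1: "\<And>u. u \<in> W \<inter> \<phi> -` V \<Longrightarrow> u \<in> M \<Longrightarrow> \<phi> u \<in> S \<and> \<phi> u \<in> U \<and> \<psi> (\<phi> u) = u"
    and 2: "\<And>q. q \<in> S \<Longrightarrow> q \<in> U \<Longrightarrow> \<psi> q \<in> W \<inter> \<phi> -` V \<and> \<psi> q \<in> M \<and> \<phi> (\<psi> q) = q"
    and 3: "continuous_on (S \<inter> U) \<psi>"
    using C1_chartE[OF *] by metis
  have eq: "S' \<inter> (U \<inter> V) = S \<inter> (U \<inter> V)" using assms(3) by auto
  show ?thesis
  proof (rule C1_chartI)
    show "open (U \<inter> V)" using U assms(2) by auto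
    show "C1_on \<phi> (W \<inter> \<phi> -` V)" "\<And>u. u \<in> W \<inter> \<phi> -` V \<Longrightarrow> inj (frechet_derivative \<phi> (at u))"
      using * unfolding C1_chart_def by blast+
    show "continuous_on (S' \<inter> (U \<inter> V)) \<psi>"
      unfolding eq by (rule continuous_on_subset[OF 3]) auto
    show "\<phi> u \<in> S' \<and> \<phi> u \<in> U \<inter> V \<and> \<psi> (\<phi> u) = u" if "u \<in> W \<inter> \<phi> -` V" "u \<in> M" for u
      using 1[of u] that assms(3) by auto
    show "\<psi> q \<in> W \<inter> \<phi> -` V \<and> \<psi> q \<in> M \<and> \<phi> (\<psi> q) = q" if "q \<in> S'" "q \<in> U \<inter> V" for q
      using 2[of q] that eq by auto
  qed fact
qed

section \<open>Inverse charts and transition maps\<close>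

lemma immersion_lower_bound:
  fixes \<phi> :: "'a::euclidean_space \<Rightarrow> 'b::euclidean_space"
  assumes "(\<phi> has_derivative D) (at u)" "inj D"
  obtains c d where "c > 0" "d > 0" "\<And>x. norm (x - u) < d \<Longrightarrow> c * norm (x - u) \<le> norm (\<phi> x - \<phi> u)"
proof -
  obtain B where B: "B > 0" "\<And>x. B * norm x \<le> norm (D x)"
    using linear_inj_bounded_below_pos assms has_derivative_linear by blast
  \<comment> \<open>\<open>D\<close> is bounded below by \<open>B\<close>; a remainder of at most
    half of this leaves \<open>B / 2\<close> for \<phi> itself.\<close>
  obtain d where d: "d > 0" "\<And>x. norm (x - u) < d \<Longrightarrow> norm (\<phi> x - \<phi> u - D (x - u)) \<le> B / 2 * norm (x - u)"
    using assms(1) B(1) unfolding has_derivative_at_alt by (metis half_gt_zero)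
  have "B / 2 * norm (x - u) \<le> norm (\<phi> x - \<phi> u)" if "norm (x - u) < d" for x
    using d(2)[OF that] B(2)[of "x - u"] norm_triangle_ineq2[of "D (x - u)" "D (x - u) - (\<phi> x - \<phi> u)"]
    by (simp add: norm_minus_commute)
  with B d show ?thesis by (intro that[of "B / 2" d]) auto
qed

text \<open>The lower bound for an immersion turns the first-order remainder of \<phi> into one for
  \<psi>. Any left inverse \<open>A\<close> of \<open>D\<close> will do: its values off the tangent
  plane are not determined by a derivative within \<open>S\<close>.\<close>

lemma chart_inverse_has_derivative:
  fixes \<phi> :: "'a::euclidean_space \<Rightarrow> 'b::euclidean_space"
  assumes "(\<phi> has_derivative D) (at u)" "linear A" "A \<circ> D = id" "open U" "\<phi> u \<in> S" "\<phi> u \<in> U"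
    and "continuous_on (S \<inter> U) \<psi>" "\<And>q. q \<in> S \<Longrightarrow> q \<in> U \<Longrightarrow> \<phi> (\<psi> q) = q" "\<psi> (\<phi> u) = u"
  shows "(\<psi> has_derivative A) (at (\<phi> u) within S)"
  unfolding has_derivative_within_alt
proof (intro conjI allI impI)
  show "bounded_linear A" using assms(2) linear_conv_bounded_linear by blast
  fix e :: real assume e: "e > 0"
  have "inj D" using assms(3) by (metis inj_on_id inj_on_imageI2)
  then obtain c d where c: "c > 0" "d > 0" "\<And>x. norm (x - u) < d \<Longrightarrow> c * norm (x - u) \<le> norm (\<phi> x - \<phi> u)"
    using immersion_lower_bound[OF assms(1)] by blast
  obtain B where B: "B > 0" "\<And>x. norm (A x) \<le> B * norm x"
    using linear_bounded_pos[OF assms(2)] by blast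
  have lD: "linear D" using assms(1) has_derivative_linear by blast
  \<comment> \<open>The remainder is later multiplied by the norm bound \<open>B\<close> of
    \<open>A\<close>, and \<open>c\<close> converts distances in the domain into distances in
    \<open>S\<close>; the factor \<open>e * c / B\<close> leaves exactly \<open>e\<close>.\<close>
  obtain d2 where d2: "d2 > 0" "\<And>x. norm (x - u) < d2 \<Longrightarrow> norm (\<phi> x - \<phi> u - D (x - u)) \<le> (e * c / B) * norm (x - u)"
    using assms(1) e B(1) c(1) unfolding has_derivative_at_alt by (metis divide_pos_pos mult_pos_pos)
  obtain r where r: "r > 0" "ball (\<phi> u) r \<subseteq> U" using assms(4,6) open_contains_ball by blast
  obtain d3 where d3: "d3 > 0" "\<And>q. q \<in> S \<inter> U \<Longrightarrow> dist q (\<phi> u) < d3 \<Longrightarrow> dist (\<psi> q) (\<psi> (\<phi> u)) < min d d2"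
    using assms(5-7) c(2) d2(1) unfolding continuous_on_iff by (metis IntI min_less_iff_conj)
  show "\<exists>d>0. \<forall>y\<in>S. norm (y - \<phi> u) < d \<longrightarrow> norm (\<psi> y - \<psi> (\<phi> u) - A (y - \<phi> u)) \<le> e * norm (y - \<phi> u)"
  proof (intro exI[of _ "min r d3"] conjI ballI impI)
    fix q assume q: "q \<in> S" "norm (q - \<phi> u) < min r d3"
    then have qU: "q \<in> U" using r by (auto simp: dist_norm norm_minus_commute)
    define x where "x = \<psi> q"
    have x: "\<phi> x = q" "norm (x - u) < d" "norm (x - u) < d2"
      using d3(2)[of q] q qU assms(8,9) by (auto simp: x_def dist_norm)
    have "\<psi> q - \<psi> (\<phi> u) - A (q - \<phi> u) = - A (\<phi> x - \<phi> u - D (x - u))"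
      using assms(2,3,9) lD by (simp add: x x_def[symmetric] linear_diff pointfree_idE)
    then have "norm (\<psi> q - \<psi> (\<phi> u) - A (q - \<phi> u)) \<le> B * norm (\<phi> x - \<phi> u - D (x - u))"
      using B by simp
    also have "\<dots> \<le> B * ((e * c / B) * norm (x - u))"
      by (rule mult_left_mono[OF d2(2)[OF x(3)] less_imp_le[OF B(1)]])
    also have "\<dots> = e * (c * norm (x - u))" using B(1) by simp
    also have "\<dots> \<le> e * norm (q - \<phi> u)" using c(3)[OF x(2)] e x(1) by simp
    finally show "norm (\<psi> q - \<psi> (\<phi> u) - A (q - \<phi> u)) \<le> e * norm (q - \<phi> u)" .
  qed (use r d3 in auto)
qed

text \<open>The transition map is the inverse of one chart after the other. Its pointwise derivative
  and the factorization of the chart derivatives are what the change of variables consumes.\<close>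

lemma chart_transition:
  assumes "C1_chart UNIV S W \<phi>" "C1_chart UNIV S W' \<phi>'"
  obtains T T' where "\<And>u. u \<in> W \<Longrightarrow> \<phi> u \<in> \<phi>' ` W' \<Longrightarrow> T u \<in> W' \<and> \<phi>' (T u) = \<phi> u"
    "\<And>u. u \<in> W \<Longrightarrow> \<phi> u \<in> \<phi>' ` W' \<Longrightarrow> (T has_derivative T' u) (at u)"
    "\<And>u v. u \<in> W \<Longrightarrow> \<phi> u \<in> \<phi>' ` W' \<Longrightarrow>
       frechet_derivative \<phi> (at u) v = frechet_derivative \<phi>' (at (T u)) (T' u v)"
proof -
  obtain U \<psi> where U: "open U" and 1: "\<And>u. u \<in> W' \<Longrightarrow> \<phi>' u \<in> S \<and> \<phi>' u \<in> U \<and> \<psi> (\<phi>' u) = u"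
    and 2: "\<And>q. q \<in> S \<Longrightarrow> q \<in> U \<Longrightarrow> \<psi> q \<in> W' \<and> \<phi>' (\<psi> q) = q"
    and 3: "continuous_on (S \<inter> U) \<psi>"
    using C1_chartE[OF assms(2)] by (metis UNIV_I)
  have S: "\<phi> u \<in> S" if "u \<in> W" for u
    using C1_chartE[OF assms(1)] that by (metis UNIV_I)
  define T where "T = \<psi> \<circ> \<phi>"
  have T: "T u \<in> W' \<and> \<phi>' (T u) = \<phi> u" if "u \<in> W" "\<phi> u \<in> \<phi>' ` W'" for u
    using 1 2 that by (force simp: T_def)
  have "\<exists>t. (T has_derivative t) (at u) \<and> (\<forall>v. frechet_derivative \<phi> (at u) v = frechet_derivative \<phi>' (at (T u)) (t v))"
    if u: "u \<in> W" "\<phi> u \<in> \<phi>' ` W'" for u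
  proof -
    let ?D = "frechet_derivative \<phi>' (at (T u))"
    have Tu: "T u \<in> W'" "\<phi>' (T u) = \<phi> u" using T u by auto
    note D = C1_chart_deriv[OF assms(2) Tu(1)]
    obtain A where A: "linear A" "A \<circ> ?D = id"
      using linear_injective_left_inverse D(2,3) by blast
    have phi_in: "\<phi> u \<in> S" "\<phi> u \<in> U" using u 1 by auto
    have dpsi: "(\<psi> has_derivative A) (at (\<phi> u) within S)"
      using chart_inverse_has_derivative[OF D(1) A U, of S \<psi>] Tu phi_in 3 2 by (simp add: T_def)
    have "(T has_derivative A \<circ> frechet_derivative \<phi> (at u)) (at u within W)"
      unfolding T_def
    proof (rule diff_chain_within)
      show "(\<phi> has_derivative frechet_derivative \<phi> (at u)) (at u within W)"
        using C1_chart_deriv(1)[OF assms(1) u(1)] has_derivative_at_withinI by blast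
      show "(\<psi> has_derivative A) (at (\<phi> u) within \<phi> ` W)"
        by (rule has_derivative_subset[OF dpsi]) (use S in auto)
    qed
    then have dT: "(T has_derivative A \<circ> frechet_derivative \<phi> (at u)) (at u)"
      using at_within_open[OF u(1) C1_chart_open[OF assms(1)]] by simp
    have opn: "open (W \<inter> \<phi> -` U)"
      by (rule continuous_open_preimage[OF C1_chart_continuous[OF assms(1)] C1_chart_open[OF assms(1)] U])
    have "((\<lambda>x. \<phi>' (T x)) has_derivative (\<lambda>v. ?D ((A \<circ> frechet_derivative \<phi> (at u)) v))) (at u)"
      using diff_chain_at[OF dT D(1)] by (simp add: o_def)
    then have "(\<phi> has_derivative (\<lambda>v. ?D ((A \<circ> frechet_derivative \<phi> (at u)) v))) (at u)"
      by (rule has_derivative_transform_within_open[OF _ opn]) (use u phi_in 2 S in \<open>auto simp: T_def\<close>)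
    then have "frechet_derivative \<phi> (at u) = (\<lambda>v. ?D ((A \<circ> frechet_derivative \<phi> (at u)) v))"
      using frechet_derivative_at by metis
    with dT show ?thesis by metis
  qed
  then obtain T' where "\<And>u. u \<in> W \<Longrightarrow> \<phi> u \<in> \<phi>' ` W' \<Longrightarrow> (T has_derivative T' u) (at u) \<and>
     (\<forall>v. frechet_derivative \<phi> (at u) v = frechet_derivative \<phi>' (at (T u)) (T' u v))"
    by metis
  with T show ?thesis using that by metis
qed

section \<open>Tangent cones\<close>

text \<open>The tangent cone of the parameter domain, so that the tangent cone of the surface
  becomes its linear image.\<close>

definition cone_dirs :: "'a::euclidean_space set \<Rightarrow> 'a \<Rightarrow> 'a set" where
  "cone_dirs M u = {w. \<exists>\<omega> \<epsilon>. 0 < (\<epsilon>::real) \<and> \<omega> 0 = u \<and> \<omega> ` {0..<\<epsilon>} \<subseteq> M \<and>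
      (\<omega> has_vector_derivative w) (at 0 within {0..})}"

lemma curve_enters_open:
  fixes \<omega> :: "real \<Rightarrow> 'a::real_normed_vector"
  assumes "(\<omega> has_vector_derivative w) (at 0 within {0..})" "open U" "\<omega> 0 \<in> U"
  obtains \<delta> where "0 < \<delta>" "\<And>t. 0 \<le> t \<Longrightarrow> t < \<delta> \<Longrightarrow> \<omega> t \<in> U"
proof -
  have "continuous (at 0 within {0..}) \<omega>"
    using assms(1) has_derivative_continuous has_vector_derivative_def by blast
  then have "\<exists>e>0. \<forall>t\<in>{0..}. dist t 0 < e \<longrightarrow> \<omega> t \<in> U"
    using assms(2,3) unfolding continuous_within_eps_delta open_dist by (metis dist_commute)
  then show ?thesis using that by (force simp: dist_real_def)
qed

lemma at_0_within_half_open: "(m::real) > 0 \<Longrightarrow> at 0 within {0..<m} = at 0 within {0..}"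
  by (rule at_within_nhd[of _ "{..<m}"]) auto

text \<open>Curves are pushed forward by the chart and pulled back by its inverse. This makes the
  tangent cone computable and is the tool that tells the kinds of points apart.\<close>

lemma tangent_cone_chart:
  fixes \<phi> :: "'a::euclidean_space \<Rightarrow> real^3"
  assumes ch: "C1_chart M S W \<phi>" and u: "u \<in> W" "u \<in> M"
  shows "tangent_cone S (\<phi> u) = frechet_derivative \<phi> (at u) ` cone_dirs M u"
proof -
  let ?D = "frechet_derivative \<phi> (at u)"
  note D = C1_chart_deriv[OF ch u(1)]
  obtain U \<psi> where U: "open U" and 1: "\<And>u. u \<in> W \<Longrightarrow> u \<in> M \<Longrightarrow> \<phi> u \<in> S \<and> \<phi> u \<in> U \<and> \<psi> (\<phi> u) = u"
    and 2: "\<And>q. q \<in> S \<Longrightarrow> q \<in> U \<Longrightarrow> \<psi> q \<in> W \<and> \<psi> q \<in> M \<and> \<phi> (\<psi> q) = q"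
    and 3: "continuous_on (S \<inter> U) \<psi>"
    using C1_chartE[OF ch] by metis
  have push: "((\<lambda>t. \<phi> (\<omega> t)) has_vector_derivative ?D w) (at 0 within T)"
    if "(\<omega> has_vector_derivative w) (at 0 within T)" "\<omega> 0 = u" for \<omega> w and T :: "real set"
  proof -
    have "(\<phi> has_derivative ?D) (at (\<omega> 0) within \<omega> ` T)"
      using D(1) that(2) has_derivative_at_withinI by metis
    from diff_chain_within[OF that(1)[unfolded has_vector_derivative_def] this]
    show ?thesis unfolding has_vector_derivative_def
      by (simp add: o_def linear_cmul[OF D(3)])
  qed
  show ?thesis
  proof (intro equalityI subsetI)
    fix v assume "v \<in> ?D ` cone_dirs M u"
    then obtain w \<omega> \<epsilon> where w: "v = ?D w" "0 < (\<epsilon>::real)" "\<omega> 0 = u" "\<omega> ` {0..<\<epsilon>} \<subseteq> M"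
      "(\<omega> has_vector_derivative w) (at 0 within {0..})"
      unfolding cone_dirs_def by auto
    obtain \<delta> where \<delta>: "0 < \<delta>" "\<And>t. 0 \<le> t \<Longrightarrow> t < \<delta> \<Longrightarrow> \<omega> t \<in> W"
      using curve_enters_open[OF w(5) C1_chart_open[OF ch]] u w(3) by blast
    show "v \<in> tangent_cone S (\<phi> u)"
      unfolding tangent_cone_def
    proof (intro CollectI exI conjI)
      show "(\<lambda>t. \<phi> (\<omega> t)) ` {0..<min \<epsilon> \<delta>} \<subseteq> S" using w(4) 1 \<delta>(2) by fastforce
    qed (use push[OF w(5,3)] w \<delta> in auto)
  next
    fix v assume "v \<in> tangent_cone S (\<phi> u)"
    then obtain \<gamma> \<epsilon> where g: "0 < (\<epsilon>::real)" "\<gamma> 0 = \<phi> u" "\<gamma> ` {0..<\<epsilon>} \<subseteq> S"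
      "(\<gamma> has_vector_derivative v) (at 0 within {0..})"
      unfolding tangent_cone_def by auto
    have pU: "\<phi> u \<in> S" "\<phi> u \<in> U" "\<psi> (\<phi> u) = u" using 1 u by auto
    obtain \<delta> where \<delta>: "0 < \<delta>" "\<And>t. 0 \<le> t \<Longrightarrow> t < \<delta> \<Longrightarrow> \<gamma> t \<in> U"
      using curve_enters_open[OF g(4) U] g(2) pU by metis
    define m where "m = min \<epsilon> \<delta>"
    have m: "m > 0" using g \<delta> by (simp add: m_def)
    obtain A where A: "linear A" "A \<circ> ?D = id"
      using linear_injective_left_inverse D(2,3) by blast
    have dpsi: "(\<psi> has_derivative A) (at (\<phi> u) within S)"
      using chart_inverse_has_derivative[OF D(1) A U, of S \<psi>] pU 3 2 by simp
    have "(\<psi> \<circ> \<gamma> has_derivative A \<circ> (\<lambda>h. h *\<^sub>R v)) (at 0 within {0..<m})"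
    proof (rule diff_chain_within)
      show "(\<gamma> has_derivative (\<lambda>h. h *\<^sub>R v)) (at 0 within {0..<m})"
        using g(4) m by (simp add: has_vector_derivative_def at_0_within_half_open)
      show "(\<psi> has_derivative A) (at (\<gamma> 0) within \<gamma> ` {0..<m})"
        unfolding g(2) by (rule has_derivative_subset[OF dpsi]) (use g(3) in \<open>auto simp: m_def\<close>)
    qed
    then have dw: "((\<lambda>t. \<psi> (\<gamma> t)) has_vector_derivative A v) (at 0 within {0..})"
      using m by (simp add: o_def has_vector_derivative_def at_0_within_half_open linear_cmul[OF A(1)])
    have gam: "\<gamma> t \<in> S" "\<gamma> t \<in> U" if "0 \<le> t" "t < m" for t
      using that g(3) \<delta>(2) by (auto simp: m_def)
    have "A v \<in> cone_dirs M u"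
      unfolding cone_dirs_def using dw m 2 gam g(2) pU(3)
      by (auto intro!: exI[of _ "\<lambda>t. \<psi> (\<gamma> t)"] exI[of _ m])
    \<comment> \<open>\<open>A\<close> is a left inverse only, so this does not follow from linear
      algebra. It holds because the curve \<open>\<gamma>\<close> equals the image of its own
      pull-back, and one-sided derivatives are unique.\<close>
    moreover have "v = ?D (A v)"
    proof -
      have "((\<lambda>t. \<phi> (\<psi> (\<gamma> t))) has_vector_derivative ?D (A v)) (at 0 within {0..<m})"
        using push[OF dw] g(2) pU(3) m by (simp add: at_0_within_half_open)
      then have "(\<gamma> has_vector_derivative ?D (A v)) (at 0 within {0..<m})"
        by (rule has_vector_derivative_transform[rotated 2]) (use 2 gam m in auto)
      then have "(\<gamma> has_vector_derivative ?D (A v)) (at 0 within {0..})"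
        using m by (simp add: at_0_within_half_open)
      moreover have "at (0::real) within {0..} \<noteq> bot"
        by (simp add: at_within_Ici_at_right)
      ultimately show ?thesis using g(4) vector_derivative_unique_within by blast
    qed
    ultimately show "v \<in> ?D ` cone_dirs M u" by blast
  qed
qed

lemma tangent_cone_local_subset:
  assumes "open V" "p \<in> V" "S \<inter> V \<subseteq> S'"
  shows "tangent_cone S p \<subseteq> tangent_cone S' p"
proof
  fix v assume "v \<in> tangent_cone S p"
  then obtain \<gamma> \<epsilon> where g: "0 < (\<epsilon>::real)" "\<gamma> 0 = p" "\<gamma> ` {0..<\<epsilon>} \<subseteq> S"
      "(\<gamma> has_vector_derivative v) (at 0 within {0..})"
    unfolding tangent_cone_def by auto
  obtain \<delta> where \<delta>: "0 < \<delta>" "\<And>t. 0 \<le> t \<Longrightarrow> t < \<delta> \<Longrightarrow> \<gamma> t \<in> V"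
    using curve_enters_open[OF g(4) assms(1)] g(2) assms(2) by metis
  show "v \<in> tangent_cone S' p"
    unfolding tangent_cone_def
  proof (intro CollectI exI conjI)
    show "\<gamma> ` {0..<min \<epsilon> \<delta>} \<subseteq> S'" using g(3) \<delta>(2) assms(3) by fastforce
  qed (use g \<delta> in auto)
qed

lemma tangent_cone_local:
  assumes "open V" "p \<in> V" "S \<inter> V = S' \<inter> V"
  shows "tangent_cone S p = tangent_cone S' p"
proof (rule equalityI)
  show "tangent_cone S p \<subseteq> tangent_cone S' p"
    by (rule tangent_cone_local_subset[OF assms(1,2)]) (use assms(3) in auto)
  show "tangent_cone S' p \<subseteq> tangent_cone S p"
    by (rule tangent_cone_local_subset[OF assms(1,2)]) (use assms(3) in auto)
qed

lemma tangent_space_local: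
  "open V \<Longrightarrow> p \<in> V \<Longrightarrow> S \<inter> V = S' \<inter> V \<Longrightarrow> tangent_space S p = tangent_space S' p"
  by (metis tangent_cone_local tangent_space_def)

lemma tangent_cone_empty: "p \<notin> S \<Longrightarrow> tangent_cone S p = {}"
  unfolding tangent_cone_def by fastforce

lemma cone_dirs_line:
  assumes "0 < (\<epsilon>::real)" "\<And>t. 0 \<le> t \<Longrightarrow> t < \<epsilon> \<Longrightarrow> u + t *\<^sub>R w \<in> M"
  shows "w \<in> cone_dirs M u"
  unfolding cone_dirs_def
proof (intro CollectI exI conjI)
  show "((\<lambda>t. u + t *\<^sub>R w) has_vector_derivative w) (at 0 within {0..})"
    by (auto intro!: derivative_eq_intros)
qed (use assms in auto)

lemma cone_dirs_interior:
  assumes "u \<in> interior M"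
  shows "cone_dirs M u = UNIV"
proof -
  have "w \<in> cone_dirs M u" for w
  proof -
    have "((\<lambda>t. u + t *\<^sub>R w) has_vector_derivative w) (at 0 within {0..})"
      by (auto intro!: derivative_eq_intros)
    from curve_enters_open[OF this open_interior[of M]] assms
    obtain \<delta> where "0 < \<delta>" "\<And>t. 0 \<le> t \<Longrightarrow> t < \<delta> \<Longrightarrow> u + t *\<^sub>R w \<in> interior M" by auto
    then show ?thesis using cone_dirs_line interior_subset by blast
  qed
  then show ?thesis by blast
qed

lemma cone_dirs_nonneg:
  fixes u :: "real^'n"
  assumes "M \<subseteq> {x. 0 \<le> x $ i}" "u $ i = 0" "w \<in> cone_dirs M u"
  shows "0 \<le> w $ i"
proof -
  obtain \<omega> \<epsilon> where w: "0 < (\<epsilon>::real)" "\<omega> 0 = u" "\<omega> ` {0..<\<epsilon>} \<subseteq> M"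
      "(\<omega> has_vector_derivative w) (at 0 within {0..})"
    using assms(3) unfolding cone_dirs_def by auto
  have "((\<lambda>t. \<omega> t $ i) has_vector_derivative w $ i) (at 0 within {0..})"
    using bounded_linear.has_vector_derivative[OF bounded_linear_vec_nth w(4)] .
  then have "((\<lambda>t. \<omega> t $ i) has_real_derivative w $ i) (at 0 within {0..<\<epsilon>})"
    using w(1) by (simp add: has_real_derivative_iff_has_vector_derivative at_0_within_half_open)
  then have lim: "((\<lambda>t. (\<omega> t $ i - \<omega> 0 $ i) / (t - 0)) \<longlongrightarrow> w $ i) (at 0 within {0..<\<epsilon>})"
    by (simp add: has_field_derivative_iff)
  show ?thesis
  proof (rule tendsto_lowerbound[OF lim])
    show "\<forall>\<^sub>F t in at 0 within {0..<\<epsilon>}. 0 \<le> (\<omega> t $ i - \<omega> 0 $ i) / (t - 0)"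
    proof -
      have "0 \<le> \<omega> t $ i" if "t \<in> {0..<\<epsilon>}" for t
        using w(3) assms(1) that by blast
      then show ?thesis
        unfolding eventually_at_filter using w(2) assms(2)
        by (intro always_eventually) auto
    qed
    show "at 0 within {0..<\<epsilon>} \<noteq> bot"
      using w(1) by (simp add: at_0_within_half_open at_within_Ici_at_right)
  qed
qed

section \<open>Regular points, boundary points and corners\<close>

lemma regular_pointsE:
  assumes "p \<in> regular_points S"
  obtains W and \<phi> :: "real^2 \<Rightarrow> real^3" and u where "C1_chart UNIV S W \<phi>" "smooth_on \<phi> W" "u \<in> W" "\<phi> u = p"
  using assms unfolding regular_points_def local_param_iff by blast

lemma regular_pointsI:
  fixes \<phi> :: "real^2 \<Rightarrow> real^3"
  assumes "C1_chart M S W \<phi>" "smooth_on \<phi> W" "u \<in> W" "u \<in> interior M"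
  shows "\<phi> u \<in> regular_points S"
proof -
  have "C1_chart M S (W \<inter> interior M) \<phi>"
    by (rule C1_chart_restrict[OF assms(1)]) (use C1_chart_open[OF assms(1)] in auto)
  moreover have "W \<inter> interior M \<inter> M = W \<inter> interior M \<inter> UNIV"
    using interior_subset by blast
  ultimately have "C1_chart UNIV S (W \<inter> interior M) \<phi>"
    using C1_chart_cong[of "W \<inter> interior M" M UNIV S \<phi>] by simp
  then show ?thesis
    unfolding regular_points_def local_param_iff
    using assms(3,4) smooth_on_subset[OF assms(2), of "W \<inter> interior M"] by blast
qed

lemma regular_points_subset: "regular_points S \<subseteq> S"
proof
  fix p assume "p \<in> regular_points S"
  then obtain W u and \<phi> :: "real^2 \<Rightarrow> real^3" where "C1_chart UNIV S W \<phi>" "smooth_on \<phi> W" "u \<in> W" "\<phi> u = p"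
    by (rule regular_pointsE)
  then show "p \<in> S" by (metis C1_chartE UNIV_I)
qed

lemma regular_points_nhd:
  assumes "p \<in> regular_points S"
  obtains U where "open U" "p \<in> U" "S \<inter> U \<subseteq> regular_points S"
proof -
  obtain W u and \<phi> :: "real^2 \<Rightarrow> real^3" where 1: "C1_chart UNIV S W \<phi>" "smooth_on \<phi> W" "u \<in> W" "\<phi> u = p"
    using regular_pointsE[OF assms] .
  obtain U where U: "open U" "\<phi> ` (W \<inter> UNIV) = S \<inter> U" using C1_chart_image_openin[OF 1(1)] .
  have "S \<inter> U \<subseteq> regular_points S"
    unfolding U(2)[symmetric] using regular_pointsI[OF 1(1,2)] by auto
  moreover have "p \<in> U" using U(2) 1(3,4) by auto
  ultimately show ?thesis using U(1) that by blast
qed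

lemma regular_points_relopen:
  obtains U where "open U" "regular_points S = S \<inter> U"
proof
  let ?U = "\<Union>{U. open U \<and> S \<inter> U \<subseteq> regular_points S}"
  show "open ?U" by auto
  show "regular_points S = S \<inter> ?U"
  proof (intro equalityI subsetI)
    fix p assume p: "p \<in> regular_points S"
    then obtain U where "open U" "p \<in> U" "S \<inter> U \<subseteq> regular_points S" by (rule regular_points_nhd)
    then show "p \<in> S \<inter> ?U" using p regular_points_subset by auto
  qed auto
qed

lemma regular_points_local:
  assumes "open V" "S \<inter> V = S' \<inter> V" "p \<in> V" "p \<in> regular_points S"
  shows "p \<in> regular_points S'"
proof -
  obtain W u and \<phi> :: "real^2 \<Rightarrow> real^3" where 1: "C1_chart UNIV S W \<phi>" "smooth_on \<phi> W" "u \<in> W" "\<phi> u = p"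
    using regular_pointsE[OF assms(4)] .
  have "\<phi> u \<in> regular_points S'"
    by (rule regular_pointsI[OF C1_chart_localize[OF 1(1) assms(1,2)]])
       (use 1 assms(3) smooth_on_subset[OF 1(2)] in auto)
  then show ?thesis using 1 by simp
qed

lemma regular_points_local_Int:
  assumes "open V" "S \<inter> V = S' \<inter> V"
  shows "regular_points S \<inter> V = regular_points S' \<inter> V"
proof (intro equalityI subsetI)
  fix p assume "p \<in> regular_points S \<inter> V"
  then show "p \<in> regular_points S' \<inter> V" using regular_points_local[OF assms, of p] by simp
next
  fix p assume "p \<in> regular_points S' \<inter> V"
  then show "p \<in> regular_points S \<inter> V" using regular_points_local[OF assms(1) assms(2)[symmetric], of p] by simp
qed

lemma surface_boundary_local_Int:
  assumes "open V" "S \<inter> V = S' \<inter> V"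
  shows "surface_boundary S \<inter> V = surface_boundary S' \<inter> V"
  unfolding surface_boundary_def Diff_Int_distrib2
  by (simp only: regular_points_local_Int[OF assms] assms(2))

lemma surface_boundary_closed: "closed S \<Longrightarrow> closed (surface_boundary S)"
proof -
  assume "closed S"
  moreover obtain U where "open U" "regular_points S = S \<inter> U" by (rule regular_points_relopen)
  moreover from this have "surface_boundary S = S - U" unfolding surface_boundary_def by blast
  ultimately show ?thesis by (simp add: closed_Diff)
qed

lemma C1_chart_translate:
  assumes "C1_chart M S W \<phi>"
  shows "C1_chart ((\<lambda>x. c + x) -` M) S ((\<lambda>x. c + x) -` W) (\<lambda>x. \<phi> (c + x))"
proof -
  have "open ((\<lambda>x. c + x) -` W)"
    by (intro open_vimage C1_chart_open[OF assms] continuous_intros)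
  moreover have "C1_on (\<lambda>x. \<phi> (c + x)) ((\<lambda>x. c + x) -` W)"
    using Ck_on_affine[OF bounded_linear_ident C1_chart_open[OF assms], of 1 \<phi> c] C1_chart_C1[OF assms]
    unfolding C1_on_def by auto
  moreover have "inj (frechet_derivative (\<lambda>x. \<phi> (c + x)) (at u))" if "u \<in> (\<lambda>x. c + x) -` W" for u
  proof -
    have "((+) c has_derivative (\<lambda>v. v)) (at u)" by (auto intro!: derivative_eq_intros)
    moreover have "(\<phi> has_derivative frechet_derivative \<phi> (at (c + u))) (at (c + u))"
      using C1_chart_deriv(1)[OF assms] that by auto
    ultimately have "((\<lambda>x. \<phi> (c + x)) has_derivative frechet_derivative \<phi> (at (c + u))) (at u)"
      using diff_chain_at[of "(+) c" "\<lambda>v. v" u \<phi>] by (simp add: o_def)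
    then have "frechet_derivative (\<lambda>x. \<phi> (c + x)) (at u) = frechet_derivative \<phi> (at (c + u))"
      using frechet_derivative_at by metis
    then show ?thesis using C1_chart_deriv(2)[OF assms] that by auto
  qed
  moreover obtain U \<psi> where U: "open U" and 1: "\<And>u. u \<in> W \<Longrightarrow> u \<in> M \<Longrightarrow> \<phi> u \<in> S \<and> \<phi> u \<in> U \<and> \<psi> (\<phi> u) = u"
    and 2: "\<And>q. q \<in> S \<Longrightarrow> q \<in> U \<Longrightarrow> \<psi> q \<in> W \<and> \<psi> q \<in> M \<and> \<phi> (\<psi> q) = q"
    and 3: "continuous_on (S \<inter> U) \<psi>"
    using C1_chartE[OF assms] by metis
  ultimately show ?thesis
    by (intro C1_chartI[where U = U and \<psi> = "\<lambda>q. \<psi> q - c"]) (auto intro!: continuous_intros)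
qed

lemma smooth_on_translate:
  "open W \<Longrightarrow> smooth_on \<phi> W \<Longrightarrow> smooth_on (\<lambda>x. \<phi> (c + x)) ((\<lambda>x. c + x) -` W)"
  using smooth_on_affine[OF bounded_linear_ident] .

lemma interior_half_plane: "interior half_plane = {u. 0 < u $ 1}"
  using interior_halfspace_component_ge[of 0 1] by (simp add: half_plane_def)

lemma open_quadrant: "open {u::real^2. 0 < u $ 1 \<and> 0 < u $ 2}"
  by (intro open_Collect_conj open_Collect_less continuous_intros)

lemma half_plane_subset: "half_plane \<subseteq> {x. 0 \<le> x $ 1}"
  by (auto simp: half_plane_def)

lemma quadrant_subset: "quadrant \<subseteq> {x. 0 \<le> x $ 1}" "quadrant \<subseteq> {x. 0 \<le> x $ 2}"
  by (auto simp: quadrant_def)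

lemma boundary_pointE:
  assumes "boundary_point S p"
  obtains W \<phi> where "C1_chart half_plane S W \<phi>" "smooth_on \<phi> W" "0 \<in> W" "\<phi> 0 = p"
  using assms unfolding boundary_point_def local_param_iff by blast

text \<open>The definition of a boundary point asks for the parameter 0. Translation along the
  boundary line preserves the half plane and moves \<open>u\<close> there.\<close>

lemma boundary_pointI:
  assumes "C1_chart half_plane S W \<phi>" "smooth_on \<phi> W" "u \<in> W" "u $ 1 = 0"
  shows "boundary_point S (\<phi> u)"
proof -
  have "(\<lambda>x. u + x) -` half_plane = half_plane" using assms(4) by (auto simp: half_plane_def)
  then have "C1_chart half_plane S ((\<lambda>x. u + x) -` W) (\<lambda>x. \<phi> (u + x))"
    using C1_chart_translate[OF assms(1), of u] by simp
  then show ?thesis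
    unfolding boundary_point_def local_param_iff
    using smooth_on_translate[OF C1_chart_open[OF assms(1)] assms(2), of u] assms(3)
    by (auto intro!: exI[of _ "(\<lambda>x. u + x) -` W"] exI[of _ "\<lambda>x. \<phi> (u + x)"])
qed

lemma linear_range_neg: "linear D \<Longrightarrow> v \<in> range D \<Longrightarrow> - v \<in> range D"
  by (auto simp: linear_neg[symmetric])

lemma regular_cone:
  assumes "p \<in> regular_points S"
  obtains D :: "real^2 \<Rightarrow> real^3" where "linear D" "inj D" "tangent_cone S p = range D"
proof -
  obtain W u and \<phi> :: "real^2 \<Rightarrow> real^3" where 1: "C1_chart UNIV S W \<phi>" "smooth_on \<phi> W" "u \<in> W" "\<phi> u = p"
    using regular_pointsE[OF assms] .
  have "tangent_cone S p = range (frechet_derivative \<phi> (at u))"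
    using tangent_cone_chart[OF 1(1,3)] 1(4) cone_dirs_interior[of u UNIV] by simp
  then show ?thesis
    using that C1_chart_deriv(2,3)[OF 1(1,3)] by blast
qed

text \<open>At a regular point the tangent cone is a whole plane, hence symmetric. Here a curve
  entering the domain has a velocity whose negative would leave it. This first-order argument takes
  the place of invariance of domain.\<close>

lemma chart_boundary_not_regular:
  fixes \<phi> :: "real^2 \<Rightarrow> real^3"
  assumes "C1_chart M S W \<phi>" "u \<in> W" "u \<in> M" "M \<subseteq> {x. 0 \<le> x $ i}" "u $ i = 0"
    "w \<in> cone_dirs M u" "0 < w $ i"
  shows "\<exists>v\<in>tangent_cone S (\<phi> u). - v \<notin> tangent_cone S (\<phi> u)" "\<phi> u \<notin> regular_points S"
proof -
  let ?D = "frechet_derivative \<phi> (at u)"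
  note D = C1_chart_deriv[OF assms(1,2)] and tc = tangent_cone_chart[OF assms(1-3)]
  have "- ?D w \<notin> tangent_cone S (\<phi> u)"
  proof
    assume "- ?D w \<in> tangent_cone S (\<phi> u)"
    then obtain w' where w': "w' \<in> cone_dirs M u" "?D w' = ?D (- w)"
      unfolding tc using linear_neg[OF D(3)] by force
    then have "w' = - w" using D(2) by (meson injD)
    then show False using cone_dirs_nonneg[OF assms(4,5) w'(1)] assms(7) by simp
  qed
  then show *: "\<exists>v\<in>tangent_cone S (\<phi> u). - v \<notin> tangent_cone S (\<phi> u)" using assms(6) tc by blast
  show "\<phi> u \<notin> regular_points S"
  proof
    assume "\<phi> u \<in> regular_points S"
    then obtain D' :: "real^2 \<Rightarrow> real^3" where "linear D'" "tangent_cone S (\<phi> u) = range D'"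
      by (rule regular_cone)
    then show False using * linear_range_neg by blast
  qed
qed

lemma axis_half_plane: "u \<in> half_plane \<Longrightarrow> axis 1 1 \<in> cone_dirs half_plane u"
  by (rule cone_dirs_line[of 1]) (auto simp: half_plane_def)

lemma axis_quadrant: "u \<in> quadrant \<Longrightarrow> axis i 1 \<in> cone_dirs quadrant u"
  by (rule cone_dirs_line[of 1]) (auto simp: quadrant_def axis_def)

lemma half_plane_chart_regular_iff:
  assumes "C1_chart half_plane S W \<phi>" "smooth_on \<phi> W" "u \<in> W" "u \<in> half_plane"
  shows "\<phi> u \<in> regular_points S \<longleftrightarrow> 0 < u $ 1"
proof (cases "0 < u $ 1")
  case True
  then show ?thesis using regular_pointsI[OF assms(1-3)] by (simp add: interior_half_plane)
next
  case False
  then have "u $ 1 = 0" using assms(4) by (simp add: half_plane_def)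
  then show ?thesis
    using chart_boundary_not_regular(2)[OF assms(1,3,4) half_plane_subset _ axis_half_plane[OF assms(4)]]
    by simp
qed

lemma boundary_point_not_symmetric:
  assumes "boundary_point S p"
  shows "\<exists>v\<in>tangent_cone S p. - v \<notin> tangent_cone S p"
proof -
  obtain W \<phi> where 1: "C1_chart half_plane S W \<phi>" "smooth_on \<phi> W" "0 \<in> W" "\<phi> 0 = p"
    using boundary_pointE[OF assms] .
  have 0: "0 \<in> half_plane" by (simp add: half_plane_def)
  show ?thesis
    using chart_boundary_not_regular(1)[OF 1(1,3) 0 half_plane_subset _ axis_half_plane[OF 0]] 1(4) by simp
qed

text \<open>The cone is the injective linear image of the directions of a quadrant, and no nonzero
  vector of the quadrant has its negative there.\<close>

lemma corner_point_no_line: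
  assumes "corner_point S p" "v \<in> tangent_cone S p" "- v \<in> tangent_cone S p"
  shows "v = 0"
proof -
  obtain W \<phi> where 1: "C1_chart quadrant S W \<phi>" "0 \<in> W" "\<phi> 0 = p"
    using assms(1) unfolding corner_point_def local_param_iff by blast
  let ?D = "frechet_derivative \<phi> (at 0)"
  have 0: "0 \<in> quadrant" by (simp add: quadrant_def)
  note D = C1_chart_deriv[OF 1(1,2)] and tc = tangent_cone_chart[OF 1(1,2) 0]
  obtain w w' where w: "w \<in> cone_dirs quadrant 0" "w' \<in> cone_dirs quadrant 0" "v = ?D w" "- v = ?D w'"
    using assms(2,3) 1(3) tc by auto
  then have "w' = - w" using D(2) linear_neg[OF D(3)] by (metis injD)
  then have "0 \<le> w $ 1" "0 \<le> - w $ 1" "0 \<le> w $ 2" "0 \<le> - w $ 2"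
    using cone_dirs_nonneg[OF quadrant_subset(1) _ w(1)] cone_dirs_nonneg[OF quadrant_subset(1) _ w(2)]
      cone_dirs_nonneg[OF quadrant_subset(2) _ w(1)] cone_dirs_nonneg[OF quadrant_subset(2) _ w(2)]
    by auto
  then have "w = 0" by (simp add: vec_eq_iff forall_2)
  then show ?thesis using w(3) linear_0[OF D(3)] by simp
qed

text \<open>Recorded for the edges of the foam, where it prevents a single piece from containing two
  of the three sheets.\<close>

lemma surface_with_corners_cone:
  assumes "surface_with_corners S" "p \<in> S"
  obtains D :: "real^2 \<Rightarrow> real^3" where "linear D" "inj D" "tangent_cone S p \<subseteq> range D"
proof -
  consider "p \<in> regular_points S" | "boundary_point S p" | "corner_point S p"
    using assms by (auto simp: surface_with_corners_def)
  then show ?thesis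
  proof cases
    case 1
    then show ?thesis using regular_cone that by (metis subset_refl)
  next
    case 2
    then obtain W \<phi> where 1: "C1_chart half_plane S W \<phi>" "smooth_on \<phi> W" "0 \<in> W" "\<phi> 0 = p"
      by (rule boundary_pointE)
    show ?thesis
      using that C1_chart_deriv[OF 1(1,3)] tangent_cone_chart[OF 1(1,3)] 1(4) by (auto simp: half_plane_def)
  next
    case 3
    then obtain W \<phi> where 1: "C1_chart quadrant S W \<phi>" "0 \<in> W" "\<phi> 0 = p"
      unfolding corner_point_def local_param_iff by blast
    show ?thesis
      using that C1_chart_deriv[OF 1(1,2)] tangent_cone_chart[OF 1(1,2)] 1(3) by (auto simp: quadrant_def)
  qed
qed

text \<open>In a surface with corners these are the corners that admit no smooth chart. They are the
  points which the cut-offs have to remove.\<close>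

definition bad_points :: "(real^3) set \<Rightarrow> (real^3) set" where
  "bad_points S = {p \<in> S. p \<notin> regular_points S \<and> \<not> boundary_point S p}"

lemma half_plane_chart_image:
  assumes "C1_chart half_plane S W \<phi>" "smooth_on \<phi> W" "u \<in> W" "u \<in> half_plane"
  shows "\<phi> u \<in> regular_points S \<or> boundary_point S (\<phi> u)"
proof (cases "0 < u $ 1")
  case True
  then show ?thesis using half_plane_chart_regular_iff[OF assms] by simp
next
  case False
  then show ?thesis using boundary_pointI[OF assms(1-3)] assms(4) by (simp add: half_plane_def)
qed

text \<open>A regular point is moved to the interior of the half plane, so that one kind of chart
  serves for all points with a smooth chart.\<close>

lemma smooth_half_plane_chart:
  assumes "p \<in> regular_points S \<or> boundary_point S p"
  obtains W \<phi> u where "C1_chart half_plane S W \<phi>" "smooth_on \<phi> W" "u \<in> W" "u \<in> half_plane" "\<phi> u = p"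
  using assms
proof
  assume "boundary_point S p"
  then obtain W \<phi> where "C1_chart half_plane S W \<phi>" "smooth_on \<phi> W" "0 \<in> W" "\<phi> 0 = p"
    by (rule boundary_pointE)
  then show thesis using that[of W \<phi> 0] by (auto simp: half_plane_def)
next
  assume "p \<in> regular_points S"
  then obtain W u and \<phi> :: "real^2 \<Rightarrow> real^3" where 1: "C1_chart UNIV S W \<phi>" "smooth_on \<phi> W" "u \<in> W" "\<phi> u = p"
    by (rule regular_pointsE)
  \<comment> \<open>The translation takes the parameter of \<open>p\<close> to
    \<open>axis 1 1\<close>, an interior point of the half plane.\<close>
  define c where "c = u - axis 1 1"
  define W' where "W' = (\<lambda>x. c + x) -` W \<inter> interior half_plane"
  have "C1_chart UNIV S ((\<lambda>x. c + x) -` W) (\<lambda>x. \<phi> (c + x))"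
    using C1_chart_translate[OF 1(1), of c] by simp
  moreover from this have "open W'"
    unfolding W'_def using C1_chart_open by blast
  ultimately have "C1_chart UNIV S W' (\<lambda>x. \<phi> (c + x))"
    using C1_chart_restrict W'_def by blast
  moreover have "W' \<inter> UNIV = W' \<inter> half_plane"
    using interior_subset unfolding W'_def by blast
  ultimately have "C1_chart half_plane S W' (\<lambda>x. \<phi> (c + x))"
    using C1_chart_cong[of W' UNIV half_plane S "\<lambda>x. \<phi> (c + x)"] by simp
  moreover have "smooth_on (\<lambda>x. \<phi> (c + x)) W'"
    using smooth_on_subset[OF smooth_on_translate[OF C1_chart_open[OF 1(1)] 1(2)]] by (auto simp: W'_def)
  moreover have "axis 1 1 \<in> W'" "\<phi> (c + axis 1 1) = p"
    using 1 by (auto simp: W'_def c_def interior_half_plane)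
  ultimately show thesis
    using that[of W' "\<lambda>x. \<phi> (c + x)" "axis 1 1"] interior_subset[of half_plane] by (auto simp: W'_def)
qed

text \<open>The chart is only C1, so it cannot by itself show that a point is regular. But every
  point of \<open>S\<close> is of one of the three kinds, and the cone decides: away from the vertex
  it contains a line, which excludes a corner; a full plane excludes a boundary point, and an
  asymmetric cone excludes a regular point.\<close>

lemma corner_chart_other_points:
  assumes S: "surface_with_corners S" and ch: "C1_chart quadrant S W \<phi>" and u: "u \<in> W" "u \<in> quadrant" "u \<noteq> 0"
  shows "\<phi> u \<notin> bad_points S" "\<phi> u \<in> regular_points S \<longleftrightarrow> 0 < u $ 1 \<and> 0 < u $ 2"
proof -
  let ?D = "frechet_derivative \<phi> (at u)"
  note D = C1_chart_deriv[OF ch u(1)] and tc = tangent_cone_chart[OF ch u(1,2)]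
  have pS: "\<phi> u \<in> S" using C1_chartE[OF ch] u by metis
  have "0 < u $ 1 \<or> 0 < u $ 2"
    using u(2,3) by (auto simp: quadrant_def vec_eq_iff forall_2)
  then obtain i where i: "0 < u $ i" by blast
  \<comment> \<open>Moving against the positive coordinate stays in the quadrant for the time
    \<open>u $ i\<close>, so the cone contains both directions of this axis.\<close>
  have "- axis i 1 \<in> cone_dirs quadrant u"
    by (rule cone_dirs_line[OF i]) (use u(2) in \<open>auto simp: quadrant_def axis_def\<close>)
  then have "?D (axis i 1) \<in> tangent_cone S (\<phi> u)" "- ?D (axis i 1) \<in> tangent_cone S (\<phi> u)"
    using axis_quadrant[OF u(2), of i] tc linear_neg[OF D(3)] by (metis imageI)+
  moreover have "?D (axis i 1) \<noteq> 0"
    using D(2,3) by (metis axis_eq_0_iff injD linear_0 zero_neq_one)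
  ultimately have nc: "\<not> corner_point S (\<phi> u)" using corner_point_no_line by blast
  then show "\<phi> u \<notin> bad_points S" using S pS by (auto simp: bad_points_def surface_with_corners_def)
  show "\<phi> u \<in> regular_points S \<longleftrightarrow> 0 < u $ 1 \<and> 0 < u $ 2"
  proof (cases "0 < u $ 1 \<and> 0 < u $ 2")
    case True
    then have "u \<in> interior quadrant"
      by (intro interiorI[OF open_quadrant]) (auto simp: quadrant_def)
    then have "tangent_cone S (\<phi> u) = range ?D" using tc cone_dirs_interior[of u quadrant] by simp
    then have "\<not> boundary_point S (\<phi> u)"
      using boundary_point_not_symmetric linear_range_neg[OF D(3)] by blast
    then show ?thesis using S pS nc True by (auto simp: surface_with_corners_def)
  next
    case False
    then have "u $ 1 = 0 \<or> u $ 2 = 0" using u(2) by (auto simp: quadrant_def)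
    then have "\<phi> u \<notin> regular_points S"
      using chart_boundary_not_regular(2)[OF ch u(1,2) quadrant_subset(1) _ axis_quadrant[OF u(2), of 1]]
        chart_boundary_not_regular(2)[OF ch u(1,2) quadrant_subset(2) _ axis_quadrant[OF u(2), of 2]]
      by auto
    then show ?thesis using False by simp
  qed
qed

text \<open>A smooth half-plane chart covers no bad point, and a corner chart covers none except
  possibly its vertex.\<close>

lemma bad_points_isolated:
  assumes S: "surface_with_corners S" and p: "p \<in> S"
  obtains U where "open U" "p \<in> U" "bad_points S \<inter> U \<subseteq> {p}"
proof (cases "p \<in> bad_points S")
  case False
  then obtain W \<phi> u where 1: "C1_chart half_plane S W \<phi>" "smooth_on \<phi> W" "u \<in> W" "u \<in> half_plane" "\<phi> u = p"
    using smooth_half_plane_chart[of p S] p unfolding bad_points_def by blast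
  obtain U where U: "open U" "\<phi> ` (W \<inter> half_plane) = S \<inter> U" using C1_chart_image_openin[OF 1(1)] .
  have "bad_points S \<inter> U = {}"
  proof -
    have "q \<notin> bad_points S" if "q \<in> S \<inter> U" for q
      using that half_plane_chart_image[OF 1(1,2)] unfolding U(2)[symmetric] bad_points_def by auto
    then show ?thesis by (auto simp: bad_points_def)
  qed
  moreover have "p \<in> U" using U(2) 1(3-5) by auto
  ultimately show ?thesis using U(1) that by blast
next
  case True
  then have "corner_point S p" using S by (auto simp: bad_points_def surface_with_corners_def)
  then obtain W \<phi> where 1: "C1_chart quadrant S W \<phi>" "0 \<in> W" "\<phi> 0 = p"
    unfolding corner_point_def local_param_iff by blast
  obtain U where U: "open U" "\<phi> ` (W \<inter> quadrant) = S \<inter> U" using C1_chart_image_openin[OF 1(1)] .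
  have "q = p" if q: "q \<in> bad_points S \<inter> U" for q
  proof -
    have "q \<in> \<phi> ` (W \<inter> quadrant)" using q U(2) by (auto simp: bad_points_def)
    then obtain x where "x \<in> W" "x \<in> quadrant" "q = \<phi> x" by blast
    then show ?thesis using corner_chart_other_points(1)[OF S 1(1), of x] q 1(3) by auto
  qed
  moreover have "p \<in> U" using U(2) 1(2,3) by (auto simp: quadrant_def)
  ultimately show ?thesis using U(1) that by blast
qed

lemma bad_points_finite:
  assumes "surface_with_corners S" "compact S"
  shows "finite (bad_points S)"
proof -
  let ?\<F> = "{U. open U \<and> finite (bad_points S \<inter> U)}"
  have "S \<subseteq> \<Union>?\<F>"
  proof
    fix p assume "p \<in> S"
    then obtain U where "open U" "p \<in> U" "bad_points S \<inter> U \<subseteq> {p}"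
      using bad_points_isolated[OF assms(1)] by blast
    then show "p \<in> \<Union>?\<F>" by (metis (mono_tags, lifting) UnionI finite.simps finite_subset mem_Collect_eq)
  qed
  then obtain \<D> where D: "\<D> \<subseteq> ?\<F>" "finite \<D>" "S \<subseteq> \<Union>\<D>"
    using compactE[OF assms(2), of ?\<F>] by (metis (lifting) mem_Collect_eq)
  have "finite (\<Union>U\<in>\<D>. bad_points S \<inter> U)" using D(1,2) by (intro finite_UN_I) auto
  moreover have "bad_points S \<subseteq> (\<Union>U\<in>\<D>. bad_points S \<inter> U)" using D(3) by (auto simp: bad_points_def)
  ultimately show ?thesis using finite_subset by blast
qed

section \<open>Area and arc length in charts\<close>

lemma nn_integral_absolutely_integrable:
  fixes g :: "'a::euclidean_space \<Rightarrow> real"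
  assumes "(\<lambda>x. indicator A x *\<^sub>R g x) \<in> borel_measurable borel" "\<And>x. x \<in> A \<Longrightarrow> 0 \<le> g x"
  shows "(\<integral>\<^sup>+x\<in>A. ennreal (g x) \<partial>lborel) = (if g absolutely_integrable_on A then ennreal (integral A g) else \<infinity>)"
proof -
  have eq: "(\<integral>\<^sup>+x\<in>A. ennreal (g x) \<partial>lborel) = (\<integral>\<^sup>+x. ennreal (indicator A x *\<^sub>R g x) \<partial>lborel)"
    by (intro nn_integral_cong) (auto split: split_indicator)
  have nn: "0 \<le> indicator A x *\<^sub>R g x" for x using assms(2) by (auto split: split_indicator)
  have m: "(\<lambda>x. indicator A x *\<^sub>R g x) \<in> borel_measurable lborel" using assms(1) by simp
  have iff: "g absolutely_integrable_on A \<longleftrightarrow> integrable lborel (\<lambda>x. indicator A x *\<^sub>R g x)"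
    unfolding set_integrable_def using integrable_completion[OF m] .
  show ?thesis
  proof (cases "g absolutely_integrable_on A")
    case True
    then have i: "integrable lborel (\<lambda>x. indicator A x *\<^sub>R g x)" using iff by simp
    then have "set_integrable lborel A g" by (simp add: set_integrable_def)
    from set_borel_integral_eq_integral(2)[OF this]
    show ?thesis unfolding eq using True nn_integral_eq_integral[OF i] nn
      by (simp add: set_lebesgue_integral_def)
  next
    case False
    then have "\<not> (\<integral>\<^sup>+x. ennreal (norm (indicator A x *\<^sub>R g x)) \<partial>lborel) < \<infinity>"
      using iff m by (simp add: integrable_iff_bounded)
    moreover have "norm (indicator A x *\<^sub>R g x) = indicator A x *\<^sub>R g x" for x
      using nn[of x] by simp
    ultimately show ?thesis unfolding eq using False by (simp add: less_top[symmetric])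
  qed
qed

text \<open>Both sides may be infinite. The change of variables for absolute integrals is an
  equivalence, so the two sides are finite together and then agree.\<close>

lemma nn_integral_change_of_variables_plane:
  fixes T :: "real^2 \<Rightarrow> real^2" and f h :: "real^2 \<Rightarrow> real"
  assumes A: "A \<in> sets borel" and d: "\<And>u. u \<in> A \<Longrightarrow> (T has_derivative T' u) (at u)" and inj: "inj_on T A"
    and h: "\<And>u. u \<in> A \<Longrightarrow> h u = \<bar>det (matrix (T' u))\<bar> * f (T u)"
    and nn: "\<And>x. 0 \<le> f x" and m: "(\<lambda>x. indicator A x *\<^sub>R h x) \<in> borel_measurable borel"
    "(\<lambda>x. indicator (T ` A) x *\<^sub>R f x) \<in> borel_measurable borel"
  shows "(\<integral>\<^sup>+u\<in>A. ennreal (h u) \<partial>lborel) = (\<integral>\<^sup>+x\<in>T ` A. ennreal (f x) \<partial>lborel)"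
proof -
  have "A \<in> sets lebesgue" using A by auto
  moreover have "(T has_derivative T' u) (at u within A)" if "u \<in> A" for u
    using d[OF that] has_derivative_at_withinI by blast
  ultimately have cov: "(\<lambda>x. \<bar>det (matrix (T' x))\<bar> *\<^sub>R (vec (f (T x)) :: real^1)) absolutely_integrable_on A \<and>
       integral A (\<lambda>x. \<bar>det (matrix (T' x))\<bar> *\<^sub>R (vec (f (T x)) :: real^1)) = vec b
    \<longleftrightarrow> (\<lambda>x. vec (f x) :: real^1) absolutely_integrable_on (T ` A) \<and> integral (T ` A) (\<lambda>x. vec (f x) :: real^1) = vec b" for b
    using has_absolute_integral_change_of_variables[of A T T' "\<lambda>x. vec (f x)"] inj by blast
  have hA: "(\<lambda>x. \<bar>det (matrix (T' x))\<bar> * f (T x)) absolutely_integrable_on A \<longleftrightarrow> h absolutely_integrable_on A"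
    by (rule set_integrable_cong) (simp_all add: h)
  have hA2: "integral A (\<lambda>x. \<bar>det (matrix (T' x))\<bar> * f (T x)) = integral A h"
    by (rule integral_cong) (simp add: h)
  \<comment> \<open>The underlying theorem speaks of vector-valued maps, hence the passage through
    \<open>real^1\<close>. Having the equivalence for every \<open>b\<close> is what yields the
    equality of the integrals later.\<close>
  have *: "h absolutely_integrable_on A \<and> integral A h = b \<longleftrightarrow> f absolutely_integrable_on (T ` A) \<and> integral (T ` A) f = b" for b
  proof -
    have i: "integral X (\<lambda>x. g x $ 1) = integral X g $ 1" if "g absolutely_integrable_on X"
      for X and g :: "real^2 \<Rightarrow> real^1"
      using that integral_component_eq_cart[of g X 1] by (simp add: absolutely_integrable_on_def)
    show ?thesis
      using cov[of b] hA hA2 i[of A "\<lambda>x. \<bar>det (matrix (T' x))\<bar> *\<^sub>R vec (f (T x))"]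
        i[of "T ` A" "\<lambda>x. vec (f x)"]
      unfolding absolutely_integrable_on_1_iff by (auto simp: vec_eq_iff)
  qed
  have nnh: "0 \<le> h u" if "u \<in> A" for u using h[OF that] nn by simp
  show ?thesis
    using nn_integral_absolutely_integrable[OF m(1) nnh] nn_integral_absolutely_integrable[OF m(2) nn]
      *[of "integral A h"] *[of "integral (T ` A) f"] by (auto split: if_splits)
qed

lemma nn_integral_change_of_variables_line:
  fixes T :: "real \<Rightarrow> real" and f h :: "real \<Rightarrow> real"
  assumes A: "A \<in> sets borel" and d: "\<And>u. u \<in> A \<Longrightarrow> (T has_derivative T' u) (at u)" and inj: "inj_on T A"
    and h: "\<And>u. u \<in> A \<Longrightarrow> h u = \<bar>T' u 1\<bar> * f (T u)"
    and nn: "\<And>x. 0 \<le> f x" and m: "(\<lambda>x. indicator A x *\<^sub>R h x) \<in> borel_measurable borel"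
    "(\<lambda>x. indicator (T ` A) x *\<^sub>R f x) \<in> borel_measurable borel"
  shows "(\<integral>\<^sup>+u\<in>A. ennreal (h u) \<partial>lborel) = (\<integral>\<^sup>+x\<in>T ` A. ennreal (f x) \<partial>lborel)"
proof -
  have A': "A \<in> sets lebesgue" using A by auto
  have dT: "(T has_field_derivative T' u 1) (at u within A)" if "u \<in> A" for u
  proof -
    have "T' u v = T' u 1 * v" for v
      using linear_cmul[OF has_derivative_linear[OF d[OF that]], of v 1] by simp
    then have "T' u = (*) (T' u 1)" by (rule ext)
    from has_derivative_eq_rhs[OF d[OF that] this] show ?thesis
      unfolding has_field_derivative_def by (rule has_derivative_at_withinI)
  qed
  have cov: "(\<lambda>x. \<bar>T' x 1\<bar> * f (T x)) absolutely_integrable_on A \<and>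
       integral A (\<lambda>x. \<bar>T' x 1\<bar> * f (T x)) = b
    \<longleftrightarrow> f absolutely_integrable_on (T ` A) \<and> integral (T ` A) f = b" for b
    by (rule has_absolute_integral_change_of_variables_1'[OF A' dT inj])
  have hA: "(\<lambda>x. \<bar>T' x 1\<bar> * f (T x)) absolutely_integrable_on A \<longleftrightarrow> h absolutely_integrable_on A"
    by (rule set_integrable_cong) (simp_all add: h)
  have hA2: "integral A (\<lambda>x. \<bar>T' x 1\<bar> * f (T x)) = integral A h"
    by (rule integral_cong) (simp add: h)
  have *: "h absolutely_integrable_on A \<and> integral A h = b \<longleftrightarrow> f absolutely_integrable_on (T ` A) \<and> integral (T ` A) f = b" for b
    using cov[of b] unfolding hA hA2 .
  have nnh: "0 \<le> h u" if "u \<in> A" for u using h[OF that] nn by simp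
  show ?thesis
    using nn_integral_absolutely_integrable[OF m(1) nnh] nn_integral_absolutely_integrable[OF m(2) nn]
      *[of "integral A h"] *[of "integral (T ` A) f"] by (auto split: if_splits)
qed

section \<open>Gluing chart densities into one measure\<close>

lemma C1_chart_preimage_borel:
  assumes "C1_chart M S W \<phi>" "B \<in> sets borel"
  shows "W \<inter> \<phi> -` B \<in> sets borel"
proof -
  have "\<phi> \<in> borel_measurable (restrict_space borel W)"
    using borel_measurable_continuous_on_restrict[OF C1_chart_continuous[OF assms(1)]] .
  from measurable_sets[OF this assms(2)] show ?thesis
    using C1_chart_open[OF assms(1)] by (auto simp: sets_restrict_space_iff space_restrict_space Int_commute)
qed

lemma C1_chart_image_borel:
  assumes "C1_chart UNIV S W \<phi>" "S \<in> sets borel"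
  shows "\<phi> ` W \<in> sets borel"
proof -
  obtain U where "open U" "\<phi> ` (W \<inter> UNIV) = S \<inter> U" using C1_chart_image_openin[OF assms(1)] .
  then show ?thesis using assms(2) by auto
qed

lemma chart_transition_change_of_variables:
  fixes \<phi> \<phi>' :: "'a::euclidean_space \<Rightarrow> 'b::euclidean_space"
  assumes \<phi>: "C1_chart UNIV S W \<phi>" "C1_chart UNIV S W' \<phi>'"
    and B: "B \<subseteq> \<phi> ` W" "B \<subseteq> \<phi>' ` W'"
  obtains T T' where "inj_on T (W \<inter> \<phi> -` B)" "T ` (W \<inter> \<phi> -` B) = W' \<inter> \<phi>' -` B"
    "\<And>u. u \<in> W \<inter> \<phi> -` B \<Longrightarrow> (T has_derivative T' u) (at u)"
    "\<And>u v. u \<in> W \<inter> \<phi> -` B \<Longrightarrow> frechet_derivative \<phi> (at u) v = frechet_derivative \<phi>' (at (T u)) (T' u v)"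
proof -
  obtain T T' where T: "\<And>u. u \<in> W \<Longrightarrow> \<phi> u \<in> \<phi>' ` W' \<Longrightarrow> T u \<in> W' \<and> \<phi>' (T u) = \<phi> u"
    and T': "\<And>u. u \<in> W \<Longrightarrow> \<phi> u \<in> \<phi>' ` W' \<Longrightarrow> (T has_derivative T' u) (at u)"
    "\<And>u v. u \<in> W \<Longrightarrow> \<phi> u \<in> \<phi>' ` W' \<Longrightarrow>
       frechet_derivative \<phi> (at u) v = frechet_derivative \<phi>' (at (T u)) (T' u v)"
    using chart_transition[OF \<phi>] by blast
  have i: "inj_on \<phi> W" "inj_on \<phi>' W'" using C1_chart_inj[OF \<phi>(1)] C1_chart_inj[OF \<phi>(2)] by auto
  have T: "T u \<in> W'" "\<phi>' (T u) = \<phi> u" if "u \<in> W \<inter> \<phi> -` B" for u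
    using that T B(2) by blast+
  show ?thesis
  proof (rule that)
    show "inj_on T (W \<inter> \<phi> -` B)"
    proof (rule inj_onI)
      fix u v assume uv: "u \<in> W \<inter> \<phi> -` B" "v \<in> W \<inter> \<phi> -` B" "T u = T v"
      then have "\<phi> u = \<phi> v" using T by metis
      then show "u = v" using i(1) uv by (auto dest: inj_onD)
    qed
    show "T ` (W \<inter> \<phi> -` B) = W' \<inter> \<phi>' -` B"
    proof (intro equalityI subsetI)
      fix x assume "x \<in> W' \<inter> \<phi>' -` B"
      moreover from this obtain u where u: "u \<in> W" "\<phi> u = \<phi>' x" using B(1) by fastforce
      ultimately have "u \<in> W \<inter> \<phi> -` B" "T u = x"
        using T[of u] i(2) by (auto dest: inj_onD)
      then show "x \<in> T ` (W \<inter> \<phi> -` B)" by blast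
    qed (use T in auto)
  qed (use T' B(2) in blast)+
qed

text \<open>Area and arc length are two instances of one construction, a measure that is prescribed
  in charts by a density. Compatibility is demanded for C1 charts, so that the glued measure can
  also be evaluated in the charts at corners.\<close>

locale chart_density =
  fixes S :: "(real^3) set" and \<rho> :: "('a::euclidean_space \<Rightarrow> real^3) \<Rightarrow> 'a \<Rightarrow> real"
  assumes S_borel: "S \<in> sets borel"
    and \<rho>_continuous: "\<And>W \<phi>. C1_chart UNIV S W \<phi> \<Longrightarrow> continuous_on W (\<rho> \<phi>)"
    and \<rho>_nonneg: "\<And>\<phi> u. 0 \<le> \<rho> \<phi> u"
    and \<rho>_compatible: "\<And>W \<phi> W' \<phi>' B. C1_chart UNIV S W \<phi> \<Longrightarrow> C1_chart UNIV S W' \<phi>' \<Longrightarrow> B \<in> sets borel \<Longrightarrow>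
       B \<subseteq> \<phi> ` W \<Longrightarrow> B \<subseteq> \<phi>' ` W' \<Longrightarrow>
       (\<integral>\<^sup>+u\<in>W \<inter> \<phi> -` B. ennreal (\<rho> \<phi> u) \<partial>lborel) = (\<integral>\<^sup>+u\<in>W' \<inter> \<phi>' -` B. ennreal (\<rho> \<phi>' u) \<partial>lborel)"
begin

text \<open>The indicators make map and density Borel although the parametrization is arbitrary outside the chart domain.\<close>

definition cm :: "'a set \<Rightarrow> ('a \<Rightarrow> real^3) \<Rightarrow> (real^3) measure" where
  "cm W \<phi> = distr (density lborel (\<lambda>u. ennreal (indicator W u *\<^sub>R \<rho> \<phi> u))) borel (\<lambda>u. indicator W u *\<^sub>R \<phi> u)"

lemma sets_cm [simp]: "sets (cm W \<phi>) = sets borel"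
  by (simp add: cm_def)

lemma cm_measurable:
  assumes "C1_chart UNIV S W \<phi>"
  shows "(\<lambda>u. indicator W u *\<^sub>R \<phi> u) \<in> borel_measurable borel"
    "(\<lambda>u. indicator W u *\<^sub>R \<rho> \<phi> u) \<in> borel_measurable borel"
proof -
  have W: "W \<in> sets borel" using C1_chart_open[OF assms] by simp
  show "(\<lambda>u. indicator W u *\<^sub>R \<phi> u) \<in> borel_measurable borel"
    by (rule borel_measurable_continuous_on_indicator[OF W C1_chart_continuous[OF assms]])
  show "(\<lambda>u. indicator W u *\<^sub>R \<rho> \<phi> u) \<in> borel_measurable borel"
    by (rule borel_measurable_continuous_on_indicator[OF W \<rho>_continuous[OF assms]])
qed

lemma emeasure_cm:
  assumes "C1_chart UNIV S W \<phi>" "B \<in> sets borel"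
  shows "emeasure (cm W \<phi>) B = (\<integral>\<^sup>+u\<in>W \<inter> \<phi> -` B. ennreal (\<rho> \<phi> u) \<partial>lborel)"
proof -
  note m = cm_measurable[OF assms(1)]
  have v: "(\<lambda>u. indicator W u *\<^sub>R \<phi> u) -` B \<in> sets borel"
    using measurable_sets[OF m(1) assms(2)] by simp
  have "emeasure (cm W \<phi>) B =
     (\<integral>\<^sup>+u. ennreal (indicator W u *\<^sub>R \<rho> \<phi> u) * indicator ((\<lambda>u. indicator W u *\<^sub>R \<phi> u) -` B) u \<partial>lborel)"
    unfolding cm_def using m v assms(2) by (simp add: emeasure_distr emeasure_density)
  also have "\<dots> = (\<integral>\<^sup>+u\<in>W \<inter> \<phi> -` B. ennreal (\<rho> \<phi> u) \<partial>lborel)"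
    by (intro nn_integral_cong) (auto split: split_indicator)
  finally show ?thesis .
qed

lemma cm_compatible:
  "C1_chart UNIV S W \<phi> \<Longrightarrow> C1_chart UNIV S W' \<phi>' \<Longrightarrow> B \<in> sets borel \<Longrightarrow>
       B \<subseteq> \<phi> ` W \<Longrightarrow> B \<subseteq> \<phi>' ` W' \<Longrightarrow> emeasure (cm W \<phi>) B = emeasure (cm W' \<phi>') B"
  by (simp only: emeasure_cm) (rule \<rho>_compatible)

text \<open>Chart images are relatively open in \<open>S\<close>; by the Lindelof property countably
  many of them suffice, and these are made disjoint.\<close>

lemma countable_charts:
  fixes \<C> :: "('a set \<times> ('a \<Rightarrow> real^3)) set"
  assumes "\<C> \<noteq> {}" and fam: "\<forall>c\<in>\<C>. C1_chart UNIV S (fst c) (snd c)"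
  shows "\<exists>W \<phi> A. (\<forall>k::nat. (W k, \<phi> k) \<in> \<C> \<and> A k \<in> sets borel \<and> A k \<subseteq> \<phi> k ` W k) \<and> disjoint_family A
    \<and> (\<Union>k. A k) = (\<Union>(W, \<phi>)\<in>\<C>. \<phi> ` W)"
proof -
  have "\<exists>U. open U \<and> snd c ` fst c = S \<inter> U" if "c \<in> \<C>" for c
    using C1_chart_image_openin[OF bspec[OF fam that]] by (metis Int_UNIV_right)
  then obtain U where U: "\<And>c. c \<in> \<C> \<Longrightarrow> open (U c) \<and> snd c ` fst c = S \<inter> U c" by metis
  obtain \<F> where F: "\<F> \<subseteq> U ` \<C>" "countable \<F>" "\<Union>\<F> = \<Union>(U ` \<C>)"
    using Lindelof[of "U ` \<C>"] U by (metis (mono_tags, lifting) image_iff)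
  obtain D where D: "countable D" "D \<subseteq> \<C>" "\<F> = U ` D"
    using F(1,2) countable_image_eq_inj by (metis countable_subset_image)
  \<comment> \<open>One chart is added to the countable family, which may be empty, so that it can
    be enumerated by all natural numbers.\<close>
  obtain c0 where c0: "c0 \<in> \<C>" using assms(1) by blast
  define E where "E = insert c0 D"
  have E: "countable E" "E \<subseteq> \<C>" "E \<noteq> {}" using D c0 by (auto simp: E_def)
  define c where "c = from_nat_into E"
  have c: "range c = E" using E by (simp add: c_def range_from_nat_into)
  then have cC: "c k \<in> \<C>" for k using E by auto
  have "(\<Union>k. snd (c k) ` fst (c k)) = (\<Union>c\<in>\<C>. snd c ` fst c)"
  proof -
    have "(\<Union>k. snd (c k) ` fst (c k)) = (\<Union>c\<in>E. snd c ` fst c)" unfolding c[symmetric] by auto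
    also have "\<dots> = (\<Union>c\<in>E. S \<inter> U c)"
      by (rule SUP_cong[OF refl]) (use U E(2) in blast)
    also have "\<dots> = S \<inter> (\<Union>c\<in>E. U c)" by blast
    also have "(\<Union>c\<in>E. U c) = \<Union>(U ` \<C>)" using F(3) D(3) c0 by (auto simp: E_def)
    also have "S \<inter> \<dots> = (\<Union>c\<in>\<C>. S \<inter> U c)" by blast
    also have "\<dots> = (\<Union>c\<in>\<C>. snd c ` fst c)"
      by (rule SUP_cong[OF refl]) (use U in blast)
    finally show ?thesis .
  qed
  moreover have "snd (c k) ` fst (c k) \<in> sets borel" for k
    using C1_chart_image_borel[OF bspec[OF fam cC] S_borel] .
  then have "disjointed (\<lambda>k. snd (c k) ` fst (c k)) k \<in> sets borel" for k
    using sets.range_disjointed_sets[of "\<lambda>k. snd (c k) ` fst (c k)" borel] by auto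
  moreover have "(\<Union>(W, \<phi>)\<in>\<C>. \<phi> ` W) = (\<Union>c\<in>\<C>. snd c ` fst c)"
    by (simp add: case_prod_unfold)
  ultimately show ?thesis
    by (intro exI[of _ "\<lambda>k. fst (c k)"] exI[of _ "\<lambda>k. snd (c k)"] exI[of _ "disjointed (\<lambda>k. snd (c k) ` fst (c k))"])
       (use cC disjoint_family_disjointed in \<open>auto simp: UN_disjointed_eq intro: disjointed_subset[THEN subsetD]\<close>)
qed

text \<open>Cutting \<open>B\<close> into countably many pieces, each inside a chart of the family,
  reduces the value in a new chart to compatibility. The family will consist of smooth charts and
  the new chart will be merely C1.\<close>

lemma chart_measure_extends:
  fixes \<C> :: "('a set \<times> ('a \<Rightarrow> real^3)) set"
  assumes "\<And>W \<phi>. (W, \<phi>) \<in> \<C> \<Longrightarrow> C1_chart UNIV S W \<phi>" "sets \<mu> = sets borel"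
    and "\<And>W \<phi> B. (W, \<phi>) \<in> \<C> \<Longrightarrow> B \<in> sets borel \<Longrightarrow> B \<subseteq> \<phi> ` W \<Longrightarrow> emeasure \<mu> B = emeasure (cm W \<phi>) B"
    and "C1_chart UNIV S W' \<phi>'" "B \<in> sets borel" "B \<subseteq> \<phi>' ` W'" "B \<subseteq> (\<Union>(W, \<phi>)\<in>\<C>. \<phi> ` W)"
  shows "emeasure \<mu> B = emeasure (cm W' \<phi>') B"
proof (cases "\<C> = {}")
  case True
  then show ?thesis using assms(7) by simp
next
  case False
  obtain W \<phi> A where c0: "\<forall>k::nat. (W k, \<phi> k) \<in> \<C> \<and> A k \<in> sets borel \<and> A k \<subseteq> \<phi> k ` W k"
    and c: "disjoint_family A" "(\<Union>k. A k) = (\<Union>(W, \<phi>)\<in>\<C>. \<phi> ` W)"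
    using countable_charts[OF False] assms(1) by (metis prod.collapse)
  have cC: "(W k, \<phi> k) \<in> \<C>" and cA: "A k \<in> sets borel" and cs: "A k \<subseteq> \<phi> k ` W k" for k
    using c0 by auto
  have B: "B = (\<Union>k. B \<inter> A k)" using assms(7) c(2) by auto
  have dj: "disjoint_family (\<lambda>k. B \<inter> A k)" using c(1) by (auto simp: disjoint_family_on_def)
  have Bm: "B \<inter> A k \<in> sets borel" for k using assms(5) cA by auto
  have sum: "(\<Sum>k. emeasure M (B \<inter> A k)) = emeasure M B" if "sets M = sets borel" for M :: "(real^3) measure"
  proof -
    have "(\<Sum>k. emeasure M (B \<inter> A k)) = emeasure M (\<Union>k. B \<inter> A k)"
      by (rule suminf_emeasure) (use Bm dj that in auto)
    then show ?thesis by (simp only: B[symmetric])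
  qed
  have "emeasure \<mu> B = (\<Sum>k. emeasure \<mu> (B \<inter> A k))"
    by (rule sum[OF assms(2), symmetric])
  also have "\<dots> = (\<Sum>k. emeasure (cm W' \<phi>') (B \<inter> A k))"
  proof (rule suminf_cong)
    fix k
    have "emeasure \<mu> (B \<inter> A k) = emeasure (cm (W k) (\<phi> k)) (B \<inter> A k)"
      using cs by (intro assms(3)[OF cC Bm]) auto
    also have "\<dots> = emeasure (cm W' \<phi>') (B \<inter> A k)"
      using cs assms(6) by (intro cm_compatible[OF assms(1)[OF cC] assms(4) Bm]) auto
    finally show "emeasure \<mu> (B \<inter> A k) = emeasure (cm W' \<phi>') (B \<inter> A k)" .
  qed
  also have "\<dots> = emeasure (cm W' \<phi>') B"
    by (rule sum) simp
  finally show ?thesis .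
qed

lemma suminf_swap_ennreal:
  fixes f :: "nat \<Rightarrow> nat \<Rightarrow> ennreal"
  shows "(\<Sum>i. \<Sum>k. f i k) = (\<Sum>k. \<Sum>i. f i k)"
proof -
  have "(\<Sum>i. \<Sum>k. f i k) = (\<Sum>i. \<integral>\<^sup>+k. f i k \<partial>count_space UNIV)"
    by (simp add: nn_integral_count_space_nat)
  also have "\<dots> = (\<integral>\<^sup>+k. (\<Sum>i. f i k) \<partial>count_space UNIV)"
    by (rule nn_integral_suminf[symmetric]) simp
  also have "\<dots> = (\<Sum>k. \<Sum>i. f i k)" by (simp add: nn_integral_count_space_nat)
  finally show ?thesis .
qed

text \<open>Each of the disjoint pieces carries the measure of its own chart, and the sum is taken.
  Compatibility shows that every other chart of the family reads the same measure.\<close>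

lemma chart_measure_exists:
  fixes \<C> :: "('a set \<times> ('a \<Rightarrow> real^3)) set"
  assumes "\<And>W \<phi>. (W, \<phi>) \<in> \<C> \<Longrightarrow> C1_chart UNIV S W \<phi>"
  obtains \<mu> where "sets \<mu> = sets borel" "emeasure \<mu> (- (\<Union>(W, \<phi>)\<in>\<C>. \<phi> ` W)) = 0"
    "\<And>W \<phi> B. (W, \<phi>) \<in> \<C> \<Longrightarrow> B \<in> sets borel \<Longrightarrow> B \<subseteq> \<phi> ` W \<Longrightarrow> emeasure \<mu> B = emeasure (cm W \<phi>) B"
proof (cases "\<C> = {}")
  case True
  show ?thesis by (rule that[of "null_measure borel"]) (use True in auto)
next
  case False
  obtain W \<phi> A where c0: "\<forall>k::nat. (W k, \<phi> k) \<in> \<C> \<and> A k \<in> sets borel \<and> A k \<subseteq> \<phi> k ` W k"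
    and c: "disjoint_family A" "(\<Union>k. A k) = (\<Union>(W, \<phi>)\<in>\<C>. \<phi> ` W)"
    using countable_charts[OF False] assms by (metis prod.collapse)
  have cC: "(W k, \<phi> k) \<in> \<C>" and cA: "A k \<in> sets borel" and cs: "A k \<subseteq> \<phi> k ` W k" for k
    using c0 by auto
  define m where "m B = (\<Sum>k. emeasure (cm (W k) (\<phi> k)) (B \<inter> A k))" for B
  define \<mu> where "\<mu> = measure_of UNIV (sets borel) m"
  have sets: "sets \<mu> = sets borel" unfolding \<mu>_def
    using sets.sets_measure_of_eq[of borel] by simp
  have em: "emeasure \<mu> B = m B" if "B \<in> sets borel" for B
  proof (rule emeasure_measure_of[OF \<mu>_def])
    show "countably_additive (sets \<mu>) m"
    proof (rule countably_additiveI)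
      fix B :: "nat \<Rightarrow> (real^3) set"
      assume B: "range B \<subseteq> sets \<mu>" "disjoint_family B"
      have "(\<Sum>i. m (B i)) = (\<Sum>k. \<Sum>i. emeasure (cm (W k) (\<phi> k)) (B i \<inter> A k))"
        unfolding m_def by (rule suminf_swap_ennreal)
      also have "\<dots> = (\<Sum>k. emeasure (cm (W k) (\<phi> k)) (\<Union>i. B i \<inter> A k))"
      proof (intro suminf_cong suminf_emeasure)
        fix k
        show "range (\<lambda>i. B i \<inter> A k) \<subseteq> sets (cm (W k) (\<phi> k))" using B(1) cA sets by auto
        show "disjoint_family (\<lambda>i. B i \<inter> A k)" using B(2) by (auto simp: disjoint_family_on_def)
      qed
      also have "\<dots> = m (\<Union>i. B i)" by (simp add: m_def)
      finally show "(\<Sum>i. m (B i)) = m (\<Union>i. B i)" .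
    qed
    show "positive (sets \<mu>) m" by (simp add: positive_def m_def)
  qed (use that sets in auto)
  show ?thesis
  proof (rule that[of \<mu>])
    have "- (\<Union>k. A k) \<in> sets borel" using cA by auto
    then have "emeasure \<mu> (- (\<Union>k. A k)) = m (- (\<Union>k. A k))" by (rule em)
    also have "\<dots> = 0"
    proof -
      have "- (\<Union>k. A k) \<inter> A j = {}" for j by auto
      then show ?thesis by (simp add: m_def)
    qed
    finally show "emeasure \<mu> (- (\<Union>(W, \<phi>)\<in>\<C>. \<phi> ` W)) = 0" by (simp only: c(2))
    fix W' \<phi>' B assume *: "(W', \<phi>') \<in> \<C>" "B \<in> sets borel" "B \<subseteq> \<phi>' ` W'"
    have Bm: "B \<inter> A k \<in> sets borel" for k using *(2) cA by auto
    have dj: "disjoint_family (\<lambda>k. B \<inter> A k)" using c(1) by (auto simp: disjoint_family_on_def)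
    have B: "B = (\<Union>k. B \<inter> A k)"
    proof -
      have "B \<subseteq> (\<Union>k. A k)" unfolding c(2) using *(1,3) by auto
      then show ?thesis by auto
    qed
    have "emeasure \<mu> B = (\<Sum>k. emeasure (cm W' \<phi>') (B \<inter> A k))"
      unfolding em[OF *(2)] m_def
    proof (rule suminf_cong)
      fix k
      show "emeasure (cm (W k) (\<phi> k)) (B \<inter> A k) = emeasure (cm W' \<phi>') (B \<inter> A k)"
        using cs *(3) by (intro cm_compatible[OF assms[OF cC] assms[OF *(1)] Bm]) auto
    qed
    also have "\<dots> = emeasure (cm W' \<phi>') B"
    proof -
      have "(\<Sum>k. emeasure (cm W' \<phi>') (B \<inter> A k)) = emeasure (cm W' \<phi>') (\<Union>k. B \<inter> A k)"
        by (rule suminf_emeasure) (use Bm dj in auto)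
      then show ?thesis by (simp only: B[symmetric])
    qed
    finally show "emeasure \<mu> B = emeasure (cm W' \<phi>') B" .
  qed fact
qed

lemma chart_integral:
  fixes f :: "real^3 \<Rightarrow> real"
  assumes ch: "C1_chart UNIV S W \<phi>" and sets: "sets \<mu> = sets borel"
    and em: "\<And>B. B \<in> sets borel \<Longrightarrow> B \<subseteq> \<phi> ` W \<Longrightarrow> emeasure \<mu> B = emeasure (cm W \<phi>) B"
    and f: "f \<in> borel_measurable borel" and zero: "\<And>x. x \<notin> \<phi> ` W \<Longrightarrow> f x = 0"
  shows "integral\<^sup>L \<mu> f = (LINT u:W|lborel. \<rho> \<phi> u * f (\<phi> u))"
proof -
  have im: "\<phi> ` W \<in> sets borel" using C1_chart_image_borel[OF ch S_borel] .
  note m = cm_measurable[OF ch]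
  \<comment> \<open>Restriction to the chart image makes the given measure a push-forward of a
    density on the parameter domain, so the standard integral formulas apply.\<close>
  have eq: "density \<mu> (\<lambda>x. ennreal (indicator (\<phi> ` W) x)) = cm W \<phi>"
  proof (rule measure_eqI)
    fix B assume "B \<in> sets (density \<mu> (\<lambda>x. ennreal (indicator (\<phi> ` W) x)))"
    then have B: "B \<in> sets borel" by (simp add: sets)
    have "emeasure (density \<mu> (\<lambda>x. ennreal (indicator (\<phi> ` W) x))) B = emeasure \<mu> (\<phi> ` W \<inter> B)"
    proof -
      have *: "\<phi> ` W \<in> sets \<mu>" "B \<in> sets \<mu>" "\<phi> ` W \<inter> B \<in> sets \<mu>" using im B sets by auto
      then have "emeasure (density \<mu> (\<lambda>x. ennreal (indicator (\<phi> ` W) x))) B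
          = (\<integral>\<^sup>+x. ennreal (indicator (\<phi> ` W) x) * indicator B x \<partial>\<mu>)"
        by (intro emeasure_density) auto
      also have "\<dots> = (\<integral>\<^sup>+x. indicator (\<phi> ` W \<inter> B) x \<partial>\<mu>)"
        by (intro nn_integral_cong) (auto split: split_indicator)
      finally show ?thesis using *(3) by simp
    qed
    also have "\<dots> = emeasure (cm W \<phi>) (\<phi> ` W \<inter> B)" using em B im by auto
    also have "\<dots> = emeasure (cm W \<phi>) B"
    proof -
      have "W \<inter> \<phi> -` (\<phi> ` W \<inter> B) = W \<inter> \<phi> -` B" by auto
      then show ?thesis using B im by (simp add: emeasure_cm[OF ch])
    qed
    finally show "emeasure (density \<mu> (\<lambda>x. ennreal (indicator (\<phi> ` W) x))) B = emeasure (cm W \<phi>) B" .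
  qed (simp add: sets)
  have f': "f \<in> borel_measurable \<mu>" using f sets measurable_cong_sets by blast
  have "integral\<^sup>L \<mu> f = (\<integral>x. indicator (\<phi> ` W) x *\<^sub>R f x \<partial>\<mu>)"
    by (intro Bochner_Integration.integral_cong) (auto simp: zero split: split_indicator)
  also have "\<dots> = integral\<^sup>L (density \<mu> (\<lambda>x. ennreal (indicator (\<phi> ` W) x))) f"
    by (rule integral_density[symmetric]) (use f' im sets in auto)
  also have "\<dots> = integral\<^sup>L (cm W \<phi>) f" by (simp only: eq)
  also have "\<dots> = (\<integral>u. f (indicator W u *\<^sub>R \<phi> u) \<partial>density lborel (\<lambda>u. ennreal (indicator W u *\<^sub>R \<rho> \<phi> u)))"
    unfolding cm_def by (rule integral_distr) (use m f in auto)
  also have "\<dots> = (\<integral>u. (indicator W u *\<^sub>R \<rho> \<phi> u) *\<^sub>R f (indicator W u *\<^sub>R \<phi> u) \<partial>lborel)"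
    by (rule integral_density) (use m f \<rho>_nonneg in auto)
  also have "\<dots> = (LINT u:W|lborel. \<rho> \<phi> u * f (\<phi> u))"
    unfolding set_lebesgue_integral_def
    by (intro Bochner_Integration.integral_cong) (auto split: split_indicator)
  finally show ?thesis .
qed

end

section \<open>The densities of area and arc length\<close>

lemma det_matrix_2: "det (matrix (f :: real^2 \<Rightarrow> real^2)) = f (axis 1 1) $ 1 * f (axis 2 1) $ 2 - f (axis 1 1) $ 2 * f (axis 2 1) $ 1"
  by (simp add: det_2 matrix_def mult.commute)

lemma vec2_expand: "(x::real^2) = (x $ 1) *\<^sub>R axis 1 1 + (x $ 2) *\<^sub>R axis 2 1"
  by (simp add: vec_eq_iff forall_2 axis_def)

lemma linear_axis_expand:
  fixes D :: "real^2 \<Rightarrow> 'b::real_vector"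
  assumes "linear D"
  shows "D x = (x $ 1) *\<^sub>R D (axis 1 1) + (x $ 2) *\<^sub>R D (axis 2 1)"
proof -
  have "D x = D ((x $ 1) *\<^sub>R axis 1 1 + (x $ 2) *\<^sub>R axis 2 1)"
    by (simp only: vec2_expand[symmetric])
  then show ?thesis by (simp only: linear_add[OF assms] linear_cmul[OF assms])
qed

lemma cross3_combination:
  "cross3 (a1 *\<^sub>R P + a2 *\<^sub>R Q) (b1 *\<^sub>R P + b2 *\<^sub>R Q) = (a1 * b2 - a2 * b1) *\<^sub>R cross3 P Q"
  by (simp add: cross3_simps)

lemma cross3_linear_image:
  fixes D :: "real^2 \<Rightarrow> real^3"
  assumes "linear D"
  shows "cross3 (D a) (D b) = (a $ 1 * b $ 2 - a $ 2 * b $ 1) *\<^sub>R cross3 (D (axis 1 1)) (D (axis 2 1))"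
  unfolding linear_axis_expand[OF assms, of a] linear_axis_expand[OF assms, of b]
  by (rule cross3_combination)

lemma area_density_continuous:
  assumes "C1_chart M S W \<phi>" shows "continuous_on W (area_density \<phi>)"
proof -
  have "continuous_on W (\<lambda>u. frechet_derivative \<phi> (at u) v)" for v
    by (rule C1_on_continuous_deriv[OF C1_chart_C1[OF assms]])
  then show ?thesis
    unfolding area_density_def by (intro continuous_on_norm continuous_on_cross)
qed

lemma area_chart_density:
  assumes "S \<in> sets borel"
  shows "chart_density S area_density"
proof
  show "S \<in> sets borel" by fact
  show "continuous_on W (area_density \<phi>)" if "C1_chart UNIV S W \<phi>" for W \<phi>
    using area_density_continuous[OF that] .
  show "0 \<le> area_density \<phi> u" for \<phi> u by (simp add: area_density_def)
  fix W W' and \<phi> \<phi>' :: "real^2 \<Rightarrow> real^3" and B :: "(real^3) set"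
  assume \<phi>: "C1_chart UNIV S W \<phi>" "C1_chart UNIV S W' \<phi>'" and B: "B \<in> sets borel" "B \<subseteq> \<phi> ` W" "B \<subseteq> \<phi>' ` W'"
  obtain T T' where T: "inj_on T (W \<inter> \<phi> -` B)" "T ` (W \<inter> \<phi> -` B) = W' \<inter> \<phi>' -` B"
    "\<And>u. u \<in> W \<inter> \<phi> -` B \<Longrightarrow> (T has_derivative T' u) (at u)"
    "\<And>u v. u \<in> W \<inter> \<phi> -` B \<Longrightarrow> frechet_derivative \<phi> (at u) v = frechet_derivative \<phi>' (at (T u)) (T' u v)"
    using chart_transition_change_of_variables[OF \<phi> B(2,3)] by blast
  have m: "(\<lambda>u. indicator (W \<inter> \<phi> -` B) u *\<^sub>R area_density \<phi> u) \<in> borel_measurable borel"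
    if "C1_chart UNIV S W \<phi>" for W \<phi>
    using borel_measurable_continuous_on_indicator[OF C1_chart_preimage_borel[OF that B(1)]]
      continuous_on_subset[OF area_density_continuous[OF that]] by blast
  show "(\<integral>\<^sup>+u\<in>W \<inter> \<phi> -` B. ennreal (area_density \<phi> u) \<partial>lborel) = (\<integral>\<^sup>+u\<in>W' \<inter> \<phi>' -` B. ennreal (area_density \<phi>' u) \<partial>lborel)"
    unfolding T(2)[symmetric]
  proof (rule nn_integral_change_of_variables_plane[where T' = T'])
    show "W \<inter> \<phi> -` B \<in> sets borel" by (rule C1_chart_preimage_borel[OF \<phi>(1) B(1)])
    show "(T has_derivative T' u) (at u)" if "u \<in> W \<inter> \<phi> -` B" for u by (rule T(3)[OF that])
    show "inj_on T (W \<inter> \<phi> -` B)" by (rule T(1))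
  next
    fix u assume u: "u \<in> W \<inter> \<phi> -` B"
    then have "T u \<in> W'" using T(2) by blast
    then have "linear (frechet_derivative \<phi>' (at (T u)))" by (rule C1_chart_deriv[OF \<phi>(2)])
    from cross3_linear_image[OF this, of "T' u (axis 1 1)" "T' u (axis 2 1)"] show "area_density \<phi> u = \<bar>det (matrix (T' u))\<bar> * area_density \<phi>' (T u)"
      unfolding area_density_def T(4)[OF u] by (simp add: det_matrix_2)
  next
    show "0 \<le> area_density \<phi>' x" for x by (simp add: area_density_def)
    show "(\<lambda>x. indicator (W \<inter> \<phi> -` B) x *\<^sub>R area_density \<phi> x) \<in> borel_measurable borel"
      by (rule m[OF \<phi>(1)])
    show "(\<lambda>x. indicator (T ` (W \<inter> \<phi> -` B)) x *\<^sub>R area_density \<phi>' x) \<in> borel_measurable borel"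
      unfolding T(2) by (rule m[OF \<phi>(2)])
  qed
qed

lemma C1_chart_vector_derivative:
  assumes "C1_chart M S W \<gamma>" "t \<in> W"
  shows "vector_derivative \<gamma> (at t) = frechet_derivative \<gamma> (at t) 1"
proof -
  note d = C1_chart_deriv[OF assms]
  have "frechet_derivative \<gamma> (at t) x = x *\<^sub>R frechet_derivative \<gamma> (at t) 1" for x
    using linear_cmul[OF d(3), of x 1] by simp
  then have "frechet_derivative \<gamma> (at t) = (\<lambda>x. x *\<^sub>R frechet_derivative \<gamma> (at t) 1)" by (rule ext)
  from has_derivative_eq_rhs[OF d(1) this] show ?thesis
    using vector_derivative_at unfolding has_vector_derivative_def by blast
qed

lemma speed_continuous:
  assumes "C1_chart M S W \<gamma>" shows "continuous_on W (\<lambda>t. norm (vector_derivative \<gamma> (at t)))"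
proof -
  have "continuous_on W (\<lambda>u. norm (frechet_derivative \<gamma> (at u) 1))"
    by (intro continuous_on_norm C1_on_continuous_deriv[OF C1_chart_C1[OF assms]])
  then show ?thesis
    by (rule continuous_on_eq) (simp add: C1_chart_vector_derivative[OF assms])
qed

lemma arc_chart_density:
  assumes "S \<in> sets borel"
  shows "chart_density S (\<lambda>\<gamma> t. norm (vector_derivative \<gamma> (at t)))"
proof
  let ?\<rho> = "\<lambda>\<gamma> t. norm (vector_derivative \<gamma> (at t) :: real^3)"
  show "S \<in> sets borel" by fact
  show "continuous_on W (?\<rho> \<phi>)" if "C1_chart UNIV S W \<phi>" for W \<phi>
    using speed_continuous[OF that] .
  show "0 \<le> ?\<rho> \<phi> u" for \<phi> u by simp
  fix W W' and \<phi> \<phi>' :: "real \<Rightarrow> real^3" and B :: "(real^3) set"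
  assume \<phi>: "C1_chart UNIV S W \<phi>" "C1_chart UNIV S W' \<phi>'" and B: "B \<in> sets borel" "B \<subseteq> \<phi> ` W" "B \<subseteq> \<phi>' ` W'"
  obtain T T' where T: "inj_on T (W \<inter> \<phi> -` B)" "T ` (W \<inter> \<phi> -` B) = W' \<inter> \<phi>' -` B"
    "\<And>u. u \<in> W \<inter> \<phi> -` B \<Longrightarrow> (T has_derivative T' u) (at u)"
    "\<And>u v. u \<in> W \<inter> \<phi> -` B \<Longrightarrow> frechet_derivative \<phi> (at u) v = frechet_derivative \<phi>' (at (T u)) (T' u v)"
    using chart_transition_change_of_variables[OF \<phi> B(2,3)] by blast
  have m: "(\<lambda>u. indicator (W \<inter> \<phi> -` B) u *\<^sub>R ?\<rho> \<phi> u) \<in> borel_measurable borel"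
    if "C1_chart UNIV S W \<phi>" for W \<phi>
    using borel_measurable_continuous_on_indicator[OF C1_chart_preimage_borel[OF that B(1)]]
      continuous_on_subset[OF speed_continuous[OF that]] by blast
  show "(\<integral>\<^sup>+u\<in>W \<inter> \<phi> -` B. ennreal (?\<rho> \<phi> u) \<partial>lborel) = (\<integral>\<^sup>+u\<in>W' \<inter> \<phi>' -` B. ennreal (?\<rho> \<phi>' u) \<partial>lborel)"
    unfolding T(2)[symmetric]
  proof (rule nn_integral_change_of_variables_line[where T' = T'])
    show "W \<inter> \<phi> -` B \<in> sets borel" by (rule C1_chart_preimage_borel[OF \<phi>(1) B(1)])
    show "(T has_derivative T' u) (at u)" if "u \<in> W \<inter> \<phi> -` B" for u by (rule T(3)[OF that])
    show "inj_on T (W \<inter> \<phi> -` B)" by (rule T(1))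
  next
    fix u assume u: "u \<in> W \<inter> \<phi> -` B"
    then have Tu: "T u \<in> W'" using T(2) by blast
    then have "linear (frechet_derivative \<phi>' (at (T u)))" by (rule C1_chart_deriv[OF \<phi>(2)])
    from linear_cmul[OF this, of "T' u 1" 1] T(4)[OF u, of 1]
    show "?\<rho> \<phi> u = \<bar>T' u 1\<bar> * ?\<rho> \<phi>' (T u)"
      using u by (simp add: C1_chart_vector_derivative[OF \<phi>(1)] C1_chart_vector_derivative[OF \<phi>(2) Tu])
  next
    show "0 \<le> ?\<rho> \<phi>' x" for x by simp
    show "(\<lambda>x. indicator (W \<inter> \<phi> -` B) x *\<^sub>R ?\<rho> \<phi> x) \<in> borel_measurable borel"
      by (rule m[OF \<phi>(1)])
    show "(\<lambda>x. indicator (T ` (W \<inter> \<phi> -` B)) x *\<^sub>R ?\<rho> \<phi>' x) \<in> borel_measurable borel"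
      unfolding T(2) by (rule m[OF \<phi>(2)])
  qed
qed

lemma regular_points_eq_charts:
  "regular_points S = (\<Union>(W, \<phi>)\<in>{(W, \<phi>). local_param UNIV S W \<phi> \<and> smooth_on \<phi> W}. \<phi> ` W)"
  unfolding regular_points_def by blast

lemma curve_points_eq_charts:
  "curve_points C = (\<Union>(W, \<gamma>)\<in>{(W, \<gamma>). curve_param C W \<gamma>}. \<gamma> ` W)"
  unfolding curve_points_def by blast

text \<open>The glued measure is a witness, so the \<open>SOME\<close> in the definition meets its
  specification. Every later evaluation of area goes back to this fact.\<close>

lemma is_area_measure_area_measure:
  assumes "S \<in> sets borel"
  shows "is_area_measure S (area_measure S)"
proof -
  interpret chart_density S area_density by (rule area_chart_density[OF assms])
  let ?C = "{(W, \<phi>). local_param UNIV S W \<phi> \<and> smooth_on \<phi> W}"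
  have ch: "C1_chart UNIV S W \<phi>" if "(W, \<phi>) \<in> ?C" for W \<phi>
    using that by (simp add: local_param_iff)
  obtain \<mu> where \<mu>: "sets \<mu> = sets borel" "emeasure \<mu> (- (\<Union>(W, \<phi>)\<in>?C. \<phi> ` W)) = 0"
    "\<And>W \<phi> B. (W, \<phi>) \<in> ?C \<Longrightarrow> B \<in> sets borel \<Longrightarrow> B \<subseteq> \<phi> ` W \<Longrightarrow> emeasure \<mu> B = emeasure (cm W \<phi>) B"
    using chart_measure_exists[of ?C] ch by blast
  have "is_area_measure S \<mu>"
    unfolding is_area_measure_def regular_points_eq_charts
  proof (intro conjI allI impI ballI)
    fix W \<phi> B assume *: "local_param UNIV S W \<phi> \<and> smooth_on \<phi> W" "B \<in> sets borel" "B \<subseteq> \<phi> ` W"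
    then have "(W, \<phi>) \<in> ?C" by simp
    from \<mu>(3)[OF this *(2,3)] emeasure_cm[OF ch[OF this] *(2)]
    show "emeasure \<mu> B = (\<integral>\<^sup>+u\<in>W \<inter> \<phi> -` B. ennreal (area_density \<phi> u) \<partial>lborel)" by simp
  qed (use \<mu>(1,2) in auto)
  then show ?thesis unfolding area_measure_def by (rule someI)
qed

lemma is_arc_length_measure_arc_length_measure:
  assumes "C \<in> sets borel"
  shows "is_arc_length_measure C (arc_length_measure C)"
proof -
  interpret chart_density C "\<lambda>\<gamma> t. norm (vector_derivative \<gamma> (at t))" by (rule arc_chart_density[OF assms])
  let ?C = "{(W, \<phi>). curve_param C W \<phi>}"
  have ch: "C1_chart UNIV C W \<phi>" if "(W, \<phi>) \<in> ?C" for W \<phi>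
    using that by (simp add: curve_param_C1_chart)
  obtain \<mu> where \<mu>: "sets \<mu> = sets borel" "emeasure \<mu> (- (\<Union>(W, \<phi>)\<in>?C. \<phi> ` W)) = 0"
    "\<And>W \<phi> B. (W, \<phi>) \<in> ?C \<Longrightarrow> B \<in> sets borel \<Longrightarrow> B \<subseteq> \<phi> ` W \<Longrightarrow> emeasure \<mu> B = emeasure (cm W \<phi>) B"
    using chart_measure_exists[of ?C] ch by blast
  have "is_arc_length_measure C \<mu>"
    unfolding is_arc_length_measure_def curve_points_eq_charts
  proof (intro conjI allI impI ballI)
    fix W \<phi> B assume *: "curve_param C W \<phi>" "B \<in> sets borel" "B \<subseteq> \<phi> ` W"
    then have "(W, \<phi>) \<in> ?C" by simp
    from \<mu>(3)[OF this *(2,3)] emeasure_cm[OF ch[OF this] *(2)]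
    show "emeasure \<mu> B = (\<integral>\<^sup>+t\<in>W \<inter> \<phi> -` B. ennreal (norm (vector_derivative \<phi> (at t))) \<partial>lborel)" by simp
  qed (use \<mu>(1,2) in auto)
  then show ?thesis unfolding arc_length_measure_def by (rule someI)
qed

lemma sets_area_measure: "S \<in> sets borel \<Longrightarrow> sets (area_measure S) = sets borel"
  using is_area_measure_area_measure[of S] unfolding is_area_measure_def by blast

lemma area_measure_null: "S \<in> sets borel \<Longrightarrow> emeasure (area_measure S) (- regular_points S) = 0"
  using is_area_measure_area_measure[of S] unfolding is_area_measure_def by blast

lemma sets_arc_length_measure: "C \<in> sets borel \<Longrightarrow> sets (arc_length_measure C) = sets borel"
  using is_arc_length_measure_arc_length_measure[of C] unfolding is_arc_length_measure_def by blast

lemma arc_length_measure_null: "C \<in> sets borel \<Longrightarrow> emeasure (arc_length_measure C) (- curve_points C) = 0"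
  using is_arc_length_measure_arc_length_measure[of C] unfolding is_arc_length_measure_def by blast

text \<open>The specification of the measure covers smooth charts; this evaluation covers C1 charts,
  as needed for the area near a corner.\<close>

lemma emeasure_area_chart:
  assumes S: "S \<in> sets borel" and ch: "C1_chart UNIV S W \<phi>" and B: "B \<in> sets borel" "B \<subseteq> \<phi> ` W" "B \<subseteq> regular_points S"
  shows "emeasure (area_measure S) B = (\<integral>\<^sup>+u\<in>W \<inter> \<phi> -` B. ennreal (area_density \<phi> u) \<partial>lborel)"
proof -
  interpret chart_density S area_density by (rule area_chart_density[OF S])
  let ?C = "{(W, \<phi>). local_param UNIV S W \<phi> \<and> smooth_on \<phi> W}"
  have "emeasure (area_measure S) B = emeasure (cm W \<phi>) B"
  proof (rule chart_measure_extends[of ?C])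
    show "C1_chart UNIV S W \<phi>" if "(W, \<phi>) \<in> ?C" for W \<phi>
      using that by (simp add: local_param_iff)
    show "emeasure (area_measure S) B = emeasure (cm W \<phi>) B"
      if "(W, \<phi>) \<in> ?C" "B \<in> sets borel" "B \<subseteq> \<phi> ` W" for W \<phi> B
      using is_area_measure_area_measure[OF S] that emeasure_cm[of W \<phi> B]
      by (auto simp: is_area_measure_def local_param_iff)
    show "B \<subseteq> (\<Union>(W, \<phi>)\<in>?C. \<phi> ` W)" using B(3) unfolding regular_points_eq_charts .
  qed (use S ch B sets_area_measure in simp_all)
  then show ?thesis by (simp add: emeasure_cm[OF ch B(1)])
qed

lemma emeasure_arc_chart:
  assumes S: "C \<in> sets borel" and ch: "C1_chart UNIV C W \<phi>" and B: "B \<in> sets borel" "B \<subseteq> \<phi> ` W" "B \<subseteq> curve_points C"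
  shows "emeasure (arc_length_measure C) B = (\<integral>\<^sup>+t\<in>W \<inter> \<phi> -` B. ennreal (norm (vector_derivative \<phi> (at t))) \<partial>lborel)"
proof -
  interpret chart_density C "\<lambda>\<gamma> t. norm (vector_derivative \<gamma> (at t))" by (rule arc_chart_density[OF S])
  let ?C = "{(W, \<phi>). curve_param C W \<phi>}"
  have "emeasure (arc_length_measure C) B = emeasure (cm W \<phi>) B"
  proof (rule chart_measure_extends[of ?C])
    show "C1_chart UNIV C W \<phi>" if "(W, \<phi>) \<in> ?C" for W \<phi>
      using that by (simp add: curve_param_C1_chart)
    show "emeasure (arc_length_measure C) B = emeasure (cm W \<phi>) B"
      if "(W, \<phi>) \<in> ?C" "B \<in> sets borel" "B \<subseteq> \<phi> ` W" for W \<phi> B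
      using is_arc_length_measure_arc_length_measure[OF S] that emeasure_cm[of W \<phi> B]
      by (auto simp: is_arc_length_measure_def curve_param_C1_chart)
    show "B \<subseteq> (\<Union>(W, \<phi>)\<in>?C. \<phi> ` W)" using B(3) unfolding curve_points_eq_charts .
  qed (use S ch B sets_arc_length_measure in simp_all)
  then show ?thesis by (simp add: emeasure_cm[OF ch B(1)])
qed

lemma integral_area_chart:
  fixes f :: "real^3 \<Rightarrow> real"
  assumes S: "S \<in> sets borel" and ch: "C1_chart UNIV S W \<phi>" "smooth_on \<phi> W"
    and f: "f \<in> borel_measurable borel" "\<And>x. x \<notin> \<phi> ` W \<Longrightarrow> f x = 0"
  shows "integral\<^sup>L (area_measure S) f = (LINT u:W|lborel. area_density \<phi> u * f (\<phi> u))"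
proof -
  interpret chart_density S area_density by (rule area_chart_density[OF S])
  show ?thesis
  proof (rule chart_integral[OF ch(1) sets_area_measure[OF S] _ f])
    fix B assume "B \<in> sets borel" "B \<subseteq> \<phi> ` W"
    then show "emeasure (area_measure S) B = emeasure (cm W \<phi>) B"
      using is_area_measure_area_measure[OF S] ch emeasure_cm[OF ch(1), of B]
      by (auto simp: is_area_measure_def local_param_iff)
  qed
qed

lemma integral_arc_chart:
  fixes f :: "real^3 \<Rightarrow> real"
  assumes S: "C \<in> sets borel" and ch: "curve_param C W \<phi>"
    and f: "f \<in> borel_measurable borel" "\<And>x. x \<notin> \<phi> ` W \<Longrightarrow> f x = 0"
  shows "integral\<^sup>L (arc_length_measure C) f = (LINT t:W|lborel. norm (vector_derivative \<phi> (at t)) * f (\<phi> t))"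
proof -
  interpret chart_density C "\<lambda>\<gamma> t. norm (vector_derivative \<gamma> (at t))" by (rule arc_chart_density[OF S])
  note c1 = curve_param_C1_chart[OF ch]
  show ?thesis
  proof (rule chart_integral[OF c1 sets_arc_length_measure[OF S] _ f])
    fix B assume "B \<in> sets borel" "B \<subseteq> \<phi> ` W"
    then show "emeasure (arc_length_measure C) B = emeasure (cm W \<phi>) B"
      using is_arc_length_measure_arc_length_measure[OF S] ch emeasure_cm[OF c1, of B]
      by (auto simp: is_arc_length_measure_def)
  qed
qed

section \<open>The intrinsic divergence in a chart\<close>

lemma second_difference_mvt:
  fixes f :: "'a::real_normed_vector \<Rightarrow> real"
  assumes r: "ball u r \<subseteq> W" and h: "0 < h" "h * (norm a + norm b) < r"
    and f: "\<And>x. x \<in> W \<Longrightarrow> (f has_derivative f' x) (at x)"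
    and fa: "\<And>x. x \<in> W \<Longrightarrow> ((\<lambda>x. f' x a) has_derivative fa x) (at x)"
  obtains x where "dist x u < r" "norm (x - u) \<le> h * (norm a + norm b)"
    "f (u + h *\<^sub>R a + h *\<^sub>R b) - f (u + h *\<^sub>R a) - f (u + h *\<^sub>R b) + f u = h * h * fa x b"
proof -
  have nb: "norm (s *\<^sub>R a + t *\<^sub>R b) \<le> h * (norm a + norm b)" if "0 \<le> s" "s \<le> h" "0 \<le> t" "t \<le> h" for s t
  proof -
    have "norm (s *\<^sub>R a + t *\<^sub>R b) \<le> s * norm a + t * norm b"
      using norm_triangle_ineq[of "s *\<^sub>R a" "t *\<^sub>R b"] that by simp
    also have "\<dots> \<le> h * norm a + h * norm b"
      using that by (intro add_mono mult_right_mono) auto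
    finally show ?thesis by (simp add: algebra_simps)
  qed
  have inW: "u + s *\<^sub>R a + t *\<^sub>R b \<in> W" if "0 \<le> s" "s \<le> h" "0 \<le> t" "t \<le> h" for s t
    using nb[OF that] h(2) r by (auto simp: subset_iff dist_norm norm_minus_commute add.assoc)
  define g where "g s = f (u + s *\<^sub>R a + h *\<^sub>R b) - f (u + s *\<^sub>R a + 0 *\<^sub>R b)" for s
  have path: "((\<lambda>s. u + s *\<^sub>R a + t *\<^sub>R b) has_derivative (\<lambda>d. d *\<^sub>R a)) (at s)" for s t
    by (auto intro!: derivative_eq_intros)
  have dg: "(g has_derivative (\<lambda>d. f' (u + s *\<^sub>R a + h *\<^sub>R b) (d *\<^sub>R a) - f' (u + s *\<^sub>R a + 0 *\<^sub>R b) (d *\<^sub>R a))) (at s)"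
    if "0 \<le> s" "s \<le> h" for s
    unfolding g_def
    by (intro has_derivative_diff has_derivative_compose[OF path] f inW) (use that h in auto)
  have "\<exists>z\<in>{0<..<h}. g h - g 0 = (\<lambda>d. f' (u + z *\<^sub>R a + h *\<^sub>R b) (d *\<^sub>R a) - f' (u + z *\<^sub>R a + 0 *\<^sub>R b) (d *\<^sub>R a)) (h - 0)"
    by (rule mvt_simple[OF h(1)]) (rule has_derivative_at_withinI[OF dg])
  then obtain z where z: "0 < z" "z < h"
    "g h - g 0 = f' (u + z *\<^sub>R a + h *\<^sub>R b) ((h - 0) *\<^sub>R a) - f' (u + z *\<^sub>R a + 0 *\<^sub>R b) ((h - 0) *\<^sub>R a)"
    unfolding greaterThanLessThan_iff Bex_def by (elim exE conjE)
  define k where "k t = f' (u + z *\<^sub>R a + t *\<^sub>R b) a" for t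
  have lin: "linear (f' x)" if "x \<in> W" for x using f[OF that] has_derivative_linear by blast
  have "linear (f' (u + z *\<^sub>R a + t *\<^sub>R b))" if "0 \<le> t" "t \<le> h" for t
    using lin[OF inW[of z t]] that z(1,2) by simp
  then have hk: "f' (u + z *\<^sub>R a + t *\<^sub>R b) ((h - 0) *\<^sub>R a) = h * k t" if "0 \<le> t" "t \<le> h" for t
    using linear_cmul[of "f' (u + z *\<^sub>R a + t *\<^sub>R b)" "h - 0" a] that by (simp add: k_def)
  have gk: "g h - g 0 = h * (k h - k 0)"
    using h unfolding z(3) hk[OF order.refl less_imp_le[OF h(1)]] hk[OF less_imp_le[OF h(1)] order.refl]
    by (simp add: right_diff_distrib)
  have path2: "((\<lambda>t. u + z *\<^sub>R a + t *\<^sub>R b) has_derivative (\<lambda>d. d *\<^sub>R b)) (at t)" for t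
    by (auto intro!: derivative_eq_intros)
  have dk: "(k has_derivative (\<lambda>d. fa (u + z *\<^sub>R a + t *\<^sub>R b) (d *\<^sub>R b))) (at t)"
    if "0 \<le> t" "t \<le> h" for t
    unfolding k_def
    by (rule has_derivative_compose[OF path2 fa[OF inW]]) (use that z in auto)
  have "\<exists>y\<in>{0<..<h}. k h - k 0 = (\<lambda>d. fa (u + z *\<^sub>R a + y *\<^sub>R b) (d *\<^sub>R b)) (h - 0)"
    by (rule mvt_simple[OF h(1)]) (rule has_derivative_at_withinI[OF dk])
  then obtain y where y: "0 < y" "y < h"
    "k h - k 0 = fa (u + z *\<^sub>R a + y *\<^sub>R b) ((h - 0) *\<^sub>R b)"
    unfolding greaterThanLessThan_iff Bex_def by (elim exE conjE)
  let ?x = "u + z *\<^sub>R a + y *\<^sub>R b"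
  have xW: "?x \<in> W" using inW z y by simp
  have "linear (fa ?x)" using fa[OF xW] has_derivative_linear by blast
  then have "k h - k 0 = h * fa ?x b" using y(3) by (simp add: linear_cmul)
  then have "g h - g 0 = h * h * fa ?x b" using gk by simp
  moreover have "norm (?x - u) \<le> h * (norm a + norm b)"
    using nb[of z y] z y by (simp add: add.assoc)
  ultimately show ?thesis
    using that[of ?x] h(2) by (simp add: g_def dist_norm)
qed

text \<open>The second difference over a small parallelogram is symmetric in \<open>a\<close> and
  \<open>b\<close>. The mean value theorem, applied twice in either order, expresses it by each of
  the two mixed derivatives at nearby points, and continuity moves these points to
  \<open>u\<close>.\<close>

lemma mixed_partials_real:
  fixes f :: "'a::real_normed_vector \<Rightarrow> real"
  assumes W: "open W" "u \<in> W"
    and f: "\<And>x. x \<in> W \<Longrightarrow> (f has_derivative f' x) (at x)"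
    and fa: "\<And>x. x \<in> W \<Longrightarrow> ((\<lambda>x. f' x a) has_derivative fa x) (at x)"
    and fb: "\<And>x. x \<in> W \<Longrightarrow> ((\<lambda>x. f' x b) has_derivative fb x) (at x)"
    and c: "continuous_on W (\<lambda>x. fa x b)" "continuous_on W (\<lambda>x. fb x a)"
  shows "fa u b = fb u a"
proof (rule ccontr)
  assume ne: "fa u b \<noteq> fb u a"
  \<comment> \<open>Half the supposed gap: each mixed derivative moves by less than
    \<open>e\<close>, so together they cannot bridge it.\<close>
  define e where "e = \<bar>fa u b - fb u a\<bar> / 2"
  have e: "e > 0" using ne by (simp add: e_def)
  obtain r0 where r0: "r0 > 0" "ball u r0 \<subseteq> W" using W open_contains_ball by blast
  obtain r1 where r1: "r1 > 0" "\<And>x. x \<in> W \<Longrightarrow> dist x u < r1 \<Longrightarrow> \<bar>fa x b - fa u b\<bar> < e"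
    using c(1) W(2) e unfolding continuous_on_iff dist_real_def by metis
  obtain r2 where r2: "r2 > 0" "\<And>x. x \<in> W \<Longrightarrow> dist x u < r2 \<Longrightarrow> \<bar>fb x a - fb u a\<bar> < e"
    using c(2) W(2) e unfolding continuous_on_iff dist_real_def by metis
  define r where "r = min r0 (min r1 r2)"
  have r: "r > 0" "ball u r \<subseteq> W" using r0 r1(1) r2(1) by (auto simp: r_def)
  define h where "h = r / (norm a + norm b + 1)"
  have pos: "norm a + norm b + 1 > 0" using norm_ge_zero[of a] norm_ge_zero[of b] by linarith
  have h: "h > 0" using r pos by (simp add: h_def)
  have hr: "h * (norm a + norm b) < r" using r pos by (simp add: h_def field_simps)
  then have hr': "h * (norm b + norm a) < r" by (simp add: add.commute)
  obtain x where x: "dist x u < r"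
    "f (u + h *\<^sub>R a + h *\<^sub>R b) - f (u + h *\<^sub>R a) - f (u + h *\<^sub>R b) + f u = h * h * fa x b"
    using second_difference_mvt[OF r(2) h hr f fa] by metis
  obtain y where y: "dist y u < r"
    "f (u + h *\<^sub>R b + h *\<^sub>R a) - f (u + h *\<^sub>R b) - f (u + h *\<^sub>R a) + f u = h * h * fb y a"
    using second_difference_mvt[OF r(2) h hr' f fb] by metis
  have "u + h *\<^sub>R b + h *\<^sub>R a = u + h *\<^sub>R a + h *\<^sub>R b" by (simp add: algebra_simps)
  then have "f (u + h *\<^sub>R b + h *\<^sub>R a) = f (u + h *\<^sub>R a + h *\<^sub>R b)" by (rule arg_cong)
  then have "h * h * fa x b = h * h * fb y a" using x(2) y(2) by linarith
  then have "fa x b = fb y a" using h by simp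
  moreover have "x \<in> W" "y \<in> W" using x(1) y(1) r(2) by (auto simp: dist_commute subset_iff)
  then have "\<bar>fa x b - fa u b\<bar> < e" "\<bar>fb y a - fb u a\<bar> < e"
    using r1(2) r2(2) x(1) y(1) by (auto simp: r_def)
  ultimately have "\<bar>fa u b - fb u a\<bar> < 2 * e" by linarith
  then show False by (simp add: e_def)
qed

definition pd :: "(real^2 \<Rightarrow> 'b::real_normed_vector) \<Rightarrow> 2 \<Rightarrow> real^2 \<Rightarrow> 'b" where
  "pd f i u = frechet_derivative f (at u) (axis i 1)"

lemma smooth_on_pd: "smooth_on f W \<Longrightarrow> smooth_on (pd f i) W"
  using smooth_on_frechet_derivative[of f W "axis i 1"] by (simp add: pd_def[abs_def])

lemma mixed_partials:
  fixes \<phi> :: "real^2 \<Rightarrow> 'b::euclidean_space"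
  assumes W: "open W" "u \<in> W" and \<phi>: "smooth_on \<phi> W"
  shows "frechet_derivative (pd \<phi> i) (at u) (axis j 1) = frechet_derivative (pd \<phi> j) (at u) (axis i 1)"
proof -
  have C: "C1_on \<phi> W" by (rule smooth_on_C1[OF \<phi>])
  have Cp: "C1_on (pd \<phi> k) W" for k by (rule smooth_on_C1[OF smooth_on_pd[OF \<phi>]])
  have "frechet_derivative (pd \<phi> i) (at u) (axis j 1) \<bullet> c = frechet_derivative (pd \<phi> j) (at u) (axis i 1) \<bullet> c" for c
  proof -
    have p: "(\<lambda>x. frechet_derivative \<phi> (at x) (axis k 1) \<bullet> c) = (\<lambda>x. pd \<phi> k x \<bullet> c)" for k
      by (simp add: pd_def)
    show ?thesis
    proof (rule mixed_partials_real[where f = "\<lambda>x. \<phi> x \<bullet> c" and f' = "\<lambda>x v. frechet_derivative \<phi> (at x) v \<bullet> c"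
          and W = W and fa = "\<lambda>x v. frechet_derivative (pd \<phi> i) (at x) v \<bullet> c"
          and fb = "\<lambda>x v. frechet_derivative (pd \<phi> j) (at x) v \<bullet> c"])
      show "((\<lambda>x. \<phi> x \<bullet> c) has_derivative (\<lambda>v. frechet_derivative \<phi> (at x) v \<bullet> c)) (at x)" if "x \<in> W" for x
        by (rule has_derivative_inner_left[OF C1_on_has_derivative[OF C that]])
      show "((\<lambda>x. frechet_derivative \<phi> (at x) (axis i 1) \<bullet> c) has_derivative (\<lambda>v. frechet_derivative (pd \<phi> i) (at x) v \<bullet> c)) (at x)" if "x \<in> W" for x
        unfolding p by (rule has_derivative_inner_left[OF C1_on_has_derivative[OF Cp that]])
      show "((\<lambda>x. frechet_derivative \<phi> (at x) (axis j 1) \<bullet> c) has_derivative (\<lambda>v. frechet_derivative (pd \<phi> j) (at x) v \<bullet> c)) (at x)" if "x \<in> W" for x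
        unfolding p by (rule has_derivative_inner_left[OF C1_on_has_derivative[OF Cp that]])
    qed (use W in \<open>auto intro!: continuous_intros C1_on_continuous_deriv[OF Cp]\<close>)
  qed
  then show ?thesis by (metis vector_eq_ldot inner_commute)
qed

section \<open>Traces on a tangent plane by cross products\<close>

lemma cross3_scalar_triple: "a \<bullet> cross3 b n = cross3 a b \<bullet> n"
  by (simp add: cross3_simps)

lemma cross3_parallel:
  assumes "norm n = 1" "x \<bullet> n = 0" "y \<bullet> n = 0"
  shows "cross3 x y = (n \<bullet> cross3 x y) *\<^sub>R n"
proof -
  have "cross3 n (cross3 x y) = 0" using assms(2,3) by (simp add: Lagrange inner_commute)
  moreover have "cross3 n (cross3 n (cross3 x y)) = (n \<bullet> cross3 x y) *\<^sub>R n - (n \<bullet> n) *\<^sub>R cross3 x y"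
    by (rule Lagrange)
  moreover have "n \<bullet> n = 1" using assms(1) by (simp add: dot_square_norm)
  ultimately show ?thesis by simp
qed

lemma inj_linear_cross3_nonzero:
  fixes D :: "real^2 \<Rightarrow> real^3"
  assumes "linear D" "inj D"
  shows "cross3 (D (axis 1 1)) (D (axis 2 1)) \<noteq> 0"
proof
  assume "cross3 (D (axis 1 1)) (D (axis 2 1)) = 0"
  then have col: "collinear {0, D (axis 1 1), D (axis 2 1)}" by (simp add: cross_eq_0)
  have nz: "D v \<noteq> 0" if "v \<noteq> 0" for v
    using assms that by (metis injD linear_0)
  have ax: "axis i (1::real) \<noteq> (0::real^2)" for i by (simp add: axis_eq_0_iff)
  obtain c where "D (axis 2 1) = c *\<^sub>R D (axis 1 1)"
    using col nz ax unfolding collinear_lemma by metis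
  then have "D (axis 2 1 - c *\<^sub>R axis 1 1) = 0"
    by (simp add: linear_diff[OF assms(1)] linear_cmul[OF assms(1)])
  moreover have "(axis 2 1 - c *\<^sub>R axis 1 1 :: real^2) $ 2 = 1"
    by (simp add: axis_def)
  then have "(axis 2 1 - c *\<^sub>R axis 1 1 :: real^2) \<noteq> 0" by (metis zero_index zero_neq_one)
  ultimately show False using nz by blast
qed

text \<open>Divided by the norm of \<open>cross3 a b\<close>, the vectors \<open>cross3 b n\<close>
  and \<open>cross3 n a\<close> form the basis of the plane dual to \<open>a\<close>,
  \<open>b\<close>. The identity says that a trace may be computed in an orthonormal basis or in a
  basis together with its dual.\<close>

lemma trace_formula:
  fixes a b :: "real^3" and L :: "real^3 \<Rightarrow> real^3"
  assumes L: "linear L" and N: "cross3 a b \<noteq> 0" and B: "pairwise orthogonal B" "\<And>e. e \<in> B \<Longrightarrow> norm e = 1"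
    and sp: "span B = span {a, b}"
  defines "n \<equiv> inverse (norm (cross3 a b)) *\<^sub>R cross3 a b"
  shows "norm (cross3 a b) * (\<Sum>e\<in>B. L e \<bullet> e) = L a \<bullet> cross3 b n + L b \<bullet> cross3 n a"
proof -
  have fin: "finite B" by (rule pairwise_orthogonal_imp_finite[OF B(1)])
  let ?m = "norm (cross3 a b)"
  have nn: "cross3 a b \<bullet> n = ?m" using N by (simp add: n_def dot_square_norm power2_eq_square)
  have an: "a \<bullet> n = 0" "b \<bullet> n = 0" by (simp_all add: n_def dot_cross_self)
  have d: "a \<bullet> cross3 b n = ?m" "b \<bullet> cross3 b n = 0" "b \<bullet> cross3 n a = ?m" "a \<bullet> cross3 n a = 0"
  proof -
    show "a \<bullet> cross3 b n = ?m" using nn by (simp add: cross3_scalar_triple)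
    have "b \<bullet> cross3 n a = n \<bullet> cross3 a b" by (simp add: cross3_simps)
    then show "b \<bullet> cross3 n a = ?m" using nn by (simp add: inner_commute)
  qed (simp_all add: dot_cross_self)
  have spn: "cross3 b n \<in> span {a, b}" "cross3 n a \<in> span {a, b}"
  proof -
    have ab: "a \<in> span {a, b}" "b \<in> span {a, b}" by (simp_all add: span_base)
    have 1: "cross3 b n = inverse ?m *\<^sub>R ((b \<bullet> b) *\<^sub>R a - (b \<bullet> a) *\<^sub>R b)"
      by (simp add: n_def cross_mult_right Lagrange)
    show "cross3 b n \<in> span {a, b}"
      unfolding 1 by (intro span_mul span_diff ab)
    have "cross3 n a = - cross3 a n" by (rule cross_skew)
    also have "\<dots> = - (inverse ?m *\<^sub>R ((a \<bullet> b) *\<^sub>R a - (a \<bullet> a) *\<^sub>R b))"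
      by (simp add: n_def cross_mult_right Lagrange)
    finally have 2: "cross3 n a = - (inverse ?m *\<^sub>R ((a \<bullet> b) *\<^sub>R a - (a \<bullet> a) *\<^sub>R b))" .
    show "cross3 n a \<in> span {a, b}"
      unfolding 2 by (intro span_neg span_mul span_diff ab)
  qed
  have e: "?m *\<^sub>R L e = (e \<bullet> cross3 b n) *\<^sub>R L a + (e \<bullet> cross3 n a) *\<^sub>R L b" if "e \<in> B" for e
  proof -
    have "e \<in> span {a, b}" using sp that span_base by blast
    then obtain x where "e - x *\<^sub>R a \<in> span {b}" using span_breakdown_eq by blast
    then obtain y where "e - x *\<^sub>R a = y *\<^sub>R b" by (auto simp: span_singleton)
    then have xy: "e = x *\<^sub>R a + y *\<^sub>R b" by (simp add: algebra_simps)
    show ?thesis unfolding xy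
      by (simp add: linear_add[OF L] linear_cmul[OF L] inner_add_left d algebra_simps)
  qed
  have exp: "(\<Sum>e\<in>B. (e \<bullet> v) *\<^sub>R e) = v" if "v \<in> span {a, b}" for v
  proof -
    have "v \<in> span B" using that sp by simp
    from orthonormal_basis_expand[OF B(1) B(2) this fin] show ?thesis by (simp add: inner_commute)
  qed
  have "?m * (\<Sum>e\<in>B. L e \<bullet> e) = (\<Sum>e\<in>B. (?m *\<^sub>R L e) \<bullet> e)"
    by (simp only: sum_distrib_left inner_scaleR_left)
  also have "\<dots> = (\<Sum>e\<in>B. L a \<bullet> ((e \<bullet> cross3 b n) *\<^sub>R e) + L b \<bullet> ((e \<bullet> cross3 n a) *\<^sub>R e))"
    by (intro sum.cong refl) (simp only: e inner_add_left inner_scaleR_left inner_scaleR_right)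
  also have "\<dots> = L a \<bullet> cross3 b n + L b \<bullet> cross3 n a"
    by (simp only: sum.distrib inner_sum_right[symmetric] exp[OF spn(1)] exp[OF spn(2)])
  finally show ?thesis .
qed

lemma tangent_space_chart:
  fixes \<phi> :: "real^2 \<Rightarrow> real^3"
  assumes "C1_chart M S W \<phi>" "u \<in> W" "u \<in> interior M"
  shows "tangent_space S (\<phi> u) = range (frechet_derivative \<phi> (at u))"
    "tangent_space S (\<phi> u) = span {pd \<phi> 1 u, pd \<phi> 2 u}"
proof -
  let ?D = "frechet_derivative \<phi> (at u)"
  note D = C1_chart_deriv[OF assms(1,2)]
  have "u \<in> M" using assms(3) interior_subset by blast
  then have tc: "tangent_cone S (\<phi> u) = range ?D"
    using tangent_cone_chart[OF assms(1,2)] cone_dirs_interior[OF assms(3)] by simp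
  have "subspace (range ?D)" using D(3) linear_subspace_image subspace_UNIV by blast
  then show 1: "tangent_space S (\<phi> u) = range ?D"
    unfolding tangent_space_def tc by (rule span_eq_iff[THEN iffD2])
  show "tangent_space S (\<phi> u) = span {pd \<phi> 1 u, pd \<phi> 2 u}"
    unfolding 1
  proof (intro equalityI subsetI)
    fix v assume "v \<in> range ?D"
    then obtain w where "v = ?D w" by blast
    then have v: "v = (w $ 1) *\<^sub>R pd \<phi> 1 u + (w $ 2) *\<^sub>R pd \<phi> 2 u"
      using linear_axis_expand[OF D(3), of w] by (simp add: pd_def)
    show "v \<in> span {pd \<phi> 1 u, pd \<phi> 2 u}"
      unfolding v by (intro span_add span_mul span_base) auto
  next
    have "{pd \<phi> 1 u, pd \<phi> 2 u} \<subseteq> range ?D" by (auto simp: pd_def)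
    then have "span {pd \<phi> 1 u, pd \<phi> 2 u} \<subseteq> range ?D"
      using \<open>subspace (range ?D)\<close> span_minimal by blast
    then show "v \<in> range ?D" if "v \<in> span {pd \<phi> 1 u, pd \<phi> 2 u}" for v using that by blast
  qed
qed

text \<open>The derivative within \<open>S\<close> in the definition of \<open>surface_div\<close>
  is a chosen linear map, arbitrary off the tangent plane. On tangent vectors the chain rule forces
  its values.\<close>

lemma chart_derivative_transfer:
  fixes \<phi> :: "real^2 \<Rightarrow> real^3" and Y :: "real^3 \<Rightarrow> 'c::real_normed_vector"
  assumes ch: "C1_chart M S W \<phi>" and u: "u \<in> W" "u \<in> interior M"
    and G: "((\<lambda>x. Y (\<phi> x)) has_derivative G) (at u)"
  shows "(Y has_derivative frechet_derivative Y (at (\<phi> u) within S)) (at (\<phi> u) within S)"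
    "frechet_derivative Y (at (\<phi> u) within S) (frechet_derivative \<phi> (at u) v) = G v"
proof -
  let ?D = "frechet_derivative \<phi> (at u)"
  note D = C1_chart_deriv[OF ch u(1)]
  have uM: "u \<in> M" using u interior_subset by blast
  obtain U \<psi> where U: "open U" and 1: "\<And>u. u \<in> W \<Longrightarrow> u \<in> M \<Longrightarrow> \<phi> u \<in> S \<and> \<phi> u \<in> U \<and> \<psi> (\<phi> u) = u"
    and 2: "\<And>q. q \<in> S \<Longrightarrow> q \<in> U \<Longrightarrow> \<psi> q \<in> W \<and> \<psi> q \<in> M \<and> \<phi> (\<psi> q) = q"
    and 3: "continuous_on (S \<inter> U) \<psi>"
    using C1_chartE[OF ch] by metis
  obtain A where A: "linear A" "A \<circ> ?D = id"
    using linear_injective_left_inverse D(2,3) by blast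
  have pU: "\<phi> u \<in> S" "\<phi> u \<in> U" "\<psi> (\<phi> u) = u" using 1 u uM by auto
  have dpsi: "(\<psi> has_derivative A) (at (\<phi> u) within S)"
    using chart_inverse_has_derivative[OF D(1) A U pU(1,2) 3 _ pU(3)] 2 by blast
  obtain d where d: "0 < d" "ball (\<phi> u) d \<subseteq> U" using U pU(2) open_contains_ball by blast
  have "((\<lambda>x. Y (\<phi> x)) has_derivative G) (at (\<psi> (\<phi> u)))" using G pU(3) by simp
  from has_derivative_compose[OF dpsi this]
  have "((\<lambda>q. Y (\<phi> (\<psi> q))) has_derivative (\<lambda>v. G (A v))) (at (\<phi> u) within S)" .
  then have "(Y has_derivative (\<lambda>v. G (A v))) (at (\<phi> u) within S)"
  proof (rule has_derivative_transform_within[OF _ d(1) pU(1)])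
    fix q assume "q \<in> S" "dist q (\<phi> u) < d"
    then have "q \<in> U" using d(2) by (auto simp: dist_commute)
    then show "Y (\<phi> (\<psi> q)) = Y q" using 2[OF \<open>q \<in> S\<close>] by simp
  qed
  then show dY: "(Y has_derivative frechet_derivative Y (at (\<phi> u) within S)) (at (\<phi> u) within S)"
    using frechet_derivative_works differentiable_def by blast
  have opn: "open (W \<inter> interior M)" using C1_chart_open[OF ch] by auto
  have "(\<phi> has_derivative ?D) (at u within W \<inter> interior M)"
    using D(1) has_derivative_at_withinI by blast
  moreover have "\<phi> ` (W \<inter> interior M) \<subseteq> S" using 1 interior_subset by blast
  ultimately have "((\<lambda>x. Y (\<phi> x)) has_derivative (\<lambda>v. frechet_derivative Y (at (\<phi> u) within S) (?D v))) (at u within W \<inter> interior M)"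
    using has_derivative_in_compose[of \<phi> ?D u "W \<inter> interior M" Y] has_derivative_subset[OF dY] by blast
  then have "((\<lambda>x. Y (\<phi> x)) has_derivative (\<lambda>v. frechet_derivative Y (at (\<phi> u) within S) (?D v))) (at u)"
    using at_within_open[of u "W \<inter> interior M"] opn u by simp
  from has_derivative_unique[OF this G]
  show "frechet_derivative Y (at (\<phi> u) within S) (?D v) = G v" by metis
qed

definition chart_normal :: "(real^2 \<Rightarrow> real^3) \<Rightarrow> real^2 \<Rightarrow> real^3" where
  "chart_normal \<phi> u = inverse (norm (cross3 (pd \<phi> 1 u) (pd \<phi> 2 u))) *\<^sub>R cross3 (pd \<phi> 1 u) (pd \<phi> 2 u)"

lemma area_density_pd: "area_density \<phi> u = norm (cross3 (pd \<phi> 1 u) (pd \<phi> 2 u))"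
  by (simp add: area_density_def pd_def)

lemma chart_cross3_nonzero:
  fixes \<phi> :: "real^2 \<Rightarrow> real^3"
  assumes "C1_chart M S W \<phi>" "u \<in> W"
  shows "cross3 (pd \<phi> 1 u) (pd \<phi> 2 u) \<noteq> 0"
  unfolding pd_def using inj_linear_cross3_nonzero C1_chart_deriv(2,3)[OF assms] by blast

lemma area_density_pos: "C1_chart M S W \<phi> \<Longrightarrow> u \<in> W \<Longrightarrow> 0 < area_density \<phi> u"
  by (simp add: area_density_pd chart_cross3_nonzero)

lemma chart_normal_orthogonal:
  "pd \<phi> 1 u \<bullet> chart_normal \<phi> u = 0" "pd \<phi> 2 u \<bullet> chart_normal \<phi> u = 0"
  by (simp_all add: chart_normal_def dot_cross_self)

lemma norm_chart_normal: "C1_chart M S W \<phi> \<Longrightarrow> u \<in> W \<Longrightarrow> norm (chart_normal \<phi> u) = 1"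
  using chart_cross3_nonzero[of M S W \<phi> u] by (simp add: chart_normal_def)

lemma chart_normal_C1:
  assumes ch: "C1_chart M S W \<phi>" "smooth_on \<phi> W"
  shows "C1_on (chart_normal \<phi>) W"
proof -
  have "C1_on (pd \<phi> i) W" for i using ch(2) smooth_on_pd smooth_on_C1 by blast
  then have c: "C1_on (\<lambda>u. cross3 (pd \<phi> 1 u) (pd \<phi> 2 u)) W" by (intro C1_on_cross3)
  show ?thesis
    unfolding chart_normal_def[abs_def]
    by (rule C1_on_scaleR[OF C1_on_inverse_norm[OF c chart_cross3_nonzero[OF ch(1)]] c])
qed

lemma surface_div_chart:
  fixes \<phi> :: "real^2 \<Rightarrow> real^3"
  assumes ch: "C1_chart M S W \<phi>" and u: "u \<in> W" "u \<in> interior M"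
    and G: "((\<lambda>x. Y (\<phi> x)) has_derivative G) (at u)"
  shows "area_density \<phi> u * surface_div S Y (\<phi> u) =
     G (axis 1 1) \<bullet> cross3 (pd \<phi> 2 u) (chart_normal \<phi> u) + G (axis 2 1) \<bullet> cross3 (chart_normal \<phi> u) (pd \<phi> 1 u)"
proof -
  define L where "L = frechet_derivative Y (at (\<phi> u) within S)"
  define B where "B = (SOME B. pairwise orthogonal B \<and> (\<forall>e\<in>B. norm e = 1) \<and> span B = tangent_space S (\<phi> u))"
  note tr = chart_derivative_transfer[OF ch u G, folded L_def]
  have "\<exists>B. pairwise orthogonal B \<and> (\<forall>e\<in>B. norm e = 1) \<and> span B = tangent_space S (\<phi> u)"
  proof -
    have "subspace (tangent_space S (\<phi> u))" by (simp add: tangent_space_def)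
    from orthonormal_basis_subspace[OF this] show ?thesis by metis
  qed
  from someI_ex[OF this] have B: "pairwise orthogonal B" "\<And>e. e \<in> B \<Longrightarrow> norm e = 1" "span B = tangent_space S (\<phi> u)"
    unfolding B_def by blast+
  have "linear L" using tr(1) has_derivative_linear by blast
  from trace_formula[OF this chart_cross3_nonzero[OF ch u(1)] B(1,2)] B(3) tangent_space_chart(2)[OF ch u]
  have "area_density \<phi> u * (\<Sum>e\<in>B. L e \<bullet> e) = L (pd \<phi> 1 u) \<bullet> cross3 (pd \<phi> 2 u) (chart_normal \<phi> u) + L (pd \<phi> 2 u) \<bullet> cross3 (chart_normal \<phi> u) (pd \<phi> 1 u)"
    by (simp add: area_density_pd chart_normal_def)
  moreover have "L (pd \<phi> i u) = G (axis i 1)" for i by (simp add: pd_def tr(2))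
  moreover have "surface_div S Y (\<phi> u) = (\<Sum>e\<in>B. L e \<bullet> e)"
    by (simp add: surface_div_def Let_def L_def B_def)
  ultimately show ?thesis by simp
qed

lemma unit_normal_chart:
  fixes \<phi> :: "real^2 \<Rightarrow> real^3"
  assumes ch: "C1_chart M S W \<phi>" and u: "u \<in> W" "u \<in> interior M"
    and w: "norm w = 1" "\<And>v. v \<in> tangent_space S (\<phi> u) \<Longrightarrow> w \<bullet> v = 0"
  shows "w = chart_normal \<phi> u \<or> w = - chart_normal \<phi> u"
proof -
  let ?N = "cross3 (pd \<phi> 1 u) (pd \<phi> 2 u)"
  have "pd \<phi> i u \<in> tangent_space S (\<phi> u)" for i
    using tangent_space_chart(1)[OF ch u] by (simp add: pd_def)
  then have "pd \<phi> i u \<bullet> w = 0" for i using w(2) by (metis inner_commute)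
  then have N: "?N = (w \<bullet> ?N) *\<^sub>R w" by (intro cross3_parallel w(1))
  define c where "c = w \<bullet> ?N"
  have Nc: "?N = c *\<^sub>R w" using N by (simp add: c_def)
  have n: "chart_normal \<phi> u = (inverse \<bar>c\<bar> * c) *\<^sub>R w"
    unfolding chart_normal_def Nc using w(1) by simp
  have "c \<noteq> 0" using Nc chart_cross3_nonzero[OF ch u(1)] by auto
  then have "inverse \<bar>c\<bar> * c = 1 \<or> inverse \<bar>c\<bar> * c = - 1" by (auto simp: abs_if)
  then show ?thesis using n by auto
qed

lemma unit_normal_field_chart:
  fixes \<phi> :: "real^2 \<Rightarrow> real^3"
  assumes ch: "C1_chart M S W \<phi>" and u: "u \<in> W" "u \<in> interior M" and nn: "unit_normal_field S nn"
  shows "nn (\<phi> u) = chart_normal \<phi> u \<or> nn (\<phi> u) = - chart_normal \<phi> u"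
proof (rule unit_normal_chart[OF ch u])
  have "\<phi> u \<in> S" using C1_chartE[OF ch] u interior_subset by (metis subsetD)
  then show "norm (nn (\<phi> u)) = 1" "v \<in> tangent_space S (\<phi> u) \<Longrightarrow> nn (\<phi> u) \<bullet> v = 0" for v
    using nn by (auto simp: unit_normal_field_def)
qed

text \<open>The normal occurs twice in the tangential part, so the sign of the unit normal
  cancels.\<close>

lemma tangential_part_chart:
  fixes \<phi> :: "real^2 \<Rightarrow> real^3"
  assumes "C1_chart M S W \<phi>" "u \<in> W" "u \<in> interior M" "unit_normal_field S nn"
  shows "tangential_part nn X (\<phi> u) = X (\<phi> u) - (X (\<phi> u) \<bullet> chart_normal \<phi> u) *\<^sub>R chart_normal \<phi> u"
  using unit_normal_field_chart[OF assms] by (auto simp: tangential_part_def)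

text \<open>The area density times the divergence of \<open>chart_normal\<close>, that is, -2 times
  the area density times the mean curvature with respect to this normal.\<close>

definition chart_curv :: "(real^2 \<Rightarrow> real^3) \<Rightarrow> real^2 \<Rightarrow> real" where
  "chart_curv \<phi> u = pd (chart_normal \<phi>) 1 u \<bullet> cross3 (pd \<phi> 2 u) (chart_normal \<phi> u)
     + pd (chart_normal \<phi>) 2 u \<bullet> cross3 (chart_normal \<phi> u) (pd \<phi> 1 u)"

text \<open>\<open>flux1\<close> and \<open>flux2\<close> are the coordinates of the tangential part
  of \<open>X\<close> in the basis \<open>pd \<phi> 1 u\<close>, \<open>pd \<phi> 2 u\<close>,
  multiplied by the area density. For such a density the intrinsic divergence is the plain
  divergence in the parameters.\<close>

definition flux1 :: "(real^2 \<Rightarrow> real^3) \<Rightarrow> (real^3 \<Rightarrow> real^3) \<Rightarrow> real^2 \<Rightarrow> real" where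
  "flux1 \<phi> X u = X (\<phi> u) \<bullet> cross3 (pd \<phi> 2 u) (chart_normal \<phi> u)"

definition flux2 :: "(real^2 \<Rightarrow> real^3) \<Rightarrow> (real^3 \<Rightarrow> real^3) \<Rightarrow> real^2 \<Rightarrow> real" where
  "flux2 \<phi> X u = X (\<phi> u) \<bullet> cross3 (chart_normal \<phi> u) (pd \<phi> 1 u)"

lemma has_derivative_transform_open_at:
  assumes "(f has_derivative f') (at x)" "open V" "x \<in> V" "\<And>y. y \<in> V \<Longrightarrow> f y = g y"
  shows "(g has_derivative f') (at x)"
  by (rule has_derivative_transform_within_open[OF assms])

text \<open>The mixed second derivative \<open>p12\<close> enters two cross products in opposite
  order and drops out. The remaining products are of vectors tangent to the surface, hence multiples
  of \<open>n\<close>, and give the curvature term.\<close>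

lemma cross3_transverse_cancel:
  fixes g n a b m1 m2 p12 :: "real^3"
  assumes n: "norm n = 1" and o: "a \<bullet> n = 0" "b \<bullet> n = 0" "m1 \<bullet> n = 0" "m2 \<bullet> n = 0"
  shows "g \<bullet> (cross3 p12 n + cross3 b m1) + g \<bullet> (cross3 m2 a + cross3 n p12)
     = - (g \<bullet> n) * (m1 \<bullet> cross3 b n + m2 \<bullet> cross3 n a)"
proof -
  have "cross3 n p12 = - cross3 p12 n" by (rule cross_skew)
  moreover have "cross3 b m1 = (n \<bullet> cross3 b m1) *\<^sub>R n" by (rule cross3_parallel[OF n o(2,3)])
  moreover have "cross3 m2 a = (n \<bullet> cross3 m2 a) *\<^sub>R n" by (rule cross3_parallel[OF n o(4,1)])
  moreover have "n \<bullet> cross3 b m1 = - (m1 \<bullet> cross3 b n)" by (simp add: cross3_simps)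
  moreover have "n \<bullet> cross3 m2 a = - (m2 \<bullet> cross3 n a)" by (simp add: cross3_simps)
  ultimately have "g \<bullet> (cross3 p12 n + cross3 b m1) + g \<bullet> (cross3 m2 a + cross3 n p12)
      = g \<bullet> ((- (m1 \<bullet> cross3 b n)) *\<^sub>R n) + g \<bullet> ((- (m2 \<bullet> cross3 n a)) *\<^sub>R n)"
    by (simp only: inner_add_right inner_minus_right)
  then show ?thesis by (simp add: algebra_simps)
qed

text \<open>The two forms serve different ends. The first isolates the curvature and gives bounds
  near corners; the second is a divergence in the parameter plane and can be integrated.\<close>

lemma surface_div_tangential:
  fixes \<phi> :: "real^2 \<Rightarrow> real^3"
  assumes ch: "C1_chart M S W \<phi>" "smooth_on \<phi> W" and u: "u \<in> W" "u \<in> interior M"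
    and nn: "unit_normal_field S nn" and X: "(X has_derivative X') (at (\<phi> u))"
  shows "area_density \<phi> u * surface_div S (tangential_part nn X) (\<phi> u) =
       area_density \<phi> u * surface_div S X (\<phi> u) - (X (\<phi> u) \<bullet> chart_normal \<phi> u) * chart_curv \<phi> u" (is ?A)
    and "area_density \<phi> u * surface_div S (tangential_part nn X) (\<phi> u) = pd (flux1 \<phi> X) 1 u + pd (flux2 \<phi> X) 2 u" (is ?B)
proof -
  let ?n = "chart_normal \<phi>" and ?a = "pd \<phi> 1" and ?b = "pd \<phi> 2"
  define G where "G = (\<lambda>v. X' (frechet_derivative \<phi> (at u) v))"
  have G: "((\<lambda>x. X (\<phi> x)) has_derivative G) (at u)"
    unfolding G_def using diff_chain_at[OF C1_chart_deriv(1)[OF ch(1) u(1)] X] by (simp add: o_def)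
  have C: "C1_on ?n W" "C1_on ?a W" "C1_on ?b W"
    using chart_normal_C1[OF ch] smooth_on_C1[OF smooth_on_pd[OF ch(2)]] by auto
  note dn = C1_on_has_derivative[OF C(1) u(1)] and da = C1_on_has_derivative[OF C(2) u(1)]
    and db = C1_on_has_derivative[OF C(3) u(1)]
  define n' where "n' = frechet_derivative ?n (at u)"
  define a' where "a' = frechet_derivative ?a (at u)"
  define b' where "b' = frechet_derivative ?b (at u)"
  define g n a b where "g = X (\<phi> u)" and "n = ?n u" and "a = ?a u" and "b = ?b u"
  have W: "open W" using C1_chart_open[OF ch(1)] .
  have nrm: "norm n = 1" and o: "a \<bullet> n = 0" "b \<bullet> n = 0"
    using norm_chart_normal[OF ch(1) u(1)] chart_normal_orthogonal[of \<phi> u] by (simp_all add: n_def a_def b_def)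
  \<comment> \<open>Differentiating the constant \<open>n \<bullet> n = 1\<close> shows that
    derivatives of the normal are tangential.\<close>
  have on: "n' v \<bullet> n = 0" for v
  proof -
    have "((\<lambda>x. ?n x \<bullet> ?n x) has_derivative (\<lambda>v. ?n u \<bullet> n' v + n' v \<bullet> ?n u)) (at u)"
      unfolding n'_def by (rule has_derivative_inner[OF dn dn])
    moreover have "((\<lambda>x. ?n x \<bullet> ?n x) has_derivative (\<lambda>v. 0)) (at u)"
    proof (rule has_derivative_transform_open_at[OF has_derivative_const W u(1)])
      show "1 = ?n x \<bullet> ?n x" if "x \<in> W" for x
        using norm_chart_normal[OF ch(1) that] by (simp add: dot_square_norm)
    qed
    ultimately have "(\<lambda>v. ?n u \<bullet> n' v + n' v \<bullet> ?n u) = (\<lambda>v. 0)" by (rule has_derivative_unique)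
    from fun_cong[OF this, of v] show ?thesis by (simp add: n_def inner_commute)
  qed
  have mixed: "b' (axis 1 1) = a' (axis 2 1)"
    unfolding a'_def b'_def by (rule mixed_partials[OF W u(1) ch(2)])
  define Y' where "Y' v = G v - ((g \<bullet> n) *\<^sub>R n' v + (g \<bullet> n' v + G v \<bullet> n) *\<^sub>R n)" for v
  have "((\<lambda>x. X (\<phi> x) - (X (\<phi> x) \<bullet> ?n x) *\<^sub>R ?n x) has_derivative Y') (at u)"
    unfolding Y'_def[abs_def] g_def n_def n'_def
    by (intro has_derivative_diff G has_derivative_scaleR has_derivative_inner dn)
  then have "((\<lambda>x. tangential_part nn X (\<phi> x)) has_derivative Y') (at u)"
    by (rule has_derivative_transform_open_at[where V = "W \<inter> interior M"])
       (use W u tangential_part_chart[OF ch(1) _ _ nn] in auto)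
  from surface_div_chart[OF ch(1) u this]
  have 1: "area_density \<phi> u * surface_div S (tangential_part nn X) (\<phi> u) =
      Y' (axis 1 1) \<bullet> cross3 b n + Y' (axis 2 1) \<bullet> cross3 n a"
    by (simp add: a_def b_def n_def)
  have 2: "area_density \<phi> u * surface_div S X (\<phi> u) = G (axis 1 1) \<bullet> cross3 b n + G (axis 2 1) \<bullet> cross3 n a"
    using surface_div_chart[OF ch(1) u G] by (simp add: a_def b_def n_def)
  have cc: "chart_curv \<phi> u = n' (axis 1 1) \<bullet> cross3 b n + n' (axis 2 1) \<bullet> cross3 n a"
    by (simp add: chart_curv_def pd_def n'_def a_def b_def n_def)
  \<comment> \<open>The part of \<open>Y' v\<close> along \<open>n\<close> is invisible, since both
    cross products are orthogonal to \<open>n\<close>.\<close>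
  have Y1: "Y' v \<bullet> cross3 b n = G v \<bullet> cross3 b n - (g \<bullet> n) * (n' v \<bullet> cross3 b n)" for v
    by (simp add: Y'_def inner_diff_left inner_add_left dot_cross_self)
  have Y2: "Y' v \<bullet> cross3 n a = G v \<bullet> cross3 n a - (g \<bullet> n) * (n' v \<bullet> cross3 n a)" for v
    by (simp add: Y'_def inner_diff_left inner_add_left dot_cross_self)
  show A: ?A
    unfolding 1 2 cc Y1 Y2 using g_def n_def by (simp add: algebra_simps)
  have "((\<lambda>x. X (\<phi> x) \<bullet> cross3 (?b x) (?n x)) has_derivative
      (\<lambda>v. g \<bullet> (cross3 b (n' v) + cross3 (b' v) n) + G v \<bullet> cross3 b n)) (at u)"
    unfolding g_def b_def n_def b'_def n'_def
    by (intro has_derivative_inner G bounded_bilinear.FDERIV[OF bounded_bilinear_cross3 db dn])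
  from fun_cong[OF frechet_derivative_at[OF this], of "axis 1 1"]
  have 3: "pd (flux1 \<phi> X) 1 u = g \<bullet> (cross3 b (n' (axis 1 1)) + cross3 (b' (axis 1 1)) n) + G (axis 1 1) \<bullet> cross3 b n"
    unfolding pd_def[of "flux1 \<phi> X"] unfolding flux1_def[abs_def] by (rule sym)
  have "((\<lambda>x. X (\<phi> x) \<bullet> cross3 (?n x) (?a x)) has_derivative
      (\<lambda>v. g \<bullet> (cross3 n (a' v) + cross3 (n' v) a) + G v \<bullet> cross3 n a)) (at u)"
    unfolding g_def a_def n_def a'_def n'_def
    by (intro has_derivative_inner G bounded_bilinear.FDERIV[OF bounded_bilinear_cross3 dn da])
  from fun_cong[OF frechet_derivative_at[OF this], of "axis 2 1"]
  have 4: "pd (flux2 \<phi> X) 2 u = g \<bullet> (cross3 n (a' (axis 2 1)) + cross3 (n' (axis 2 1)) a) + G (axis 2 1) \<bullet> cross3 n a"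
    unfolding pd_def[of "flux2 \<phi> X"] unfolding flux2_def[abs_def] by (rule sym)
  have "pd (flux1 \<phi> X) 1 u + pd (flux2 \<phi> X) 2 u =
     (g \<bullet> (cross3 (a' (axis 2 1)) n + cross3 b (n' (axis 1 1))) + g \<bullet> (cross3 (n' (axis 2 1)) a + cross3 n (a' (axis 2 1))))
     + (G (axis 1 1) \<bullet> cross3 b n + G (axis 2 1) \<bullet> cross3 n a)"
    unfolding 3 4 mixed by (simp add: inner_add_right)
  also have "\<dots> = - (g \<bullet> n) * chart_curv \<phi> u + area_density \<phi> u * surface_div S X (\<phi> u)"
    unfolding cross3_transverse_cancel[OF nrm o on on] cc 2 ..
  finally show ?B unfolding A by (simp add: g_def n_def)
qed

lemma unit_normal_local_sign:
  fixes \<phi> :: "real^2 \<Rightarrow> real^3"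
  assumes ch: "C1_chart M S W \<phi>" "smooth_on \<phi> W" and u: "u \<in> W" "u \<in> interior M" and nn: "unit_normal_field S nn"
  obtains \<sigma> V where "\<sigma> = 1 \<or> \<sigma> = (-1::real)" "open V" "u \<in> V" "\<And>x. x \<in> V \<Longrightarrow> nn (\<phi> x) = \<sigma> *\<^sub>R chart_normal \<phi> x"
proof -
  let ?O = "W \<inter> interior M"
  have O: "open ?O" using C1_chart_open[OF ch(1)] by auto
  have img: "\<phi> ` ?O \<subseteq> S" using C1_chartE[OF ch(1)] interior_subset by (smt (verit) IntE image_subsetI subsetD)
  have "continuous_on ?O (\<lambda>x. nn (\<phi> x))"
    using nn continuous_on_compose2[OF _ continuous_on_subset[OF C1_chart_continuous[OF ch(1)]] img]
    by (auto simp: unit_normal_field_def)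
  moreover have "continuous_on ?O (chart_normal \<phi>)"
    using C1_on_continuous[OF chart_normal_C1[OF ch]] continuous_on_subset by blast
  ultimately have c: "continuous_on ?O (\<lambda>x. nn (\<phi> x) \<bullet> chart_normal \<phi> x)" by (intro continuous_intros)
  have v: "nn (\<phi> x) = (nn (\<phi> x) \<bullet> chart_normal \<phi> x) *\<^sub>R chart_normal \<phi> x
      \<and> (nn (\<phi> x) \<bullet> chart_normal \<phi> x = 1 \<or> nn (\<phi> x) \<bullet> chart_normal \<phi> x = -1)" if "x \<in> ?O" for x
    using unit_normal_field_chart[OF ch(1) _ _ nn, of x] norm_chart_normal[OF ch(1), of x] that
    by (auto simp: dot_square_norm)
  define \<sigma> where "\<sigma> = nn (\<phi> u) \<bullet> chart_normal \<phi> u"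
  \<comment> \<open>The inner product of the two normals is continuous with values 1 and -1, and a
    ball of radius 1 about one value excludes the other.\<close>
  define V where "V = ?O \<inter> (\<lambda>x. nn (\<phi> x) \<bullet> chart_normal \<phi> x) -` ball \<sigma> 1"
  have uO: "u \<in> ?O" using u by simp
  show ?thesis
  proof (rule that[of \<sigma> V])
    show "\<sigma> = 1 \<or> \<sigma> = -1" using v[OF uO] by (simp add: \<sigma>_def)
    show "open V" unfolding V_def by (rule continuous_open_preimage[OF c O open_ball])
    show "u \<in> V" using uO by (simp add: V_def \<sigma>_def)
    show "nn (\<phi> x) = \<sigma> *\<^sub>R chart_normal \<phi> x" if "x \<in> V" for x
    proof -
      have x: "x \<in> ?O" "\<bar>\<sigma> - nn (\<phi> x) \<bullet> chart_normal \<phi> x\<bar> < 1" using that by (auto simp: V_def dist_real_def)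
      then have "nn (\<phi> x) \<bullet> chart_normal \<phi> x = \<sigma>"
        using v[OF x(1)] v[OF uO] unfolding \<sigma>_def by auto
      then show ?thesis using v[OF x(1)] by simp
    qed
  qed
qed

lemma surface_div_normal:
  fixes \<phi> :: "real^2 \<Rightarrow> real^3"
  assumes ch: "C1_chart M S W \<phi>" "smooth_on \<phi> W" and u: "u \<in> W" "u \<in> interior M" and nn: "unit_normal_field S nn"
  obtains \<sigma> where "\<sigma> = 1 \<or> \<sigma> = (-1::real)" "nn (\<phi> u) = \<sigma> *\<^sub>R chart_normal \<phi> u"
    "area_density \<phi> u * surface_div S nn (\<phi> u) = \<sigma> * chart_curv \<phi> u"
proof -
  obtain \<sigma> V where s: "\<sigma> = 1 \<or> \<sigma> = (-1::real)" "open V" "u \<in> V" "\<And>x. x \<in> V \<Longrightarrow> nn (\<phi> x) = \<sigma> *\<^sub>R chart_normal \<phi> x"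
    using unit_normal_local_sign[OF assms] by blast
  have "((\<lambda>x. \<sigma> *\<^sub>R chart_normal \<phi> x) has_derivative (\<lambda>v. \<sigma> *\<^sub>R frechet_derivative (chart_normal \<phi>) (at u) v)) (at u)"
    by (rule has_derivative_scaleR_right[OF C1_on_has_derivative[OF chart_normal_C1[OF ch] u(1)]])
  then have "((\<lambda>x. nn (\<phi> x)) has_derivative (\<lambda>v. \<sigma> *\<^sub>R frechet_derivative (chart_normal \<phi>) (at u) v)) (at u)"
    by (rule has_derivative_transform_open_at[OF _ s(2,3)]) (simp add: s(4))
  from surface_div_chart[OF ch(1) u this]
  have "area_density \<phi> u * surface_div S nn (\<phi> u) = \<sigma> * chart_curv \<phi> u"
    by (simp add: chart_curv_def pd_def algebra_simps)
  with s show ?thesis using that by blast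
qed

text \<open>Derivatives of the normal enter only through its divergence. Hence a bound on the mean
  curvature controls the left side, whatever the full second fundamental form does. The sign
  relating \<open>nn\<close> to the chart normal occurs twice and cancels.\<close>

lemma surface_div_decomposition:
  assumes p: "p \<in> regular_points S" and nn: "unit_normal_field S nn" and X: "(X has_derivative X') (at p)"
  shows "surface_div S (tangential_part nn X) p = surface_div S X p - (X p \<bullet> nn p) * surface_div S nn p"
proof -
  obtain W u and \<phi> :: "real^2 \<Rightarrow> real^3" where 1: "C1_chart UNIV S W \<phi>" "smooth_on \<phi> W" "u \<in> W" "\<phi> u = p"
    using regular_pointsE[OF p] .
  have u: "u \<in> W" "u \<in> interior UNIV" using 1 by auto
  obtain \<sigma> where s: "\<sigma> = 1 \<or> \<sigma> = (-1::real)" "nn (\<phi> u) = \<sigma> *\<^sub>R chart_normal \<phi> u"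
    "area_density \<phi> u * surface_div S nn (\<phi> u) = \<sigma> * chart_curv \<phi> u"
    using surface_div_normal[OF 1(1,2) u nn] .
  have "area_density \<phi> u * surface_div S (tangential_part nn X) (\<phi> u) =
       area_density \<phi> u * surface_div S X (\<phi> u) - (X (\<phi> u) \<bullet> chart_normal \<phi> u) * chart_curv \<phi> u"
    by (rule surface_div_tangential(1)[OF 1(1,2) u nn]) (use X 1(4) in simp)
  also have "(X (\<phi> u) \<bullet> chart_normal \<phi> u) * chart_curv \<phi> u = (X (\<phi> u) \<bullet> nn (\<phi> u)) * (\<sigma> * chart_curv \<phi> u)"
    using s(1) unfolding s(2) by auto
  also have "\<dots> = (X (\<phi> u) \<bullet> nn (\<phi> u)) * (area_density \<phi> u * surface_div S nn (\<phi> u))"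
    unfolding s(3) ..
  finally have "area_density \<phi> u * surface_div S (tangential_part nn X) (\<phi> u) =
     area_density \<phi> u * (surface_div S X (\<phi> u) - (X (\<phi> u) \<bullet> nn (\<phi> u)) * surface_div S nn (\<phi> u))"
    by (simp add: algebra_simps)
  then show ?thesis using area_density_pos[OF 1(1,3)] 1(4) by simp
qed

text \<open>The derivative within \<open>S\<close> is chosen separately for every field and need not
  be additive; in a chart only its determined values on tangent vectors appear.\<close>

lemma surface_div_sum:
  assumes p: "p \<in> regular_points S" and X: "\<And>i. i \<in> I \<Longrightarrow> (X i has_derivative X' i) (at p)"
  shows "surface_div S (\<lambda>x. \<Sum>i\<in>I. X i x) p = (\<Sum>i\<in>I. surface_div S (X i) p)"
proof -
  obtain W u and \<phi> :: "real^2 \<Rightarrow> real^3" where 1: "C1_chart UNIV S W \<phi>" "smooth_on \<phi> W" "u \<in> W" "\<phi> u = p"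
    using regular_pointsE[OF p] .
  have u: "u \<in> W" "u \<in> interior UNIV" using 1 by auto
  let ?D = "frechet_derivative \<phi> (at u)"
  have d: "((\<lambda>x. X i (\<phi> x)) has_derivative (\<lambda>v. X' i (?D v))) (at u)" if "i \<in> I" for i
    using diff_chain_at[OF C1_chart_deriv(1)[OF 1(1,3)], of "X i" "X' i"] X[OF that] 1(4) by (simp add: o_def)
  have "((\<lambda>x. \<Sum>i\<in>I. X i (\<phi> x)) has_derivative (\<lambda>v. \<Sum>i\<in>I. X' i (?D v))) (at u)"
    by (rule has_derivative_sum[OF d])
  from surface_div_chart[OF 1(1) u this]
  have "area_density \<phi> u * surface_div S (\<lambda>x. \<Sum>i\<in>I. X i x) (\<phi> u) =
      (\<Sum>i\<in>I. X' i (?D (axis 1 1)) \<bullet> cross3 (pd \<phi> 2 u) (chart_normal \<phi> u) + X' i (?D (axis 2 1)) \<bullet> cross3 (chart_normal \<phi> u) (pd \<phi> 1 u))"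
    by (simp add: inner_sum_left sum.distrib)
  also have "\<dots> = (\<Sum>i\<in>I. area_density \<phi> u * surface_div S (X i) (\<phi> u))"
    by (intro sum.cong refl) (simp only: surface_div_chart[OF 1(1) u d])
  also have "\<dots> = area_density \<phi> u * (\<Sum>i\<in>I. surface_div S (X i) (\<phi> u))" by (simp add: sum_distrib_left)
  finally show ?thesis using area_density_pos[OF 1(1,3)] 1(4) by simp
qed

lemma surface_div_tangential_sum:
  assumes p: "p \<in> regular_points S" and nn: "unit_normal_field S nn"
    and X: "\<And>i. i \<in> I \<Longrightarrow> (X i has_derivative X' i) (at p)"
  shows "surface_div S (tangential_part nn (\<lambda>x. \<Sum>i\<in>I. X i x)) p = (\<Sum>i\<in>I. surface_div S (tangential_part nn (X i)) p)"
proof -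
  have "((\<lambda>x. \<Sum>i\<in>I. X i x) has_derivative (\<lambda>v. \<Sum>i\<in>I. X' i v)) (at p)" by (rule has_derivative_sum[OF X])
  from surface_div_decomposition[OF p nn this]
  have "surface_div S (tangential_part nn (\<lambda>x. \<Sum>i\<in>I. X i x)) p
     = (\<Sum>i\<in>I. surface_div S (X i) p - (X i p \<bullet> nn p) * surface_div S nn p)"
    by (simp add: surface_div_sum[OF p X] inner_sum_left sum_distrib_right sum_subtractf)
  also have "\<dots> = (\<Sum>i\<in>I. surface_div S (tangential_part nn (X i)) p)"
    by (intro sum.cong refl) (simp only: surface_div_decomposition[OF p nn X])
  finally show ?thesis .
qed

lemma surface_div_cong:
  assumes "\<And>x. x \<in> S \<Longrightarrow> Y x = Z x" "p \<in> S"
  shows "surface_div S Y p = surface_div S Z p"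
proof -
  have "(Y has_derivative L) (at p within S) \<longleftrightarrow> (Z has_derivative L) (at p within S)" for L
    using has_derivative_transform[OF assms(2), of Y Z L] has_derivative_transform[OF assms(2), of Z Y L] assms(1)
    by auto
  then have "frechet_derivative Y (at p within S) = frechet_derivative Z (at p within S)"
    by (simp add: frechet_derivative_def)
  then show ?thesis by (simp add: surface_div_def)
qed

text \<open>An orthonormal set in three dimensions has at most 3 elements; this crude count gives
  the constant 3.\<close>

lemma surface_div_bound:
  assumes p: "p \<in> regular_points S" and X: "(X has_derivative X') (at p)" and K: "\<And>v. norm (X' v) \<le> K * norm v"
  shows "\<bar>surface_div S X p\<bar> \<le> 3 * K"
proof -
  obtain W u and \<phi> :: "real^2 \<Rightarrow> real^3" where 1: "C1_chart UNIV S W \<phi>" "smooth_on \<phi> W" "u \<in> W" "\<phi> u = p"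
    using regular_pointsE[OF p] .
  have u: "u \<in> W" "u \<in> interior UNIV" using 1 by auto
  let ?D = "frechet_derivative \<phi> (at u)"
  have "((\<lambda>x. X (\<phi> x)) has_derivative (\<lambda>v. X' (?D v))) (at u)"
    using diff_chain_at[OF C1_chart_deriv(1)[OF 1(1,3)], of X X'] X 1(4) by (simp add: o_def)
  note tr = chart_derivative_transfer(2)[OF 1(1) u this, unfolded 1(4)]
  define L where "L = frechet_derivative X (at p within S)"
  define B where "B = (SOME B. pairwise orthogonal B \<and> (\<forall>e\<in>B. norm e = 1) \<and> span B = tangent_space S p)"
  have "\<exists>B. pairwise orthogonal B \<and> (\<forall>e\<in>B. norm e = 1) \<and> span B = tangent_space S p"
  proof -
    have "subspace (tangent_space S p)" by (simp add: tangent_space_def)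
    from orthonormal_basis_subspace[OF this] show ?thesis by metis
  qed
  from someI_ex[OF this] have B: "pairwise orthogonal B" "\<And>e. e \<in> B \<Longrightarrow> norm e = 1" "span B = tangent_space S p"
    unfolding B_def by blast+
  have "0 \<notin> B" using B(2) by force
  then have "independent B" using pairwise_orthogonal_independent[OF B(1)] by blast
  then have card: "card B \<le> 3" using independent_bound[of B] by simp
  have "norm (X' (axis 1 1)) \<le> K" using K[of "axis 1 1"] by (simp add: norm_axis_1)
  then have K0: "0 \<le> K" by (rule order_trans[OF norm_ge_zero])
  have b: "\<bar>L e \<bullet> e\<bar> \<le> K" if "e \<in> B" for e
  proof -
    have "e \<in> range ?D" using B(3) span_base[OF that] tangent_space_chart(1)[OF 1(1) u] 1(4) by simp
    then have "L e = X' e" using tr by (auto simp: L_def)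
    then show ?thesis using Cauchy_Schwarz_ineq2[of "L e" e] K[of e] B(2)[OF that] by simp
  qed
  have "surface_div S X p = (\<Sum>e\<in>B. L e \<bullet> e)"
    by (simp add: surface_div_def Let_def L_def B_def)
  also have "\<bar>\<dots>\<bar> \<le> (\<Sum>e\<in>B. K)"
    by (rule order_trans[OF sum_abs]) (rule sum_mono[OF b])
  also have "\<dots> = card B * K" by simp
  also have "\<dots> \<le> 3 * K" using card K0 by (intro mult_right_mono) auto
  finally show ?thesis .
qed

text \<open>In a chart the divergence is a quotient of continuous functions: derivatives of the C1
  flux components over the positive area density. The result supplies measurability of the
  integrand.\<close>

lemma surface_div_continuous:
  assumes nn: "unit_normal_field S nn" and X: "C1_on X O'" "S \<subseteq> O'"
  shows "continuous_on (regular_points S) (surface_div S (tangential_part nn X))"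
  unfolding continuous_on_eq_continuous_within
proof
  fix p assume p: "p \<in> regular_points S"
  obtain W u and \<phi> :: "real^2 \<Rightarrow> real^3" where 1: "C1_chart UNIV S W \<phi>" "smooth_on \<phi> W" "u \<in> W" "\<phi> u = p"
    using regular_pointsE[OF p] .
  obtain U \<psi> where U: "open U" and 2: "\<And>u. u \<in> W \<Longrightarrow> \<phi> u \<in> S \<and> \<phi> u \<in> U \<and> \<psi> (\<phi> u) = u"
    and 3: "\<And>q. q \<in> S \<Longrightarrow> q \<in> U \<Longrightarrow> \<psi> q \<in> W \<and> \<phi> (\<psi> q) = q"
    and 4: "continuous_on (S \<inter> U) \<psi>"
    using C1_chartE[OF 1(1)] by (metis UNIV_I)
  have img: "\<phi> ` W \<subseteq> O'" using 2 X(2) by auto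
  have XC: "C1_on (\<lambda>x. X (\<phi> x)) W" by (rule C1_on_compose[OF C1_chart_C1[OF 1(1)] X(1) img])
  have C: "C1_on (chart_normal \<phi>) W" "C1_on (pd \<phi> i) W" for i
    using chart_normal_C1[OF 1(1,2)] smooth_on_C1[OF smooth_on_pd[OF 1(2)]] by auto
  have F: "C1_on (flux1 \<phi> X) W" "C1_on (flux2 \<phi> X) W"
    unfolding flux1_def[abs_def] flux2_def[abs_def] by (intro C1_on_inner C1_on_cross3 XC C)+
  define h where "h u = (pd (flux1 \<phi> X) 1 u + pd (flux2 \<phi> X) 2 u) / area_density \<phi> u" for u
  have "continuous_on W h" unfolding h_def pd_def
    using area_density_pos[OF 1(1)]
    by (intro continuous_intros C1_on_continuous_deriv[OF F(1)] C1_on_continuous_deriv[OF F(2)] area_density_continuous[OF 1(1)])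
       (metis less_irrefl)
  then have "continuous_on (S \<inter> U) (\<lambda>q. h (\<psi> q))"
    by (rule continuous_on_compose2[OF _ 4]) (use 3 in auto)
  moreover have "h (\<psi> q) = surface_div S (tangential_part nn X) q" if q: "q \<in> S \<inter> U" for q
  proof -
    have w: "\<psi> q \<in> W" "\<phi> (\<psi> q) = q" using 3 q by auto
    then have "(X has_derivative frechet_derivative X (at q)) (at (\<phi> (\<psi> q)))"
      using C1_on_has_derivative[OF X(1)] X(2) q by auto
    from surface_div_tangential(2)[OF 1(1,2) w(1) _ nn this] area_density_pos[OF 1(1) w(1)]
    show ?thesis by (simp add: h_def w(2) field_simps)
  qed
  ultimately have "continuous_on (S \<inter> U) (surface_div S (tangential_part nn X))"
    using continuous_on_eq by blast
  moreover have "regular_points S \<inter> U \<subseteq> S \<inter> U" using regular_points_subset by blast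
  moreover have pU: "p \<in> U" using 2 1 by blast
  ultimately have "continuous (at p within regular_points S \<inter> U) (surface_div S (tangential_part nn X))"
    using continuous_on_subset p by (metis IntI continuous_on_eq_continuous_within)
  moreover have "at p within regular_points S \<inter> U = at p within regular_points S"
    using pU U by (intro at_within_nhd[of p U]) auto
  ultimately show "continuous (at p within regular_points S) (surface_div S (tangential_part nn X))" by simp
qed

section \<open>The divergence theorem in a half plane\<close>

text \<open>An explicit identification with the product of two lines. It carries Lebesgue measure to
  Lebesgue measure, so that Fubini can be used for \<open>real^2\<close>.\<close>

definition vec2 :: "real \<times> real \<Rightarrow> real^2" where
  "vec2 z = fst z *\<^sub>R axis 1 1 + snd z *\<^sub>R axis 2 1"

lemma vec2_nth [simp]: "vec2 z $ 1 = fst z" "vec2 z $ 2 = snd z"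
  by (simp_all add: vec2_def axis_def)

lemma vec2_measurable [measurable]: "vec2 \<in> borel_measurable borel"
  unfolding vec2_def by (intro borel_measurable_continuous_onI continuous_intros)

lemma Basis_vec2: "(Basis :: (real^2) set) = {axis 1 1, axis 2 1}"
  by (auto simp: Basis_vec_def UNIV_2)

lemma distr_vec2: "distr lborel borel vec2 = (lborel :: (real^2) measure)"
proof (rule lborel_eqI[symmetric])
  fix l u :: "real^2" assume le: "\<And>b. b \<in> Basis \<Longrightarrow> l \<bullet> b \<le> u \<bullet> b"
  have le': "l $ 1 \<le> u $ 1" "l $ 2 \<le> u $ 2"
    using le[of "axis 1 1"] le[of "axis 2 1"] by (auto simp: Basis_vec2 inner_axis)
  have pre: "vec2 -` box l u = {l $ 1<..<u $ 1} \<times> {l $ 2<..<u $ 2}"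
    by (auto simp: mem_box_cart forall_2)
  have "emeasure (distr lborel borel vec2) (box l u) = emeasure lborel ({l $ 1<..<u $ 1} \<times> {l $ 2<..<u $ 2})"
    by (subst emeasure_distr) (simp_all add: pre)
  also have "\<dots> = emeasure (lborel \<Otimes>\<^sub>M lborel) ({l $ 1<..<u $ 1} \<times> {l $ 2<..<u $ 2})"
    by (simp add: lborel_prod)
  also have "\<dots> = ennreal (u $ 1 - l $ 1) * ennreal (u $ 2 - l $ 2)"
    using le' by (simp add: lborel.emeasure_pair_measure_Times)
  also have "\<dots> = (\<Prod>b\<in>Basis. (u - l) \<bullet> b)"
  proof -
    have "axis 1 1 \<noteq> (axis 2 1 :: real^2)" by (simp add: axis_eq_axis)
    then show ?thesis using le' by (simp add: Basis_vec2 inner_axis ennreal_mult)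
  qed
  finally show "emeasure (distr lborel borel vec2) (box l u) = (\<Prod>b\<in>Basis. (u - l) \<bullet> b)" .
qed simp

lemma Fubini_vec2:
  fixes f :: "real^2 \<Rightarrow> real"
  assumes "integrable lborel f"
  shows "integral\<^sup>L lborel f = (\<integral>x. (\<integral>y. f (vec2 (x, y)) \<partial>lborel) \<partial>lborel)"
    "integral\<^sup>L lborel f = (\<integral>y. (\<integral>x. f (vec2 (x, y)) \<partial>lborel) \<partial>lborel)"
proof -
  have m: "f \<in> borel_measurable borel" using borel_measurable_integrable[OF assms] by simp
  have i: "integrable (lborel \<Otimes>\<^sub>M lborel) (\<lambda>z. f (vec2 z))"
    using assms m unfolding lborel_prod by (subst (asm) distr_vec2[symmetric], subst (asm) integrable_distr_eq) auto
  have e: "integral\<^sup>L lborel f = integral\<^sup>L (lborel \<Otimes>\<^sub>M lborel) (\<lambda>z. f (vec2 z))"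
    unfolding lborel_prod by (subst distr_vec2[symmetric], subst integral_distr) (use m in auto)
  show "integral\<^sup>L lborel f = (\<integral>x. (\<integral>y. f (vec2 (x, y)) \<partial>lborel) \<partial>lborel)"
    unfolding e by (rule lborel_pair.integral_fst'[OF i, symmetric])
  have "integrable (lborel \<Otimes>\<^sub>M lborel) (case_prod (\<lambda>x y. f (vec2 (x, y))))" using i by (simp add: case_prod_unfold)
  from lborel_pair.integral_snd[OF this]
  show "integral\<^sup>L lborel f = (\<integral>y. (\<integral>x. f (vec2 (x, y)) \<partial>lborel) \<partial>lborel)"
    unfolding e by (simp add: case_prod_unfold)
qed

section \<open>Fields in a half plane that vanish off a compact set\<close>

context
  fixes W K :: "(real^2) set" and Z :: "real^2 \<Rightarrow> real"
  assumes W: "open W" and Z: "C1_on Z W" and K: "compact K" "K \<subseteq> W"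
    and vanish: "\<And>u. u \<in> W \<Longrightarrow> 0 \<le> u $ 1 \<Longrightarrow> u \<notin> K \<Longrightarrow> Z u = 0"
begin

abbreviation "half_deriv i u \<equiv> indicator {u \<in> W. 0 < u $ 1} u * pd Z i u"

lemma open_half: "open {u \<in> W. 0 < u $ 1}"
proof -
  have "{u \<in> W. 0 < u $ 1} = W \<inter> {u. 0 < u $ 1}" by auto
  then show ?thesis using W by (auto intro!: open_Collect_less continuous_intros)
qed

lemma half_deriv_outside: "u \<notin> K \<Longrightarrow> half_deriv i u = 0"
proof (cases "u \<in> W \<and> 0 < u $ 1")
  case True
  assume u: "u \<notin> K"
  have o: "open ({u \<in> W. 0 < u $ 1} - K)" using open_half compact_imp_closed[OF K(1)] by auto
  have "(Z has_derivative (\<lambda>v. 0)) (at u)"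
    by (rule has_derivative_transform_open_at[OF has_derivative_const o]) (use True u vanish in auto)
  from fun_cong[OF frechet_derivative_at[OF this]] show ?thesis by (simp add: pd_def)
qed auto

lemma half_deriv_integrable:
  obtains C where "\<And>u. \<bar>half_deriv i u\<bar> \<le> C" "half_deriv i \<in> borel_measurable borel" "integrable lborel (half_deriv i)"
proof -
  have "continuous_on W (pd Z i)"
    using C1_on_continuous_deriv[OF Z] by (simp add: pd_def[abs_def])
  then have "compact (pd Z i ` K)" using compact_continuous_image[OF _ K(1)] continuous_on_subset[OF _ K(2)] by blast
  then obtain C where C: "\<And>u. u \<in> K \<Longrightarrow> \<bar>pd Z i u\<bar> \<le> C"
    using compact_imp_bounded[of "pd Z i ` K"] unfolding bounded_iff by auto
  have b: "\<bar>half_deriv i u\<bar> \<le> \<bar>C\<bar> * indicator K u" for u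
    using half_deriv_outside[of u i] C[of u] by (cases "u \<in> K") (auto simp: indicator_def)
  have m: "half_deriv i \<in> borel_measurable borel"
    using borel_measurable_continuous_on_indicator[of "{u \<in> W. 0 < u $ 1}" "pd Z i"] open_half
      continuous_on_subset[OF \<open>continuous_on W (pd Z i)\<close>, of "{u \<in> W. 0 < u $ 1}"] by auto
  have "integrable lborel (\<lambda>u. \<bar>C\<bar> * indicator K u :: real)"
    using emeasure_compact_finite[OF K(1)] compact_imp_closed[OF K(1)]
    by (intro integrable_mult_right integrable_real_indicator) auto
  then have "integrable lborel (half_deriv i)"
    by (rule Bochner_Integration.integrable_bound) (use m b in auto)
  moreover have "\<bar>half_deriv i u\<bar> \<le> \<bar>C\<bar>" for u
    by (rule order_trans[OF b]) (simp split: split_indicator)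
  ultimately show ?thesis using that m by blast
qed

text \<open>Outside \<open>W\<close> the function \<open>Z\<close> is unknown, and \<open>Z0\<close>
  replaces it by 0. This extension is continuous along the line because a point outside
  \<open>W\<close> has a neighbourhood that misses the compact set \<open>K\<close>. At the end
  points only continuity is available, as the integrand is cut off on the boundary line.\<close>

lemma half_line_FTC:
  fixes c :: "real^2" and i :: 2
  defines "L \<equiv> \<lambda>s. c + s *\<^sub>R axis i 1" and "Z0 \<equiv> \<lambda>u. if u \<in> W then Z u else 0"
  assumes bd: "b \<le> d" "\<And>s. b \<le> s \<Longrightarrow> s \<le> d \<Longrightarrow> 0 \<le> L s $ 1" "\<And>s. b < s \<Longrightarrow> s < d \<Longrightarrow> 0 < L s $ 1"
  shows "((\<lambda>s. half_deriv i (L s)) has_integral Z0 (L d) - Z0 (L b)) {b..d}"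
proof (rule fundamental_theorem_of_calculus_interior[OF bd(1)])
  have Lc: "isCont L s" for s unfolding L_def by (intro continuous_intros)
  have nhd: "\<exists>\<delta>>0. \<forall>t. \<bar>t - s\<bar> < \<delta> \<longrightarrow> L t \<in> T" if "open T" "L s \<in> T" for s T
  proof -
    have "open (L -` T)" using that(1) Lc by (intro continuous_open_vimage) (auto intro: continuous_at_imp_continuous_at_within)
    then show ?thesis using that(2) unfolding open_dist by (auto simp: dist_real_def)
  qed
  have Z0_out: "\<exists>\<delta>>0. \<forall>t\<in>{b..d}. \<bar>t - s\<bar> < \<delta> \<longrightarrow> Z0 (L t) = 0" if "L s \<notin> W" for s
  proof -
    have "L s \<in> - K" using that K by auto
    then obtain \<delta> where "\<delta> > 0" "\<And>t. \<bar>t - s\<bar> < \<delta> \<Longrightarrow> L t \<in> - K"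
      using nhd[of "- K" s] compact_imp_closed[OF K(1)] by auto
    then show ?thesis using vanish bd(2) by (intro exI[of _ \<delta>]) (auto simp: Z0_def)
  qed
  show "continuous_on {b..d} (\<lambda>s. Z0 (L s))"
    unfolding continuous_on_eq_continuous_within
  proof
    fix s assume s: "s \<in> {b..d}"
    show "continuous (at s within {b..d}) (\<lambda>s. Z0 (L s))"
    proof (cases "L s \<in> W")
      case True
      obtain \<delta> where \<delta>: "\<delta> > 0" "\<And>t. \<bar>t - s\<bar> < \<delta> \<Longrightarrow> L t \<in> W" using nhd[OF W True] by auto
      have "isCont Z (L s)" using C1_on_has_derivative[OF Z True] has_derivative_continuous by blast
      then have "isCont (\<lambda>s. Z (L s)) s" using Lc isCont_o2 by blast
      then have "continuous (at s within {b..d}) (\<lambda>s. Z (L s))" by (rule continuous_at_imp_continuous_at_within)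
      then show ?thesis
        by (rule continuous_transform_within[OF _ \<delta>(1) s]) (use \<delta>(2) in \<open>auto simp: Z0_def dist_real_def\<close>)
    next
      case False
      obtain \<delta> where \<delta>: "\<delta> > 0" "\<And>t. t \<in> {b..d} \<Longrightarrow> \<bar>t - s\<bar> < \<delta> \<Longrightarrow> Z0 (L t) = 0" using Z0_out[OF False] by auto
      show ?thesis
        by (rule continuous_transform_within[OF continuous_const \<delta>(1) s]) (use \<delta>(2) in \<open>auto simp: dist_real_def\<close>)
    qed
  qed
  fix s assume s: "s \<in> {b<..<d}"
  obtain \<eta> where \<eta>: "\<eta> > 0" "\<And>t. \<bar>t - s\<bar> < \<eta> \<Longrightarrow> t \<in> {b..d}"
  proof
    show "min (s - b) (d - s) > 0" using s by auto
  qed (auto simp: abs_if split: if_splits)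
  show "((\<lambda>s. Z0 (L s)) has_vector_derivative half_deriv i (L s)) (at s)"
  proof (cases "L s \<in> W")
    case True
    obtain \<delta> where \<delta>: "\<delta> > 0" "\<And>t. \<bar>t - s\<bar> < \<delta> \<Longrightarrow> L t \<in> W" using nhd[OF W True] by auto
    have dL: "(L has_derivative (\<lambda>h. h *\<^sub>R axis i 1)) (at s)"
      unfolding L_def by (auto intro!: derivative_eq_intros)
    have dZ: "(Z has_derivative frechet_derivative Z (at (L s))) (at (L s))" by (rule C1_on_has_derivative[OF Z True])
    have "((\<lambda>s. Z (L s)) has_derivative (\<lambda>h. frechet_derivative Z (at (L s)) (h *\<^sub>R axis i 1))) (at s)"
      by (rule has_derivative_compose[OF dL dZ])
    moreover have "frechet_derivative Z (at (L s)) (h *\<^sub>R axis i 1) = h *\<^sub>R half_deriv i (L s)" for h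
      using linear_cmul[OF has_derivative_linear[OF dZ]] True bd(3) s by (simp add: pd_def)
    ultimately have "((\<lambda>s. Z (L s)) has_vector_derivative half_deriv i (L s)) (at s)"
      by (simp only: has_vector_derivative_def)
    then show ?thesis
      by (rule has_vector_derivative_transform_within[OF _ \<delta>(1)]) (use \<delta>(2) in \<open>auto simp: Z0_def dist_real_def\<close>)
  next
    case False
    obtain \<delta> where \<delta>: "\<delta> > 0" "\<And>t. t \<in> {b..d} \<Longrightarrow> \<bar>t - s\<bar> < \<delta> \<Longrightarrow> Z0 (L t) = 0" using Z0_out[OF False] by auto
    have "half_deriv i (L s) = 0" using False by simp
    moreover have "((\<lambda>s. Z0 (L s)) has_vector_derivative 0) (at s)"
      by (rule has_vector_derivative_transform_within[OF has_vector_derivative_const, of "min \<delta> \<eta>"])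
         (use \<delta> \<eta> in \<open>auto simp: dist_real_def\<close>)
    ultimately show ?thesis by (simp only:)
  qed
qed

lemma half_line_integral:
  fixes c :: "real^2" and i :: 2
  defines "L \<equiv> \<lambda>s. c + s *\<^sub>R axis i 1" and "Z0 \<equiv> \<lambda>u. if u \<in> W then Z u else 0"
  assumes bd: "b \<le> d" "\<And>s. b \<le> s \<Longrightarrow> s \<le> d \<Longrightarrow> 0 \<le> L s $ 1" "\<And>s. b < s \<Longrightarrow> s < d \<Longrightarrow> 0 < L s $ 1"
    and out: "\<And>s. s \<notin> {b..d} \<Longrightarrow> half_deriv i (L s) = 0"
  shows "(\<integral>s. half_deriv i (L s) \<partial>lborel) = Z0 (L d) - Z0 (L b)"
proof -
  have "((\<lambda>s. half_deriv i (L s)) has_integral Z0 (L d) - Z0 (L b)) {b..d}"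
    unfolding L_def Z0_def by (rule half_line_FTC) (use bd in \<open>auto simp: L_def\<close>)
  then have 1: "((\<lambda>s. half_deriv i (L s)) has_integral Z0 (L d) - Z0 (L b)) UNIV"
    by (rule has_integral_on_superset) (use out in auto)
  obtain C where C: "\<And>u. \<bar>half_deriv i u\<bar> \<le> C" "half_deriv i \<in> borel_measurable borel"
    using half_deriv_integrable by blast
  have Lm: "L \<in> borel_measurable borel"
    unfolding L_def by (intro borel_measurable_continuous_onI continuous_intros)
  have m: "(\<lambda>s. half_deriv i (L s)) \<in> borel_measurable lborel"
    using measurable_compose[OF Lm C(2)] by simp
  have "integrable lborel (\<lambda>s. C * indicator {b..d} s :: real)"
    by (intro integrable_mult_right integrable_real_indicator) (simp_all add: bd(1))
  then have "integrable lborel (\<lambda>s. half_deriv i (L s))"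
  proof (rule Bochner_Integration.integrable_bound[OF _ m])
    show "AE s in lborel. norm (half_deriv i (L s)) \<le> norm (C * indicator {b..d} s :: real)"
    proof (rule AE_I2)
      fix s
      show "norm (half_deriv i (L s)) \<le> norm (C * indicator {b..d} s :: real)"
        using out[of s] C(1)[of "L s"] by (cases "s \<in> {b..d}") auto
    qed
  qed
  then have "((\<lambda>s. half_deriv i (L s)) has_integral (\<integral>s. half_deriv i (L s) \<partial>lborel)) UNIV"
    by (rule has_integral_integral_lborel)
  from has_integral_unique[OF this 1] show ?thesis .
qed

text \<open>The inner integration of Fubini is taken in the direction of the derivative. Normal to
  the boundary it starts on the boundary line and leaves the value there; parallel to it both ends
  lie outside the support.\<close>

lemma integral_half_deriv:
  shows "integral\<^sup>L lborel (half_deriv 1) = - (LINT t:{t. t *\<^sub>R axis 2 1 \<in> W}|lborel. Z (t *\<^sub>R axis 2 1))"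
    "integral\<^sup>L lborel (half_deriv 2) = 0"
proof -
  let ?Z0 = "\<lambda>u. if u \<in> W then Z u else 0"
  \<comment> \<open>A ball of radius \<open>a\<close> contains \<open>K\<close>, so a coordinate of
    absolute value at least \<open>a\<close> already excludes a point from \<open>K\<close>.\<close>
  obtain a where a: "a > 0" "K \<subseteq> ball 0 a" using compact_imp_bounded[OF K(1)] bounded_subset_ballD by blast
  have aK: "u \<notin> K" if "a \<le> \<bar>u $ i\<bar>" for u :: "real^2" and i
    using component_le_norm_cart[of u i] that a(2) by auto
  have Z0K: "?Z0 u = 0" if "u \<notin> K" "0 \<le> u $ 1" for u using vanish that by auto
  have v1: "vec2 (x, y) = y *\<^sub>R axis 2 1 + x *\<^sub>R axis 1 1" and v2: "vec2 (x, y) = x *\<^sub>R axis 1 1 + y *\<^sub>R axis 2 1" for x y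
    by (simp_all add: vec2_def)
  have n1: "(y *\<^sub>R axis 2 1 + x *\<^sub>R axis 1 1 :: real^2) $ 1 = x" "(y *\<^sub>R axis 2 1 + x *\<^sub>R axis 1 1 :: real^2) $ 2 = y"
    "(x *\<^sub>R axis 1 1 + y *\<^sub>R axis 2 1 :: real^2) $ 1 = x" "(x *\<^sub>R axis 1 1 + y *\<^sub>R axis 2 1 :: real^2) $ 2 = y" for x y
    by (simp_all add: axis_def)
  have in1: "integrable lborel (half_deriv i)" for i using half_deriv_integrable by blast
  have "(\<integral>x. half_deriv 1 (y *\<^sub>R axis 2 1 + x *\<^sub>R axis 1 1) \<partial>lborel) = ?Z0 (y *\<^sub>R axis 2 1 + a *\<^sub>R axis 1 1) - ?Z0 (y *\<^sub>R axis 2 1 + 0 *\<^sub>R axis 1 1)" for y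
  proof (rule half_line_integral)
    show "half_deriv 1 (y *\<^sub>R axis 2 1 + s *\<^sub>R axis 1 1) = 0" if "s \<notin> {0..a}" for s
    proof (cases "s < 0")
      case True
      then have "\<not> 0 < (y *\<^sub>R axis 2 1 + s *\<^sub>R axis 1 1 :: real^2) $ 1" unfolding n1 by simp
      then show ?thesis by (simp add: indicator_def)
    next
      case False
      then have "y *\<^sub>R axis 2 1 + s *\<^sub>R axis 1 1 \<notin> K" using that aK[of "y *\<^sub>R axis 2 1 + s *\<^sub>R axis 1 1" 1] unfolding n1 by simp
      then show ?thesis by (rule half_deriv_outside)
    qed
  qed (insert a, unfold n1, auto)
  moreover have "?Z0 (y *\<^sub>R axis 2 1 + a *\<^sub>R axis 1 1) = 0" for y
    using a aK[of "y *\<^sub>R axis 2 1 + a *\<^sub>R axis 1 1" 1] unfolding n1 by (intro Z0K, simp_all only: n1) auto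
  ultimately have "(\<integral>x. half_deriv 1 (vec2 (x, y)) \<partial>lborel) = - ?Z0 (y *\<^sub>R axis 2 1)" for y
    by (simp add: v1)
  then have "integral\<^sup>L lborel (half_deriv 1) = (\<integral>y. - ?Z0 (y *\<^sub>R axis 2 1) \<partial>lborel)"
    using Fubini_vec2(2)[OF in1] by simp
  also have "\<dots> = - (LINT t:{t. t *\<^sub>R axis 2 1 \<in> W}|lborel. Z (t *\<^sub>R axis 2 1))"
    unfolding set_lebesgue_integral_def integral_minus
    by (intro arg_cong[where f = uminus] Bochner_Integration.integral_cong) (auto simp: indicator_def)
  finally show "integral\<^sup>L lborel (half_deriv 1) = - (LINT t:{t. t *\<^sub>R axis 2 1 \<in> W}|lborel. Z (t *\<^sub>R axis 2 1))" .
  have "(\<integral>y. half_deriv 2 (vec2 (x, y)) \<partial>lborel) = 0" for x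
  proof (cases "0 < x")
    case False
    then show ?thesis by simp
  next
    case True
    have "(\<integral>y. half_deriv 2 (x *\<^sub>R axis 1 1 + y *\<^sub>R axis 2 1) \<partial>lborel) = ?Z0 (x *\<^sub>R axis 1 1 + a *\<^sub>R axis 2 1) - ?Z0 (x *\<^sub>R axis 1 1 + (- a) *\<^sub>R axis 2 1)"
    proof (rule half_line_integral)
      show "half_deriv 2 (x *\<^sub>R axis 1 1 + s *\<^sub>R axis 2 1) = 0" if "s \<notin> {-a..a}" for s
        proof -
        have "\<not> (- a \<le> s \<and> s \<le> a)" using that by simp
        then have "a \<le> \<bar>s\<bar>" by linarith
        then have "x *\<^sub>R axis 1 1 + s *\<^sub>R axis 2 1 \<notin> K"
          using aK[of "x *\<^sub>R axis 1 1 + s *\<^sub>R axis 2 1" 2] unfolding n1 by simp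
        then show ?thesis by (rule half_deriv_outside)
      qed
    qed (insert a True, unfold n1, auto)
    also have "?Z0 (x *\<^sub>R axis 1 1 + a *\<^sub>R axis 2 1) = 0"
      using a True aK[of "x *\<^sub>R axis 1 1 + a *\<^sub>R axis 2 1" 2] unfolding n1 by (intro Z0K, simp_all only: n1) auto
    also have "?Z0 (x *\<^sub>R axis 1 1 + (- a) *\<^sub>R axis 2 1) = 0"
      using a True aK[of "x *\<^sub>R axis 1 1 + (- a) *\<^sub>R axis 2 1" 2] unfolding n1 by (intro Z0K, simp_all only: n1) auto
    finally show ?thesis by (simp add: v2)
  qed
  then show "integral\<^sup>L lborel (half_deriv 2) = 0"
    using Fubini_vec2(1)[OF in1] by simp
qed

end

text \<open>The minus sign comes from the outward normal of the half plane, the negative of the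
  first axis.\<close>

lemma half_plane_divergence:
  fixes Z1 Z2 :: "real^2 \<Rightarrow> real"
  assumes W: "open W" and Z: "C1_on Z1 W" "C1_on Z2 W" and K: "compact K" "K \<subseteq> W"
    and vanish: "\<And>u. u \<in> W \<Longrightarrow> 0 \<le> u $ 1 \<Longrightarrow> u \<notin> K \<Longrightarrow> Z1 u = 0 \<and> Z2 u = 0"
  shows "(LINT u:{u \<in> W. 0 < u $ 1}|lborel. pd Z1 1 u + pd Z2 2 u) =
     - (LINT t:{t. t *\<^sub>R axis 2 1 \<in> W}|lborel. Z1 (t *\<^sub>R axis 2 1))"
proof -
  let ?I = "indicator {u \<in> W. 0 < u $ 1} :: real^2 \<Rightarrow> real"
  have 1: "Z1 u = 0" and 2: "Z2 u = 0" if "u \<in> W" "0 \<le> u $ 1" "u \<notin> K" for u using vanish that by auto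
  have i: "integrable lborel (\<lambda>u. ?I u * pd Z1 1 u)" "integrable lborel (\<lambda>u. ?I u * pd Z2 2 u)"
    using half_deriv_integrable[OF W Z(1) K 1] half_deriv_integrable[OF W Z(2) K 2] by blast+
  have "(LINT u:{u \<in> W. 0 < u $ 1}|lborel. pd Z1 1 u + pd Z2 2 u) = (\<integral>u. ?I u * pd Z1 1 u + ?I u * pd Z2 2 u \<partial>lborel)"
    unfolding set_lebesgue_integral_def by (simp add: distrib_left)
  also have "\<dots> = (\<integral>u. ?I u * pd Z1 1 u \<partial>lborel) + (\<integral>u. ?I u * pd Z2 2 u \<partial>lborel)"
    by (rule Bochner_Integration.integral_add[OF i])
  finally show ?thesis
    using integral_half_deriv(1)[OF W Z(1) K 1] integral_half_deriv(2)[OF W Z(2) K 2] by simp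
qed

section \<open>Boundary curves and conormals\<close>

text \<open>As a model set for charts, this line lets the half-plane chart of a surface serve
  unchanged as a chart of its boundary curve.\<close>

definition boundary_line :: "(real^2) set" where
  "boundary_line = {u. u $ 1 = 0}"

lemma boundary_line_iff [simp]: "u \<in> boundary_line \<longleftrightarrow> u $ 1 = 0"
  by (simp add: boundary_line_def)

lemma cone_dirs_line_directions:
  fixes u :: "real^2"
  assumes "u $ 1 = 0" shows "cone_dirs boundary_line u = {w. w $ 1 = 0}"
proof (intro equalityI subsetI)
  fix w assume w: "w \<in> cone_dirs boundary_line u"
  then obtain \<omega> \<epsilon> where o: "0 < (\<epsilon>::real)" "\<omega> 0 = u" "\<omega> ` {0..<\<epsilon>} \<subseteq> boundary_line"
      "(\<omega> has_vector_derivative w) (at 0 within {0..})"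
    unfolding cone_dirs_def by auto
  have "- w \<in> cone_dirs boundary_line u"
    unfolding cone_dirs_def
  proof (intro CollectI exI conjI)
    \<comment> \<open>The curve is reflected in \<open>u\<close>. The line is preserved, so the cone
      is symmetric, and its first coordinate is both nonnegative and nonpositive.\<close>
    show "((\<lambda>t. 2 *\<^sub>R u - \<omega> t) has_vector_derivative - w) (at 0 within {0..})"
      using has_vector_derivative_diff[OF has_vector_derivative_const[of "2 *\<^sub>R u"] o(4)] by simp
    show "2 *\<^sub>R u - \<omega> 0 = u" using o(2) by (simp add: scaleR_2)
    show "(\<lambda>t. 2 *\<^sub>R u - \<omega> t) ` {0..<\<epsilon>} \<subseteq> boundary_line" using o(3) assms by auto
  qed fact
  then have "0 \<le> (- w) $ 1" by (rule cone_dirs_nonneg[rotated 2]) (auto simp: assms)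
  moreover have "0 \<le> w $ 1" by (rule cone_dirs_nonneg[OF _ assms w]) auto
  ultimately show "w \<in> {w. w $ 1 = 0}" by simp
next
  fix w :: "real^2" assume "w \<in> {w. w $ 1 = 0}"
  then show "w \<in> cone_dirs boundary_line u"
    using assms by (intro cone_dirs_line[of 1]) auto
qed

lemma half_plane_boundary_chart:
  assumes ch: "C1_chart half_plane S W \<phi>" "smooth_on \<phi> W"
  shows "C1_chart boundary_line (surface_boundary S) W \<phi>"
proof -
  obtain U \<psi> where U: "open U" and 1: "\<And>u. u \<in> W \<Longrightarrow> u \<in> half_plane \<Longrightarrow> \<phi> u \<in> S \<and> \<phi> u \<in> U \<and> \<psi> (\<phi> u) = u"
    and 2: "\<And>q. q \<in> S \<Longrightarrow> q \<in> U \<Longrightarrow> \<psi> q \<in> W \<and> \<psi> q \<in> half_plane \<and> \<phi> (\<psi> q) = q"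
    and 3: "continuous_on (S \<inter> U) \<psi>"
    using C1_chartE[OF ch(1)] by metis
  show ?thesis
  proof (rule C1_chartI[where U = U and \<psi> = \<psi>])
    show "open W" "C1_on \<phi> W" "\<And>u. u \<in> W \<Longrightarrow> inj (frechet_derivative \<phi> (at u))"
      using ch(1) unfolding C1_chart_def by blast+
    show "continuous_on (surface_boundary S \<inter> U) \<psi>"
      by (rule continuous_on_subset[OF 3]) (auto simp: surface_boundary_def)
    show "\<phi> u \<in> surface_boundary S \<and> \<phi> u \<in> U \<and> \<psi> (\<phi> u) = u" if u: "u \<in> W" "u \<in> boundary_line" for u
    proof -
      have "u \<in> half_plane" using u by (simp add: half_plane_def)
      with 1[OF u(1)] half_plane_chart_regular_iff[OF ch u(1)] u(2) show ?thesis by (auto simp: surface_boundary_def)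
    qed
    show "\<psi> q \<in> W \<and> \<psi> q \<in> boundary_line \<and> \<phi> (\<psi> q) = q" if q: "q \<in> surface_boundary S" "q \<in> U" for q
    proof -
      have qS: "q \<in> S" "q \<notin> regular_points S" using q by (auto simp: surface_boundary_def)
      then have "\<not> 0 < \<psi> q $ 1" using half_plane_chart_regular_iff[OF ch, of "\<psi> q"] 2[OF qS(1) q(2)] by auto
      then show ?thesis using 2[OF qS(1) q(2)] by (auto simp: half_plane_def)
    qed
  qed fact
qed

lemma line_curve:
  fixes \<phi> :: "real^2 \<Rightarrow> real^3"
  assumes ch: "C1_chart boundary_line C W \<phi>"
  defines "W1 \<equiv> {t. t *\<^sub>R axis 2 1 \<in> W}" and "\<gamma> \<equiv> \<lambda>t. \<phi> (t *\<^sub>R axis 2 1)"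
  shows "C1_chart UNIV C W1 \<gamma>"
    and "\<And>t. t \<in> W1 \<Longrightarrow> vector_derivative \<gamma> (at t) = pd \<phi> 2 (t *\<^sub>R axis 2 1)"
    and "smooth_on \<phi> W \<Longrightarrow> curve_param C W1 \<gamma>"
    and "\<gamma> ` W1 = \<phi> ` (W \<inter> boundary_line)"
proof -
  have lin: "bounded_linear (\<lambda>t. t *\<^sub>R axis 2 (1::real) :: real^2)" by (rule bounded_linear_scaleR_left)
  have W1: "W1 = (\<lambda>t. 0 + t *\<^sub>R axis 2 1) -` W" by (auto simp: W1_def)
  have g: "\<gamma> = (\<lambda>t. \<phi> (0 + t *\<^sub>R axis 2 1))" by (simp add: \<gamma>_def)
  have oW1: "open W1" unfolding W1 by (intro open_vimage C1_chart_open[OF ch] continuous_intros)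
  have C1: "C1_on \<gamma> W1" unfolding g W1 C1_on_def
    by (rule Ck_on_affine[OF lin C1_chart_open[OF ch]]) (use C1_chart_C1[OF ch] in \<open>simp add: C1_on_def\<close>)
  have d: "(\<gamma> has_derivative (\<lambda>h. h *\<^sub>R pd \<phi> 2 (t *\<^sub>R axis 2 1))) (at t)" if "t \<in> W1" for t
  proof -
    have tW: "t *\<^sub>R axis 2 1 \<in> W" using that by (simp add: W1_def)
    note D = C1_chart_deriv[OF ch tW]
    have "((\<lambda>t. t *\<^sub>R axis 2 1) has_derivative (\<lambda>h. h *\<^sub>R axis 2 1)) (at t)"
      by (auto intro!: derivative_eq_intros)
    from has_derivative_compose[OF this D(1)] show ?thesis
      by (simp add: \<gamma>_def pd_def linear_cmul[OF D(3)])
  qed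
  show vd: "vector_derivative \<gamma> (at t) = pd \<phi> 2 (t *\<^sub>R axis 2 1)" if "t \<in> W1" for t
    using d[OF that] vector_derivative_at unfolding has_vector_derivative_def by blast
  have pn: "pd \<phi> 2 (t *\<^sub>R axis 2 1) \<noteq> 0" if "t \<in> W1" for t
  proof -
    have tW: "t *\<^sub>R axis 2 1 \<in> W" using that by (simp add: W1_def)
    show ?thesis using chart_cross3_nonzero[OF ch tW] by auto
  qed
  have inj: "inj (frechet_derivative \<gamma> (at t))" if "t \<in> W1" for t
    using pn[OF that] unfolding frechet_derivative_at[OF d[OF that], symmetric] by (auto intro: injI)
  obtain U \<psi> where U: "open U" and 1: "\<And>u. u \<in> W \<Longrightarrow> u \<in> boundary_line \<Longrightarrow> \<phi> u \<in> C \<and> \<phi> u \<in> U \<and> \<psi> (\<phi> u) = u"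
    and 2: "\<And>q. q \<in> C \<Longrightarrow> q \<in> U \<Longrightarrow> \<psi> q \<in> W \<and> \<psi> q \<in> boundary_line \<and> \<phi> (\<psi> q) = q"
    and 3: "continuous_on (C \<inter> U) \<psi>"
    using C1_chartE[OF ch] by metis
  have e2: "(t *\<^sub>R axis 2 1 :: real^2) $ 1 = 0" "(t *\<^sub>R axis 2 1 :: real^2) $ 2 = t" for t by (simp_all add: axis_def)
  have line: "x = (x $ 2) *\<^sub>R axis 2 1" if "x $ 1 = 0" for x :: "real^2" using vec2_expand[of x] that by simp
  show ch1: "C1_chart UNIV C W1 \<gamma>"
  proof (rule C1_chartI[OF oW1 C1 inj U])
    show "\<gamma> t \<in> C \<and> \<gamma> t \<in> U \<and> \<psi> (\<gamma> t) $ 2 = t" if "t \<in> W1" for t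
      using 1[of "t *\<^sub>R axis 2 1"] that e2 by (simp add: W1_def \<gamma>_def)
    show "\<psi> q $ 2 \<in> W1 \<and> \<psi> q $ 2 \<in> UNIV \<and> \<gamma> (\<psi> q $ 2) = q" if "q \<in> C" "q \<in> U" for q
      using 2[OF that] line[of "\<psi> q"] by (simp add: W1_def \<gamma>_def)
    show "continuous_on (C \<inter> U) (\<lambda>q. \<psi> q $ 2)" by (intro continuous_intros 3)
  qed
  show "\<gamma> ` W1 = \<phi> ` (W \<inter> boundary_line)"
  proof (intro equalityI subsetI)
    fix q assume "q \<in> \<phi> ` (W \<inter> boundary_line)"
    then obtain x where x: "x \<in> W" "x $ 1 = 0" "q = \<phi> x" by auto
    with line[OF x(2)] show "q \<in> \<gamma> ` W1" by (intro image_eqI[of _ _ "x $ 2"]) (simp_all add: W1_def \<gamma>_def)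
  qed (use e2 in \<open>auto simp: W1_def \<gamma>_def\<close>)
  show "curve_param C W1 \<gamma>" if sm: "smooth_on \<phi> W"
    unfolding curve_param_def
  proof (intro conjI ballI)
    show "smooth_on \<gamma> W1" unfolding g W1 by (rule smooth_on_affine[OF lin C1_chart_open[OF ch] sm])
    show "vector_derivative \<gamma> (at t) \<noteq> 0" if "t \<in> W1" for t using vd[OF that] pn[OF that] by simp
    show "\<exists>U \<psi>. open U \<and> homeomorphism W1 (C \<inter> U) \<gamma> \<psi>" using ch1 unfolding C1_chart_def by simp
  qed fact
qed

text \<open>\<open>cross3 (pd \<phi> 2 u) (chart_normal \<phi> u)\<close> is tangent to the surface
  and orthogonal to the coordinate line of the second parameter. By the third formula it points to
  increasing first coordinate, that is, inwards from the boundary line.\<close>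

lemma cross3_normal_facts:
  assumes ch: "C1_chart M S W \<phi>" "u \<in> W"
  shows "norm (cross3 (pd \<phi> 2 u) (chart_normal \<phi> u)) = norm (pd \<phi> 2 u)" "pd \<phi> 2 u \<noteq> 0"
    "frechet_derivative \<phi> (at u) w \<bullet> cross3 (pd \<phi> 2 u) (chart_normal \<phi> u) = w $ 1 * area_density \<phi> u"
    "cross3 (pd \<phi> 2 u) (chart_normal \<phi> u) \<in> range (frechet_derivative \<phi> (at u))"
proof -
  let ?a = "pd \<phi> 1 u" and ?b = "pd \<phi> 2 u" and ?n = "chart_normal \<phi> u"
  note D = C1_chart_deriv[OF ch]
  have "(norm (cross3 ?b ?n))\<^sup>2 = (norm ?b)\<^sup>2"
    using norm_cross_dot[of ?b ?n] chart_normal_orthogonal[of \<phi> u] norm_chart_normal[OF ch] by simp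
  then show "norm (cross3 ?b ?n) = norm ?b" by simp
  show "?b \<noteq> 0" using chart_cross3_nonzero[OF ch] by auto
  have "?a \<bullet> cross3 ?b ?n = cross3 ?a ?b \<bullet> ?n" by (rule cross3_scalar_triple)
  also have "\<dots> = area_density \<phi> u"
    using chart_cross3_nonzero[OF ch] by (simp add: chart_normal_def area_density_pd dot_square_norm power2_eq_square)
  finally have aa: "?a \<bullet> cross3 ?b ?n = area_density \<phi> u" .
  show "frechet_derivative \<phi> (at u) w \<bullet> cross3 ?b ?n = w $ 1 * area_density \<phi> u"
    unfolding linear_axis_expand[OF D(3), of w] using aa by (simp add: inner_add_left pd_def dot_cross_self)
  have "cross3 ?b ?n = inverse (norm (cross3 ?a ?b)) *\<^sub>R ((?b \<bullet> ?b) *\<^sub>R ?a - (?b \<bullet> ?a) *\<^sub>R ?b)"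
    by (simp add: chart_normal_def cross_mult_right Lagrange)
  also have "\<dots> = frechet_derivative \<phi> (at u) (inverse (norm (cross3 ?a ?b)) *\<^sub>R ((?b \<bullet> ?b) *\<^sub>R axis 1 1 - (?b \<bullet> ?a) *\<^sub>R axis 2 1))"
    by (simp add: pd_def linear_cmul[OF D(3)] linear_diff[OF D(3)])
  finally show "cross3 ?b ?n \<in> range (frechet_derivative \<phi> (at u))" by (rule range_eqI)
qed

lemma half_plane_tangent:
  fixes \<phi> :: "real^2 \<Rightarrow> real^3"
  assumes ch: "C1_chart half_plane S W \<phi>" "smooth_on \<phi> W" and u: "u \<in> W" "u $ 1 = 0"
  shows "tangent_cone S (\<phi> u) = frechet_derivative \<phi> (at u) ` {w. 0 \<le> w $ 1}"
    "tangent_space S (\<phi> u) = range (frechet_derivative \<phi> (at u))"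
    "tangent_cone (surface_boundary S) (\<phi> u) = range (\<lambda>c. c *\<^sub>R pd \<phi> 2 u)"
proof -
  let ?D = "frechet_derivative \<phi> (at u)"
  note D = C1_chart_deriv[OF ch(1) u(1)]
  have uH: "u \<in> half_plane" using u by (simp add: half_plane_def)
  have "cone_dirs half_plane u = {w. 0 \<le> w $ 1}"
  proof (intro equalityI subsetI)
    fix w assume "w \<in> cone_dirs half_plane u"
    then show "w \<in> {w. 0 \<le> w $ 1}" using cone_dirs_nonneg[OF half_plane_subset u(2)] by simp
  next
    fix w :: "real^2" assume "w \<in> {w. 0 \<le> w $ 1}"
    then show "w \<in> cone_dirs half_plane u"
      using u(2) by (intro cone_dirs_line[of 1]) (auto simp: half_plane_def)
  qed
  then show tc: "tangent_cone S (\<phi> u) = ?D ` {w. 0 \<le> w $ 1}" using tangent_cone_chart[OF ch(1) u(1) uH] by simp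
  show "tangent_space S (\<phi> u) = range ?D"
  proof (intro equalityI)
    have "subspace (range ?D)" using D(3) linear_subspace_image subspace_UNIV by blast
    then show "tangent_space S (\<phi> u) \<subseteq> range ?D"
      unfolding tangent_space_def tc by (intro span_minimal) auto
    show "range ?D \<subseteq> tangent_space S (\<phi> u)"
    proof
      fix v assume "v \<in> range ?D"
      then obtain w where w: "v = ?D w" by blast
      show "v \<in> tangent_space S (\<phi> u)"
      proof (cases "0 \<le> w $ 1")
        case True
        then show ?thesis unfolding tangent_space_def tc w by (intro span_base) auto
      next
        case False
        then have "?D (- w) \<in> span (tangent_cone S (\<phi> u))" unfolding tc by (intro span_base) auto
        from span_neg[OF this] show ?thesis by (simp add: tangent_space_def w linear_neg[OF D(3)])
      qed
    qed
  qed
  have "tangent_cone (surface_boundary S) (\<phi> u) = ?D ` {w. w $ 1 = 0}"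
    using tangent_cone_chart[OF half_plane_boundary_chart[OF ch] u(1)] cone_dirs_line_directions[OF u(2)] u(2) by simp
  also have "\<dots> = range (\<lambda>c. c *\<^sub>R pd \<phi> 2 u)"
  proof (intro equalityI subsetI)
    fix v assume "v \<in> ?D ` {w. w $ 1 = 0}"
    then obtain w where "w $ 1 = 0" "v = ?D w" by auto
    then have "v = w $ 2 *\<^sub>R pd \<phi> 2 u" using linear_axis_expand[OF D(3), of w] by (simp add: pd_def)
    then show "v \<in> range (\<lambda>c. c *\<^sub>R pd \<phi> 2 u)" by blast
  next
    fix v assume "v \<in> range (\<lambda>c. c *\<^sub>R pd \<phi> 2 u)"
    then obtain c where "v = ?D (c *\<^sub>R axis 2 1)" by (auto simp: pd_def linear_cmul[OF D(3)])
    moreover have "(c *\<^sub>R axis 2 1 :: real^2) $ 1 = 0" by (simp add: axis_def)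
    ultimately show "v \<in> ?D ` {w. w $ 1 = 0}" by blast
  qed
  finally show "tangent_cone (surface_boundary S) (\<phi> u) = range (\<lambda>c. c *\<^sub>R pd \<phi> 2 u)" .
qed

text \<open>In the tangent plane only two unit vectors are orthogonal to the boundary curve, and the
  condition that the negative lies in the tangent cone selects one. The explicit formula makes the
  length element times the normal component of \<open>X\<close> equal to minus
  \<open>flux1\<close>.\<close>

lemma outward_conormal_chart:
  fixes \<phi> :: "real^2 \<Rightarrow> real^3"
  assumes ch: "C1_chart half_plane S W \<phi>" "smooth_on \<phi> W" and u: "u \<in> W" "u $ 1 = 0"
  shows "outward_conormal S (\<phi> u) = - (inverse (norm (pd \<phi> 2 u)) *\<^sub>R cross3 (pd \<phi> 2 u) (chart_normal \<phi> u))" (is "_ = ?\<nu>")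
    and "is_outward_conormal S (\<phi> u) (outward_conormal S (\<phi> u))"
proof -
  let ?D = "frechet_derivative \<phi> (at u)" and ?b = "pd \<phi> 2 u" and ?n = "chart_normal \<phi> u"
  let ?\<alpha> = "cross3 ?b ?n"
  note D = C1_chart_deriv[OF ch(1) u(1)] and T = half_plane_tangent[OF ch u]
  note F = cross3_normal_facts[OF ch(1) u(1)]
  have pos: "0 < area_density \<phi> u" by (rule area_density_pos[OF ch(1) u(1)])
  have nb: "norm ?b > 0" using F(2) by simp
  have bT: "v \<bullet> ?b = 0 \<Longrightarrow> \<forall>w\<in>tangent_space (surface_boundary S) (\<phi> u). v \<bullet> w = 0" for v
  proof
    fix w assume v: "v \<bullet> ?b = 0" and w: "w \<in> tangent_space (surface_boundary S) (\<phi> u)"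
    have "orthogonal v w"
    proof (rule orthogonal_to_span[OF w[unfolded tangent_space_def]])
      fix y assume "y \<in> tangent_cone (surface_boundary S) (\<phi> u)"
      then show "orthogonal v y" unfolding T(3) using v by (auto simp: orthogonal_def)
    qed
    then show "v \<bullet> w = 0" by (simp add: orthogonal_def)
  qed
  have isn: "is_outward_conormal S (\<phi> u) ?\<nu>"
    unfolding is_outward_conormal_def
  proof (intro conjI)
    obtain w where w: "?\<alpha> = ?D w" using F(4) by blast
    have "?\<nu> = ?D (- (inverse (norm ?b) *\<^sub>R w))" by (simp add: w linear_neg[OF D(3)] linear_cmul[OF D(3)])
    then show "?\<nu> \<in> tangent_space S (\<phi> u)" unfolding T(2) by blast
    show "norm ?\<nu> = 1" using F(1) nb by simp
    show "\<forall>v\<in>tangent_space (surface_boundary S) (\<phi> u). ?\<nu> \<bullet> v = 0"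
      by (rule bT) (simp add: dot_cross_self)
    have "w $ 1 * area_density \<phi> u = ?\<alpha> \<bullet> ?\<alpha>" using F(3)[of w] w by simp
    then have "0 \<le> w $ 1 * area_density \<phi> u" by simp
    then have "0 \<le> w $ 1" using pos by (simp add: zero_le_mult_iff)
    moreover have "- ?\<nu> = ?D (inverse (norm ?b) *\<^sub>R w)" by (simp add: w linear_cmul[OF D(3)])
    ultimately show "- ?\<nu> \<in> tangent_cone S (\<phi> u)" unfolding T(1) by (auto simp: zero_le_mult_iff)
  qed
  have "\<nu> = ?\<nu>" if n: "is_outward_conormal S (\<phi> u) \<nu>" for \<nu>
  proof -
    have n1: "\<nu> \<in> range ?D" "norm \<nu> = 1" "- \<nu> \<in> ?D ` {w. 0 \<le> w $ 1}"
      using n unfolding is_outward_conormal_def T by auto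
    have "?b \<in> tangent_space (surface_boundary S) (\<phi> u)"
      unfolding tangent_space_def T(3) by (intro span_base range_eqI[of _ _ 1]) simp
    then have "\<nu> \<bullet> ?b = 0" using n unfolding is_outward_conormal_def by blast
    then have nb0: "?b \<bullet> \<nu> = 0" by (simp add: inner_commute)
    obtain w where w: "- \<nu> = ?D w" "0 \<le> w $ 1" using n1(3) by auto
    have "?n \<bullet> \<nu> = 0"
    proof -
      have "?D w \<bullet> ?n = 0" unfolding linear_axis_expand[OF D(3), of w]
        using chart_normal_orthogonal[of \<phi> u] by (simp add: inner_add_left pd_def)
      then show ?thesis unfolding w(1)[symmetric] by (simp add: inner_commute)
    qed
    \<comment> \<open>Both \<open>?b\<close> and \<open>?n\<close> are orthogonal to the unit vector
      \<open>\<nu>\<close>, so their cross product is a multiple of it.\<close>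
    then have par: "?\<alpha> = (\<nu> \<bullet> ?\<alpha>) *\<^sub>R \<nu>" by (intro cross3_parallel n1(2) nb0)
    define c where "c = \<nu> \<bullet> ?\<alpha>"
    have "- c = w $ 1 * area_density \<phi> u" using F(3)[of w] w(1)[symmetric] by (simp add: c_def)
    then have c0: "c \<le> 0" using w(2) pos by (metis mult_nonneg_nonneg less_imp_le neg_0_le_iff_le)
    have al: "?\<alpha> = c *\<^sub>R \<nu>" using par by (simp add: c_def)
    then have "norm ?b = \<bar>c\<bar>" using F(1) n1(2) by simp
    then have "c = - norm ?b" using c0 by simp
    then show ?thesis using al nb by simp
  qed
  note uniq = this
  have ex: "\<exists>!\<nu>. is_outward_conormal S (\<phi> u) \<nu>" using isn uniq by (intro ex1I[of _ ?\<nu>])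
  have the: "(THE \<nu>. is_outward_conormal S (\<phi> u) \<nu>) = ?\<nu>" using isn uniq by (intro the_equality)
  show 1: "outward_conormal S (\<phi> u) = ?\<nu>" unfolding outward_conormal_def the using ex by simp
  show "is_outward_conormal S (\<phi> u) (outward_conormal S (\<phi> u))" unfolding 1 by (rule isn)
qed

text \<open>The boundary has no tangent vectors at such a point, so every unit tangent vector
  qualifies, together with its negative. Uniqueness fails and the default value 0 is taken. Interior
  points of a piece on the sphere therefore contribute no flux.\<close>

lemma outward_conormal_regular:
  assumes "p \<in> regular_points S" shows "outward_conormal S p = 0"
proof -
  obtain D :: "real^2 \<Rightarrow> real^3" where D: "linear D" "inj D" "tangent_cone S p = range D" by (rule regular_cone[OF assms])
  have "tangent_space (surface_boundary S) p = {0}"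
    using assms by (simp add: tangent_space_def tangent_cone_empty surface_boundary_def)
  moreover have "D (axis 1 1) \<noteq> 0" using D(1,2) by (metis axis_eq_0_iff injD linear_0 zero_neq_one)
  define \<nu> where "\<nu> = D (inverse (norm (D (axis 1 1))) *\<^sub>R axis 1 1)"
  have n: "norm \<nu> = 1" using \<open>D (axis 1 1) \<noteq> 0\<close> by (simp add: \<nu>_def linear_cmul[OF D(1)])
  have "\<nu> \<in> range D" "- \<nu> \<in> range D" using linear_range_neg[OF D(1)] by (auto simp: \<nu>_def)
  ultimately have "is_outward_conormal S p \<nu>" "is_outward_conormal S p (- \<nu>)"
    using n D(3) span_base[of _ "range D"] by (auto simp: is_outward_conormal_def tangent_space_def)
  moreover have "\<nu> \<noteq> - \<nu>"
  proof
    assume "\<nu> = - \<nu>"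
    then have "2 *\<^sub>R \<nu> = 0" by (metis scaleR_2 add.right_inverse)
    then show False using n by simp
  qed
  ultimately have "\<not> (\<exists>!\<nu>. is_outward_conormal S p \<nu>)" by blast
  then show ?thesis by (simp add: outward_conormal_def)
qed

lemma outward_conormal_continuous:
  "continuous_on (surface_boundary S - bad_points S) (outward_conormal S)"
  unfolding continuous_on_eq_continuous_within
proof
  fix p assume p: "p \<in> surface_boundary S - bad_points S"
  then have "boundary_point S p" by (auto simp: surface_boundary_def bad_points_def)
  then obtain W and \<phi> :: "real^2 \<Rightarrow> real^3" where ch: "C1_chart half_plane S W \<phi>" "smooth_on \<phi> W" "0 \<in> W" "\<phi> 0 = p"
    by (rule boundary_pointE)
  obtain U \<psi> where U: "open U" and 1: "\<And>u. u \<in> W \<Longrightarrow> u \<in> boundary_line \<Longrightarrow> \<phi> u \<in> surface_boundary S \<and> \<phi> u \<in> U \<and> \<psi> (\<phi> u) = u"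
    and 2: "\<And>q. q \<in> surface_boundary S \<Longrightarrow> q \<in> U \<Longrightarrow> \<psi> q \<in> W \<and> \<psi> q \<in> boundary_line \<and> \<phi> (\<psi> q) = q"
    and 3: "continuous_on (surface_boundary S \<inter> U) \<psi>"
    using C1_chartE[OF half_plane_boundary_chart[OF ch(1,2)]] by metis
  let ?h = "\<lambda>u. - (inverse (norm (pd \<phi> 2 u)) *\<^sub>R cross3 (pd \<phi> 2 u) (chart_normal \<phi> u))"
  have "continuous_on W (pd \<phi> 2)" by (rule C1_on_continuous[OF smooth_on_C1[OF smooth_on_pd[OF ch(2)]]])
  moreover have "continuous_on W (chart_normal \<phi>)" by (rule C1_on_continuous[OF chart_normal_C1[OF ch(1,2)]])
  ultimately have "continuous_on W ?h"
    using cross3_normal_facts(2)[OF ch(1)] by (intro continuous_intros continuous_on_cross) auto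
  then have c: "continuous_on (surface_boundary S \<inter> U) (\<lambda>q. ?h (\<psi> q))"
    by (rule continuous_on_compose2[OF _ 3]) (use 2 in auto)
  have "continuous_on (surface_boundary S \<inter> U) (outward_conormal S)"
  proof (rule continuous_on_eq[OF c])
    fix q assume "q \<in> surface_boundary S \<inter> U"
    then have w: "\<psi> q \<in> W" "\<psi> q $ 1 = 0" "\<phi> (\<psi> q) = q" using 2[of q] by auto
    from outward_conormal_chart(1)[OF ch(1,2) w(1,2)] show "?h (\<psi> q) = outward_conormal S q" by (simp add: w(3))
  qed
  moreover have pU: "p \<in> U" using 1[of 0] ch(3,4) by simp
  ultimately have "continuous (at p within surface_boundary S \<inter> U) (outward_conormal S)"
    using p by (auto simp: continuous_on_eq_continuous_within)
  moreover have "at p within surface_boundary S \<inter> U = at p within surface_boundary S"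
    using pU U by (intro at_within_nhd[of p U]) auto
  ultimately have "continuous (at p within surface_boundary S) (outward_conormal S)" by simp
  then show "continuous (at p within surface_boundary S - bad_points S) (outward_conormal S)"
    by (rule continuous_within_subset) auto
qed

lemma norm_outward_conormal: "norm (outward_conormal S p) \<le> 1"
proof (cases "\<exists>!\<nu>. is_outward_conormal S p \<nu>")
  case True
  have "norm \<nu> = 1" if "is_outward_conormal S p \<nu>" for \<nu>
    using that by (simp add: is_outward_conormal_def)
  from this[OF theI'[OF True]] show ?thesis using True by (simp add: outward_conormal_def)
qed (simp add: outward_conormal_def)

section \<open>The divergence theorem near a smooth point\<close>

text \<open>Both sides are pulled back to a half plane. The area integral becomes that of the
  divergence of \<open>flux1\<close>, \<open>flux2\<close>, and the length integral becomes minus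
  that of \<open>flux1\<close> along the boundary line.\<close>

lemma local_divergence:
  assumes S: "closed S" and nn: "unit_normal_field S nn" and p: "p \<in> regular_points S \<or> boundary_point S p"
  obtains r where "r > 0" "\<And>(X :: real^3 \<Rightarrow> real^3) O'. open O' \<Longrightarrow> C1_on X O' \<Longrightarrow> S \<subseteq> O' \<Longrightarrow> (\<And>x. x \<notin> ball p r \<Longrightarrow> X x = 0) \<Longrightarrow>
     surface_integral S (surface_div S (tangential_part nn X)) =
     (LINT x:surface_boundary S|arc_length_measure (surface_boundary S). X x \<bullet> outward_conormal S x)"
proof -
  obtain W and \<phi> :: "real^2 \<Rightarrow> real^3" and u where ch0: "C1_chart half_plane S W \<phi>" "smooth_on \<phi> W" and u: "u \<in> W" "u \<in> half_plane" "\<phi> u = p"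
    using smooth_half_plane_chart[OF p] .
  obtain U \<psi> where U: "open U" and 1: "\<And>u. u \<in> W \<Longrightarrow> u \<in> half_plane \<Longrightarrow> \<phi> u \<in> S \<and> \<phi> u \<in> U \<and> \<psi> (\<phi> u) = u"
    and 2: "\<And>q. q \<in> S \<Longrightarrow> q \<in> U \<Longrightarrow> \<psi> q \<in> W \<and> \<psi> q \<in> half_plane \<and> \<phi> (\<psi> q) = q"
    and 3: "continuous_on (S \<inter> U) \<psi>"
    using C1_chartE[OF ch0(1)] by metis
  have "p \<in> U" using 1 u by blast
  then obtain r where r: "r > 0" "cball p r \<subseteq> U" using U open_contains_cball by blast
  show ?thesis
  proof (rule that[OF r(1)])
    fix X :: "real^3 \<Rightarrow> real^3" and O' assume O': "open O'" and X: "C1_on X O'" "S \<subseteq> O'" and zero: "\<And>x. x \<notin> ball p r \<Longrightarrow> X x = 0"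
    \<comment> \<open>Shrinks the chart to where \<open>X\<close> after \<phi> is known to be
      C1.\<close>
    define W' where "W' = W \<inter> \<phi> -` O'"
    have oW': "open W'" unfolding W'_def
      by (rule continuous_open_preimage[OF C1_chart_continuous[OF ch0(1)] C1_chart_open[OF ch0(1)] O'])
    have ch: "C1_chart half_plane S W' \<phi>" by (rule C1_chart_restrict[OF ch0(1) oW']) (simp add: W'_def)
    have sm: "smooth_on \<phi> W'" by (rule smooth_on_subset[OF ch0(2)]) (simp add: W'_def)
    \<comment> \<open>Since \<open>S\<close> is closed and the closed ball lies inside the chart,
      the part of \<open>S\<close> in it is compact, and so is its preimage. This is the compact
      support of the field in the parameters.\<close>
    define K where "K = \<psi> ` (S \<inter> cball p r)"
    have "compact (S \<inter> cball p r)" using S by (simp add: closed_Int_compact)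
    then have cK: "compact K" unfolding K_def
      by (rule compact_continuous_image[rotated]) (rule continuous_on_subset[OF 3], use r(2) in auto)
    have KW: "K \<subseteq> W'" using 2 r(2) X(2) unfolding K_def W'_def by auto
    have X0: "X (\<phi> u) = 0" if "u \<in> W'" "0 \<le> u $ 1" "u \<notin> K" for u
    proof -
      have u: "\<phi> u \<in> S" "\<psi> (\<phi> u) = u" using 1[of u] that(1,2) by (auto simp: W'_def half_plane_def)
      have "\<phi> u \<notin> cball p r"
      proof
        assume "\<phi> u \<in> cball p r"
        then have "\<psi> (\<phi> u) \<in> K" unfolding K_def using u(1) by blast
        then show False using u(2) that(3) by simp
      qed
      then show ?thesis using zero by (auto simp: mem_ball mem_cball)
    qed
    have XC: "C1_on (\<lambda>x. X (\<phi> x)) W'"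
      by (rule C1_on_compose[OF C1_chart_C1[OF ch] X(1)]) (auto simp: W'_def)
    have C: "C1_on (chart_normal \<phi>) W'" "C1_on (pd \<phi> i) W'" for i
      using chart_normal_C1[OF ch sm] smooth_on_C1[OF smooth_on_pd[OF sm]] by auto
    have F: "C1_on (flux1 \<phi> X) W'" "C1_on (flux2 \<phi> X) W'"
      unfolding flux1_def[abs_def] flux2_def[abs_def] by (intro C1_on_inner C1_on_cross3 XC C)+
    have flat: "(LINT u:{u \<in> W'. 0 < u $ 1}|lborel. pd (flux1 \<phi> X) 1 u + pd (flux2 \<phi> X) 2 u) =
       - (LINT t:{t. t *\<^sub>R axis 2 1 \<in> W'}|lborel. flux1 \<phi> X (t *\<^sub>R axis 2 1))"
      by (rule half_plane_divergence[OF oW' F cK KW]) (simp add: flux1_def flux2_def X0)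
    let ?R = "regular_points S" and ?D = "surface_div S (tangential_part nn X)"
    let ?W1 = "{u \<in> W'. 0 < u $ 1}"
    have SB: "S \<in> sets borel" using S by simp
    have RB: "?R \<in> sets borel" using regular_points_relopen[of S] SB by (metis sets.Int borel_open)
    define f where "f = (\<lambda>x. indicator ?R x *\<^sub>R ?D x)"
    have fm: "f \<in> borel_measurable borel" unfolding f_def
      by (rule borel_measurable_continuous_on_indicator[OF RB surface_div_continuous[OF nn X]])
    have W1: "?W1 = W' \<inter> interior half_plane" by (auto simp: interior_half_plane)
    have ch1: "C1_chart UNIV S ?W1 \<phi>"
    proof -
      have "C1_chart half_plane S ?W1 \<phi>" unfolding W1 by (rule C1_chart_restrict[OF ch]) (use oW' in auto)
      moreover have "?W1 \<inter> half_plane = ?W1 \<inter> UNIV" unfolding W1 using interior_subset by blast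
      ultimately show ?thesis using C1_chart_cong[of ?W1 half_plane UNIV S \<phi>] by simp
    qed
    have sm1: "smooth_on \<phi> ?W1" by (rule smooth_on_subset[OF sm]) auto
    have f0: "f x = 0" if x: "x \<notin> \<phi> ` ?W1" for x
    proof (cases "x \<in> ?R")
      case True
      then have xS: "x \<in> S" using regular_points_subset by blast
      have "x \<notin> cball p r"
      proof
        assume "x \<in> cball p r"
        then have "x \<in> U" using r(2) by blast
        from 2[OF xS this] X(2) xS have w: "\<psi> x \<in> W'" "\<psi> x \<in> half_plane" "\<phi> (\<psi> x) = x" by (auto simp: W'_def)
        then have "0 < \<psi> x $ 1" using half_plane_chart_regular_iff[OF ch sm w(1,2)] True by simp
        then have "\<psi> x \<in> ?W1" using w(1) by simp
        then have "\<phi> (\<psi> x) \<in> \<phi> ` ?W1" by (rule imageI)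
        then show False using x w(3) by simp
      qed
      \<comment> \<open>Off the closed ball \<open>X\<close> vanishes on an open set; with value and
        derivative 0, both terms of the decomposed divergence vanish.\<close>
      have d0: "(X has_derivative (\<lambda>v. 0)) (at x)"
      proof (rule has_derivative_transform_open_at[OF has_derivative_const])
        show "open (- cball p r)" by (rule open_Compl[OF closed_cball])
        show "x \<in> - cball p r" using \<open>x \<notin> cball p r\<close> by simp
        fix y assume "y \<in> - cball p r"
        then have "y \<notin> ball p r" by simp
        from zero[OF this] show "0 = X y" ..
      qed
      have "x \<notin> ball p r" using \<open>x \<notin> cball p r\<close> by simp
      then have "X x = 0" by (rule zero)
      then have "?D x = 0"
        using surface_div_decomposition[OF True nn d0] surface_div_bound[OF True d0, of 0] by simp
      then show ?thesis by (simp add: f_def)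
    qed (simp add: f_def)
    have "surface_integral S ?D = integral\<^sup>L (area_measure S) f"
      by (simp add: surface_integral_def set_lebesgue_integral_def f_def)
    also have "\<dots> = (LINT u:?W1|lborel. area_density \<phi> u * f (\<phi> u))"
      by (rule integral_area_chart[OF SB ch1 sm1 fm f0])
    also have "\<dots> = (LINT u:?W1|lborel. pd (flux1 \<phi> X) 1 u + pd (flux2 \<phi> X) 2 u)"
    proof (rule set_lebesgue_integral_cong)
      show "?W1 \<in> sets lborel" using C1_chart_open[OF ch1] by simp
      show "\<forall>u. u \<in> ?W1 \<longrightarrow> area_density \<phi> u * f (\<phi> u) = pd (flux1 \<phi> X) 1 u + pd (flux2 \<phi> X) 2 u"
      proof (intro allI impI)
        fix u assume u: "u \<in> ?W1"
        then have "\<phi> u \<in> ?R" using regular_pointsI[OF ch1 sm1] by simp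
        then have fu: "f (\<phi> u) = ?D (\<phi> u)" and "\<phi> u \<in> O'" using regular_points_subset X(2) by (auto simp: f_def)
        have u': "u \<in> W'" "u \<in> interior half_plane" using u by (auto simp: interior_half_plane)
        show "area_density \<phi> u * f (\<phi> u) = pd (flux1 \<phi> X) 1 u + pd (flux2 \<phi> X) 2 u"
          unfolding fu by (rule surface_div_tangential(2)[OF ch sm u' nn C1_on_has_derivative[OF X(1) \<open>\<phi> u \<in> O'\<close>]])
      qed
    qed
    finally have lhs: "surface_integral S ?D = - (LINT t:{t. t *\<^sub>R axis 2 1 \<in> W'}|lborel. flux1 \<phi> X (t *\<^sub>R axis 2 1))"
      unfolding flat .
    let ?B = "surface_boundary S" and ?\<nu> = "outward_conormal S"
    have Bc: "closed ?B" by (rule surface_boundary_closed[OF S])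
    have bch: "C1_chart boundary_line ?B W' \<phi>" by (rule half_plane_boundary_chart[OF ch sm])
    note L = line_curve[OF bch]
    let ?\<gamma> = "\<lambda>t. \<phi> (t *\<^sub>R axis 2 1)" and ?V = "{t. t *\<^sub>R axis 2 (1::real) \<in> W'}"
    define g where "g = (\<lambda>x. indicator ?B x *\<^sub>R (X x \<bullet> ?\<nu> x))"
    have near: "\<psi> x \<in> W' \<inter> boundary_line \<and> \<phi> (\<psi> x) = x \<and> x \<notin> bad_points S" if x: "x \<in> ?B" "x \<in> cball p r" for x
    proof -
      have xS: "x \<in> S" "x \<notin> ?R" using x(1) by (auto simp: surface_boundary_def)
      have "x \<in> U" using x(2) r(2) by blast
      from 2[OF xS(1) this] X(2) xS have w: "\<psi> x \<in> W'" "\<psi> x \<in> half_plane" "\<phi> (\<psi> x) = x" by (auto simp: W'_def)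
      then have "\<not> 0 < \<psi> x $ 1" using half_plane_chart_regular_iff[OF ch sm w(1,2)] xS(2) by simp
      moreover have "x \<notin> bad_points S" using half_plane_chart_image[OF ch sm w(1,2)] w(3) by (simp add: bad_points_def)
      ultimately show ?thesis using w by (auto simp: half_plane_def)
    qed
    have geq: "g = (\<lambda>x. indicator (?B \<inter> cball p r) x *\<^sub>R (X x \<bullet> ?\<nu> x))"
    proof (rule ext)
      fix x show "g x = indicator (?B \<inter> cball p r) x *\<^sub>R (X x \<bullet> ?\<nu> x)"
      proof (cases "x \<in> cball p r")
        case False
        then have "X x = 0" using zero by simp
        then show ?thesis by (simp add: g_def)
      qed (simp add: g_def indicator_def)
    qed
    have gm: "g \<in> borel_measurable borel" unfolding geq
    proof (rule borel_measurable_continuous_on_indicator)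
      show "?B \<inter> cball p r \<in> sets borel" using Bc by simp
      have "continuous_on (?B \<inter> cball p r) X"
        by (rule continuous_on_subset[OF C1_on_continuous[OF X(1)]]) (use X(2) in \<open>auto simp: surface_boundary_def\<close>)
      moreover have "continuous_on (?B \<inter> cball p r) ?\<nu>"
        by (rule continuous_on_subset[OF outward_conormal_continuous]) (use near in auto)
      ultimately show "continuous_on (?B \<inter> cball p r) (\<lambda>x. X x \<bullet> ?\<nu> x)" by (intro continuous_intros)
    qed
    have g0: "g x = 0" if x: "x \<notin> ?\<gamma> ` ?V" for x
    proof -
      have "\<not> (x \<in> ?B \<and> x \<in> cball p r)"
      proof
        assume "x \<in> ?B \<and> x \<in> cball p r"
        with near[of x] have "x \<in> \<phi> ` (W' \<inter> boundary_line)" by (metis imageI)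
        then show False using x unfolding L(4) by simp
      qed
      then show ?thesis unfolding geq by (simp add: indicator_def)
    qed
    have "(LINT x:?B|arc_length_measure ?B. X x \<bullet> ?\<nu> x) = integral\<^sup>L (arc_length_measure ?B) g"
      by (simp add: set_lebesgue_integral_def g_def)
    also have "\<dots> = (LINT t:?V|lborel. norm (vector_derivative ?\<gamma> (at t)) * g (?\<gamma> t))"
      by (rule integral_arc_chart[OF borel_closed[OF Bc] L(3)[OF sm] gm g0])
    also have "\<dots> = (LINT t:?V|lborel. - flux1 \<phi> X (t *\<^sub>R axis 2 1))"
    proof (rule set_lebesgue_integral_cong)
      show "?V \<in> sets lborel" using C1_chart_open[OF L(1)] by simp
      show "\<forall>t. t \<in> ?V \<longrightarrow> norm (vector_derivative ?\<gamma> (at t)) * g (?\<gamma> t) = - flux1 \<phi> X (t *\<^sub>R axis 2 1)"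
      proof (intro allI impI)
        fix t assume t: "t \<in> ?V"
        let ?u = "t *\<^sub>R axis 2 1 :: real^2"
        have u: "?u \<in> W'" "?u $ 1 = 0" using t by (auto simp: axis_def)
        have "?\<gamma> t \<in> \<phi> ` (W' \<inter> boundary_line)" using u by auto
        then have "?\<gamma> t \<in> ?B" using C1_chart_image_openin[OF bch] by (metis IntD1)
        then have g: "g (?\<gamma> t) = X (\<phi> ?u) \<bullet> ?\<nu> (\<phi> ?u)" by (simp add: g_def)
        have "norm (pd \<phi> 2 ?u) \<noteq> 0" using cross3_normal_facts(2)[OF ch u(1)] by simp
        then show "norm (vector_derivative ?\<gamma> (at t)) * g (?\<gamma> t) = - flux1 \<phi> X ?u"
          unfolding L(2)[OF t] g outward_conormal_chart(1)[OF ch sm u] flux1_def by (simp add: field_simps)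
      qed
    qed
    also have "\<dots> = - (LINT t:?V|lborel. flux1 \<phi> X (t *\<^sub>R axis 2 1))"
      by (simp add: set_lebesgue_integral_def)
    finally show "surface_integral S ?D =
     (LINT x:?B|arc_length_measure ?B. X x \<bullet> ?\<nu> x)" using lhs by simp
  qed
qed

section \<open>Finiteness of area and length\<close>

lemma C1_compact_bound:
  fixes f :: "'a::euclidean_space \<Rightarrow> 'b::real_normed_vector"
  assumes f: "C1_on f U" and K: "compact K" "K \<subseteq> U"
  obtains C where "C \<ge> 0" "\<And>x. x \<in> K \<Longrightarrow> norm (f x) \<le> C"
    "\<And>x v. x \<in> K \<Longrightarrow> norm (frechet_derivative f (at x) v) \<le> C * norm v"
proof -
  have b: "\<exists>C. \<forall>x\<in>K. norm (g x) \<le> C" if "continuous_on U g" for g :: "'a \<Rightarrow> 'b"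
    using compact_imp_bounded[OF compact_continuous_image[OF continuous_on_subset[OF that K(2)] K(1)]]
    unfolding bounded_iff by blast
  obtain C0 where C0: "\<And>x. x \<in> K \<Longrightarrow> norm (f x) \<le> C0" using b[OF C1_on_continuous[OF f]] by blast
  obtain C1 where C1: "\<And>v x. x \<in> K \<Longrightarrow> norm (frechet_derivative f (at x) v) \<le> C1 v"
    using b[OF C1_on_continuous_deriv[OF f]] by metis
  define s1 where "s1 = (\<Sum>b\<in>(Basis::'a set). \<bar>C1 b\<bar>)"
  define C where "C = \<bar>C0\<bar> + s1"
  have s: "0 \<le> s1" unfolding s1_def by (rule sum_nonneg) simp
  show ?thesis
  proof (rule that[of C])
    show "C \<ge> 0" using s by (simp add: C_def)
    show "norm (f x) \<le> C" if "x \<in> K" for x using C0[OF that] s unfolding C_def by linarith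
    show "norm (frechet_derivative f (at x) v) \<le> C * norm v" if x: "x \<in> K" for x v
    proof -
      have "norm (frechet_derivative f (at x) v) = norm (\<Sum>b\<in>Basis. (v \<bullet> b) *\<^sub>R frechet_derivative f (at x) b)"
        using frechet_expand[OF f, of x v] x K(2) by auto
      also have "\<dots> \<le> (\<Sum>b\<in>Basis. norm v * \<bar>C1 b\<bar>)"
      proof (rule order_trans[OF norm_sum], rule sum_mono)
        fix b :: 'a assume "b \<in> Basis"
        then have "\<bar>v \<bullet> b\<bar> \<le> norm v" by (rule Basis_le_norm)
        moreover have "norm (frechet_derivative f (at x) b) \<le> \<bar>C1 b\<bar>" using C1[OF x, of b] by linarith
        ultimately show "norm ((v \<bullet> b) *\<^sub>R frechet_derivative f (at x) b) \<le> norm v * \<bar>C1 b\<bar>"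
          by (simp add: mult_mono)
      qed
      also have "\<dots> = s1 * norm v" unfolding s1_def by (simp only: sum_distrib_left mult.commute)
      also have "\<dots> \<le> C * norm v" by (rule mult_right_mono) (simp_all add: C_def)
      finally show ?thesis .
    qed
  qed
qed

section \<open>Area of small balls and finiteness of area\<close>

lemma area_near_chart_point:
  fixes \<phi> :: "real^2 \<Rightarrow> real^3"
  assumes S: "closed S" and ch: "C1_chart M S W \<phi>" and u0: "u0 \<in> W" "u0 \<in> M"
    and reg: "\<And>u. u \<in> W \<Longrightarrow> u \<in> M \<Longrightarrow> \<phi> u \<in> regular_points S \<Longrightarrow> u \<in> interior M"
  obtains C r where "C \<ge> 0" "r > 0"
    "\<And>\<epsilon>. 0 < \<epsilon> \<Longrightarrow> \<epsilon> \<le> r \<Longrightarrow> emeasure (area_measure S) (regular_points S \<inter> ball (\<phi> u0) \<epsilon>) \<le> ennreal (C * \<epsilon>\<^sup>2)"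
proof -
  note D = C1_chart_deriv[OF ch u0(1)]
  obtain c d where cd: "c > 0" "d > 0" "\<And>x. norm (x - u0) < d \<Longrightarrow> c * norm (x - u0) \<le> norm (\<phi> x - \<phi> u0)"
    using immersion_lower_bound[OF D(1,2)] by blast
  obtain U \<psi> where U: "open U" and 1: "\<And>u. u \<in> W \<Longrightarrow> u \<in> M \<Longrightarrow> \<phi> u \<in> S \<and> \<phi> u \<in> U \<and> \<psi> (\<phi> u) = u"
    and 2: "\<And>q. q \<in> S \<Longrightarrow> q \<in> U \<Longrightarrow> \<psi> q \<in> W \<and> \<psi> q \<in> M \<and> \<phi> (\<psi> q) = q"
    and 3: "continuous_on (S \<inter> U) \<psi>"
    using C1_chartE[OF ch] by metis
  have p: "\<phi> u0 \<in> S" "\<phi> u0 \<in> U" "\<psi> (\<phi> u0) = u0" using 1 u0 by auto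
  obtain d1 where d1: "d1 > 0" "cball u0 d1 \<subseteq> W" using C1_chart_open[OF ch] u0(1) open_contains_cball by blast
  define d2 where "d2 = min d d1"
  have d2: "d2 > 0" using d1 cd by (simp add: d2_def)
  obtain A where A: "\<And>u. u \<in> cball u0 d1 \<Longrightarrow> area_density \<phi> u \<le> A"
  proof -
    have "compact (area_density \<phi> ` cball u0 d1)"
      by (intro compact_continuous_image continuous_on_subset[OF area_density_continuous[OF ch] d1(2)] compact_cball)
    from compact_imp_bounded[OF this] obtain a where a: "\<forall>x\<in>area_density \<phi> ` cball u0 d1. norm x \<le> a"
      unfolding bounded_iff by blast
    show ?thesis
    proof (rule that)
      show "area_density \<phi> u \<le> a" if "u \<in> cball u0 d1" for u
        using bspec[OF a imageI[OF that]] by simp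
    qed
  qed
  obtain r1 where r1: "r1 > 0" "ball (\<phi> u0) r1 \<subseteq> U" using U p(2) open_contains_ball by blast
  obtain r2 where r2: "r2 > 0" "\<And>q. q \<in> S \<inter> U \<Longrightarrow> dist q (\<phi> u0) < r2 \<Longrightarrow> dist (\<psi> q) (\<psi> (\<phi> u0)) < d2"
    using 3 p d2 unfolding continuous_on_iff by (metis IntI)
  \<comment> \<open>A bound for the area density times the area of a disc of radius
    \<open>1 / c\<close>: by the immersion bound the part of the surface within \<epsilon> of the
    point comes from parameters within \<open>\<epsilon> / c\<close>.\<close>
  define C where "C = \<bar>A\<bar> * (unit_ball_vol (real DIM(real^2)) * (1 / c)\<^sup>2)"
  show ?thesis
  proof (rule that[of C "min r1 r2"])
    show "C \<ge> 0" by (simp add: C_def unit_ball_vol_nonneg)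
    fix \<epsilon> :: real assume e: "0 < \<epsilon>" "\<epsilon> \<le> min r1 r2"
    let ?B = "regular_points S \<inter> ball (\<phi> u0) \<epsilon>" and ?W0 = "W \<inter> interior M"
    have SB: "S \<in> sets borel" using S by simp
    obtain V where V: "open V" "regular_points S = S \<inter> V" by (rule regular_points_relopen)
    have Bb: "?B \<in> sets borel" unfolding V(2) using SB V(1) by auto
    have ch0: "C1_chart UNIV S ?W0 \<phi>"
    proof -
      have "C1_chart M S ?W0 \<phi>" by (rule C1_chart_restrict[OF ch]) (use C1_chart_open[OF ch] in auto)
      moreover have "?W0 \<inter> M = ?W0 \<inter> UNIV" using interior_subset by blast
      ultimately show ?thesis using C1_chart_cong[of ?W0 M UNIV S \<phi>] by simp
    qed
    have q: "\<psi> q \<in> ?W0 \<and> \<phi> (\<psi> q) = q \<and> \<psi> q \<in> cball u0 (\<epsilon> / c) \<and> \<psi> q \<in> cball u0 d1" if "q \<in> ?B" for q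
    proof -
      have qS: "q \<in> S" "dist q (\<phi> u0) < \<epsilon>" using that regular_points_subset by (auto simp: dist_commute)
      then have qU: "q \<in> U" using r1(2) e(2) by (auto simp: dist_commute subset_iff)
      have w: "\<psi> q \<in> W" "\<psi> q \<in> M" "\<phi> (\<psi> q) = q" using 2[OF qS(1) qU] by auto
      have n: "norm (\<psi> q - u0) < d2" using r2(2)[of q] qS qU e(2) p(3) by (simp add: dist_norm)
      then have "c * norm (\<psi> q - u0) \<le> norm (q - \<phi> u0)" using cd(3)[of "\<psi> q"] w(3) by (simp add: d2_def)
      also have "\<dots> < \<epsilon>" using qS(2) by (simp add: dist_norm)
      finally have "norm (\<psi> q - u0) < \<epsilon> / c" using cd(1) by (simp add: field_simps)
      moreover have "\<psi> q \<in> interior M" using reg[OF w(1,2)] w(3) that by simp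
      ultimately show ?thesis using w n by (simp add: dist_norm norm_minus_commute d2_def)
    qed
    have "?B \<subseteq> \<phi> ` ?W0" using q by (metis imageI subsetI)
    from emeasure_area_chart[OF SB ch0 Bb this]
    have "emeasure (area_measure S) ?B = (\<integral>\<^sup>+u\<in>?W0 \<inter> \<phi> -` ?B. ennreal (area_density \<phi> u) \<partial>lborel)" by simp
    also have "\<dots> \<le> (\<integral>\<^sup>+u. ennreal \<bar>A\<bar> * indicator (cball u0 (\<epsilon> / c)) u \<partial>lborel)"
    proof (rule nn_integral_mono)
      fix u
      show "ennreal (area_density \<phi> u) * indicator (?W0 \<inter> \<phi> -` ?B) u \<le> ennreal \<bar>A\<bar> * indicator (cball u0 (\<epsilon> / c)) u"
      proof (cases "u \<in> ?W0 \<inter> \<phi> -` ?B")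
        case True
        then have "\<psi> (\<phi> u) = u" using 1[of u] interior_subset by blast
        with q[of "\<phi> u"] True have "u \<in> cball u0 (\<epsilon> / c)" "u \<in> cball u0 d1" by auto
        then show ?thesis using A[of u] True by (auto intro!: ennreal_leI)
      qed simp
    qed
    also have "\<dots> = ennreal \<bar>A\<bar> * emeasure lborel (cball u0 (\<epsilon> / c))" by (simp add: nn_integral_cmult_indicator)
    also have "\<dots> = ennreal (\<bar>A\<bar> * (unit_ball_vol (real DIM(real^2)) * (\<epsilon> / c) ^ DIM(real^2)))"
      using e(1) cd(1) by (simp add: emeasure_cball ennreal_mult)
    also have "\<dots> = ennreal (C * \<epsilon>\<^sup>2)" by (simp add: C_def power_divide)
    finally show "emeasure (area_measure S) ?B \<le> ennreal (C * \<epsilon>\<^sup>2)" .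
  qed (use r1 r2 in simp)
qed

text \<open>The quadratic decay is needed at corners, where it beats the gradient of a cut-off. At
  the other points it only serves to bound the total area.\<close>

lemma area_near_point:
  assumes S: "closed S" "surface_with_corners S" and p: "p \<in> S"
  obtains C r where "C \<ge> 0" "r > 0"
    "\<And>\<epsilon>. 0 < \<epsilon> \<Longrightarrow> \<epsilon> \<le> r \<Longrightarrow> emeasure (area_measure S) (regular_points S \<inter> ball p \<epsilon>) \<le> ennreal (C * \<epsilon>\<^sup>2)"
proof (cases "p \<in> regular_points S \<or> boundary_point S p")
  case True
  obtain W and \<phi> :: "real^2 \<Rightarrow> real^3" and u where ch: "C1_chart half_plane S W \<phi>" "smooth_on \<phi> W" and u: "u \<in> W" "u \<in> half_plane" "\<phi> u = p"
    using smooth_half_plane_chart[OF True] .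
  show ?thesis
  proof (rule area_near_chart_point[OF S(1) ch(1) u(1,2)])
    show "x \<in> interior half_plane" if "x \<in> W" "x \<in> half_plane" "\<phi> x \<in> regular_points S" for x
      using half_plane_chart_regular_iff[OF ch that(1,2)] that(3) by (simp add: interior_half_plane)
  qed (use that u(3) in blast)
next
  case False
  then have "corner_point S p" using S p by (auto simp: surface_with_corners_def)
  then obtain W \<phi> where ch: "C1_chart quadrant S W \<phi>" "0 \<in> W" "\<phi> 0 = p"
    unfolding corner_point_def local_param_iff by blast
  have q0: "0 \<in> quadrant" by (simp add: quadrant_def)
  show ?thesis
  proof (rule area_near_chart_point[OF S(1) ch(1,2) q0])
    show "x \<in> interior quadrant" if x: "x \<in> W" "x \<in> quadrant" "\<phi> x \<in> regular_points S" for x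
    proof (cases "x = 0")
      case True
      then show ?thesis using x(3) ch(3) False by simp
    next
      case False
      have "0 < x $ 1 \<and> 0 < x $ 2" using corner_chart_other_points(2)[OF S(2) ch(1) x(1,2) False] x(3) by simp
      then show ?thesis by (intro interiorI[OF open_quadrant]) (auto simp: quadrant_def)
    qed
  qed (use that ch(3) in blast)
qed

lemma finite_measure_from_cover:
  assumes "compact S" "sets \<mu> = sets borel" "A \<in> sets borel" "A \<subseteq> S" "emeasure \<mu> (- A) = 0"
    and loc: "\<And>p. p \<in> S \<Longrightarrow> \<exists>r>0. emeasure \<mu> (A \<inter> ball p r) < \<infinity>"
  shows "finite_measure \<mu>"
proof -
  obtain r where r: "\<And>p. p \<in> S \<Longrightarrow> r p > 0 \<and> emeasure \<mu> (A \<inter> ball p (r p)) < \<infinity>" using loc by metis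
  obtain F where F: "F \<subseteq> S" "finite F" "S \<subseteq> (\<Union>p\<in>F. ball p (r p))"
  proof (rule compactE_image[OF assms(1), of S "\<lambda>p. ball p (r p)"])
    show "S \<subseteq> (\<Union>p\<in>S. ball p (r p))" using r by force
  qed auto
  have sp: "space \<mu> = UNIV" using sets_eq_imp_space_eq[OF assms(2)] by simp
  have m: "A \<inter> ball p (r p) \<in> sets \<mu>" for p using assms(2,3) by auto
  have mA: "- A \<in> sets \<mu>" unfolding assms(2) by (rule borel_comp[OF assms(3)])
  have mU: "(\<Union>p\<in>F. A \<inter> ball p (r p)) \<in> sets \<mu>" by (rule sets.finite_UN[OF F(2) m])
  have "UNIV = - A \<union> (\<Union>p\<in>F. A \<inter> ball p (r p))" using F(3) assms(4) by auto
  then have "emeasure \<mu> UNIV = emeasure \<mu> (- A \<union> (\<Union>p\<in>F. A \<inter> ball p (r p)))" by simp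
  also have "\<dots> \<le> emeasure \<mu> (- A) + emeasure \<mu> (\<Union>p\<in>F. A \<inter> ball p (r p))"
    by (rule emeasure_subadditive[OF mA mU])
  also have "\<dots> = emeasure \<mu> (\<Union>p\<in>F. A \<inter> ball p (r p))" by (simp only: assms(5) add_0)
  also have "\<dots> \<le> (\<Sum>p\<in>F. emeasure \<mu> (A \<inter> ball p (r p)))"
    by (rule emeasure_subadditive_finite[OF F(2)]) (rule image_subsetI, rule m)
  also have "\<dots> < \<infinity>"
    unfolding infinity_ennreal_def ennreal_sum_less_top[OF F(2)] using r F(1) by auto
  finally show ?thesis by (intro finite_measureI) (simp add: sp)
qed

lemma finite_area_measure:
  assumes "compact S" "surface_with_corners S"
  shows "finite_measure (area_measure S)"
proof (rule finite_measure_from_cover[OF assms(1)])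
  have S: "S \<in> sets borel" using compact_imp_closed[OF assms(1)] by simp
  show "sets (area_measure S) = sets borel" by (rule sets_area_measure[OF S])
  obtain V where V: "open V" "regular_points S = S \<inter> V" by (rule regular_points_relopen)
  show "regular_points S \<in> sets borel" unfolding V(2) using S V(1) by auto
  show "regular_points S \<subseteq> S" by (rule regular_points_subset)
  show "emeasure (area_measure S) (- regular_points S) = 0" by (rule area_measure_null[OF S])
  fix p assume "p \<in> S"
  then obtain C r where "r > 0"
    "\<And>\<epsilon>. 0 < \<epsilon> \<Longrightarrow> \<epsilon> \<le> r \<Longrightarrow> emeasure (area_measure S) (regular_points S \<inter> ball p \<epsilon>) \<le> ennreal (C * \<epsilon>\<^sup>2)"
    using area_near_point[OF compact_imp_closed[OF assms(1)] assms(2)] by metis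
  then have "emeasure (area_measure S) (regular_points S \<inter> ball p r) \<le> ennreal (C * r\<^sup>2)" by simp
  also have "\<dots> < \<infinity>" by simp
  finally show "\<exists>r>0. emeasure (area_measure S) (regular_points S \<inter> ball p r) < \<infinity>" using \<open>r > 0\<close> by blast
qed

section \<open>Finiteness of boundary length\<close>

lemma curve_points_subset: "curve_points C \<subseteq> C"
proof
  fix p assume "p \<in> curve_points C"
  then obtain W \<gamma> where g: "curve_param C W \<gamma>" "p \<in> \<gamma> ` W" by (auto simp: curve_points_def)
  obtain U where "\<gamma> ` (W \<inter> UNIV) = C \<inter> U" using C1_chart_image_openin[OF curve_param_C1_chart[OF g(1)]] by metis
  then show "p \<in> C" using g(2) by auto
qed

lemma curve_points_borel:
  assumes "C \<in> sets borel" shows "curve_points C \<in> sets borel"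
proof -
  let ?\<U> = "{U. open U \<and> C \<inter> U \<subseteq> curve_points C}"
  have eq: "curve_points C = C \<inter> \<Union>?\<U>"
  proof (intro equalityI subsetI)
    fix p assume p: "p \<in> curve_points C"
    then obtain W \<gamma> where g: "curve_param C W \<gamma>" "p \<in> \<gamma> ` W" by (auto simp: curve_points_def)
    obtain U where U: "open U" "\<gamma> ` (W \<inter> UNIV) = C \<inter> U" using C1_chart_image_openin[OF curve_param_C1_chart[OF g(1)]] .
    have "C \<inter> U \<subseteq> curve_points C"
    proof
      fix x assume "x \<in> C \<inter> U"
      then have "x \<in> \<gamma> ` W" using U(2) by simp
      then show "x \<in> curve_points C" using g(1) unfolding curve_points_def by blast
    qed
    moreover have "p \<in> U" using g(2) U(2) by auto
    ultimately show "p \<in> C \<inter> \<Union>?\<U>" using U(1) p curve_points_subset by blast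
  qed auto
  have "open (\<Union>?\<U>)" by auto
  with eq obtain U where "open U" "curve_points C = C \<inter> U" by blast
  then show ?thesis using assms by simp
qed

lemma arc_length_bound:
  fixes \<gamma> :: "real \<Rightarrow> real^3"
  assumes C: "C \<in> sets borel" and ch: "C1_chart UNIV C W \<gamma>" and B: "B \<in> sets borel" "B \<subseteq> \<gamma> ` W" "B \<subseteq> curve_points C"
    and bd: "\<And>t. t \<in> W \<Longrightarrow> \<gamma> t \<in> B \<Longrightarrow> \<bar>t\<bar> \<le> a \<and> norm (vector_derivative \<gamma> (at t)) \<le> D"
  shows "emeasure (arc_length_measure C) B < \<infinity>"
proof -
  have "emeasure (arc_length_measure C) B = (\<integral>\<^sup>+t\<in>W \<inter> \<gamma> -` B. ennreal (norm (vector_derivative \<gamma> (at t))) \<partial>lborel)"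
    by (rule emeasure_arc_chart[OF C ch B])
  also have "\<dots> \<le> (\<integral>\<^sup>+t. ennreal \<bar>D\<bar> * indicator {-\<bar>a\<bar>..\<bar>a\<bar>} t \<partial>lborel)"
  proof (rule nn_integral_mono)
    fix t
    show "ennreal (norm (vector_derivative \<gamma> (at t))) * indicator (W \<inter> \<gamma> -` B) t \<le> ennreal \<bar>D\<bar> * indicator {-\<bar>a\<bar>..\<bar>a\<bar>} t"
    proof (cases "t \<in> W \<inter> \<gamma> -` B")
      case True
      then have "\<bar>t\<bar> \<le> a" "norm (vector_derivative \<gamma> (at t)) \<le> D" using bd by auto
      then have "t \<in> {-\<bar>a\<bar>..\<bar>a\<bar>}" "norm (vector_derivative \<gamma> (at t)) \<le> \<bar>D\<bar>" by auto
      then show ?thesis using True by (simp add: ennreal_leI)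
    qed simp
  qed
  also have "\<dots> = ennreal \<bar>D\<bar> * emeasure lborel {-\<bar>a\<bar>..\<bar>a\<bar>}" by (simp add: nn_integral_cmult_indicator)
  also have "\<dots> < \<infinity>" by (simp add: ennreal_mult_less_top)
  finally show ?thesis .
qed

text \<open>A curve point has a single parameter, a null set of the line; all other points are null
  by the specification of the measure.\<close>

lemma arc_length_singleton:
  assumes C: "C \<in> sets borel" shows "emeasure (arc_length_measure C) {q} = 0"
proof (cases "q \<in> curve_points C")
  case False
  have "emeasure (arc_length_measure C) {q} \<le> emeasure (arc_length_measure C) (- curve_points C)"
    by (rule emeasure_mono) (use False curve_points_borel[OF C] sets_arc_length_measure[OF C] in auto)
  then show ?thesis using arc_length_measure_null[OF C] by simp
next
  case True
  then obtain W \<gamma> where g: "curve_param C W \<gamma>" "q \<in> \<gamma> ` W" by (auto simp: curve_points_def)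
  note ch = curve_param_C1_chart[OF g(1)]
  obtain t where t: "t \<in> W" "\<gamma> t = q" using g(2) by auto
  have pre: "W \<inter> \<gamma> -` {q} = {t}" using C1_chart_inj[OF ch] t by (auto dest: inj_onD)
  have "emeasure (arc_length_measure C) {q} = (\<integral>\<^sup>+t\<in>W \<inter> \<gamma> -` {q}. ennreal (norm (vector_derivative \<gamma> (at t))) \<partial>lborel)"
    by (rule emeasure_arc_chart[OF C ch]) (use g(2) True in auto)
  also have "\<dots> = 0" unfolding pre by simp
  finally show ?thesis .
qed

text \<open>Each open leg of the quadrant parametrizes a boundary arc. The vertex is left out since
  the two legs meet there at an angle; as a point it carries no length.\<close>

lemma corner_chart_edge:
  fixes i j :: 2
  assumes S: "surface_with_corners S" and ch: "C1_chart quadrant S W \<phi>" and ij: "i \<noteq> j"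
  defines "W1 \<equiv> {t. 0 < t \<and> t *\<^sub>R axis i 1 \<in> W}" and "\<gamma> \<equiv> \<lambda>t. \<phi> (t *\<^sub>R axis i 1)"
  shows "C1_chart UNIV (surface_boundary S) W1 \<gamma>"
    "\<And>t. t \<in> W1 \<Longrightarrow> vector_derivative \<gamma> (at t) = pd \<phi> i (t *\<^sub>R axis i 1)"
proof -
  let ?B = "surface_boundary S"
  have lin: "bounded_linear (\<lambda>t. t *\<^sub>R axis i (1::real) :: real^2)" by (rule bounded_linear_scaleR_left)
  have W1: "W1 = {0<..} \<inter> ((\<lambda>t. 0 + t *\<^sub>R axis i 1) -` W)" by (auto simp: W1_def)
  have oW1: "open W1" unfolding W1 by (intro open_Int open_greaterThan open_vimage C1_chart_open[OF ch] continuous_intros)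
  have C1': "C1_on (\<lambda>t. \<phi> (0 + t *\<^sub>R axis i 1)) ((\<lambda>t. 0 + t *\<^sub>R axis i 1) -` W)" unfolding C1_on_def
    by (rule Ck_on_affine[OF lin C1_chart_open[OF ch]]) (use C1_chart_C1[OF ch] in \<open>simp add: C1_on_def\<close>)
  have C1: "C1_on \<gamma> W1" using C1_on_subset[OF C1', of W1] by (auto simp: W1_def \<gamma>_def)
  have d: "(\<gamma> has_derivative (\<lambda>h. h *\<^sub>R pd \<phi> i (t *\<^sub>R axis i 1))) (at t)" if "t \<in> W1" for t
  proof -
    have tW: "t *\<^sub>R axis i 1 \<in> W" using that by (simp add: W1_def)
    note D = C1_chart_deriv[OF ch tW]
    have "((\<lambda>t. t *\<^sub>R axis i 1) has_derivative (\<lambda>h. h *\<^sub>R axis i 1)) (at t)"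
      by (auto intro!: derivative_eq_intros)
    from has_derivative_compose[OF this D(1)] show ?thesis
      by (simp add: \<gamma>_def pd_def linear_cmul[OF D(3)])
  qed
  show "vector_derivative \<gamma> (at t) = pd \<phi> i (t *\<^sub>R axis i 1)" if "t \<in> W1" for t
    using d[OF that] vector_derivative_at unfolding has_vector_derivative_def by blast
  have inj: "inj (frechet_derivative \<gamma> (at t))" if "t \<in> W1" for t
  proof -
    have tW: "t *\<^sub>R axis i 1 \<in> W" using that by (simp add: W1_def)
    note D = C1_chart_deriv[OF ch tW]
    have "pd \<phi> i (t *\<^sub>R axis i 1) \<noteq> 0" unfolding pd_def using D(2,3) by (metis axis_eq_0_iff injD linear_0 zero_neq_one)
    then show ?thesis unfolding frechet_derivative_at[OF d[OF that], symmetric] by (auto intro: injI)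
  qed
  obtain U \<psi> where U: "open U" and 1: "\<And>u. u \<in> W \<Longrightarrow> u \<in> quadrant \<Longrightarrow> \<phi> u \<in> S \<and> \<phi> u \<in> U \<and> \<psi> (\<phi> u) = u"
    and 2: "\<And>q. q \<in> S \<Longrightarrow> q \<in> U \<Longrightarrow> \<psi> q \<in> W \<and> \<psi> q \<in> quadrant \<and> \<phi> (\<psi> q) = q"
    and 3: "continuous_on (S \<inter> U) \<psi>"
    using C1_chartE[OF ch] by metis
  have "open {x :: real^2. 0 < x $ i}" by (intro open_Collect_less continuous_intros)
  \<comment> \<open>\<open>T\<close> restricts to points with positive coordinate \<open>i\<close>,
    which removes the vertex and the other leg, so that a single arc remains.\<close>
  then obtain T where T: "open T" "T \<inter> (S \<inter> U) = \<psi> -` {x. 0 < x $ i} \<inter> (S \<inter> U)"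
    using 3 unfolding continuous_on_open_invariant by blast
  have c: "(t *\<^sub>R axis i 1 :: real^2) $ i = t" "(t *\<^sub>R axis i 1 :: real^2) $ j = 0" for t using ij by (simp_all add: axis_def)
  have ij12: "i = 1 \<and> j = 2 \<or> i = 2 \<and> j = 1" using ij exhaust_2[of i] exhaust_2[of j] by auto
  show "C1_chart UNIV ?B W1 \<gamma>"
  proof (rule C1_chartI[OF oW1 C1 inj open_Int[OF U T(1)]])
    show "\<gamma> t \<in> ?B \<and> \<gamma> t \<in> U \<inter> T \<and> \<psi> (\<gamma> t) $ i = t" if t: "t \<in> W1" for t
    proof -
      let ?u = "t *\<^sub>R axis i 1 :: real^2"
      have "?u \<noteq> 0"
      proof
        assume "?u = 0"
        then have "t = 0" using c(1)[of t] by simp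
        then show False using t by (simp add: W1_def)
      qed
      then have u: "?u \<in> W" "?u \<in> quadrant" "?u \<noteq> 0" using t by (auto simp: W1_def quadrant_def axis_def)
      have "\<phi> ?u \<notin> regular_points S" using corner_chart_other_points(2)[OF S ch u] c[of t] ij12 by auto
      moreover have g: "\<gamma> t \<in> S" "\<gamma> t \<in> U" "\<psi> (\<gamma> t) = ?u" using 1[OF u(1,2)] by (auto simp: \<gamma>_def)
      moreover have "\<gamma> t \<in> T"
      proof -
        have "\<gamma> t \<in> \<psi> -` {x. 0 < x $ i} \<inter> (S \<inter> U)" using g t c(1)[of t] by (simp add: W1_def)
        then show ?thesis unfolding T(2)[symmetric] by simp
      qed
      ultimately show ?thesis using c(1)[of t] by (simp add: surface_boundary_def \<gamma>_def)
    qed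
    show "\<psi> q $ i \<in> W1 \<and> \<psi> q $ i \<in> UNIV \<and> \<gamma> (\<psi> q $ i) = q" if q: "q \<in> ?B" "q \<in> U \<inter> T" for q
    proof -
      have qS: "q \<in> S" "q \<notin> regular_points S" using q(1) by (auto simp: surface_boundary_def)
      have w: "\<psi> q \<in> W" "\<psi> q \<in> quadrant" "\<phi> (\<psi> q) = q" using 2[OF qS(1)] q(2) by auto
      have "q \<in> T \<inter> (S \<inter> U)" using q(2) qS(1) by simp
      then have pos: "0 < \<psi> q $ i" unfolding T(2) by simp
      then have "\<psi> q \<noteq> 0" by auto
      from corner_chart_other_points(2)[OF S ch w(1,2) this] have "\<psi> q $ j = 0"
        using w(2,3) qS(2) pos ij12 by (auto simp: quadrant_def)
      then have "(\<psi> q $ i) *\<^sub>R axis i 1 = \<psi> q"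
        using ij12 c by (auto simp: vec_eq_iff forall_2)
      then show ?thesis using w pos by (simp add: W1_def \<gamma>_def)
    qed
    show "continuous_on (?B \<inter> (U \<inter> T)) (\<lambda>q. \<psi> q $ i)"
      by (intro continuous_intros continuous_on_subset[OF 3]) (auto simp: surface_boundary_def)
  qed
qed

text \<open>Near every point the boundary lies on at most two C1 arcs and one point, with bounded
  parameters and bounded speed; compactness of \<open>S\<close> leaves finitely many
  neighbourhoods.\<close>

lemma finite_arc_length_measure:
  assumes "compact S" "surface_with_corners S"
  shows "finite_measure (arc_length_measure (surface_boundary S))"
proof (rule finite_measure_from_cover[OF assms(1)])
  let ?B = "surface_boundary S"
  have S: "closed S" using compact_imp_closed[OF assms(1)] by simp
  have B: "?B \<in> sets borel" using surface_boundary_closed[OF S] by simp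
  show "sets (arc_length_measure ?B) = sets borel" by (rule sets_arc_length_measure[OF B])
  show cb: "curve_points ?B \<in> sets borel" by (rule curve_points_borel[OF B])
  show "curve_points ?B \<subseteq> S" using curve_points_subset by (auto simp: surface_boundary_def)
  show "emeasure (arc_length_measure ?B) (- curve_points ?B) = 0" by (rule arc_length_measure_null[OF B])
  fix p assume p: "p \<in> S"
  obtain M W and \<phi> :: "real^2 \<Rightarrow> real^3" and u0 where M: "M = half_plane \<and> smooth_on \<phi> W \<or> M = quadrant \<and> u0 = 0" and ch: "C1_chart M S W \<phi>" and u0: "u0 \<in> W" "u0 \<in> M" "\<phi> u0 = p"
  proof (cases "p \<in> regular_points S \<or> boundary_point S p")
    case True
    from smooth_half_plane_chart[OF this] show ?thesis using that by metis
  next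
    case False
    then have "corner_point S p" using assms(2) p by (auto simp: surface_with_corners_def)
    then show ?thesis using that[of quadrant _ _ 0] unfolding corner_point_def local_param_iff by (auto simp: quadrant_def)
  qed
  obtain U \<psi> where U: "open U" and 1: "\<And>u. u \<in> W \<Longrightarrow> u \<in> M \<Longrightarrow> \<phi> u \<in> S \<and> \<phi> u \<in> U \<and> \<psi> (\<phi> u) = u"
    and 2: "\<And>q. q \<in> S \<Longrightarrow> q \<in> U \<Longrightarrow> \<psi> q \<in> W \<and> \<psi> q \<in> M \<and> \<phi> (\<psi> q) = q"
    and 3: "continuous_on (S \<inter> U) \<psi>"
    using C1_chartE[OF ch] by metis
  have pp: "p \<in> S" "p \<in> U" "\<psi> p = u0" using 1[OF u0(1,2)] u0(3) by auto
  obtain d where d: "d > 0" "cball u0 d \<subseteq> W" using C1_chart_open[OF ch] u0(1) open_contains_cball by blast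
  obtain r1 where r1: "r1 > 0" "ball p r1 \<subseteq> U" using U pp(2) open_contains_ball by blast
  obtain r2 where r2: "r2 > 0" "\<And>q. q \<in> S \<inter> U \<Longrightarrow> dist q p < r2 \<Longrightarrow> dist (\<psi> q) (\<psi> p) < d"
    using 3 pp d unfolding continuous_on_iff by (metis IntI)
  define r where "r = min r1 r2"
  let ?A = "curve_points ?B \<inter> ball p r"
  have q: "\<psi> q \<in> W \<and> \<psi> q \<in> M \<and> \<phi> (\<psi> q) = q \<and> \<psi> q \<in> cball u0 d \<and> q \<notin> regular_points S" if "q \<in> ?A" for q
  proof -
    have qB: "q \<in> ?B" "dist q p < r" using that curve_points_subset by (auto simp: dist_commute)
    then have "q \<in> S" "q \<in> U" "q \<notin> regular_points S" using r1(2) by (auto simp: surface_boundary_def r_def dist_commute subset_iff)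
    then show ?thesis using 2[of q] r2(2)[of q] qB(2) pp(3) by (auto simp: r_def dist_commute)
  qed
  obtain C where C: "\<And>x v. x \<in> cball u0 d \<Longrightarrow> norm (frechet_derivative \<phi> (at x) v) \<le> C * norm v"
    using C1_compact_bound[OF C1_chart_C1[OF ch] compact_cball d(2)] by metis
  have pdC: "norm (pd \<phi> i x) \<le> C" if "x \<in> cball u0 d" for x i
    using C[OF that, of "axis i 1"] by (simp add: pd_def norm_axis_1)
  have bd: "\<bar>t\<bar> \<le> norm u0 + d" if "t *\<^sub>R axis i 1 \<in> cball u0 d" for t and i :: 2
  proof -
    have "\<bar>t\<bar> = norm (t *\<^sub>R axis i 1 :: real^2)" by (simp add: norm_axis_1)
    also have "\<dots> \<le> norm u0 + norm (t *\<^sub>R axis i 1 - u0)" using norm_triangle_ineq[of u0 "t *\<^sub>R axis i 1 - u0"] by simp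
    finally show ?thesis using that by (simp add: dist_norm norm_minus_commute)
  qed
  have Ab: "?A \<in> sets borel" using cb by auto
  have "emeasure (arc_length_measure ?B) ?A < \<infinity>"
    using M
  proof
    assume m: "M = half_plane \<and> smooth_on \<phi> W"
    then have chh: "C1_chart half_plane S W \<phi>" "smooth_on \<phi> W" using ch by auto
    note L = line_curve[OF half_plane_boundary_chart[OF chh]]
    have line: "\<psi> q = (\<psi> q $ 2) *\<^sub>R axis 2 1" if "q \<in> ?A" for q
    proof -
      have w: "\<psi> q \<in> W" "\<psi> q \<in> half_plane" "\<phi> (\<psi> q) = q" "q \<notin> regular_points S" using q[OF that] m by auto
      then have "\<psi> q $ 1 = 0" using half_plane_chart_regular_iff[OF chh w(1,2)] by (auto simp: half_plane_def)
      then show ?thesis using vec2_expand[of "\<psi> q"] by simp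
    qed
    show ?thesis
    proof (rule arc_length_bound[OF B L(1) Ab])
      show "?A \<subseteq> (\<lambda>t. \<phi> (t *\<^sub>R axis 2 1)) ` {t. t *\<^sub>R axis 2 1 \<in> W}"
      proof
        fix x assume x: "x \<in> ?A"
        show "x \<in> (\<lambda>t. \<phi> (t *\<^sub>R axis 2 1)) ` {t. t *\<^sub>R axis 2 1 \<in> W}"
          using q[OF x] line[OF x] by (intro image_eqI[of _ _ "\<psi> x $ 2"]) auto
      qed
      fix t assume t: "t \<in> {t. t *\<^sub>R axis 2 1 \<in> W}" "\<phi> (t *\<^sub>R axis 2 1) \<in> ?A"
      have "(t *\<^sub>R axis 2 1 :: real^2) \<in> half_plane" by (simp add: half_plane_def axis_def)
      then have "\<psi> (\<phi> (t *\<^sub>R axis 2 1)) = t *\<^sub>R axis 2 1" using 1 t(1) m by blast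
      then have "t *\<^sub>R axis 2 1 \<in> cball u0 d" using q[OF t(2)] by simp
      then show "\<bar>t\<bar> \<le> norm u0 + d \<and> norm (vector_derivative (\<lambda>t. \<phi> (t *\<^sub>R axis 2 1)) (at t)) \<le> C"
        using bd pdC L(2)[OF t(1)] by simp
    qed auto
  next
    assume m: "M = quadrant \<and> u0 = 0"
    then have chq: "C1_chart quadrant S W \<phi>" using ch by auto
    let ?V = "\<lambda>i::2. {t. 0 < t \<and> t *\<^sub>R axis i 1 \<in> W}" and ?g = "\<lambda>(i::2) t. \<phi> (t *\<^sub>R axis i 1)"
    have im: "?g i ` ?V i \<in> sets borel" if "i \<noteq> j" for i j
      by (rule C1_chart_image_borel[OF corner_chart_edge(1)[OF assms(2) chq that] B])
    have fin: "emeasure (arc_length_measure ?B) (?A \<inter> ?g i ` ?V i) < \<infinity>" if ij: "i \<noteq> j" for i j :: 2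
    proof (rule arc_length_bound[OF B corner_chart_edge(1)[OF assms(2) chq ij]])
      fix t assume t: "t \<in> ?V i" "?g i t \<in> ?A \<inter> ?g i ` ?V i"
      have "(t *\<^sub>R axis i 1 :: real^2) \<in> quadrant" using t(1) by (simp add: quadrant_def axis_def)
      then have "\<psi> (?g i t) = t *\<^sub>R axis i 1" using 1 t(1) m by blast
      then have "t *\<^sub>R axis i 1 \<in> cball u0 d" using q[of "?g i t"] t(2) by simp
      then show "\<bar>t\<bar> \<le> norm u0 + d \<and> norm (vector_derivative (?g i) (at t)) \<le> C"
        using bd pdC corner_chart_edge(2)[OF assms(2) chq ij t(1)] by simp
    qed (use Ab im[OF ij] in auto)
    \<comment> \<open>The boundary near a corner is the corner itself and the two legs.\<close>
    have sub: "?A \<subseteq> {p} \<union> ((?A \<inter> ?g 1 ` ?V 1) \<union> (?A \<inter> ?g 2 ` ?V 2))"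
    proof
      fix x assume x: "x \<in> ?A"
      have w: "\<psi> x \<in> W" "\<psi> x \<in> quadrant" "\<phi> (\<psi> x) = x" "x \<notin> regular_points S" using q[OF x] m by auto
      show "x \<in> {p} \<union> ((?A \<inter> ?g 1 ` ?V 1) \<union> (?A \<inter> ?g 2 ` ?V 2))"
      proof (cases "\<psi> x = 0")
        case True
        then show ?thesis using w(3) u0(3) m by simp
      next
        case False
        have "\<not> (0 < \<psi> x $ 1 \<and> 0 < \<psi> x $ 2)" using corner_chart_other_points(2)[OF assms(2) chq w(1,2) False] w(3,4) by simp
        then have "(0 < \<psi> x $ 1 \<and> \<psi> x $ 2 = 0) \<or> (0 < \<psi> x $ 2 \<and> \<psi> x $ 1 = 0)"
          using w(2) False by (auto simp: quadrant_def vec_eq_iff forall_2)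
        then show ?thesis
        proof
          assume a: "0 < \<psi> x $ 1 \<and> \<psi> x $ 2 = 0"
          then have "\<psi> x = (\<psi> x $ 1) *\<^sub>R axis 1 1" using vec2_expand[of "\<psi> x"] by simp
          then have "x \<in> ?g 1 ` ?V 1" using w a by (intro image_eqI[of _ _ "\<psi> x $ 1"]) auto
          then show ?thesis using x by blast
        next
          assume a: "0 < \<psi> x $ 2 \<and> \<psi> x $ 1 = 0"
          then have "\<psi> x = (\<psi> x $ 2) *\<^sub>R axis 2 1" using vec2_expand[of "\<psi> x"] by simp
          then have "x \<in> ?g 2 ` ?V 2" using w a by (intro image_eqI[of _ _ "\<psi> x $ 2"]) auto
          then show ?thesis using x by blast
        qed
      qed
    qed
    note sA = sets_arc_length_measure[OF B]
    have s1: "?A \<inter> ?g 1 ` ?V 1 \<in> sets (arc_length_measure ?B)" "?A \<inter> ?g 2 ` ?V 2 \<in> sets (arc_length_measure ?B)"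
      using im[of 1 2] im[of 2 1] Ab sA by auto
    have "emeasure (arc_length_measure ?B) ?A \<le> emeasure (arc_length_measure ?B) ({p} \<union> ((?A \<inter> ?g 1 ` ?V 1) \<union> (?A \<inter> ?g 2 ` ?V 2)))"
      by (rule emeasure_mono[OF sub]) (use s1 sA in auto)
    also have "\<dots> \<le> emeasure (arc_length_measure ?B) {p} + (emeasure (arc_length_measure ?B) (?A \<inter> ?g 1 ` ?V 1) + emeasure (arc_length_measure ?B) (?A \<inter> ?g 2 ` ?V 2))"
      by (rule order_trans[OF emeasure_subadditive add_left_mono[OF emeasure_subadditive]]) (use s1 sA in auto)
    also have "\<dots> < \<infinity>" using fin[of 1 2] fin[of 2 1] by (simp add: arc_length_singleton[OF B] less_top)
    finally show ?thesis .
  qed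
  then show "\<exists>r>0. emeasure (arc_length_measure ?B) (curve_points ?B \<inter> ball p r) < \<infinity>"
    using r1 r2 by (intro exI[of _ r]) (simp add: r_def)
qed

section \<open>Cut-off functions\<close>

text \<open>The divergence theorem only needs test functions of class C1, so the square of the positive part
can replace the usual smooth cut-offs.\<close>

definition sq_pos :: "real \<Rightarrow> real" where
  "sq_pos t = (max 0 t)\<^sup>2"

lemma sq_pos_C1: "C1_on sq_pos UNIV"
proof (rule C1_onI)
  fix x :: real
  have "(sq_pos has_real_derivative 2 * max 0 x) (at x)"
  proof -
    consider "x > 0" | "x < 0" | "x = 0" by linarith
    then show ?thesis
    proof cases
      case 1
      have "((\<lambda>t. t\<^sup>2) has_real_derivative 2 * x) (at x)" by (auto intro!: derivative_eq_intros)
      then have "(sq_pos has_real_derivative 2 * x) (at x)"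
        by (rule has_field_derivative_transform_within_open[OF _ open_greaterThan[of 0]]) (use 1 in \<open>auto simp: sq_pos_def max_def\<close>)
      then show ?thesis using 1 by (simp add: max_def)
    next
      case 2
      have "((\<lambda>t::real. 0::real) has_real_derivative 0) (at x)" by simp
      then have "(sq_pos has_real_derivative 0) (at x)"
        by (rule has_field_derivative_transform_within_open[OF _ open_lessThan[of 0]]) (use 2 in \<open>auto simp: sq_pos_def max_def\<close>)
      then show ?thesis using 2 by (simp add: max_def)
    next
      case 3
      have "((\<lambda>h. max 0 h) \<longlongrightarrow> max 0 (0::real)) (at 0)" by (intro tendsto_intros)
      moreover have "(sq_pos (0 + h) - sq_pos 0) / h = max 0 h" for h
        by (auto simp: sq_pos_def max_def power2_eq_square)
      ultimately show ?thesis unfolding 3 by (simp add: DERIV_def)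
    qed
  qed
  then show "(sq_pos has_derivative (\<lambda>v. 2 * max 0 x * v)) (at x)" by (simp add: has_field_derivative_def)
next
  show "continuous_on UNIV (\<lambda>x::real. 2 * max 0 x * v)" for v by (intro continuous_intros)
qed

lemma sq_pos_nonneg: "0 \<le> sq_pos t" and sq_pos_pos: "0 < t \<Longrightarrow> 0 < sq_pos t" and sq_pos_zero: "t \<le> 0 \<Longrightarrow> sq_pos t = 0"
  by (auto simp: sq_pos_def)

section \<open>Bumps for partitions of unity and plateaus for cut-offs\<close>

definition bump :: "real^3 \<Rightarrow> real \<Rightarrow> real^3 \<Rightarrow> real" where
  "bump p r x = sq_pos (r\<^sup>2 - (x - p) \<bullet> (x - p))"

lemma C1_on_sq_dist: "C1_on (\<lambda>x. c - (x - p) \<bullet> (x - p)) U"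
proof -
  have D: "C1_on (\<lambda>x. x - p) U" by (intro C1_on_diff C1_on_const C1_on_linear bounded_linear_ident)
  show ?thesis by (rule C1_on_diff[OF C1_on_const C1_on_inner[OF D D]])
qed

lemma bump_C1: "C1_on (bump p r) U"
  unfolding bump_def[abs_def] by (rule C1_on_compose[OF C1_on_sq_dist sq_pos_C1]) simp

lemma bump_nonneg: "0 \<le> bump p r x"
  by (simp add: bump_def sq_pos_nonneg)

lemma bump_pos:
  assumes "x \<in> ball p r" shows "0 < bump p r x"
proof -
  have "norm (x - p) < r" using assms by (simp add: dist_norm norm_minus_commute)
  then have "(norm (x - p))\<^sup>2 < r\<^sup>2" by (intro power_strict_mono) simp_all
  then show ?thesis unfolding bump_def dot_square_norm by (intro sq_pos_pos) simp
qed

lemma bump_zero: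
  assumes "0 \<le> r" "x \<notin> ball p r" shows "bump p r x = 0"
proof -
  have "r \<le> norm (x - p)" using assms(2) by (simp add: dist_norm norm_minus_commute)
  then have "r\<^sup>2 \<le> (norm (x - p))\<^sup>2" by (intro power_mono assms(1))
  then show ?thesis unfolding bump_def dot_square_norm by (intro sq_pos_zero) simp
qed

text \<open>Equals 1 on the ball of radius 1/2 and 0 outside the unit ball. The denominator never
  vanishes because the conditions \<open>y \<bullet> y < 1\<close> and
  \<open>y \<bullet> y > 1 / 2\<close> cover all cases.\<close>

definition plateau :: "real^3 \<Rightarrow> real" where
  "plateau y = sq_pos (1 - y \<bullet> y) * inverse (sq_pos (1 - y \<bullet> y) + sq_pos (y \<bullet> y - 1 / 2))"

lemma plateau_denominator: "0 < sq_pos (1 - y \<bullet> y) + sq_pos (y \<bullet> y - 1 / 2)"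
proof (cases "y \<bullet> y < 1")
  case True
  then show ?thesis using sq_pos_pos[of "1 - y \<bullet> y"] sq_pos_nonneg[of "y \<bullet> y - 1 / 2"] by linarith
next
  case False
  then show ?thesis using sq_pos_pos[of "y \<bullet> y - 1 / 2"] sq_pos_nonneg[of "1 - y \<bullet> y"] by linarith
qed

lemma plateau_C1: "C1_on plateau UNIV"
proof -
  have 1: "C1_on (\<lambda>y::real^3. y \<bullet> y) UNIV" by (intro C1_on_inner C1_on_linear bounded_linear_ident)
  have 2: "C1_on (\<lambda>y::real^3. sq_pos (1 - y \<bullet> y)) UNIV"
    by (rule C1_on_compose[OF C1_on_diff[OF C1_on_const 1] sq_pos_C1]) simp
  have 3: "C1_on (\<lambda>y::real^3. sq_pos (y \<bullet> y - 1 / 2)) UNIV"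
    by (rule C1_on_compose[OF C1_on_diff[OF 1 C1_on_const] sq_pos_C1]) simp
  have "C1_on (\<lambda>y::real^3. inverse (sq_pos (1 - y \<bullet> y) + sq_pos (y \<bullet> y - 1 / 2))) UNIV"
    by (rule C1_on_inverse[OF C1_on_add[OF 2 3]]) (metis plateau_denominator less_irrefl)
  from C1_on_bilinear[OF bounded_bilinear_mult 2 this] show ?thesis by (simp add: plateau_def[abs_def])
qed

lemma plateau_range: "0 \<le> plateau y" "plateau y \<le> 1"
proof -
  show "0 \<le> plateau y" unfolding plateau_def
    using plateau_denominator[of y] sq_pos_nonneg[of "1 - y \<bullet> y"] by simp
  show "plateau y \<le> 1" unfolding plateau_def divide_inverse[symmetric]
    using plateau_denominator[of y] sq_pos_nonneg[of "y \<bullet> y - 1 / 2"] by (simp add: divide_le_eq)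
qed

lemma plateau_one: "norm y \<le> 1 / 2 \<Longrightarrow> plateau y = 1"
proof -
  assume "norm y \<le> 1 / 2"
  then have "(norm y)\<^sup>2 \<le> (1 / 2)\<^sup>2" by (intro power_mono) auto
  then have le: "y \<bullet> y \<le> 1 / 4" by (simp add: dot_square_norm power2_eq_square)
  have "sq_pos (y \<bullet> y - 1 / 2) = 0" by (rule sq_pos_zero) (use le in linarith)
  moreover have "sq_pos (1 - y \<bullet> y) > 0" by (rule sq_pos_pos) (use le in linarith)
  ultimately show "plateau y = 1" by (simp add: plateau_def)
qed

lemma plateau_zero: "1 \<le> norm y \<Longrightarrow> plateau y = 0"
proof -
  assume "1 \<le> norm y"
  then have "1\<^sup>2 \<le> (norm y)\<^sup>2" by (intro power_mono) auto
  then have "1 - y \<bullet> y \<le> 0" by (simp add: dot_square_norm)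
  then show "plateau y = 0" by (simp add: plateau_def sq_pos_zero)
qed

lemma plateau_deriv_bound:
  obtains K where "K \<ge> 0" "\<And>y v. norm (frechet_derivative plateau (at y) v) \<le> K * norm v"
proof -
  obtain K where K: "K \<ge> 0" "\<And>y v. y \<in> cball 0 1 \<Longrightarrow> norm (frechet_derivative plateau (at y) v) \<le> K * norm v"
    using C1_compact_bound[OF plateau_C1 compact_cball subset_UNIV] by metis
  have "norm (frechet_derivative plateau (at y) v) \<le> K * norm v" for y v
  proof (cases "y \<in> cball 0 1")
    case False
    have "(plateau has_derivative (\<lambda>v. 0)) (at y)"
    proof (rule has_derivative_transform_open_at[OF has_derivative_const open_Compl[OF closed_cball]])
      show "y \<in> - cball 0 1" using False by simp
      show "0 = plateau z" if "z \<in> - cball 0 1" for z using that plateau_zero[of z] by simp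
    qed
    from fun_cong[OF frechet_derivative_at[OF this], of v] K(1) show ?thesis by (simp flip: \<open>_ = _\<close>)
  qed (rule K(2))
  with K(1) show ?thesis using that by blast
qed

section \<open>The divergence theorem on a compact surface with corners\<close>

text \<open>The number \<open>h\<close> bounds the divergence of the normal, that is, twice the mean
  curvature, on the regular part. This is the only control over second derivatives that reaches up
  to the corners.\<close>

locale compact_surface =
  fixes S :: "(real^3) set" and nn :: "real^3 \<Rightarrow> real^3" and h :: real
  assumes compact_S: "compact S" and corners_S: "surface_with_corners S" and normal_S: "unit_normal_field S nn"
    and bounded_curvature: "\<And>p. p \<in> regular_points S \<Longrightarrow> \<bar>surface_div S nn p\<bar> \<le> h"
begin

abbreviation "R \<equiv> regular_points S"
abbreviation "B \<equiv> surface_boundary S"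
abbreviation "\<nu> \<equiv> outward_conormal S"
abbreviation "area \<equiv> area_measure S"
abbreviation "len \<equiv> arc_length_measure B"

definition div_integrand :: "(real^3 \<Rightarrow> real^3) \<Rightarrow> real^3 \<Rightarrow> real" where
  "div_integrand X x = indicator R x *\<^sub>R surface_div S (tangential_part nn X) x"

definition flux_integrand :: "(real^3 \<Rightarrow> real^3) \<Rightarrow> real^3 \<Rightarrow> real" where
  "flux_integrand X x = indicator B x *\<^sub>R (X x \<bullet> \<nu> x)"

text \<open>The defect in the divergence theorem. It is additive, so the theorem can be proved for
  the summands of a decomposition of the field.\<close>

definition \<Phi> :: "(real^3 \<Rightarrow> real^3) \<Rightarrow> real" where
  "\<Phi> X = integral\<^sup>L area (div_integrand X) - integral\<^sup>L len (flux_integrand X)"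

lemma closed_S: "closed S" using compact_imp_closed[OF compact_S] .
lemma closed_B: "closed B" by (rule surface_boundary_closed[OF closed_S])
lemma S_borel: "S \<in> sets borel" using closed_S by simp
lemma B_borel: "B \<in> sets borel" using closed_B by simp
lemma R_borel: "R \<in> sets borel"
proof -
  obtain V where V: "open V" "R = S \<inter> V" by (rule regular_points_relopen)
  show ?thesis unfolding V(2) using S_borel V(1) by simp
qed
lemma finite_area: "finite_measure area" by (rule finite_area_measure[OF compact_S corners_S])
lemma finite_len: "finite_measure len" by (rule finite_arc_length_measure[OF compact_S corners_S])
lemma sets_area: "sets area = sets borel" by (rule sets_area_measure[OF S_borel])
lemma sets_len: "sets len = sets borel" by (rule sets_arc_length_measure[OF B_borel])
lemma B_subset: "B \<subseteq> S" by (auto simp: surface_boundary_def)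

lemma div_integrand_measurable:
  assumes "C1_on X O'" "S \<subseteq> O'"
  shows "div_integrand X \<in> borel_measurable borel"
  unfolding div_integrand_def[abs_def]
  by (rule borel_measurable_continuous_on_indicator[OF R_borel surface_div_continuous[OF normal_S assms]])

text \<open>The conormal vanishes on the regular part and is continuous on the boundary off the
  corners. The finitely many corners are restored as separate one-point terms, whatever values the
  conormal takes there.\<close>

lemma flux_measurable_on:
  assumes "continuous_on S X" "A \<in> sets borel" "A \<subseteq> S"
  shows "(\<lambda>x. indicator A x *\<^sub>R (X x \<bullet> \<nu> x)) \<in> borel_measurable borel"
proof -
  let ?Q = "bad_points S" and ?f = "\<lambda>x. X x \<bullet> \<nu> x"
  have fin: "finite ?Q" by (rule bad_points_finite[OF corners_S compact_S])
  have Qb: "?Q \<in> sets borel" using fin by (simp add: finite_imp_closed)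
  have "continuous_on (B - ?Q) X" by (rule continuous_on_subset[OF assms(1)]) (use B_subset in auto)
  then have c: "continuous_on (A \<inter> (B - ?Q)) ?f"
    by (intro continuous_intros continuous_on_subset[OF outward_conormal_continuous]) (auto intro: continuous_on_subset)
  have m1: "(\<lambda>x. indicator (A \<inter> (B - ?Q)) x *\<^sub>R ?f x) \<in> borel_measurable borel"
    by (rule borel_measurable_continuous_on_indicator[OF _ c]) (use assms(2) B_borel Qb in auto)
  have m2: "(\<lambda>x. \<Sum>q\<in>?Q. indicator {q} x * (indicator A q * ?f q)) \<in> borel_measurable borel"
    by (intro borel_measurable_sum borel_measurable_times borel_measurable_const borel_measurable_indicator) auto
  have "indicator A x *\<^sub>R ?f x = indicator (A \<inter> (B - ?Q)) x *\<^sub>R ?f x + (\<Sum>q\<in>?Q. indicator {q} x * (indicator A q * ?f q))" for x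
  proof -
    have s: "(\<Sum>q\<in>?Q. indicator {q} x * (indicator A q * ?f q)) = (if x \<in> ?Q then indicator A x * ?f x else 0)"
    proof -
      have "(\<Sum>q\<in>?Q. indicator {q} x * (indicator A q * ?f q)) = (\<Sum>q\<in>?Q. if q = x then indicator A q * ?f q else 0)"
        by (intro sum.cong) auto
      then show ?thesis using fin by simp
    qed
    show ?thesis
    proof (cases "x \<in> A")
      case True
      then have "x \<in> R \<or> x \<in> B" using assms(3) by (auto simp: surface_boundary_def)
      then show ?thesis unfolding s using True outward_conormal_regular[of x S]
        by (auto simp: indicator_def bad_points_def)
    qed (simp add: s)
  qed
  then show ?thesis using borel_measurable_add[OF m1 m2] by presburger
qed

lemma flux_integrand_measurable:
  assumes "C1_on X O'" "S \<subseteq> O'"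
  shows "flux_integrand X \<in> borel_measurable borel"
  unfolding flux_integrand_def[abs_def]
  by (rule flux_measurable_on[OF continuous_on_subset[OF C1_on_continuous[OF assms(1)] assms(2)] B_borel B_subset])

lemma div_integrand_bound:
  assumes X: "(X has_derivative X') (at x)" "\<And>v. norm (X' v) \<le> K * norm v" "norm (X x) \<le> C" and "x \<in> S" "0 \<le> K" "0 \<le> C"
  shows "\<bar>div_integrand X x\<bar> \<le> 3 * K + C * \<bar>h\<bar>"
proof (cases "x \<in> R")
  case False
  then show ?thesis using assms(5,6) by (simp add: div_integrand_def)
next
  case True
  have "norm (nn x) = 1" using normal_S \<open>x \<in> S\<close> by (simp add: unit_normal_field_def)
  then have "\<bar>X x \<bullet> nn x\<bar> \<le> C" using Cauchy_Schwarz_ineq2[of "X x" "nn x"] X(3) by simp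
  moreover have "\<bar>surface_div S nn x\<bar> \<le> \<bar>h\<bar>" using bounded_curvature[OF True] by simp
  ultimately have "\<bar>X x \<bullet> nn x\<bar> * \<bar>surface_div S nn x\<bar> \<le> C * \<bar>h\<bar>" by (intro mult_mono) auto
  then have "\<bar>(X x \<bullet> nn x) * surface_div S nn x\<bar> \<le> C * \<bar>h\<bar>" by (simp add: abs_mult)
  moreover have "\<bar>surface_div S X x\<bar> \<le> 3 * K" by (rule surface_div_bound[OF True X(1,2)])
  moreover have "div_integrand X x = surface_div S X x - (X x \<bullet> nn x) * surface_div S nn x"
    using surface_div_decomposition[OF True normal_S X(1)] True by (simp add: div_integrand_def)
  ultimately show ?thesis by linarith
qed

lemma flux_integrand_bound: "norm (X x) \<le> C \<Longrightarrow> \<bar>flux_integrand X x\<bar> \<le> C"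
proof -
  assume C: "norm (X x) \<le> C"
  have "\<bar>X x \<bullet> \<nu> x\<bar> \<le> norm (X x) * norm (\<nu> x)" by (rule Cauchy_Schwarz_ineq2)
  also have "\<dots> \<le> norm (X x) * 1" by (rule mult_left_mono[OF norm_outward_conormal]) simp
  finally show ?thesis using C order_trans[OF norm_ge_zero C] by (auto simp: flux_integrand_def indicator_def)
qed

lemma integrable_of_bounded:
  assumes "finite_measure \<mu>" "sets \<mu> = sets borel" "f \<in> borel_measurable borel" "\<And>x. \<bar>f x\<bar> \<le> (C::real)"
  shows "integrable \<mu> f"
proof (rule finite_measure.integrable_const_bound[OF assms(1), of _ C])
  show "AE x in \<mu>. norm (f x) \<le> C" using assms(4) by simp
  show "f \<in> borel_measurable \<mu>" using assms(3) by (simp only: measurable_cong_sets[OF assms(2) refl])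
qed

lemma integrands_integrable:
  assumes X: "C1_on X O'" "S \<subseteq> O'"
  shows "integrable area (div_integrand X)" "integrable len (flux_integrand X)"
proof -
  obtain C where C: "C \<ge> 0" "\<And>x. x \<in> S \<Longrightarrow> norm (X x) \<le> C"
    "\<And>x v. x \<in> S \<Longrightarrow> norm (frechet_derivative X (at x) v) \<le> C * norm v"
    using C1_compact_bound[OF X(1) compact_S X(2)] by metis
  show "integrable area (div_integrand X)"
  proof (rule integrable_of_bounded[OF finite_area sets_area div_integrand_measurable[OF X]])
    show "\<bar>div_integrand X x\<bar> \<le> 3 * C + C * \<bar>h\<bar>" for x
    proof (cases "x \<in> S")
      case True
      then show ?thesis
        by (intro div_integrand_bound[OF C1_on_has_derivative[OF X(1)]] C) (use X(2) C(1) in auto)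
    next
      case False
      then have "x \<notin> R" using regular_points_subset by blast
      then show ?thesis using C(1) by (simp add: div_integrand_def)
    qed
  qed
  show "integrable len (flux_integrand X)"
  proof (rule integrable_of_bounded[OF finite_len sets_len flux_integrand_measurable[OF X]])
    show "\<bar>flux_integrand X x\<bar> \<le> C" for x
    proof (cases "x \<in> S")
      case True
      then show ?thesis by (intro flux_integrand_bound C)
    next
      case False
      then have "x \<notin> B" using B_subset by blast
      then show ?thesis using C(1) by (simp add: flux_integrand_def)
    qed
  qed
qed

lemma \<Phi>_sum:
  assumes X: "\<And>i. i \<in> I \<Longrightarrow> C1_on (X i) O'" "S \<subseteq> O'"
  shows "\<Phi> (\<lambda>x. \<Sum>i\<in>I. X i x) = (\<Sum>i\<in>I. \<Phi> (X i))"
proof -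
  have d: "div_integrand (\<lambda>x. \<Sum>i\<in>I. X i x) x = (\<Sum>i\<in>I. div_integrand (X i) x)" for x
  proof (cases "x \<in> R")
    case True
    then have "x \<in> O'" using regular_points_subset X(2) by blast
    then have "surface_div S (tangential_part nn (\<lambda>x. \<Sum>i\<in>I. X i x)) x = (\<Sum>i\<in>I. surface_div S (tangential_part nn (X i)) x)"
      by (intro surface_div_tangential_sum[OF True normal_S C1_on_has_derivative[OF X(1)]])
    then show ?thesis by (simp add: div_integrand_def True)
  qed (simp add: div_integrand_def)
  have f: "flux_integrand (\<lambda>x. \<Sum>i\<in>I. X i x) x = (\<Sum>i\<in>I. flux_integrand (X i) x)" for x
    by (simp add: flux_integrand_def inner_sum_left sum_distrib_left)
  have "integral\<^sup>L area (\<lambda>x. \<Sum>i\<in>I. div_integrand (X i) x) = (\<Sum>i\<in>I. integral\<^sup>L area (div_integrand (X i)))"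
    by (rule Bochner_Integration.integral_sum) (rule integrands_integrable(1)[OF X])
  moreover have "integral\<^sup>L len (\<lambda>x. \<Sum>i\<in>I. flux_integrand (X i) x) = (\<Sum>i\<in>I. integral\<^sup>L len (flux_integrand (X i)))"
    by (rule Bochner_Integration.integral_sum) (rule integrands_integrable(2)[OF X])
  ultimately show ?thesis unfolding \<Phi>_def d f by (simp add: sum_subtractf)
qed

lemma integrand_cong:
  assumes "\<And>x. x \<in> S \<Longrightarrow> X x = Y x"
  shows "div_integrand X = div_integrand Y" "flux_integrand X = flux_integrand Y"
proof -
  show "div_integrand X = div_integrand Y"
  proof
    fix x
    show "div_integrand X x = div_integrand Y x"
    proof (cases "x \<in> R")
      case True
      then have "x \<in> S" using regular_points_subset by blast
      then show ?thesis unfolding div_integrand_def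
        by (intro arg_cong2[where f = "(*\<^sub>R)"] refl surface_div_cong) (simp_all add: tangential_part_def assms)
    qed (simp add: div_integrand_def)
  qed
  show "flux_integrand X = flux_integrand Y"
    using assms B_subset by (auto simp: flux_integrand_def fun_eq_iff indicator_def)
qed

lemma \<Phi>_cong: "(\<And>x. x \<in> S \<Longrightarrow> X x = Y x) \<Longrightarrow> \<Phi> X = \<Phi> Y"
  using integrand_cong[of X Y] by (simp only: \<Phi>_def)

lemma \<Phi>_add:
  assumes "C1_on X O'" "C1_on Y O'" "S \<subseteq> O'"
  shows "\<Phi> (\<lambda>x. X x + Y x) = \<Phi> X + \<Phi> Y"
proof -
  have "\<Phi> (\<lambda>x. \<Sum>b\<in>{True, False}. (if b then X else Y) x) = (\<Sum>b\<in>{True, False}. \<Phi> (if b then X else Y))"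
    by (rule \<Phi>_sum) (use assms in auto)
  then show ?thesis by simp
qed

section \<open>The partition of unity away from the corners\<close>

lemma \<Phi>_local:
  assumes "p \<in> S" "p \<notin> bad_points S"
  obtains r where "r > 0" "\<And>(X :: real^3 \<Rightarrow> real^3) O'. open O' \<Longrightarrow> C1_on X O' \<Longrightarrow> S \<subseteq> O' \<Longrightarrow> (\<And>x. x \<notin> ball p r \<Longrightarrow> X x = 0) \<Longrightarrow> \<Phi> X = 0"
proof -
  have "p \<in> R \<or> boundary_point S p" using assms by (auto simp: bad_points_def)
  from local_divergence[OF closed_S normal_S this] obtain r where r: "r > 0"
    "\<And>(X :: real^3 \<Rightarrow> real^3) O'. open O' \<Longrightarrow> C1_on X O' \<Longrightarrow> S \<subseteq> O' \<Longrightarrow> (\<And>x. x \<notin> ball p r \<Longrightarrow> X x = 0) \<Longrightarrow>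
     surface_integral S (surface_div S (tangential_part nn X)) = (LINT x:B|len. X x \<bullet> \<nu> x)" by blast
  show ?thesis
  proof (rule that[OF r(1)])
    fix X :: "real^3 \<Rightarrow> real^3" and O' assume "open O'" "C1_on X O'" "S \<subseteq> O'" "\<And>x. x \<notin> ball p r \<Longrightarrow> X x = 0"
    then have "surface_integral S (surface_div S (tangential_part nn X)) = (LINT x:B|len. X x \<bullet> \<nu> x)" by (rule r(2))
    then show "\<Phi> X = 0"
      by (simp add: \<Phi>_def surface_integral_def set_lebesgue_integral_def div_integrand_def[abs_def] flux_integrand_def[abs_def])
  qed
qed

lemma \<Phi>_zero: "\<Phi> (\<lambda>x. 0) = 0"
  using \<Phi>_sum[of "{}" "\<lambda>_ _. 0" UNIV] by simp

text \<open>The balls about the corners are part of the cover although no local theorem holds there: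
  pieces of \<open>X\<close> supported in them vanish together with \<open>X\<close>.\<close>

lemma \<Phi>_vanish_near_corners:
  assumes O': "open O'" "S \<subseteq> O'" and X: "C1_on X O'" and \<delta>: "\<delta> > 0" "\<And>q x. q \<in> bad_points S \<Longrightarrow> x \<in> ball q \<delta> \<Longrightarrow> X x = 0"
  shows "\<Phi> X = 0"
proof -
  \<comment> \<open>The clause that \<open>Y\<close> vanishes wherever \<open>X\<close> does is what
    disposes of the corner case, and all pieces of the partition satisfy it.\<close>
  have "\<exists>r>0. \<forall>Y O'. open O' \<longrightarrow> C1_on Y O' \<longrightarrow> S \<subseteq> O' \<longrightarrow> (\<forall>x. x \<notin> ball p r \<longrightarrow> Y x = 0) \<longrightarrow>
      (\<forall>x. X x = 0 \<longrightarrow> Y x = 0) \<longrightarrow> \<Phi> Y = 0" if p: "p \<in> S" for p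
  proof (cases "p \<in> bad_points S")
    case True
    show ?thesis
    proof (intro exI[of _ \<delta>] conjI allI impI \<delta>(1))
      fix Y :: "real^3 \<Rightarrow> real^3"
      assume "\<forall>x. x \<notin> ball p \<delta> \<longrightarrow> Y x = 0" "\<forall>x. X x = 0 \<longrightarrow> Y x = 0"
      then have "Y x = 0" for x using \<delta>(2)[OF True, of x] by blast
      then have "Y = (\<lambda>x. 0)" by (rule ext)
      then show "\<Phi> Y = 0" using \<Phi>_zero by (simp only:)
    qed
  next
    case False
    obtain r where r: "r > 0" "\<And>X O'. open O' \<Longrightarrow> C1_on X O' \<Longrightarrow> S \<subseteq> O' \<Longrightarrow> (\<And>x. x \<notin> ball p r \<Longrightarrow> X x = 0) \<Longrightarrow> \<Phi> X = 0"
      using \<Phi>_local[OF p False] by blast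
    show ?thesis by (intro exI[of _ r] conjI allI impI r(1)) (rule r(2), auto)
  qed
  then obtain r where r: "\<And>p. p \<in> S \<Longrightarrow> r p > 0"
    "\<And>p Y O'. p \<in> S \<Longrightarrow> open O' \<Longrightarrow> C1_on Y O' \<Longrightarrow> S \<subseteq> O' \<Longrightarrow> (\<forall>x. x \<notin> ball p (r p) \<longrightarrow> Y x = 0) \<Longrightarrow>
      (\<forall>x. X x = 0 \<longrightarrow> Y x = 0) \<Longrightarrow> \<Phi> Y = 0" by metis
  obtain F where F: "F \<subseteq> S" "finite F" "S \<subseteq> (\<Union>p\<in>F. ball p (r p))"
  proof (rule compactE_image[OF compact_S, of S "\<lambda>p. ball p (r p)"])
    show "S \<subseteq> (\<Union>p\<in>S. ball p (r p))" using r(1) by force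
  qed auto
  define O2 where "O2 = O' \<inter> (\<Union>p\<in>F. ball p (r p))"
  have O2: "open O2" "S \<subseteq> O2" using O' F by (auto simp: O2_def)
  \<comment> \<open>The bumps have a positive sum on \<open>O2\<close>, and division by it
    normalizes them.\<close>
  define w where "w x = (\<Sum>p\<in>F. bump p (r p) x)" for x
  have wpos: "w x > 0" if x: "x \<in> O2" for x
  proof -
    obtain p where p: "p \<in> F" "x \<in> ball p (r p)" using x unfolding O2_def by blast
    show ?thesis unfolding w_def
      using sum_pos2[OF F(2) p(1), of "\<lambda>p. bump p (r p) x"] bump_pos[OF p(2)] bump_nonneg by blast
  qed
  have w1: "C1_on w O2" unfolding w_def[abs_def] by (rule C1_on_sum) (rule bump_C1)
  have wi: "C1_on (\<lambda>x. inverse (w x)) O2" by (rule C1_on_inverse[OF w1]) (metis wpos less_irrefl)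
  define Y where "Y p x = (bump p (r p) x * inverse (w x)) *\<^sub>R X x" for p x
  have YC: "C1_on (Y p) O2" for p
    unfolding Y_def[abs_def]
    by (rule C1_on_scaleR[OF C1_on_bilinear[OF bounded_bilinear_mult bump_C1 wi] C1_on_subset[OF X]]) (simp add: O2_def)
  have "\<Phi> X = \<Phi> (\<lambda>x. \<Sum>p\<in>F. Y p x)"
  proof (rule \<Phi>_cong)
    fix x assume "x \<in> S"
    then have "w x \<noteq> 0" using wpos[of x] O2(2) by auto
    have "(\<Sum>p\<in>F. Y p x) = (\<Sum>p\<in>F. bump p (r p) x * inverse (w x)) *\<^sub>R X x"
      unfolding Y_def by (rule scaleR_sum_left[symmetric])
    also have "(\<Sum>p\<in>F. bump p (r p) x * inverse (w x)) = w x * inverse (w x)" by (simp only: w_def sum_distrib_right)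
    finally show "X x = (\<Sum>p\<in>F. Y p x)" using \<open>w x \<noteq> 0\<close> by simp
  qed
  also have "\<dots> = (\<Sum>p\<in>F. \<Phi> (Y p))" by (rule \<Phi>_sum[OF YC O2(2)])
  also have "\<dots> = 0"
  proof (rule sum.neutral, rule ballI)
    fix p assume "p \<in> F"
    then have pS: "p \<in> S" using F(1) by blast
    show "\<Phi> (Y p) = 0"
      by (rule r(2)[OF pS O2(1) YC O2(2)]) (use bump_zero[of "r p" _ p] r(1)[OF pS] in \<open>auto simp: Y_def\<close>)
  qed
  finally show ?thesis .
qed

text \<open>Continuity from above for a finite measure, and points have no length. The radii are
  twice those used for the cut-offs, because the estimate there is taken on doubled balls.\<close>

lemma len_small_balls: "(\<lambda>n. measure len (ball q (2 / real (Suc n)))) \<longlonglongrightarrow> 0"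
proof -
  interpret finite_measure len by (rule finite_len)
  have dec: "decseq (\<lambda>n. ball q (2 / real (Suc n)))"
    by (intro decseq_SucI subset_ball) (simp add: field_simps)
  have int: "(\<Inter>n. ball q (2 / real (Suc n))) = {q}"
  proof (intro equalityI subsetI)
    fix x assume x: "x \<in> (\<Inter>n. ball q (2 / real (Suc n)))"
    show "x \<in> {q}"
    proof (rule ccontr)
      assume "x \<notin> {q}"
      then have "dist q x / 2 > 0" by simp
      then obtain n where "inverse (real (Suc n)) < dist q x / 2" using reals_Archimedean by blast
      then have "2 / real (Suc n) < dist q x" by (simp add: field_simps)
      moreover have "dist q x < 2 / real (Suc n)" using x by auto
      ultimately show False by linarith
    qed
  qed auto
  have "(\<lambda>n. measure len (ball q (2 / real (Suc n)))) \<longlonglongrightarrow> measure len (\<Inter>n. ball q (2 / real (Suc n)))"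
    by (rule finite_Lim_measure_decseq[OF _ dec]) (simp add: sets_len image_subset_iff)
  moreover have "measure len {q} = 0" by (simp add: measure_def arc_length_singleton[OF B_borel])
  ultimately show ?thesis unfolding int by simp
qed

lemma cutoff_C1:
  assumes "C1_on X O'" shows "C1_on (\<lambda>x. plateau (c *\<^sub>R (x - q)) *\<^sub>R X x) O'"
proof -
  have "C1_on (\<lambda>x. c *\<^sub>R (x - q)) O'"
    by (intro C1_on_scaleR C1_on_diff C1_on_const C1_on_linear bounded_linear_ident)
  then have "C1_on (\<lambda>x. plateau (c *\<^sub>R (x - q))) O'" by (rule C1_on_compose[OF _ plateau_C1]) simp
  then show ?thesis by (rule C1_on_scaleR[OF _ assms])
qed

text \<open>The gradient of the cut-off is of order $1/\epsilon$ on a set of area $O(\epsilon^2)$, and points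
carry no arc length.\<close>

lemma \<Phi>_cutoff_small:
  assumes q: "q \<in> S" and X: "C1_on X O'" "S \<subseteq> O'" and e: "e > 0"
  obtains \<epsilon> where "\<epsilon> > 0" "\<bar>\<Phi> (\<lambda>x. plateau ((1 / \<epsilon>) *\<^sub>R (x - q)) *\<^sub>R X x)\<bar> < e"
proof -
  obtain C where C: "C \<ge> 0" "\<And>x. x \<in> S \<Longrightarrow> norm (X x) \<le> C"
    "\<And>x v. x \<in> S \<Longrightarrow> norm (frechet_derivative X (at x) v) \<le> C * norm v"
    using C1_compact_bound[OF X(1) compact_S X(2)] by metis
  obtain K where K: "K \<ge> 0" "\<And>y v. norm (frechet_derivative plateau (at y) v) \<le> K * norm v"
    using plateau_deriv_bound by metis
  obtain C2 r where C2: "C2 \<ge> 0" "r > 0"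
    "\<And>\<epsilon>. 0 < \<epsilon> \<Longrightarrow> \<epsilon> \<le> r \<Longrightarrow> emeasure area (R \<inter> ball q \<epsilon>) \<le> ennreal (C2 * \<epsilon>\<^sup>2)"
    using area_near_point[OF closed_S corners_S q] by metis
  \<comment> \<open>For a cut-off at scale \<epsilon> the derivative of the field is at most
    \<open>(C + K * C) / \<epsilon>\<close>; with the trace constant 3 and the curvature term,
    \<open>A / \<epsilon>\<close> bounds the divergence.\<close>
  define A where "A = 3 * (C + K * C) + C * \<bar>h\<bar>"
  have A0: "A \<ge> 0" using C(1) K(1) by (simp add: A_def)
  \<comment> \<open>The estimate is a bound of order \<open>1 / \<epsilon>\<close> times the area of
    a ball of radius \<open>2 * \<epsilon>\<close>, of order \<epsilon>^2. The doubled ball contains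
    the closed ball outside which the field vanishes.\<close>
  have est: "\<bar>\<Phi> (\<lambda>x. plateau ((1 / \<epsilon>) *\<^sub>R (x - q)) *\<^sub>R X x)\<bar> \<le> 4 * A * C2 * \<epsilon> + C * measure len (ball q (2 * \<epsilon>))"
    if eps: "0 < \<epsilon>" "\<epsilon> \<le> 1" "2 * \<epsilon> \<le> r" for \<epsilon>
  proof -
    define \<zeta> where "\<zeta> x = plateau ((1 / \<epsilon>) *\<^sub>R (x - q))" for x
    define Y where "Y x = \<zeta> x *\<^sub>R X x" for x
    have YC: "C1_on Y O'" unfolding Y_def[abs_def] \<zeta>_def by (rule cutoff_C1[OF X(1)])
    have Y0: "Y x = 0" if "x \<notin> ball q \<epsilon>" for x
    proof -
      have "\<epsilon> \<le> norm (x - q)" using that by (simp add: dist_norm norm_minus_commute)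
      then have "1 \<le> norm ((1 / \<epsilon>) *\<^sub>R (x - q))" unfolding norm_scaleR using eps(1) by (simp add: le_divide_eq)
      then show ?thesis by (simp add: Y_def \<zeta>_def plateau_zero)
    qed
    have YX: "norm (Y x) \<le> norm (X x)" for x
      using plateau_range[of "(1 / \<epsilon>) *\<^sub>R (x - q)"] mult_right_mono[of "\<bar>\<zeta> x\<bar>" 1 "norm (X x)"] by (simp add: Y_def \<zeta>_def)
    have d\<zeta>: "(\<zeta> has_derivative (\<lambda>v. frechet_derivative plateau (at ((1 / \<epsilon>) *\<^sub>R (x - q))) ((1 / \<epsilon>) *\<^sub>R v))) (at x)" for x
    proof -
      have "((\<lambda>x. (1 / \<epsilon>) *\<^sub>R (x - q)) has_derivative (\<lambda>v. (1 / \<epsilon>) *\<^sub>R v)) (at x)"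
        by (auto intro!: derivative_eq_intros)
      from has_derivative_compose[OF this C1_on_has_derivative[OF plateau_C1 UNIV_I]]
      show ?thesis by (simp add: \<zeta>_def[abs_def])
    qed
    have bnd: "\<bar>div_integrand Y x\<bar> \<le> A / \<epsilon> * indicator (R \<inter> ball q (2 * \<epsilon>)) x" for x
    proof (cases "x \<in> R")
      case False
      then show ?thesis by (simp add: div_integrand_def)
    next
      case True
      then have xS: "x \<in> S" using regular_points_subset by blast
      show ?thesis
      proof (cases "x \<in> cball q \<epsilon>")
        case True
        let ?\<zeta>' = "\<lambda>v. frechet_derivative plateau (at ((1 / \<epsilon>) *\<^sub>R (x - q))) ((1 / \<epsilon>) *\<^sub>R v)"
        let ?X' = "frechet_derivative X (at x)"
        have dY: "(Y has_derivative (\<lambda>v. \<zeta> x *\<^sub>R ?X' v + ?\<zeta>' v *\<^sub>R X x)) (at x)"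
          unfolding Y_def[abs_def]
          by (rule has_derivative_scaleR[OF d\<zeta> C1_on_has_derivative[OF X(1)]]) (use xS X(2) in auto)
        have b: "norm (\<zeta> x *\<^sub>R ?X' v + ?\<zeta>' v *\<^sub>R X x) \<le> ((C + K * C) / \<epsilon>) * norm v" for v
        proof -
          have "norm (\<zeta> x *\<^sub>R ?X' v) \<le> 1 * (C * norm v)"
            unfolding norm_scaleR using plateau_range[of "(1 / \<epsilon>) *\<^sub>R (x - q)"] C(3)[OF xS, of v]
            by (intro mult_mono) (simp_all add: \<zeta>_def)
          \<comment> \<open>Uses \<epsilon> at most 1, so that the terms without a gradient of the
            cut-off are absorbed into the same order.\<close>
          also have "\<dots> \<le> C * norm v / \<epsilon>"
            using eps(1,2) C(1) by (simp add: le_divide_eq mult_left_le mult_nonneg_nonneg)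
          finally have 1: "norm (\<zeta> x *\<^sub>R ?X' v) \<le> C * norm v / \<epsilon>" .
          have "\<bar>?\<zeta>' v\<bar> \<le> K * (norm v / \<epsilon>)" using K(2)[of "(1 / \<epsilon>) *\<^sub>R (x - q)" "(1 / \<epsilon>) *\<^sub>R v"] eps(1) by simp
          then have "norm (?\<zeta>' v *\<^sub>R X x) \<le> (K * (norm v / \<epsilon>)) * C"
            unfolding norm_scaleR using C(2)[OF xS] K(1) eps(1) by (intro mult_mono) simp_all
          with 1 have "norm (\<zeta> x *\<^sub>R ?X' v + ?\<zeta>' v *\<^sub>R X x) \<le> C * norm v / \<epsilon> + (K * (norm v / \<epsilon>)) * C"
            by (intro norm_triangle_le add_mono)
          also have "\<dots> = ((C + K * C) / \<epsilon>) * norm v" by (simp add: add_divide_distrib distrib_right)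
          finally show ?thesis .
        qed
        have "norm (Y x) \<le> C" using YX[of x] C(2)[OF xS] by linarith
        from div_integrand_bound[OF dY b this xS _ C(1)]
        have "\<bar>div_integrand Y x\<bar> \<le> 3 * ((C + K * C) / \<epsilon>) + C * \<bar>h\<bar>" using C(1) K(1) eps(1) by simp
        also have "\<dots> \<le> 3 * ((C + K * C) / \<epsilon>) + C * \<bar>h\<bar> / \<epsilon>"
          using eps(1,2) C(1) by (simp add: le_divide_eq mult_left_le mult_nonneg_nonneg)
        also have "\<dots> = A / \<epsilon>" by (simp add: A_def add_divide_distrib)
        finally show ?thesis using \<open>x \<in> R\<close> True eps(1) by (simp add: indicator_def)
      next
        case False
        have d0: "(Y has_derivative (\<lambda>v. 0)) (at x)"
        proof (rule has_derivative_transform_open_at[OF has_derivative_const open_Compl[OF closed_cball]])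
          show "x \<in> - cball q \<epsilon>" using False by simp
          fix y assume "y \<in> - cball q \<epsilon>"
          then have "y \<notin> ball q \<epsilon>" by simp
          from Y0[OF this] show "0 = Y y" ..
        qed
        have "x \<notin> ball q \<epsilon>" using False by simp
        from Y0[OF this] have "\<bar>div_integrand Y x\<bar> \<le> 3 * 0 + 0 * \<bar>h\<bar>"
          by (intro div_integrand_bound[OF d0]) (simp_all add: xS)
        then show ?thesis using A0 eps(1) by (simp add: indicator_def)
      qed
    qed
    interpret a: finite_measure area by (rule finite_area)
    interpret l: finite_measure len by (rule finite_len)
    have Rb: "R \<inter> ball q (2 * \<epsilon>) \<in> sets area" using R_borel sets_area by auto
    have "\<bar>integral\<^sup>L area (div_integrand Y)\<bar> \<le> (\<integral>x. A / \<epsilon> * indicator (R \<inter> ball q (2 * \<epsilon>)) x \<partial>area)"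
    proof (rule integral_abs_bound_integral)
      show "integrable area (div_integrand Y)" by (rule integrands_integrable(1)[OF YC X(2)])
      show "integrable area (\<lambda>x. A / \<epsilon> * indicator (R \<inter> ball q (2 * \<epsilon>)) x)"
        using Rb by (intro integrable_mult_right integrable_real_indicator) (simp_all add: a.emeasure_eq_measure)
    qed (rule bnd)
    also have "\<dots> = A / \<epsilon> * measure area (R \<inter> ball q (2 * \<epsilon>))" using Rb by simp
    also have "\<dots> \<le> A / \<epsilon> * (C2 * (2 * \<epsilon>)\<^sup>2)"
    proof (rule mult_left_mono)
      have "emeasure area (R \<inter> ball q (2 * \<epsilon>)) \<le> ennreal (C2 * (2 * \<epsilon>)\<^sup>2)" using C2(3)[of "2 * \<epsilon>"] eps by simp
      then show "measure area (R \<inter> ball q (2 * \<epsilon>)) \<le> C2 * (2 * \<epsilon>)\<^sup>2"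
        using C2(1) by (simp add: a.emeasure_eq_measure)
    qed (use A0 eps(1) in simp)
    also have "\<dots> = 4 * A * C2 * \<epsilon>" using eps(1) by (simp add: power2_eq_square field_simps)
    finally have 1: "\<bar>integral\<^sup>L area (div_integrand Y)\<bar> \<le> 4 * A * C2 * \<epsilon>" .
    have bl: "ball q (2 * \<epsilon>) \<in> sets len" using sets_len by simp
    have "\<bar>integral\<^sup>L len (flux_integrand Y)\<bar> \<le> (\<integral>x. C * indicator (ball q (2 * \<epsilon>)) x \<partial>len)"
    proof (rule integral_abs_bound_integral)
      show "integrable len (flux_integrand Y)" by (rule integrands_integrable(2)[OF YC X(2)])
      show "integrable len (\<lambda>x. C * indicator (ball q (2 * \<epsilon>)) x)"
        using bl by (intro integrable_mult_right integrable_real_indicator) (simp_all add: l.emeasure_eq_measure)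
      fix x
      show "\<bar>flux_integrand Y x\<bar> \<le> C * indicator (ball q (2 * \<epsilon>)) x"
      proof (cases "x \<in> B \<and> x \<in> ball q \<epsilon>")
        case True
        then have "x \<in> S" using B_subset by blast
        then have "norm (Y x) \<le> C" using YX[of x] C(2)[of x] by linarith
        then have "\<bar>flux_integrand Y x\<bar> \<le> C" by (rule flux_integrand_bound)
        then show ?thesis using True eps(1) by simp
      next
        case False
        then have "flux_integrand Y x = 0" using Y0[of x] by (auto simp: flux_integrand_def indicator_def)
        then show ?thesis using C(1) by simp
      qed
    qed
    also have "\<dots> = C * measure len (ball q (2 * \<epsilon>))" using bl by simp
    finally have 2: "\<bar>integral\<^sup>L len (flux_integrand Y)\<bar> \<le> C * measure len (ball q (2 * \<epsilon>))" .
    have Yeq: "(\<lambda>x. plateau ((1 / \<epsilon>) *\<^sub>R (x - q)) *\<^sub>R X x) = Y" by (simp add: Y_def[abs_def] \<zeta>_def)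
    show ?thesis unfolding Yeq \<Phi>_def using 1 2 by linarith
  qed
  have "(\<lambda>n. 4 * A * C2 * (1 / real (Suc n)) + C * measure len (ball q (2 / real (Suc n)))) \<longlonglongrightarrow> 4 * A * C2 * 0 + C * 0"
    by (intro tendsto_intros len_small_balls LIMSEQ_Suc[OF lim_1_over_n])
  then have "\<forall>\<^sub>F n in sequentially. 4 * A * C2 * (1 / real (Suc n)) + C * measure len (ball q (2 / real (Suc n))) < e"
    by (rule order_tendstoD) (use e in simp)
  moreover have "\<forall>\<^sub>F n in sequentially. 1 / real (Suc n) < r / 2"
    by (rule order_tendstoD[OF LIMSEQ_Suc[OF lim_1_over_n]]) (use C2(2) in simp)
  ultimately have "\<forall>\<^sub>F n in sequentially. 4 * A * C2 * (1 / real (Suc n)) + C * measure len (ball q (2 / real (Suc n))) < e \<and> 1 / real (Suc n) < r / 2"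
    by (rule eventually_conj)
  then obtain n where n: "4 * A * C2 * (1 / real (Suc n)) + C * measure len (ball q (2 / real (Suc n))) < e" "1 / real (Suc n) < r / 2"
    using eventually_happens'[OF sequentially_bot] by blast
  have "\<bar>\<Phi> (\<lambda>x. plateau ((1 / (1 / real (Suc n))) *\<^sub>R (x - q)) *\<^sub>R X x)\<bar> \<le> 4 * A * C2 * (1 / real (Suc n)) + C * measure len (ball q (2 * (1 / real (Suc n))))"
    by (rule est) (use n(2) in auto)
  also have "\<dots> < e" using n(1) by simp
  finally show ?thesis using that[of "1 / real (Suc n)"] by simp
qed

text \<open>\<open>T\<close> collects the corners near which \<open>X\<close> need not vanish, so
  the induction removes one corner at a time. With \<open>T\<close> empty the partition of unity
  applies; with \<open>T\<close> all of the corners nothing is demanded of \<open>X\<close>.\<close>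

lemma \<Phi>_induct:
  assumes O': "open O'" "S \<subseteq> O'" and "finite T" "T \<subseteq> bad_points S"
  shows "\<forall>X :: real^3 \<Rightarrow> real^3. C1_on X O' \<longrightarrow> (\<exists>\<delta>>0. \<forall>q\<in>bad_points S - T. \<forall>x\<in>ball q \<delta>. X x = 0) \<longrightarrow> \<Phi> X = 0"
  using assms(3,4)
proof (induction T rule: finite_induct)
  case empty
  show ?case
  proof (intro allI impI)
    fix X :: "real^3 \<Rightarrow> real^3" assume X: "C1_on X O'" and "\<exists>\<delta>>0. \<forall>q\<in>bad_points S - {}. \<forall>x\<in>ball q \<delta>. X x = 0"
    then obtain \<delta> where "\<delta> > 0" "\<And>q x. q \<in> bad_points S \<Longrightarrow> x \<in> ball q \<delta> \<Longrightarrow> X x = 0" by auto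
    then show "\<Phi> X = 0" by (rule \<Phi>_vanish_near_corners[OF O' X])
  qed
next
  case (insert q T)
  show ?case
  proof (intro allI impI)
    fix X :: "real^3 \<Rightarrow> real^3" assume X: "C1_on X O'" and "\<exists>\<delta>>0. \<forall>p\<in>bad_points S - insert q T. \<forall>x\<in>ball p \<delta>. X x = 0"
    then obtain \<delta> where \<delta>: "\<delta> > 0" "\<And>p x. p \<in> bad_points S - insert q T \<Longrightarrow> x \<in> ball p \<delta> \<Longrightarrow> X x = 0" by metis
    have qS: "q \<in> S" using insert.prems by (auto simp: bad_points_def)
    \<comment> \<open>The field is split into a cut-off part near \<open>q\<close>, of defect below
      \<open>e\<close>, and a remainder vanishing near \<open>q\<close>, of defect 0 by
      induction.\<close>
    have "\<bar>\<Phi> X\<bar> < e" if e: "e > 0" for e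
    proof -
      obtain \<epsilon> where eps: "\<epsilon> > 0" "\<bar>\<Phi> (\<lambda>x. plateau ((1 / \<epsilon>) *\<^sub>R (x - q)) *\<^sub>R X x)\<bar> < e"
        by (rule \<Phi>_cutoff_small[OF qS X O'(2) e])
      let ?Y = "\<lambda>x. plateau ((1 / \<epsilon>) *\<^sub>R (x - q)) *\<^sub>R X x"
      let ?Z = "\<lambda>x. X x - ?Y x"
      have Y: "C1_on ?Y O'" by (rule cutoff_C1[OF X])
      have Z: "C1_on ?Z O'" by (rule C1_on_diff[OF X Y])
      have "\<exists>\<delta>>0. \<forall>p\<in>bad_points S - T. \<forall>x\<in>ball p \<delta>. ?Z x = 0"
      proof (intro exI[of _ "min \<delta> (\<epsilon> / 2)"] conjI ballI)
        show "min \<delta> (\<epsilon> / 2) > 0" using \<delta>(1) eps(1) by simp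
        fix p x assume p: "p \<in> bad_points S - T" and x: "x \<in> ball p (min \<delta> (\<epsilon> / 2))"
        show "?Z x = 0"
        proof (cases "p = q")
          case True
          have "norm (x - q) \<le> \<epsilon> / 2" using x True by (simp add: dist_norm norm_minus_commute)
          then have "norm ((1 / \<epsilon>) *\<^sub>R (x - q)) \<le> 1 / 2" unfolding norm_scaleR using eps(1) by (simp add: divide_le_eq)
          then show ?thesis by (simp add: plateau_one)
        next
          case False
          then have "X x = 0" using \<delta>(2)[of p x] p x by simp
          then show ?thesis by simp
        qed
      qed
      then have "\<Phi> ?Z = 0" using insert.IH insert.prems Z by blast
      moreover have "\<Phi> (\<lambda>x. ?Z x + ?Y x) = \<Phi> ?Z + \<Phi> ?Y" by (rule \<Phi>_add[OF Z Y O'(2)])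
      ultimately show ?thesis using eps(2) by simp
    qed
    then show "\<Phi> X = 0" by (metis zero_less_abs_iff less_irrefl)
  qed
qed

theorem divergence_theorem:
  assumes "open O'" "S \<subseteq> O'" "C1_on X O'"
  shows "integral\<^sup>L area (div_integrand X) = integral\<^sup>L len (flux_integrand X)"
proof -
  have "\<exists>\<delta>>0::real. \<forall>q\<in>bad_points S - bad_points S. \<forall>x\<in>ball q \<delta>. X x = 0" by (intro exI[of _ 1]) simp
  then have "\<Phi> X = 0"
    using \<Phi>_induct[OF assms(1,2) bad_points_finite[OF corners_S compact_S] order.refl] assms(3) by blast
  then show ?thesis by (simp add: \<Phi>_def)
qed

end

section \<open>Sheets and faces of a foam\<close>

text \<open>The sheets of a foam at an edge or vertex are not assumed closed. Near a chart point
  such a set is the image of a compact parameter set, which makes it locally closed and lets it be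
  removed from a neighbourhood.\<close>

lemma chart_locally_closed:
  fixes \<phi> :: "'a::euclidean_space \<Rightarrow> real^3"
  assumes ch: "C1_chart M T W \<phi>" and M: "closed M" and u: "u \<in> W" "u \<in> M"
  shows "\<exists>r>0. closed (T \<inter> cball (\<phi> u) r)"
proof -
  obtain d where d: "d > 0" "cball u d \<subseteq> W"
    using C1_chart_open[OF ch] u(1) open_contains_cball by metis
  have ch': "C1_chart M T (ball u d) \<phi>"
    by (rule C1_chart_restrict[OF ch open_ball]) (use d(2) in auto)
  obtain U where U: "open U" "\<phi> ` (ball u d \<inter> M) = T \<inter> U" using C1_chart_image_openin[OF ch'] .
  have "\<phi> u \<in> U" using U(2) u(2) d(1) by (metis IntD2 IntI centre_in_ball imageI)
  then obtain r where r: "r > 0" "cball (\<phi> u) r \<subseteq> U" using U(1) open_contains_cball by metis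
  obtain U2 where U2: "\<phi> ` (W \<inter> M) = T \<inter> U2" using C1_chart_image_openin[OF ch] by metis
  have "T \<inter> cball (\<phi> u) r = \<phi> ` (cball u d \<inter> M) \<inter> cball (\<phi> u) r"
  proof (intro subset_antisym subsetI)
    fix x assume "x \<in> T \<inter> cball (\<phi> u) r"
    then have "x \<in> \<phi> ` (ball u d \<inter> M)" "x \<in> cball (\<phi> u) r" unfolding U(2) using r(2) by auto
    then show "x \<in> \<phi> ` (cball u d \<inter> M) \<inter> cball (\<phi> u) r" by force
  next
    fix x assume x: "x \<in> \<phi> ` (cball u d \<inter> M) \<inter> cball (\<phi> u) r"
    then have "x \<in> \<phi> ` (W \<inter> M)" using d(2) by blast
    then show "x \<in> T \<inter> cball (\<phi> u) r" unfolding U2 using x by blast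
  qed
  moreover have "compact (\<phi> ` (cball u d \<inter> M))"
    by (intro compact_continuous_image continuous_on_subset[OF C1_chart_continuous[OF ch]] compact_Int_closed compact_cball M)
      (use d(2) in auto)
  ultimately have "closed (T \<inter> cball (\<phi> u) r)" by (simp add: closed_Int compact_imp_closed)
  then show ?thesis using r(1) by blast
qed

lemma closed_half_plane: "closed half_plane"
  unfolding half_plane_def by (intro closed_Collect_le continuous_intros)

lemma closed_quadrant: "closed quadrant"
  unfolding quadrant_def by (intro closed_Collect_conj closed_Collect_le continuous_intros)

lemma corners_locally_closed:
  assumes S: "surface_with_corners S" and p: "p \<in> S"
  shows "\<exists>r>0. closed (S \<inter> cball p r)"
proof -
  consider "p \<in> regular_points S \<or> boundary_point S p" | "corner_point S p"
    using S p by (auto simp: surface_with_corners_def)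
  then show ?thesis
  proof cases
    case 1
    obtain W and \<phi> :: "real^2 \<Rightarrow> real^3" and u where "C1_chart half_plane S W \<phi>" "u \<in> W" "u \<in> half_plane" "\<phi> u = p"
      using smooth_half_plane_chart[OF 1] by metis
    then show ?thesis using chart_locally_closed[OF _ closed_half_plane] by metis
  next
    case 2
    then obtain W and \<phi> :: "real^2 \<Rightarrow> real^3" where ch: "C1_chart quadrant S W \<phi>" "0 \<in> W" "\<phi> 0 = p"
      by (auto simp: corner_point_def local_param_iff)
    have "0 \<in> quadrant" by (simp add: quadrant_def)
    from chart_locally_closed[OF ch(1) closed_quadrant ch(2) this] ch(3) show ?thesis by simp
  qed
qed

text \<open>A point that lies on one sheet only keeps a distance from the others because these are
  locally closed, so near it the foam is that sheet.\<close>

lemma regular_in_union: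
  fixes F :: "(real^3) set" and I :: "'i set"
  assumes U: "open U" "p \<in> U" "F \<inter> U = (\<Union>i\<in>I. T i)" and I: "finite I"
    and T: "\<And>i. i \<in> I \<Longrightarrow> surface_with_corners (T i) \<and> p \<in> T i"
  obtains r where "r > 0" "ball p r \<subseteq> U" "\<And>i. i \<in> I \<Longrightarrow> closed (T i \<inter> cball p r)"
    "\<And>x i. x \<in> ball p r \<Longrightarrow> i \<in> I \<Longrightarrow> x \<in> regular_points (T i) \<Longrightarrow>
       (\<And>j. j \<in> I \<Longrightarrow> j \<noteq> i \<Longrightarrow> x \<notin> T j) \<Longrightarrow> x \<in> regular_points F"
proof -
  have "\<forall>i\<in>I. \<exists>r>0. closed (T i \<inter> cball p r)" using corners_locally_closed T by blast
  then obtain \<rho> where \<rho>: "\<And>i. i \<in> I \<Longrightarrow> \<rho> i > 0 \<and> closed (T i \<inter> cball p (\<rho> i))" by metis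
  obtain r0 where r0: "r0 > 0" "ball p r0 \<subseteq> U" using U open_contains_ball by metis
  define r where "r = Min (insert r0 (\<rho> ` I))"
  have r: "r > 0" unfolding r_def using I \<rho> r0(1) by (subst Min_gr_iff) auto
  have rr0: "r \<le> r0" unfolding r_def using I by (intro Min_le) auto
  have rr: "r \<le> \<rho> i" if "i \<in> I" for i unfolding r_def using I that by (intro Min_le) auto
  have BU: "ball p r \<subseteq> U" using r0(2) subset_ball[OF rr0] by blast
  have cl: "closed (T i \<inter> cball p r)" if i: "i \<in> I" for i
  proof -
    have "T i \<inter> cball p r = (T i \<inter> cball p (\<rho> i)) \<inter> cball p r" using rr[OF i] by auto
    then show ?thesis using \<rho>[OF i] by (metis closed_Int closed_cball)
  qed
  have reg: "x \<in> regular_points F"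
    if x: "x \<in> ball p r" and i: "i \<in> I" and xi: "x \<in> regular_points (T i)" and xj: "\<And>j. j \<in> I \<Longrightarrow> j \<noteq> i \<Longrightarrow> x \<notin> T j"
    for x i
  proof (rule regular_points_local[OF _ _ _ xi])
    \<comment> \<open>A neighbourhood from which all sheets except the chosen one have been
      removed.\<close>
    let ?V = "ball p r - (\<Union>j\<in>I - {i}. T j \<inter> cball p r)"
    show "open ?V" using I cl by (intro open_Diff closed_UN) auto
    show "x \<in> ?V" using x xj by auto
    show "T i \<inter> ?V = F \<inter> ?V"
    proof (intro subset_antisym subsetI)
      fix y assume y: "y \<in> T i \<inter> ?V"
      then have "y \<in> F \<inter> U" unfolding U(3) using i by blast
      then show "y \<in> F \<inter> ?V" using y by blast
    next
      fix y assume y: "y \<in> F \<inter> ?V"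
      then have "y \<in> F \<inter> U" using BU by blast
      then obtain j where j: "j \<in> I" "y \<in> T j" unfolding U(3) by blast
      have "y \<in> cball p r" using y by auto
      then have "j = i" using y j by blast
      then show "y \<in> T i \<inter> ?V" using y j by blast
    qed
  qed
  show ?thesis by (rule that[OF r BU cl reg])
qed

lemma regular_points_connected_nhd:
  assumes p: "p \<in> regular_points F" and G: "open G" "p \<in> G"
  obtains V K where "open V" "p \<in> V" "connected K" "F \<inter> V \<subseteq> K" "K \<subseteq> regular_points F \<inter> G"
proof -
  obtain W and \<phi> :: "real^2 \<Rightarrow> real^3" and u where ch: "C1_chart UNIV F W \<phi>" "smooth_on \<phi> W" and u: "u \<in> W" "\<phi> u = p"
    using regular_pointsE[OF p] .
  have "open (W \<inter> \<phi> -` G)"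
    using continuous_open_preimage[OF C1_chart_continuous[OF ch(1)] C1_chart_open[OF ch(1)] G(1)] .
  then obtain d where d: "d > 0" "ball u d \<subseteq> W \<inter> \<phi> -` G"
    using u G(2) by (metis IntI open_contains_ball vimageI)
  have dW: "ball u d \<subseteq> W" using d(2) by blast
  have ch': "C1_chart UNIV F (ball u d) \<phi>" by (rule C1_chart_restrict[OF ch(1) open_ball dW])
  obtain V where V: "open V" "\<phi> ` (ball u d \<inter> UNIV) = F \<inter> V" using C1_chart_image_openin[OF ch'] .
  show ?thesis
  proof (rule that[OF V(1)])
    have "p \<in> \<phi> ` (ball u d \<inter> UNIV)" using u(2) d(1) by auto
    then show "p \<in> V" using V(2) by blast
    show "connected (\<phi> ` ball u d)"
      by (intro connected_continuous_image continuous_on_subset[OF C1_chart_continuous[OF ch(1)] dW] connected_ball)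
    show "F \<inter> V \<subseteq> \<phi> ` ball u d" using V(2) by simp
    show "\<phi> ` ball u d \<subseteq> regular_points F \<inter> G"
      using regular_pointsI[OF ch' smooth_on_subset[OF ch(2) dW]] d(2) by auto
  qed
qed

text \<open>Regular points have connected neighbourhoods, so a component that accumulates at one
  contains all of the foam near it. In the interior of the ball a piece can therefore end only at
  points that are not regular in \<open>F\<close>.\<close>

lemma component_closure_nhd:
  assumes C: "C \<in> components (regular_points F \<inter> G)" and G: "open G"
    and p: "p \<in> regular_points F" "p \<in> G" "p \<in> closure C"
  obtains V where "open V" "p \<in> V" "F \<inter> V \<subseteq> C"
proof -
  obtain V K where V: "open V" "p \<in> V" "connected K" "F \<inter> V \<subseteq> K" "K \<subseteq> regular_points F \<inter> G"
    using regular_points_connected_nhd[OF p(1) G p(2)] .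
  have "C \<inter> V \<noteq> {}" using p(3) V(1,2) by (metis Int_commute open_Int_closure_eq_empty IntI empty_iff)
  moreover have "C \<subseteq> F" using in_components_subset[OF C] regular_points_subset by blast
  ultimately have "C \<inter> K \<noteq> {}" using V(4) by blast
  from components_maximal[OF C V(3,5) this] have "F \<inter> V \<subseteq> C" using V(4) by blast
  then show ?thesis by (rule that[OF V(1,2)])
qed

section \<open>Three sheets at an edge\<close>

lemma orthogonal_in_plane:
  fixes D :: "real^2 \<Rightarrow> real^3" and a b t :: "real^3"
  assumes D: "linear D" and r: "a \<in> range D" "b \<in> range D" "t \<in> range D"
    and t: "a \<bullet> t = 0" "b \<bullet> t = 0" "t \<noteq> 0" and a: "a \<bullet> a = 1" and b: "b \<bullet> b = 1"
  shows "(a \<bullet> b)\<^sup>2 = 1"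
proof -
  let ?N = "cross3 (D (axis 1 1)) (D (axis 2 1))"
  obtain x y z where x: "a = D x" "b = D y" "t = D z" using r by blast
  \<comment> \<open>Cross products of vectors of the plane are all multiples of one normal
    \<open>?N\<close>. Hence \<open>cross3 a b\<close>, being parallel and also orthogonal to the
    nonzero \<open>cross3 a t\<close>, vanishes.\<close>
  have c: "\<exists>c. cross3 (D v) (D w) = c *\<^sub>R ?N" for v w
    using cross3_linear_image[OF D, of v w] by blast
  obtain \<alpha> \<beta> \<gamma> where abc: "cross3 a t = \<alpha> *\<^sub>R ?N" "cross3 b t = \<beta> *\<^sub>R ?N" "cross3 a b = \<gamma> *\<^sub>R ?N"
    unfolding x using c by metis
  have at: "cross3 a t \<bullet> cross3 a t = t \<bullet> t" unfolding dot_cross using t a by (simp add: inner_commute)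
  then have N0: "\<alpha> \<noteq> 0" "?N \<noteq> 0" using t(3) abc(1) by auto
  have "cross3 a b \<bullet> cross3 a t = 0" unfolding dot_cross using t by (simp add: inner_commute)
  then have "\<gamma> * \<alpha> * (?N \<bullet> ?N) = 0" unfolding abc by auto
  then have "cross3 a b = 0" using N0 abc(3) by auto
  then have "(a \<bullet> a) * (b \<bullet> b) - (a \<bullet> b) * (b \<bullet> a) = 0" using dot_cross[of a b a b] by simp
  then show ?thesis unfolding a b power2_eq_square by (simp add: inner_commute)
qed

text \<open>Names the local data that are bound inside \<open>edge_points\<close>, so that they can
  be fixed and used again at every point of the edge curve \<open>\<Gamma>\<close>.\<close>

definition edge_sheets :: "(real^3) set \<Rightarrow> (real^3) set \<Rightarrow> (real^3) set \<Rightarrow> (nat \<Rightarrow> (real^3) set) \<Rightarrow> bool" where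
  "edge_sheets F U \<Gamma> T \<longleftrightarrow>
     open U \<and> F \<inter> U = (\<Union>k<3. T k) \<and>
     (\<forall>k<3. surface_with_boundary (T k) \<and> surface_boundary (T k) = \<Gamma>) \<and>
     (\<forall>j<3. \<forall>k<3. j \<noteq> k \<longrightarrow> T j \<inter> T k = \<Gamma> \<and>
        (\<forall>q\<in>\<Gamma>. angle (outward_conormal (T j) q) (outward_conormal (T k) q) = 2 * pi / 3))"

lemma edge_points_iff: "p \<in> edge_points F \<longleftrightarrow> (\<exists>U \<Gamma> T. edge_sheets F U \<Gamma> T \<and> p \<in> U \<and> p \<in> \<Gamma>)"
  by (auto simp: edge_points_def edge_sheets_def)

context
  fixes F U \<Gamma> T
  assumes E: "edge_sheets F U \<Gamma> T"
begin

lemma sheet_basic: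
  "open U" "F \<inter> U = (\<Union>k<3. T k)"
  "k < 3 \<Longrightarrow> surface_with_boundary (T k)" "k < 3 \<Longrightarrow> surface_with_corners (T k)"
  "k < 3 \<Longrightarrow> surface_boundary (T k) = \<Gamma>" "k < 3 \<Longrightarrow> \<Gamma> \<subseteq> T k"
  "j < 3 \<Longrightarrow> k < 3 \<Longrightarrow> j \<noteq> k \<Longrightarrow> T j \<inter> T k = \<Gamma>" "k < 3 \<Longrightarrow> T k \<subseteq> F \<inter> U"
proof -
  show "open U" and FU: "F \<inter> U = (\<Union>k<3. T k)" using E by (simp_all add: edge_sheets_def)
  show sb: "k < 3 \<Longrightarrow> surface_with_boundary (T k)" using E by (simp add: edge_sheets_def)
  then show "k < 3 \<Longrightarrow> surface_with_corners (T k)" by (auto simp: surface_with_boundary_def surface_with_corners_def)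
  show bd: "k < 3 \<Longrightarrow> surface_boundary (T k) = \<Gamma>" using E by (simp add: edge_sheets_def)
  show "k < 3 \<Longrightarrow> \<Gamma> \<subseteq> T k" using bd surface_boundary_def by blast
  show "j < 3 \<Longrightarrow> k < 3 \<Longrightarrow> j \<noteq> k \<Longrightarrow> T j \<inter> T k = \<Gamma>" using E by (simp add: edge_sheets_def)
  show "k < 3 \<Longrightarrow> T k \<subseteq> F \<inter> U" unfolding FU by blast
qed

lemma sheet_chart:
  assumes "k < 3" "q \<in> \<Gamma>"
  obtains W and \<phi> :: "real^2 \<Rightarrow> real^3" where "C1_chart half_plane (T k) W \<phi>" "smooth_on \<phi> W" "0 \<in> W" "\<phi> 0 = q"
proof -
  have "q \<in> T k" "q \<notin> regular_points (T k)" using sheet_basic(5)[OF assms(1)] assms(2) by (auto simp: surface_boundary_def)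
  then have "boundary_point (T k) q" using sheet_basic(3)[OF assms(1)] by (auto simp: surface_with_boundary_def)
  from boundary_pointE[OF this] show ?thesis using that by metis
qed

lemma sheet_conormal:
  assumes "k < 3" "q \<in> \<Gamma>"
  shows "is_outward_conormal (T k) q (outward_conormal (T k) q)"
proof -
  obtain W and \<phi> :: "real^2 \<Rightarrow> real^3" where ch: "C1_chart half_plane (T k) W \<phi>" "smooth_on \<phi> W" "0 \<in> W" "\<phi> 0 = q"
    using sheet_chart[OF assms] .
  from outward_conormal_chart(2)[OF ch(1-3)] ch(4) show ?thesis by simp
qed

lemma sheet_conormal_inner:
  assumes "j < 3" "k < 3" "q \<in> \<Gamma>"
  shows "outward_conormal (T j) q \<bullet> outward_conormal (T k) q = (if j = k then 1 else - 1 / 2)"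
proof -
  let ?a = "outward_conormal (T j) q" and ?b = "outward_conormal (T k) q"
  have n: "norm ?a = 1" "norm ?b = 1" using sheet_conormal assms by (auto simp: is_outward_conormal_def)
  show ?thesis
  proof (cases "j = k")
    case True
    then show ?thesis using n by (simp add: norm_eq_1)
  next
    case False
    then have "angle ?a ?b = 2 * pi / 3" using E assms by (simp add: edge_sheets_def)
    then have "arccos (?a \<bullet> ?b) = 2 * pi / 3" by (simp add: angle_def n)
    moreover have "\<bar>?a \<bullet> ?b\<bar> \<le> 1" using Cauchy_Schwarz_ineq2[of ?a ?b] n by simp
    ultimately have "?a \<bullet> ?b = cos (2 * pi / 3)" by (metis cos_arccos_abs)
    then show ?thesis using False by (simp add: cos_120)
  qed
qed

text \<open>The squared norm of the sum is 3 + 6 * (-1/2) = 0.\<close>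

lemma sheet_conormal_sum:
  assumes "q \<in> \<Gamma>"
  shows "(\<Sum>k<3. outward_conormal (T k) q) = 0"
proof -
  let ?\<nu> = "\<lambda>k. outward_conormal (T k) q"
  have i: "?\<nu> j \<bullet> ?\<nu> k = (if j = k then 1 else - 1 / 2)" if "j < 3" "k < 3" for j k
    by (rule sheet_conormal_inner[OF that assms])
  have s: "(\<Sum>k<3. f k) = f 0 + f 1 + f 2" for f :: "nat \<Rightarrow> real^3" by (simp add: eval_nat_numeral)
  have "(?\<nu> 0 + ?\<nu> 1 + ?\<nu> 2) \<bullet> (?\<nu> 0 + ?\<nu> 1 + ?\<nu> 2) = 0"
    by (simp add: inner_add_left inner_add_right i)
  then show ?thesis unfolding s by simp
qed

text \<open>In a common plane both conormals would be orthogonal to the tangent of the edge, so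
  their inner product would be 1 or -1; the angle makes it -1/2. This shows both that edge points
  are not regular and that different sheets belong to different pieces.\<close>

lemma sheets_not_in_plane:
  fixes D :: "real^2 \<Rightarrow> real^3"
  assumes q: "q \<in> \<Gamma>" and jk: "j < 3" "k < 3" "j \<noteq> k" and D: "linear D"
    and c: "tangent_cone (T j) q \<subseteq> range D" "tangent_cone (T k) q \<subseteq> range D"
  shows False
proof -
  let ?a = "outward_conormal (T j) q" and ?b = "outward_conormal (T k) q"
  obtain W and \<phi> :: "real^2 \<Rightarrow> real^3" where ch: "C1_chart half_plane (T j) W \<phi>" "smooth_on \<phi> W" "0 \<in> W" "\<phi> 0 = q"
    using sheet_chart[OF jk(1) q] .
  have "tangent_cone \<Gamma> q = range (\<lambda>c. c *\<^sub>R pd \<phi> 2 0)"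
    using half_plane_tangent(3)[OF ch(1-3)] sheet_basic(5)[OF jk(1)] ch(4) by simp
  then have t: "pd \<phi> 2 0 \<in> tangent_cone \<Gamma> q" by (metis rangeI scaleR_one)
  have t0: "pd \<phi> 2 0 \<noteq> 0" using cross3_normal_facts(2)[OF ch(1,3)] .
  have "tangent_cone \<Gamma> q \<subseteq> tangent_cone (T j) q"
    by (rule tangent_cone_local_subset[OF open_UNIV]) (use sheet_basic(6)[OF jk(1)] in auto)
  then have tD: "pd \<phi> 2 0 \<in> range D" using t c(1) by blast
  have ort: "outward_conormal (T i) q \<bullet> pd \<phi> 2 0 = 0" if "i < 3" for i
    using sheet_conormal[OF that q] sheet_basic(5)[OF that] t span_base[OF t]
    by (auto simp: is_outward_conormal_def tangent_space_def)
  have rng: "outward_conormal (T i) q \<in> range D" if "i < 3" "tangent_cone (T i) q \<subseteq> range D" for i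
  proof -
    have "- outward_conormal (T i) q \<in> range D" using sheet_conormal[OF that(1) q] that(2) by (auto simp: is_outward_conormal_def)
    from linear_range_neg[OF D this] show ?thesis by simp
  qed
  have "(?a \<bullet> ?b)\<^sup>2 = 1"
    by (rule orthogonal_in_plane[OF D rng[OF jk(1) c(1)] rng[OF jk(2) c(2)] tD ort[OF jk(1)] ort[OF jk(2)] t0])
      (use sheet_conormal_inner[OF jk(1) jk(1) q] sheet_conormal_inner[OF jk(2) jk(2) q] in simp_all)
  then show False using sheet_conormal_inner[OF jk(1,2) q] jk(3) by (simp add: power2_eq_square)
qed

end

lemma edge_points_not_regular: "edge_points F \<inter> regular_points F = {}"
proof (intro equals0I)
  fix p assume p: "p \<in> edge_points F \<inter> regular_points F"
  then obtain U \<Gamma> T where E: "edge_sheets F U \<Gamma> T" "p \<in> U" "p \<in> \<Gamma>" by (auto simp: edge_points_iff)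
  obtain D :: "real^2 \<Rightarrow> real^3" where D: "linear D" "tangent_cone F p = range D"
    using p regular_cone[of p F] by (metis IntD2)
  have "tangent_cone (T k) p \<subseteq> range D" if "k < 3" for k
    unfolding D(2)[symmetric] by (rule tangent_cone_local_subset[OF open_UNIV]) (use sheet_basic(8)[OF E(1) that] in auto)
  from sheets_not_in_plane[OF E(1,3) _ _ _ D(1) this this, of 0 1] show False by simp
qed

lemma isolated_countable:
  fixes A :: "'a::second_countable_topology set"
  assumes "\<And>x. x \<in> A \<Longrightarrow> \<exists>V. open V \<and> x \<in> V \<and> A \<inter> V \<subseteq> {x}"
  shows "countable A"
proof -
  obtain V where V: "\<And>x. x \<in> A \<Longrightarrow> open (V x) \<and> x \<in> V x \<and> A \<inter> V x \<subseteq> {x}" using assms by metis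
  then have "\<And>S. S \<in> V ` A \<Longrightarrow> open S" by auto
  then obtain \<G> where G: "\<G> \<subseteq> V ` A" "countable \<G>" "\<Union>\<G> = \<Union>(V ` A)" by (rule Lindelof)
  have "A \<subseteq> (\<Union>B\<in>\<G>. A \<inter> B)"
  proof
    fix x assume x: "x \<in> A"
    then have "x \<in> \<Union>\<G>" unfolding G(3) using V[OF x] by blast
    then show "x \<in> (\<Union>B\<in>\<G>. A \<inter> B)" using x by blast
  qed
  moreover have "countable (\<Union>B\<in>\<G>. A \<inter> B)"
  proof (intro countable_UN[OF G(2)])
    fix B assume "B \<in> \<G>"
    then obtain x where "x \<in> A" "B = V x" using G(1) by blast
    then have "A \<inter> B \<subseteq> {x}" using V[of x] by simp
    then show "countable (A \<inter> B)" by (rule countable_subset) simp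
  qed
  ultimately show ?thesis by (rule countable_subset)
qed

text \<open>The sectors at a vertex overlap only in the vertex and in the four arcs, whose other
  points are edge points. A nearby point off these lies in the interior of exactly one sector, hence
  is regular. Isolation makes the exceptional set countable.\<close>

lemma vertices_isolated:
  assumes "v \<in> vertices F"
  obtains V where "open V" "v \<in> V" "F \<inter> V \<subseteq> insert v (regular_points F \<union> edge_points F)"
proof -
  obtain U and \<gamma> :: "nat \<Rightarrow> real \<Rightarrow> real^3" and S :: "nat \<Rightarrow> nat \<Rightarrow> (real^3) set" where
    U: "open U" "v \<in> U" and g: "\<And>i. i < 4 \<Longrightarrow> \<gamma> i 0 = v \<and> \<gamma> i ` {0<..<1} \<subseteq> edge_points F"
    and FU: "F \<inter> U = (\<Union>j<4. \<Union>i<j. S i j)"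
    and S: "\<And>i j. j < 4 \<Longrightarrow> i < j \<Longrightarrow> surface_with_corners (S i j) \<and>
           surface_boundary (S i j) = \<gamma> i ` {0..<1} \<union> \<gamma> j ` {0..<1}"
    and SS: "\<And>i j k l. j < 4 \<Longrightarrow> i < j \<Longrightarrow> l < 4 \<Longrightarrow> k < l \<Longrightarrow> (i, j) \<noteq> (k, l) \<Longrightarrow>
           S i j \<inter> S k l = {v} \<union> (\<Union>m\<in>{i, j} \<inter> {k, l}. \<gamma> m ` {0..<1})"
  proof -
    obtain U \<gamma> S where
        h: "open U" "v \<in> U"
        "\<forall>i<4. \<gamma> i 0 = v \<and> Ck_on 1 (\<gamma> i) {-1<..<1} \<and> inj_on (\<gamma> i) {0..<1} \<and>
           (\<forall>t\<in>{0..<1}. vector_derivative (\<gamma> i) (at t) \<noteq> 0) \<and> \<gamma> i ` {0<..<1} \<subseteq> edge_points F"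
        "F \<inter> U = (\<Union>j<(4::nat). \<Union>i<j. S i j)"
        "\<forall>j<4. \<forall>i<j. surface_with_corners (S i j) \<and>
           surface_boundary (S i j) = \<gamma> i ` {0..<1} \<union> \<gamma> j ` {0..<1}"
        "\<forall>j<4. \<forall>i<j. \<forall>l<4. \<forall>k<l. (i, j) \<noteq> (k, l) \<longrightarrow>
           S i j \<inter> S k l = {v} \<union> (\<Union>m\<in>{i, j} \<inter> {k, l}. \<gamma> m ` {0..<1})"
      using assms unfolding vertices_def mem_Collect_eq by (elim exE conjE) (rule that)
    show ?thesis
    proof (rule that[OF h(1,2) _ h(4)])
      show "\<gamma> i 0 = v \<and> \<gamma> i ` {0<..<1} \<subseteq> edge_points F" if "i < 4" for i using h(3) that by simp
      show "surface_with_corners (S i j) \<and> surface_boundary (S i j) = \<gamma> i ` {0..<1} \<union> \<gamma> j ` {0..<1}"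
        if "j < 4" "i < j" for i j using h(5) that by simp
      show "S i j \<inter> S k l = {v} \<union> (\<Union>m\<in>{i, j} \<inter> {k, l}. \<gamma> m ` {0..<1})"
        if "j < 4" "i < j" "l < 4" "k < l" "(i, j) \<noteq> (k, l)" for i j k l by (rule h(6)[rule_format, OF that])
    qed
  qed
  define I :: "(nat \<times> nat) set" where "I = {(i, j). i < j \<and> j < 4}"
  define T where "T = (\<lambda>(i, j). S i j)"
  have I: "finite I" by (rule finite_subset[of _ "{..<4} \<times> {..<4}"]) (auto simp: I_def)
  have FU': "F \<inter> U = (\<Union>i\<in>I. T i)"
  proof (intro subset_antisym subsetI)
    fix x assume "x \<in> F \<inter> U"
    then obtain i j where "j < 4" "i < j" "x \<in> S i j" unfolding FU by blast
    then show "x \<in> (\<Union>i\<in>I. T i)" by (intro UN_I[of "(i, j)"]) (simp_all add: I_def T_def)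
  next
    fix x assume "x \<in> (\<Union>i\<in>I. T i)"
    then obtain i j where "j < 4" "i < j" "x \<in> S i j" by (auto simp: I_def T_def)
    then show "x \<in> F \<inter> U" unfolding FU by blast
  qed
  have edge: "x \<in> edge_points F" if x: "x \<in> \<gamma> i ` {0..<1}" "x \<noteq> v" "i < 4" for x i
  proof -
    obtain t where t: "t \<in> {0..<1}" "x = \<gamma> i t" using x(1) by blast
    then have "t \<noteq> 0" using g[OF x(3)] x(2) by metis
    then have "t \<in> {0<..<1}" using t(1) by simp
    then show ?thesis using g[OF x(3)] t(2) by blast
  qed
  have T: "surface_with_corners (T k) \<and> v \<in> T k" if k: "k \<in> I" for k
  proof -
    obtain i j where ij: "k = (i, j)" "i < j" "j < 4" using k by (auto simp: I_def)
    have "\<gamma> i 0 \<in> surface_boundary (S i j)" using S[OF ij(3,2)] by auto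
    then have "v \<in> S i j" using g[of i] ij by (auto simp: surface_boundary_def)
    then show ?thesis using S[OF ij(3,2)] by (simp add: T_def ij(1))
  qed
  obtain r where r: "r > 0" "ball v r \<subseteq> U"
    "\<And>x i. x \<in> ball v r \<Longrightarrow> i \<in> I \<Longrightarrow> x \<in> regular_points (T i) \<Longrightarrow>
       (\<And>j. j \<in> I \<Longrightarrow> j \<noteq> i \<Longrightarrow> x \<notin> T j) \<Longrightarrow> x \<in> regular_points F"
    using regular_in_union[OF U FU' I T] by metis
  show ?thesis
  proof (rule that[of "ball v r"])
    show "open (ball v r)" by (rule open_ball)
    show "v \<in> ball v r" using r(1) by simp
    show "F \<inter> ball v r \<subseteq> insert v (regular_points F \<union> edge_points F)"
    proof
      fix x assume x: "x \<in> F \<inter> ball v r"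
      show "x \<in> insert v (regular_points F \<union> edge_points F)"
      proof (cases "x = v \<or> x \<in> edge_points F")
        case False
        then have xv: "x \<noteq> v" "x \<notin> edge_points F" by auto
        have "x \<in> F \<inter> U" using x r(2) by blast
        then obtain i j where ij: "i < j" "j < 4" "x \<in> S i j" unfolding FU by blast
        \<comment> \<open>Off the arcs the point avoids the boundary of its sector as well as every
          intersection with another sector.\<close>
        have arc: "x \<notin> \<gamma> m ` {0..<1}" if "m < 4" for m using edge[OF _ xv(1) that] xv(2) by blast
        have "x \<notin> surface_boundary (S i j)" using S[OF ij(2,1)] arc[of i] arc[of j] ij by simp
        then have xr: "x \<in> regular_points (T (i, j))" using ij(3) by (auto simp: surface_boundary_def T_def)
        have "x \<in> regular_points F"
        proof (rule r(3)[OF _ _ xr])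
          show "x \<in> ball v r" using x by blast
          show "(i, j) \<in> I" using ij by (simp add: I_def)
          fix k assume k: "k \<in> I" "k \<noteq> (i, j)"
          obtain a b where ab: "k = (a, b)" "a < b" "b < 4" using k(1) by (auto simp: I_def)
          have eq: "S i j \<inter> S a b = {v} \<union> (\<Union>m\<in>{i, j} \<inter> {a, b}. \<gamma> m ` {0..<1})"
            by (rule SS[OF ij(2,1) ab(3,2)]) (use k(2) ab(1) in auto)
          show "x \<notin> T k"
          proof
            assume "x \<in> T k"
            then have "x \<in> S i j \<inter> S a b" using ij(3) ab(1) by (simp add: T_def)
            then obtain m where "m \<in> {i, j}" "x \<in> \<gamma> m ` {0..<1}" unfolding eq using xv(1) by blast
            then show False using arc[of m] ij by auto
          qed
        qed
        then show ?thesis by blast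
      qed auto
    qed
  qed
qed

lemma exceptional_points_countable:
  assumes "F = regular_points F \<union> edge_points F \<union> vertices F"
  shows "countable (F - (regular_points F \<union> edge_points F))"
proof (rule isolated_countable)
  fix v assume v: "v \<in> F - (regular_points F \<union> edge_points F)"
  then have "v \<in> vertices F" using assms by blast
  then obtain V where "open V" "v \<in> V" "F \<inter> V \<subseteq> insert v (regular_points F \<union> edge_points F)"
    by (rule vertices_isolated)
  then show "\<exists>V. open V \<and> v \<in> V \<and> (F - (regular_points F \<union> edge_points F)) \<inter> V \<subseteq> {v}" by blast
qed

section \<open>Cancellation along the edges\<close>

text \<open>One parametrization covers the common part of the two sets in \<open>N\<close>, and both
  measures are computed from it. This lets the pieces that share an edge be compared by one length
  measure.\<close>

lemma arc_length_measure_local: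
  fixes \<phi> :: "real^2 \<Rightarrow> real^3"
  assumes C: "C \<in> sets borel" "C' \<in> sets borel" and N: "open N" "C \<inter> N = C' \<inter> N"
    and ch: "C1_chart boundary_line C W \<phi>" "smooth_on \<phi> W" "C \<inter> N \<subseteq> \<phi> ` (W \<inter> boundary_line)"
    and B: "B \<in> sets borel" "B \<subseteq> N"
  shows "emeasure (arc_length_measure C) B = emeasure (arc_length_measure C') B"
proof -
  define W' where "W' = W \<inter> \<phi> -` N"
  define W1 where "W1 = {t. t *\<^sub>R axis 2 1 \<in> W'}"
  define \<gamma> where "\<gamma> = (\<lambda>t. \<phi> (t *\<^sub>R axis 2 1))"
  have "emeasure (arc_length_measure D) B = (\<integral>\<^sup>+t\<in>W1 \<inter> \<gamma> -` (B \<inter> C). ennreal (norm (vector_derivative \<gamma> (at t))) \<partial>lborel)"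
    if D: "D \<in> sets borel" "C \<inter> N = D \<inter> N" for D
  proof -
    have ch': "C1_chart boundary_line D W' \<phi>" unfolding W'_def by (rule C1_chart_localize[OF ch(1) N(1) D(2)])
    have sm: "smooth_on \<phi> W'" by (rule smooth_on_subset[OF ch(2)]) (auto simp: W'_def)
    have img: "\<gamma> ` W1 = \<phi> ` (W' \<inter> boundary_line)" unfolding W1_def \<gamma>_def by (rule line_curve(4)[OF ch'])
    have BW: "B \<inter> C \<subseteq> \<gamma> ` W1"
    proof
      fix x assume x: "x \<in> B \<inter> C"
      then have "x \<in> C \<inter> N" using B(2) by blast
      then obtain u where "x = \<phi> u" "u \<in> W" "u \<in> boundary_line" using ch(3) by blast
      then show "x \<in> \<gamma> ` W1" unfolding img W'_def using \<open>x \<in> C \<inter> N\<close> by blast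
    qed
    have cp: "curve_param D W1 \<gamma>" unfolding W1_def \<gamma>_def by (rule line_curve(3)[OF ch' sm])
    then have BD: "B \<inter> C \<subseteq> curve_points D" using BW unfolding curve_points_def by blast
    have "B - C \<subseteq> - curve_points D"
    proof
      fix x assume x: "x \<in> B - C"
      then have "x \<in> N" "x \<notin> C" using B(2) by auto
      then have "x \<notin> D" using D(2) by blast
      then show "x \<in> - curve_points D" using curve_points_subset[of D] by blast
    qed
    \<comment> \<open>The rest of \<open>B\<close> lies off the curve, where the specification of
      the measure puts no mass.\<close>
    then have "emeasure (arc_length_measure D) (B - C) \<le> emeasure (arc_length_measure D) (- curve_points D)"
      by (rule emeasure_mono) (use sets_arc_length_measure[OF D(1)] curve_points_borel[OF D(1)] in auto)
    then have "emeasure (arc_length_measure D) (B - C) = 0" using arc_length_measure_null[OF D(1)] by simp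
    then have "B - C \<in> null_sets (arc_length_measure D)"
      using B(1) C(1) sets_arc_length_measure[OF D(1)] by (auto simp: null_sets_def)
    then have "emeasure (arc_length_measure D) ((B \<inter> C) \<union> (B - C)) = emeasure (arc_length_measure D) (B \<inter> C)"
      by (rule emeasure_Un_null_set[rotated]) (use B(1) C(1) sets_arc_length_measure[OF D(1)] in auto)
    moreover have "(B \<inter> C) \<union> (B - C) = B" by blast
    ultimately show ?thesis
      using emeasure_arc_chart[OF D(1) curve_param_C1_chart[OF cp] _ BW BD] B(1) C(1) by simp
  qed
  from this[OF C(1) refl] this[OF C(2) N(2)] show ?thesis by simp
qed

lemma integral_eq_on:
  fixes f :: "'a::topological_space \<Rightarrow> real"
  assumes s: "sets M = sets borel" "sets M' = sets borel" and N: "N \<in> sets borel"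
    and e: "\<And>B. B \<in> sets borel \<Longrightarrow> B \<subseteq> N \<Longrightarrow> emeasure M B = emeasure M' B"
  shows "(\<integral>x. indicator N x *\<^sub>R f x \<partial>M) = (\<integral>x. indicator N x *\<^sub>R f x \<partial>M')"
proof -
  have sp: "space M = UNIV" "space M' = UNIV" using s by (auto dest: sets_eq_imp_space_eq)
  have "restrict_space M N = restrict_space M' N"
  proof (rule measure_eqI)
    show "sets (restrict_space M N) = sets (restrict_space M' N)" by (simp add: sets_restrict_space s)
    fix A assume "A \<in> sets (restrict_space M N)"
    then obtain B where "B \<in> sets borel" "A = N \<inter> B" by (auto simp: sets_restrict_space s)
    then have A: "A \<in> sets borel" "A \<subseteq> N" using N by auto
    then show "emeasure (restrict_space M N) A = emeasure (restrict_space M' N) A"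
      using e N by (simp add: emeasure_restrict_space sp s)
  qed
  then have "integral\<^sup>L (restrict_space M N) f = integral\<^sup>L (restrict_space M' N) f" by simp
  then show ?thesis using N by (simp add: integral_restrict_space sp s)
qed

lemma outward_conormal_local:
  assumes "open V" "p \<in> V" "S \<inter> V = S' \<inter> V"
  shows "outward_conormal S p = outward_conormal S' p"
proof -
  have "tangent_space S p = tangent_space S' p" "tangent_cone S p = tangent_cone S' p"
    "tangent_space (surface_boundary S) p = tangent_space (surface_boundary S') p"
    by (rule tangent_space_local[OF assms] tangent_cone_local[OF assms]
        tangent_space_local[OF assms(1,2) surface_boundary_local_Int[OF assms(1,3)]])+
  then have "is_outward_conormal S p = is_outward_conormal S' p"
    by (intro ext) (simp add: is_outward_conormal_def)
  then show ?thesis by (simp add: outward_conormal_def)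
qed

text \<open>\<open>P k\<close> is the part of sheet \<open>k\<close> near \<open>p\<close> without
  the edge. Being connected and contained in the regular points inside \<open>G\<close>, it
  determines the component to which the sheet belongs, and its closure recovers the sheet in
  \<open>N\<close>.\<close>

lemma edge_sheets_nbhd:
  assumes E: "edge_sheets F U \<Gamma> T" and p: "p \<in> U" "p \<in> \<Gamma>" and G: "open G" "p \<in> G"
  obtains N P W and \<phi> :: "real^2 \<Rightarrow> real^3" where "open N" "p \<in> N" "N \<subseteq> G \<inter> U"
    "\<And>k. k < (3::nat) \<Longrightarrow> connected (P k) \<and> P k \<subseteq> regular_points F \<inter> G \<and> P k \<subseteq> T k
       \<and> T k \<inter> N \<subseteq> closure (P k) \<and> T k \<inter> N \<subseteq> P k \<union> \<Gamma> \<and> closure (T k) \<inter> N \<subseteq> T k"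
    "C1_chart boundary_line \<Gamma> W \<phi>" "smooth_on \<phi> W" "\<Gamma> \<inter> N \<subseteq> \<phi> ` (W \<inter> boundary_line)"
proof -
  note basic = sheet_basic[OF E]
  have pT: "p \<in> T k" if "k < 3" for k using basic(6)[OF that] p(2) by blast
  have T: "surface_with_corners (T k) \<and> p \<in> T k" if "k \<in> {..<3}" for k
    using that basic(4)[of k] pT[of k] by simp
  obtain r where r: "r > 0" "ball p r \<subseteq> U" "\<And>i. i \<in> {..<3} \<Longrightarrow> closed (T i \<inter> cball p r)"
    and reg: "\<And>x i. x \<in> ball p r \<Longrightarrow> i \<in> {..<3} \<Longrightarrow> x \<in> regular_points (T i) \<Longrightarrow>
       (\<And>j. j \<in> {..<3} \<Longrightarrow> j \<noteq> i \<Longrightarrow> x \<notin> T j) \<Longrightarrow> x \<in> regular_points F"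
    using regular_in_union[OF basic(1) p(1) basic(2) finite_lessThan T] by metis
  have ex: "\<exists>V P. open V \<and> p \<in> V \<and> connected P \<and> P \<subseteq> regular_points F \<inter> G \<and> P \<subseteq> T k \<and>
      T k \<inter> V \<subseteq> closure P \<and> T k \<inter> V \<subseteq> P \<union> \<Gamma> \<and>
      (\<exists>W. \<exists>\<phi> :: real^2 \<Rightarrow> real^3. C1_chart half_plane (T k) W \<phi> \<and> smooth_on \<phi> W \<and> T k \<inter> V \<subseteq> \<phi> ` (W \<inter> half_plane))"
    if k: "k < 3" for k
  proof -
    obtain W and \<phi> :: "real^2 \<Rightarrow> real^3" where ch: "C1_chart half_plane (T k) W \<phi>" "smooth_on \<phi> W" "0 \<in> W" "\<phi> 0 = p"
      using sheet_chart[OF E k p(2)] .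
    note cont = C1_chart_continuous[OF ch(1)]
    have "open (W \<inter> \<phi> -` (ball p r \<inter> G))"
      using continuous_open_preimage[OF cont C1_chart_open[OF ch(1)] open_Int[OF open_ball G(1)]] .
    moreover have "0 \<in> W \<inter> \<phi> -` (ball p r \<inter> G)" using ch(3,4) r(1) G(2) by simp
    ultimately obtain d where d: "d > 0" "cball 0 d \<subseteq> W \<inter> \<phi> -` (ball p r \<inter> G)" using open_contains_cball by metis
    let ?B = "ball (0::real^2) d"
    have BW: "?B \<subseteq> W" and BG: "\<phi> ` ?B \<subseteq> ball p r \<inter> G" using d(2) ball_subset_cball[of 0 d] by blast+
    have ch': "C1_chart half_plane (T k) ?B \<phi>" by (rule C1_chart_restrict[OF ch(1) open_ball BW])
    have sm': "smooth_on \<phi> ?B" by (rule smooth_on_subset[OF ch(2) BW])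
    obtain V where V: "open V" "\<phi> ` (?B \<inter> half_plane) = T k \<inter> V" using C1_chart_image_openin[OF ch'] .
    \<comment> \<open>The image of an open half disc: convexity of the half disc gives connectedness
      of \<open>P\<close>.\<close>
    define P where "P = \<phi> ` (?B \<inter> interior half_plane)"
    have cvx: "convex half_plane" by (rule convexI) (simp add: half_plane_def)
    have ih: "u \<in> interior half_plane \<longleftrightarrow> 0 < u $ 1" for u unfolding interior_half_plane by simp
    have hp: "interior half_plane \<subseteq> half_plane" by (rule interior_subset)
    have PT: "P \<subseteq> T k \<inter> V" unfolding P_def V(2)[symmetric] using hp by blast
    have pV: "p \<in> V"
    proof -
      have "0 \<in> ?B \<inter> half_plane" using d(1) by (simp add: half_plane_def)
      then have "\<phi> 0 \<in> \<phi> ` (?B \<inter> half_plane)" by (rule imageI)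
      then show ?thesis unfolding V(2) ch(4) by blast
    qed
    have conn: "connected P" unfolding P_def
      by (intro connected_continuous_image continuous_on_subset[OF cont] convex_connected convex_Int convex_ball convex_interior[OF cvx])
        (use BW in blast)
    have rT: "x \<in> regular_points (T k)" if x: "x \<in> P" for x
    proof -
      obtain u where u: "x = \<phi> u" "u \<in> ?B" "0 < u $ 1" using x ih unfolding P_def by blast
      then show ?thesis using half_plane_chart_regular_iff[OF ch' sm' u(2)] by (simp add: half_plane_def)
    qed
    have PF: "P \<subseteq> regular_points F \<inter> G"
    proof
      fix x assume x: "x \<in> P"
      have xB: "x \<in> ball p r \<inter> G" using x BG unfolding P_def by blast
      have "x \<notin> \<Gamma>" using rT[OF x] basic(5)[OF k] by (auto simp: surface_boundary_def)
      have "x \<in> regular_points F"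
      proof (rule reg[OF _ _ rT[OF x]])
        fix j assume j: "j \<in> {..<3}" "j \<noteq> k"
        have "T j \<inter> T k = \<Gamma>" by (rule basic(7)) (use j k in auto)
        then show "x \<notin> T j" using \<open>x \<notin> \<Gamma>\<close> x PT by blast
      qed (use xB k in auto)
      then show "x \<in> regular_points F \<inter> G" using xB by blast
    qed
    have cl: "T k \<inter> V \<subseteq> closure P"
    proof -
      have "half_plane \<subseteq> closure (interior half_plane)"
      proof -
        have "axis 1 1 \<in> interior half_plane" unfolding ih by simp
        then have "closure (interior half_plane) = closure half_plane" by (intro convex_closure_interior[OF cvx]) blast
        then show ?thesis using closure_subset by simp
      qed
      \<comment> \<open>Boundary parameters are limits of interior ones inside the same disc, so
        edge points of the sheet are limits of \<open>P\<close>.\<close>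
      then have "?B \<inter> half_plane \<subseteq> closure (?B \<inter> interior half_plane)"
        using open_Int_closure_subset[OF open_ball, of 0 d "interior half_plane"] by blast
      moreover have "closure (?B \<inter> interior half_plane) \<subseteq> W"
      proof -
        have "closure (?B \<inter> interior half_plane) \<subseteq> cball 0 d"
          by (rule closure_minimal) (use ball_subset_cball[of 0 d] in auto)
        then show ?thesis using d(2) by blast
      qed
      then have "\<phi> ` closure (?B \<inter> interior half_plane) \<subseteq> closure P" unfolding P_def
        by (rule continuous_image_closure_subset[OF cont])
      ultimately show ?thesis unfolding V(2)[symmetric] by blast
    qed
    have pg: "T k \<inter> V \<subseteq> P \<union> \<Gamma>"
    proof
      fix x assume x: "x \<in> T k \<inter> V"
      then obtain u where u: "x = \<phi> u" "u \<in> ?B" "u \<in> half_plane" unfolding V(2)[symmetric] by blast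
      show "x \<in> P \<union> \<Gamma>"
      proof (cases "0 < u $ 1")
        case True
        then show ?thesis unfolding P_def u(1) using u(2) ih by blast
      next
        case False
        then have "x \<notin> regular_points (T k)" using half_plane_chart_regular_iff[OF ch' sm' u(2,3)] u(1) by simp
        then have "x \<in> surface_boundary (T k)" using x by (simp add: surface_boundary_def)
        then show ?thesis using basic(5)[OF k] by blast
      qed
    qed
    have "T k \<inter> V \<subseteq> \<phi> ` (?B \<inter> half_plane)" using V(2) by simp
    then show ?thesis
      by (intro exI[of _ V] exI[of _ P] conjI V(1) pV conn PF cl pg) (use PT ch' sm' in blast)+
  qed
  then obtain V P where VP: "\<And>k. k < 3 \<Longrightarrow> open (V k) \<and> p \<in> V k \<and> connected (P k) \<and> P k \<subseteq> regular_points F \<inter> G \<and> P k \<subseteq> T k \<and>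
      T k \<inter> V k \<subseteq> closure (P k) \<and> T k \<inter> V k \<subseteq> P k \<union> \<Gamma> \<and>
      (\<exists>W. \<exists>\<phi> :: real^2 \<Rightarrow> real^3. C1_chart half_plane (T k) W \<phi> \<and> smooth_on \<phi> W \<and> T k \<inter> V k \<subseteq> \<phi> ` (W \<inter> half_plane))"
    by metis
  obtain W and \<phi> :: "real^2 \<Rightarrow> real^3" where ch: "C1_chart half_plane (T 0) W \<phi>" "smooth_on \<phi> W" "T 0 \<inter> V 0 \<subseteq> \<phi> ` (W \<inter> half_plane)"
    using VP[of 0] by auto
  define N where "N = ball p r \<inter> G \<inter> (\<Inter>k\<in>{..<3}. V k)"
  have NV: "N \<subseteq> V k" if "k < 3" for k using that unfolding N_def by blast
  show ?thesis
  proof (rule that)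
    show "open N" unfolding N_def using VP G(1) by (intro open_Int open_ball open_INT) auto
    show "p \<in> N" unfolding N_def using VP G(2) r(1) by auto
    show "N \<subseteq> G \<inter> U" using r(2) unfolding N_def by blast
    fix k :: nat assume k: "k < 3"
    have "closure (T k) \<inter> N \<subseteq> T k"
    proof -
      have "ball p r \<inter> closure (T k) \<subseteq> closure (ball p r \<inter> T k)" by (rule open_Int_closure_subset[OF open_ball])
      also have "\<dots> \<subseteq> T k \<inter> cball p r" by (rule closure_minimal) (use r(3) k ball_subset_cball[of p r] in auto)
      finally show ?thesis unfolding N_def by blast
    qed
    then show "connected (P k) \<and> P k \<subseteq> regular_points F \<inter> G \<and> P k \<subseteq> T k
       \<and> T k \<inter> N \<subseteq> closure (P k) \<and> T k \<inter> N \<subseteq> P k \<union> \<Gamma> \<and> closure (T k) \<inter> N \<subseteq> T k"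
      using VP[OF k] NV[OF k] by blast
  next
    show "C1_chart boundary_line \<Gamma> W \<phi>" using half_plane_boundary_chart[OF ch(1,2)] basic(5)[of 0] by simp
    show "smooth_on \<phi> W" by (rule ch(2))
    show "\<Gamma> \<inter> N \<subseteq> \<phi> ` (W \<inter> boundary_line)"
    proof
      fix x assume x: "x \<in> \<Gamma> \<inter> N"
      then have "x \<in> T 0 \<inter> V 0" using basic(6)[of 0] NV[of 0] by auto
      then obtain u where u: "x = \<phi> u" "u \<in> W" "u \<in> half_plane" using ch(3) by blast
      have "x \<notin> regular_points (T 0)" using x basic(5)[of 0] by (auto simp: surface_boundary_def)
      then have "\<not> 0 < u $ 1" using half_plane_chart_regular_iff[OF ch(1,2) u(2,3)] u(1) by simp
      then have "u \<in> boundary_line" using u(3) by (simp add: half_plane_def)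
      then show "x \<in> \<phi> ` (W \<inter> boundary_line)" using u by blast
    qed
  qed
qed

section \<open>The part of a foam in a ball\<close>

text \<open>The field is given as a C1 map on an open set around the closed ball, the form in which
  the divergence theorem for a piece takes it.\<close>

locale foam_disc =
  fixes F :: "(real^3) set" and R :: real and nn :: "(real^3) set \<Rightarrow> real^3 \<Rightarrow> real^3"
    and X :: "real^3 \<Rightarrow> real^3" and O' :: "(real^3) set"
  assumes foam_F: "foam F" and finite_disc: "finite (disc_faces F R)"
    and corners: "\<And>S. S \<in> disc_faces F R \<Longrightarrow> surface_with_corners S"
    and normal: "\<And>S. S \<in> disc_faces F R \<Longrightarrow> unit_normal_field S (nn S)"
    and O': "open O'" "cball 0 R \<subseteq> O'" "C1_on X O'"
begin

definition flux :: "(real^3) set \<Rightarrow> real^3 \<Rightarrow> real" where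
  "flux S x = indicator (surface_boundary S) x *\<^sub>R (X x \<bullet> outward_conormal S x)"

abbreviation "len S \<equiv> arc_length_measure (surface_boundary S)"

abbreviation "A \<equiv> regular_points F \<inter> ball 0 R"

lemma disc_faceE:
  assumes "S \<in> disc_faces F R"
  obtains C where "C \<in> components A" "S = closure C"
  using assms that by (auto simp: disc_faces_def faces_def)

lemma disc_faceI: "C \<in> components A \<Longrightarrow> closure C \<in> disc_faces F R"
  by (auto simp: disc_faces_def faces_def)

lemma disc_face_subset:
  assumes "S \<in> disc_faces F R"
  shows "S \<subseteq> F" "S \<subseteq> cball 0 R" "compact S"
proof -
  obtain C where C: "C \<in> components A" "S = closure C" using disc_faceE[OF assms] .
  have CA: "C \<subseteq> A" by (rule in_components_subset[OF C(1)])
  show "S \<subseteq> F" unfolding C(2)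
    by (rule closure_minimal) (use CA regular_points_subset foam_F in \<open>auto simp: foam_def\<close>)
  show S: "S \<subseteq> cball 0 R" unfolding C(2)
    by (rule closure_minimal) (use CA in auto)
  show "compact S" using S bounded_subset[OF bounded_cball S] unfolding C(2) by (simp add: compact_eq_bounded_closed)
qed

lemma disc_face_regular:
  assumes S: "S \<in> disc_faces F R" and p: "p \<in> S" "p \<in> regular_points F" "p \<in> ball 0 R"
  shows "p \<in> regular_points S"
proof -
  obtain C where C: "C \<in> components A" "S = closure C" using disc_faceE[OF S] .
  have "p \<in> closure C" using p(1) C(2) by simp
  then obtain V where V: "open V" "p \<in> V" "F \<inter> V \<subseteq> C"
    using component_closure_nhd[OF C(1) open_ball p(2,3)] by metis
  have "C \<subseteq> S" unfolding C(2) by (rule closure_subset)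
  then have "F \<inter> V = S \<inter> V" using V(3) disc_face_subset(1)[OF S] by blast
  from regular_points_local[OF V(1) this V(2) p(2)] show ?thesis .
qed

lemma disc_face_boundary:
  assumes S: "S \<in> disc_faces F R"
  shows "surface_boundary S \<inter> ball 0 R \<subseteq> edge_points F \<union> (F - (regular_points F \<union> edge_points F))"
proof
  fix x assume x: "x \<in> surface_boundary S \<inter> ball 0 R"
  then have "x \<in> S" "x \<notin> regular_points S" by (auto simp: surface_boundary_def)
  then have "x \<in> F" "x \<notin> regular_points F" using disc_face_regular[OF S] x disc_face_subset(1)[OF S] by blast+
  then show "x \<in> edge_points F \<union> (F - (regular_points F \<union> edge_points F))" by blast
qed

text \<open>The closure of a component may have regular points outside the regular part of the foam, where its
curvature is known only by continuity.\<close>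

lemma disc_face_compact_surface:
  assumes S: "S \<in> disc_faces F R"
  obtains h where "compact_surface S (nn S) h"
proof -
  obtain C where C: "C \<in> components A" "S = closure C" using disc_faceE[OF S] .
  have CA: "C \<subseteq> A" and C0: "C \<noteq> {}" and Cc: "connected C"
    using in_components_subset[OF C(1)] in_components_nonempty[OF C(1)] in_components_connected[OF C(1)] .
  have "C \<subseteq> regular_points F" "regular_points F \<noteq> {}" using CA C0 by auto
  from exists_component_superset[OF this Cc] obtain f where f: "f \<in> faces F" "C \<subseteq> f" unfolding faces_def by blast
  obtain m H where m: "unit_normal_field f m" "\<And>p. p \<in> f \<Longrightarrow> mean_curvature f m p = H"
    using foam_F f(1) unfolding foam_def by metis
  \<comment> \<open>On the open component the piece and the face of \<open>F\<close> coincide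
    locally. Their normals are chosen independently and agree up to sign, hence the absolute
    values.\<close>
  have onC: "\<bar>surface_div S (nn S) p\<bar> = 2 * \<bar>H\<bar>" if p: "p \<in> C" for p
  proof -
    have pF: "p \<in> regular_points F" "p \<in> ball 0 R" using p CA by auto
    have pc: "p \<in> closure C" using p closure_subset by blast
    have pf: "p \<in> f" using p f(2) by blast
    obtain V1 where V1: "open V1" "p \<in> V1" "F \<inter> V1 \<subseteq> C"
      using component_closure_nhd[OF C(1) open_ball pF pc] .
    have f': "f \<in> components (regular_points F \<inter> UNIV)" using f(1) by (simp add: faces_def)
    obtain V2 where V2: "open V2" "p \<in> V2" "F \<inter> V2 \<subseteq> f"
      using component_closure_nhd[OF f' open_UNIV pF(1) UNIV_I] pf closure_subset by blast
    have fF: "f \<subseteq> F" using in_components_subset[OF f'] regular_points_subset by blast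
    have CS: "C \<subseteq> S" unfolding C(2) by (rule closure_subset)
    have V: "open (V1 \<inter> V2)" "p \<in> V1 \<inter> V2" using V1 V2 by auto
    have Sf: "S \<inter> (V1 \<inter> V2) = f \<inter> (V1 \<inter> V2)"
      using V1(3) V2(3) fF CS disc_face_subset(1)[OF S] by blast
    have "p \<in> regular_points S" by (rule disc_face_regular[OF S _ pF]) (use p CS in blast)
    then obtain W and \<phi> :: "real^2 \<Rightarrow> real^3" and u where ch: "C1_chart UNIV S W \<phi>" "smooth_on \<phi> W" and u: "u \<in> W" "\<phi> u = p"
      by (rule regular_pointsE)
    have ui: "u \<in> interior UNIV" by simp
    let ?W = "W \<inter> \<phi> -` (V1 \<inter> V2)"
    have ch2: "C1_chart UNIV f ?W \<phi>" by (rule C1_chart_localize[OF ch(1) V(1) Sf])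
    have sm2: "smooth_on \<phi> ?W" by (rule smooth_on_subset[OF ch(2)]) blast
    have u2: "u \<in> ?W" using u V(2) by simp
    obtain \<sigma> where s: "\<sigma> = 1 \<or> \<sigma> = (-1::real)" "area_density \<phi> u * surface_div S (nn S) (\<phi> u) = \<sigma> * chart_curv \<phi> u"
      using surface_div_normal[OF ch u(1) ui normal[OF S]] by metis
    obtain \<tau> where t: "\<tau> = 1 \<or> \<tau> = (-1::real)" "area_density \<phi> u * surface_div f m (\<phi> u) = \<tau> * chart_curv \<phi> u"
      using surface_div_normal[OF ch2 sm2 u2 ui m(1)] by metis
    have "\<bar>area_density \<phi> u * surface_div S (nn S) p\<bar> = \<bar>area_density \<phi> u * surface_div f m p\<bar>"
      using s t u(2) by (auto simp: abs_mult)
    then have "\<bar>surface_div S (nn S) p\<bar> = \<bar>surface_div f m p\<bar>"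
      using area_density_pos[OF ch(1) u(1)] by (simp add: abs_mult)
    also have "surface_div f m p = - 2 * H" using m(2)[OF pf] by (simp add: mean_curvature_def)
    finally show ?thesis by (simp add: abs_mult)
  qed
  have "\<bar>surface_div S (nn S) p\<bar> \<le> 2 * \<bar>H\<bar>" if p: "p \<in> regular_points S" for p
  proof -
    obtain W and \<phi> :: "real^2 \<Rightarrow> real^3" and u where ch: "C1_chart UNIV S W \<phi>" "smooth_on \<phi> W" and u: "u \<in> W" "\<phi> u = p"
      using regular_pointsE[OF p] .
    note op = C1_chart_open[OF ch(1)]
    define g where "g v = \<bar>chart_curv \<phi> v\<bar> / area_density \<phi> v" for v
    have g: "g v = \<bar>surface_div S (nn S) (\<phi> v)\<bar>" if v: "v \<in> W" for v
    proof -
      have vi: "v \<in> interior UNIV" by simp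
      obtain \<sigma> where s: "\<sigma> = 1 \<or> \<sigma> = (-1::real)" "area_density \<phi> v * surface_div S (nn S) (\<phi> v) = \<sigma> * chart_curv \<phi> v"
        using surface_div_normal[OF ch v vi normal[OF S]] by metis
      then have "\<bar>chart_curv \<phi> v\<bar> = \<bar>area_density \<phi> v * surface_div S (nn S) (\<phi> v)\<bar>" by (auto simp: abs_mult)
      then show ?thesis using area_density_pos[OF ch(1) v] by (simp add: g_def abs_mult)
    qed
    have cn: "C1_on (chart_normal \<phi>) W" by (rule chart_normal_C1[OF ch])
    have cpd: "continuous_on W (pd \<phi> i)" for i using smooth_on_C1[OF smooth_on_pd[OF ch(2)]] by (rule C1_on_continuous)
    have cpn: "continuous_on W (pd (chart_normal \<phi>) i)" for i
      unfolding pd_def by (rule C1_on_continuous_deriv[OF cn])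
    have cont: "continuous_on W g" unfolding g_def chart_curv_def area_density_pd
      by (intro continuous_intros cpd cpn C1_on_continuous[OF cn] bounded_bilinear.continuous_on[OF bounded_bilinear_cross3])
        (use area_density_pos[OF ch(1)] in \<open>auto simp: area_density_pd\<close>)
    \<comment> \<open>The component is dense in its closure \<open>S\<close>, and \<open>g\<close>
      is continuous, so its constant value on the component persists at every regular point of
      \<open>S\<close>.\<close>
    have "g u = 2 * \<bar>H\<bar>"
    proof (rule ccontr)
      assume ne: "g u \<noteq> 2 * \<bar>H\<bar>"
      let ?W = "W \<inter> g -` (- {2 * \<bar>H\<bar>})"
      have "open ?W" using continuous_open_preimage[OF cont op open_Compl[OF closed_singleton]] .
      then have ch2: "C1_chart UNIV S ?W \<phi>" by (rule C1_chart_restrict[OF ch(1)]) blast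
      obtain U where U: "open U" "\<phi> ` (?W \<inter> UNIV) = S \<inter> U" using C1_chart_image_openin[OF ch2] .
      have "p \<in> \<phi> ` (?W \<inter> UNIV)" using u ne by auto
      then have "p \<in> closure C" "p \<in> U" unfolding U(2) C(2) by auto
      then have "U \<inter> C \<noteq> {}" using open_Int_closure_eq_empty[OF U(1), of C] by blast
      then obtain q where q: "q \<in> C" "q \<in> U" by blast
      then have "q \<in> S \<inter> U" unfolding C(2) using closure_subset by blast
      then obtain v where v: "v \<in> ?W" "q = \<phi> v" unfolding U(2)[symmetric] by blast
      then have "g v = 2 * \<bar>H\<bar>" using g[of v] onC[OF q(1)] by simp
      then show False using v(1) by simp
    qed
    then show ?thesis using g[OF u(1)] u(2) by simp
  qed
  then have "compact_surface S (nn S) (2 * \<bar>H\<bar>)"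
    by (intro compact_surface.intro disc_face_subset(3)[OF S] corners[OF S] normal[OF S])
  then show ?thesis by (rule that)
qed

lemma disc_face_divergence:
  assumes S: "S \<in> disc_faces F R"
  shows "surface_integral S (surface_div S (tangential_part (nn S) X)) = integral\<^sup>L (len S) (flux S)"
    and "finite_measure (len S)" and "sets (len S) = sets borel" and "flux S \<in> borel_measurable borel"
    and "\<exists>K. \<forall>x. \<bar>flux S x\<bar> \<le> K" and "surface_boundary S \<subseteq> S" and "surface_boundary S \<in> sets borel"
proof -
  obtain h where "compact_surface S (nn S) h" using disc_face_compact_surface[OF S] .
  then interpret s: compact_surface S "nn S" h .
  have SO: "S \<subseteq> O'" using disc_face_subset(2)[OF S] O'(2) by blast
  have fl: "s.flux_integrand X = flux S" by (intro ext) (simp add: s.flux_integrand_def flux_def)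
  have "surface_integral S (surface_div S (tangential_part (nn S) X)) = integral\<^sup>L (area_measure S) (s.div_integrand X)"
    unfolding surface_integral_def set_lebesgue_integral_def s.div_integrand_def[abs_def] ..
  also have "\<dots> = integral\<^sup>L (len S) (flux S)"
    unfolding s.divergence_theorem[OF O'(1) SO O'(3)] fl ..
  finally show "surface_integral S (surface_div S (tangential_part (nn S) X)) = integral\<^sup>L (len S) (flux S)" .
  show "finite_measure (len S)" by (rule s.finite_len)
  show "sets (len S) = sets borel" by (rule s.sets_len)
  show "flux S \<in> borel_measurable borel" using s.flux_integrand_measurable[OF O'(3) SO] unfolding fl .
  show "surface_boundary S \<subseteq> S" by (rule s.B_subset)
  show "surface_boundary S \<in> sets borel" by (rule s.B_borel)
  obtain K where K: "K \<ge> 0" "\<And>x. x \<in> S \<Longrightarrow> norm (X x) \<le> K"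
    using C1_compact_bound[OF O'(3) s.compact_S SO] by metis
  have "\<bar>flux S x\<bar> \<le> K" for x
  proof (cases "x \<in> S")
    case True
    from s.flux_integrand_bound[where X=X and x=x and C=K] K(2)[OF True] show ?thesis unfolding fl by blast
  next
    case False
    then have "flux S x = 0" using s.B_subset by (auto simp: flux_def indicator_def)
    then show ?thesis using K(1) by simp
  qed
  then show "\<exists>K. \<forall>x. \<bar>flux S x\<bar> \<le> K" by blast
qed

lemma flux_integrable:
  assumes S: "S \<in> disc_faces F R" and S': "S' \<in> disc_faces F R" and B: "B \<in> sets borel"
  shows "set_integrable (len S) B (flux S')"
proof -
  interpret finite_measure "len S" by (rule disc_face_divergence(2)[OF S])
  obtain K where K: "\<And>x. \<bar>flux S' x\<bar> \<le> K" using disc_face_divergence(5)[OF S'] by blast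
  have m: "flux S' \<in> borel_measurable (len S)"
    using disc_face_divergence(4)[OF S'] measurable_cong_sets[OF disc_face_divergence(3)[OF S] refl] by blast
  have "integrable (len S) (flux S')" by (rule integrable_const_bound[of _ K]) (use K m in auto)
  then show ?thesis unfolding set_integrable_def
    by (rule integrable_mult_indicator[rotated]) (use B disc_face_divergence(3)[OF S] in simp)
qed

text \<open>The net outward flux of all pieces through a Borel set of space. As a set function it is
  additive, and the cancellation at the edges can be stated locally.\<close>

definition total :: "(real^3) set \<Rightarrow> real" where
  "total B = (\<Sum>S\<in>disc_faces F R. LINT x:B|len S. flux S x)"

text \<open>Vanishing is claimed for all Borel subsets of \<open>N\<close>, so that neighbourhoods
  of a countable cover may be made disjoint.\<close>

lemma edge_neighbourhood:
  assumes p: "p \<in> edge_points F" "p \<in> ball 0 R"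
  shows "\<exists>N. open N \<and> p \<in> N \<and> N \<subseteq> ball 0 R \<and> (\<forall>B\<in>sets borel. B \<subseteq> N \<longrightarrow> total B = 0)"
proof -
  obtain U \<Gamma> T where E: "edge_sheets F U \<Gamma> T" and pU: "p \<in> U" "p \<in> \<Gamma>" using p(1) by (auto simp: edge_points_iff)
  note basic = sheet_basic[OF E]
  obtain N P W and \<phi> :: "real^2 \<Rightarrow> real^3" where N: "open N" "p \<in> N" "N \<subseteq> ball 0 R \<inter> U"
    and P: "\<And>k. k < (3::nat) \<Longrightarrow> connected (P k) \<and> P k \<subseteq> A \<and> P k \<subseteq> T k
       \<and> T k \<inter> N \<subseteq> closure (P k) \<and> T k \<inter> N \<subseteq> P k \<union> \<Gamma> \<and> closure (T k) \<inter> N \<subseteq> T k"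
    and ch: "C1_chart boundary_line \<Gamma> W \<phi>" "smooth_on \<phi> W" "\<Gamma> \<inter> N \<subseteq> \<phi> ` (W \<inter> boundary_line)"
    by (rule edge_sheets_nbhd[OF E pU open_ball p(2)]) (rule that)
  have pN: "p \<in> T k \<inter> N" if "k < 3" for k using basic(6)[OF that] pU(2) N(2) by blast
  have "\<exists>C. C \<in> components A \<and> P k \<subseteq> C" if k: "k < 3" for k
  proof -
    have "p \<in> closure (P k)" using P[OF k] pN[OF k] by blast
    then have "P k \<noteq> {}" by auto
    then have "A \<noteq> {}" using P[OF k] by blast
    then show ?thesis using P[OF k] by (intro exists_component_superset) auto
  qed
  then obtain C where C: "\<And>k. k < 3 \<Longrightarrow> C k \<in> components A \<and> P k \<subseteq> C k" by metis
  define D where "D k = closure (C k)" for k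
  have D: "D k \<in> disc_faces F R" if "k < 3" for k using disc_faceI C[OF that] by (simp add: D_def)
  have TD: "T k \<inter> N \<subseteq> D k" if "k < 3" for k
    using P[OF that] closure_mono[of "P k" "C k"] C[OF that] unfolding D_def by blast
  \<comment> \<open>A single piece containing two of the sheets would not have a planar tangent cone at p.\<close>
  have inj: "j = k" if jk: "j < 3" "k < 3" "D j = D k" for j k
  proof (rule ccontr)
    assume ne: "j \<noteq> k"
    have "p \<in> D k" using TD[OF jk(2)] pN[OF jk(2)] by blast
    then obtain L :: "real^2 \<Rightarrow> real^3" where L: "linear L" "tangent_cone (D k) p \<subseteq> range L"
      using surface_with_corners_cone[OF corners[OF D[OF jk(2)]]] by metis
    have "tangent_cone (T i) p \<subseteq> range L" if i: "i < 3" "D i = D k" for i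
    proof -
      have "tangent_cone (T i) p \<subseteq> tangent_cone (D i) p"
        by (rule tangent_cone_local_subset[OF N(1,2) TD[OF i(1)]])
      then show ?thesis using L(2) i(2) by simp
    qed
    from sheets_not_in_plane[OF E pU(2) jk(1,2) ne L(1) this[OF jk(1,3)] this[OF jk(2) refl]] show False .
  qed
  \<comment> \<open>A component that enters \<open>N\<close> does so in a regular point, which lies
    on one of the sheets off the edge; so it is one of the three components
    \<open>C k\<close>.\<close>
  have meets: "\<exists>k<3. x \<in> P k \<and> C' = C k" if x: "x \<in> C'" "x \<in> N" and C': "C' \<in> components A" for x C'
  proof -
    have xA: "x \<in> A" using in_components_subset[OF C'] x(1) by blast
    then have "x \<in> F \<inter> U" using x(2) N(3) regular_points_subset by blast
    then obtain k where k: "k < 3" "x \<in> T k" unfolding basic(2) by blast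
    have "x \<notin> \<Gamma>"
    proof
      assume "x \<in> \<Gamma>"
      then have "x \<in> edge_points F" using E x(2) N(3) unfolding edge_points_iff by blast
      then show False using xA edge_points_not_regular by blast
    qed
    then have xP: "x \<in> P k" using P[OF k(1)] k(2) x(2) by blast
    then have "C' \<inter> C k \<noteq> {}" using C[OF k(1)] x(1) by blast
    then have "C' = C k" using components_eq[OF C', of "C k"] C[OF k(1)] by simp
    then show ?thesis using k(1) xP by blast
  qed
  have other: "S \<inter> N = {}" if S: "S \<in> disc_faces F R" "S \<notin> D ` {..<3}" for S
  proof (rule ccontr)
    assume ne: "S \<inter> N \<noteq> {}"
    obtain C' where C': "C' \<in> components A" "S = closure C'" using disc_faceE[OF S(1)] .
    then have "N \<inter> C' \<noteq> {}" using ne open_Int_closure_eq_empty[OF N(1), of C'] by blast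
    then obtain x where "x \<in> C'" "x \<in> N" by blast
    from meets[OF this C'(1)] obtain k where "k < 3" "C' = C k" by blast
    then show False using S(2) C'(2) by (auto simp: D_def)
  qed
  \<comment> \<open>Distinctness of the pieces is essential for the inclusion into the sheet: within
    \<open>N\<close> the component \<open>C k\<close> meets no other \<open>P j\<close>.\<close>
  have DT: "D k \<inter> N = T k \<inter> N" if k: "k < 3" for k
  proof
    have "C k \<inter> N \<subseteq> T k"
    proof
      fix y assume y: "y \<in> C k \<inter> N"
      then obtain j where j: "j < 3" "y \<in> P j" "C k = C j" using meets[of y "C k"] C[OF k] by blast
      then have "j = k" by (intro inj k) (simp_all add: D_def)
      then show "y \<in> T k" using j(2) P[OF k] by blast
    qed
    then have "closure (C k \<inter> N) \<subseteq> closure (T k)" by (rule closure_mono)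
    moreover have "N \<inter> closure (C k) \<subseteq> closure (N \<inter> C k)" by (rule open_Int_closure_subset[OF N(1)])
    ultimately show "D k \<inter> N \<subseteq> T k \<inter> N" using P[OF k] unfolding D_def by (auto simp: Int_commute)
  qed (use TD[OF k] in blast)
  have bd: "surface_boundary (D k) \<inter> N = \<Gamma> \<inter> N" if k: "k < 3" for k
    using surface_boundary_local_Int[OF N(1) DT[OF k]] basic(5)[OF k] by simp
  have con: "outward_conormal (D k) x = outward_conormal (T k) x" if "k < 3" "x \<in> N" for k x
    by (rule outward_conormal_local[OF N(1) that(2) DT[OF that(1)]])
  \<comment> \<open>The boundary of a piece is closed, and in \<open>N\<close> it is
    \<open>\<Gamma>\<close>. Measurability is obtained for this trace of \<open>\<Gamma>\<close>,
    which is the set used in the comparison of lengths.\<close>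
  have \<Gamma>: "\<Gamma> \<inter> N \<in> sets borel"
    using disc_face_divergence(7)[OF D[of 0]] N(1) bd[of 0, symmetric] by simp
  have len_eq: "emeasure (len (D k)) B = emeasure (len (D 0)) B" if k: "k < 3" and B: "B \<in> sets borel" "B \<subseteq> N" for k B
  proof -
    have *: "emeasure (arc_length_measure (\<Gamma> \<inter> N)) B = emeasure (len (D i)) B" if i: "i < 3" for i
    proof (rule arc_length_measure_local[OF \<Gamma> disc_face_divergence(7)[OF D[OF i]] N(1) _ _ _ _ B])
      show "\<Gamma> \<inter> N \<inter> N = surface_boundary (D i) \<inter> N" using bd[OF i] by simp
      show "C1_chart boundary_line (\<Gamma> \<inter> N) (W \<inter> \<phi> -` N) \<phi>" by (rule C1_chart_localize[OF ch(1) N(1)]) simp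
      show "smooth_on \<phi> (W \<inter> \<phi> -` N)" by (rule smooth_on_subset[OF ch(2)]) blast
      show "\<Gamma> \<inter> N \<inter> N \<subseteq> \<phi> ` (W \<inter> \<phi> -` N \<inter> boundary_line)" using ch(3) by blast
    qed
    from *[OF k] *[of 0] show ?thesis by simp
  qed
  have "total B = 0" if B: "B \<in> sets borel" "B \<subseteq> N" for B
  proof -
    have "total B = (\<Sum>S\<in>D ` {..<3}. LINT x:B|len S. flux S x)" unfolding total_def
    proof (rule sum.mono_neutral_right[OF finite_disc])
      show "D ` {..<3} \<subseteq> disc_faces F R" using D by auto
      show "\<forall>S\<in>disc_faces F R - D ` {..<3}. (LINT x:B|len S. flux S x) = 0"
      proof
        fix S assume S: "S \<in> disc_faces F R - D ` {..<3}"
        then have "S \<inter> N = {}" using other by blast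
        moreover have "surface_boundary S \<subseteq> S" using disc_face_divergence(6) S by blast
        ultimately have "(\<lambda>x. indicator B x *\<^sub>R flux S x) = (\<lambda>x. 0)" using B(2) by (intro ext) (auto simp: indicator_def flux_def)
        then show "(LINT x:B|len S. flux S x) = 0" unfolding set_lebesgue_integral_def by simp
      qed
    qed
    also have "\<dots> = (\<Sum>k<3. LINT x:B|len (D k). flux (D k) x)"
    proof -
      have "inj_on D {..<3}" by (rule inj_onI, rule inj) auto
      from sum.reindex[OF this] show ?thesis by (simp only: comp_def)
    qed
    \<comment> \<open>All three integrals are moved to one measure, so that the integrands can be
      added pointwise and the sum of the conormals appears.\<close>
    also have "\<dots> = (\<Sum>k<3. LINT x:B|len (D 0). flux (D k) x)"
    proof (rule sum.cong[OF refl])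
      fix k :: nat assume "k \<in> {..<3}"
      then have k: "k < 3" by simp
      show "(LINT x:B|len (D k). flux (D k) x) = (LINT x:B|len (D 0). flux (D k) x)"
        unfolding set_lebesgue_integral_def
        by (rule integral_eq_on[OF disc_face_divergence(3)[OF D[OF k]] disc_face_divergence(3)[OF D[of 0]] B(1)])
          (use len_eq[OF k] B(2) in auto)
    qed
    also have "\<dots> = (\<integral>x. (\<Sum>k<3. indicator B x *\<^sub>R flux (D k) x) \<partial>len (D 0))"
      unfolding set_lebesgue_integral_def
      by (rule Bochner_Integration.integral_sum[symmetric])
        (use flux_integrable[OF D D B(1)] in \<open>simp add: set_integrable_def\<close>)
    also have "(\<lambda>x. \<Sum>k<3. indicator B x *\<^sub>R flux (D k) x) = (\<lambda>x. 0)"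
    proof
      fix x
      show "(\<Sum>k<3. indicator B x *\<^sub>R flux (D k) x) = 0"
      proof (cases "x \<in> B")
        case True
        then have xN: "x \<in> N" using B(2) by blast
        have bx: "x \<in> surface_boundary (D k) \<longleftrightarrow> x \<in> \<Gamma>" if "k < 3" for k using bd[OF that] xN by blast
        have "(\<Sum>k<3. indicator B x *\<^sub>R flux (D k) x) = (\<Sum>k<3. indicator \<Gamma> x * (X x \<bullet> outward_conormal (T k) x))"
          by (rule sum.cong[OF refl]) (use True bx con xN in \<open>simp add: flux_def indicator_def\<close>)
        also have "\<dots> = indicator \<Gamma> x * (X x \<bullet> (\<Sum>k<3. outward_conormal (T k) x))"
          by (simp add: inner_sum_right sum_distrib_left)
        also have "\<dots> = 0" using sheet_conormal_sum[OF E, of x] by (simp add: indicator_def)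
        finally show ?thesis .
      qed simp
    qed
    finally show ?thesis by simp
  qed
  then show ?thesis using N by blast
qed

lemma total_Un:
  assumes "B \<in> sets borel" "B' \<in> sets borel" "B \<inter> B' = {}"
  shows "total (B \<union> B') = total B + total B'"
  unfolding total_def sum.distrib[symmetric]
proof (rule sum.cong[OF refl])
  fix S assume S: "S \<in> disc_faces F R"
  show "(LINT x:B \<union> B'|len S. flux S x) = (LINT x:B|len S. flux S x) + (LINT x:B'|len S. flux S x)"
    by (rule set_integral_Un[OF assms(3) flux_integrable[OF S S assms(1)] flux_integrable[OF S S assms(2)]])
qed

text \<open>Countably many of the neighbourhoods cover the edge points in the ball. What remains of
  the piece boundaries there lies in the countable exceptional set, which is null for arc
  length.\<close>

lemma total_ball: "total (ball 0 R) = 0"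
proof -
  define Ed where "Ed = edge_points F \<inter> ball 0 R"
  define good where "good N \<longleftrightarrow> open N \<and> N \<subseteq> ball 0 R \<and> (\<forall>B\<in>sets borel. B \<subseteq> N \<longrightarrow> total B = 0)" for N
  have "\<forall>p\<in>Ed. \<exists>N. p \<in> N \<and> good N" 
  proof
    fix p assume "p \<in> Ed"
    then show "\<exists>N. p \<in> N \<and> good N" using edge_neighbourhood[of p] unfolding Ed_def good_def by auto
  qed
  then obtain N where N: "\<And>p. p \<in> Ed \<Longrightarrow> p \<in> N p \<and> good (N p)" by metis
  then have "\<And>V. V \<in> N ` Ed \<Longrightarrow> open V" by (auto simp: good_def)
  then obtain \<G> where G: "\<G> \<subseteq> N ` Ed" "countable \<G>" "\<Union>\<G> = \<Union>(N ` Ed)" by (rule Lindelof)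
  \<comment> \<open>The empty set pads the countable cover to a sequence, also when there are no
    edge points at all.\<close>
  have g0: "good {}" by (simp add: good_def total_def set_lebesgue_integral_def)
  define M where "M = from_nat_into (insert {} \<G>)"
  have rM: "range M = insert {} \<G>" unfolding M_def using G(2) by (intro range_from_nat_into) auto
  have gM: "good (M k)" for k
  proof -
    have "M k \<in> insert {} \<G>" using rM by blast
    then show ?thesis using g0 G(1) N by auto
  qed
  define Q where "Q m = (\<Union>k<m. M k)" for m :: nat
  have Qb: "Q m \<in> sets borel" for m
    unfolding Q_def by (rule borel_open) (use gM in \<open>auto simp: good_def\<close>)
  have Q0: "total (Q m) = 0" for m
  proof (induction m)
    case 0
    then show ?case using g0 by (simp add: Q_def good_def)
  next
    case (Suc m)
    have "Q (Suc m) = Q m \<union> (M m - Q m)" by (auto simp: Q_def lessThan_Suc)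
    moreover have Mb: "M m \<in> sets borel" using gM[of m] by (simp add: good_def borel_open)
    moreover have "total (M m - Q m) = 0" using gM[of m] Mb Qb[of m] by (auto simp: good_def)
    ultimately show ?case using total_Un[of "Q m" "M m - Q m"] Qb[of m] Suc.IH by auto
  qed
  have UQ: "(\<Union>m. Q m) = \<Union>(N ` Ed)"
  proof -
    have "(\<Union>m. Q m) = \<Union>(range M)" unfolding Q_def by auto
    then show ?thesis using rM G(3) by simp
  qed
  define V where "V = (\<Union>m. Q m)"
  have Vb: "V \<in> sets borel" unfolding V_def using Qb by blast
  \<comment> \<open>Finite unions of the cover have net flux 0, and dominated convergence along the
    increasing unions carries this to \<open>V\<close>.\<close>
  have "(\<lambda>m. total (Q m)) \<longlonglongrightarrow> total V" unfolding total_def V_def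
  proof (rule tendsto_sum, rule set_integral_cont_up)
    fix S m assume S: "S \<in> disc_faces F R"
    show "Q m \<in> sets (len S)" using Qb disc_face_divergence(3)[OF S] by simp
    show "incseq Q" unfolding incseq_def Q_def by (intro allI impI UN_mono) auto
    show "set_integrable (len S) (\<Union>m. Q m) (flux S)" using flux_integrable[OF S S Vb] unfolding V_def .
  qed
  then have V0: "total V = 0" using Q0 by (simp add: LIMSEQ_const_iff)
  have EV: "Ed \<subseteq> V" unfolding V_def UQ using N by blast
  have VB: "V \<subseteq> ball 0 R" unfolding V_def UQ using N by (auto simp: good_def)
  have "total (ball 0 R - V) = 0" unfolding total_def
  proof (rule sum.neutral, rule ballI)
    fix S assume S: "S \<in> disc_faces F R"
    let ?Z = "F - (regular_points F \<union> edge_points F)"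
    have "countable ?Z" by (rule exceptional_points_countable) (use foam_F in \<open>simp add: foam_def\<close>)
    then have "(\<Union>x\<in>?Z. {x}) \<in> null_sets (len S)"
    proof (rule null_sets_UN')
      fix x
      show "{x} \<in> null_sets (len S)"
        using arc_length_singleton[OF disc_face_divergence(7)[OF S]] disc_face_divergence(3)[OF S] by (simp add: null_sets_def)
    qed
    then have "AE x in len S. x \<notin> ?Z" using AE_not_in[of "\<Union>x\<in>?Z. {x}" "len S"] by simp
    moreover have "indicator (ball 0 R - V) x *\<^sub>R flux S x = 0" if "x \<notin> ?Z" for x
    proof (rule ccontr)
      assume "indicator (ball 0 R - V) x *\<^sub>R flux S x \<noteq> 0"
      then have "x \<in> ball 0 R - V" "x \<in> surface_boundary S" by (auto simp: indicator_def flux_def split: if_splits)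
      then show False using disc_face_boundary[OF S] that EV unfolding Ed_def by blast
    qed
    ultimately have "AE x in len S. indicator (ball 0 R - V) x *\<^sub>R flux S x = 0" by (auto elim: eventually_mono)
    then show "(LINT x:ball 0 R - V|len S. flux S x) = 0"
      unfolding set_lebesgue_integral_def by (rule integral_eq_zero_AE)
  qed
  moreover have "total (V \<union> (ball 0 R - V)) = total V + total (ball 0 R - V)"
    by (rule total_Un) (use Vb in auto)
  moreover have "V \<union> (ball 0 R - V) = ball 0 R" using VB by blast
  ultimately show ?thesis using V0 by simp
qed

text \<open>The boundary flux of every piece splits into a part in the open ball, where the total
  vanishes, and a part on the sphere.\<close>

lemma disc_divergence:
  "(\<Sum>S\<in>disc_faces F R. surface_integral S (surface_div S (tangential_part (nn S) X))) =
   (\<Sum>S\<in>disc_faces F R. LINT x:S \<inter> sphere 0 R|len S. X x \<bullet> outward_conormal S x)"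
proof -
  have bs: "ball 0 R \<union> sphere 0 R = cball (0::real^3) R" "ball 0 R \<inter> sphere 0 R = ({} :: (real^3) set)" by auto
  have "(\<Sum>S\<in>disc_faces F R. surface_integral S (surface_div S (tangential_part (nn S) X))) = total (cball 0 R)"
    unfolding total_def
  proof (rule sum.cong[OF refl])
    fix S assume S: "S \<in> disc_faces F R"
    have "(\<lambda>x. indicator (cball 0 R) x *\<^sub>R flux S x) = flux S"
      using disc_face_subset(2)[OF S] disc_face_divergence(6)[OF S] by (intro ext) (auto simp: indicator_def flux_def)
    then show "surface_integral S (surface_div S (tangential_part (nn S) X)) = (LINT x:cball 0 R|len S. flux S x)"
      unfolding disc_face_divergence(1)[OF S] set_lebesgue_integral_def by simp
  qed
  also have "\<dots> = total (ball 0 R) + total (sphere 0 R)"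
    unfolding bs(1)[symmetric] by (rule total_Un) (use bs(2) in auto)
  also have "\<dots> = total (sphere 0 R)" by (simp add: total_ball)
  also have "\<dots> = (\<Sum>S\<in>disc_faces F R. LINT x:S \<inter> sphere 0 R|len S. X x \<bullet> outward_conormal S x)"
    unfolding total_def
  proof (rule sum.cong[OF refl])
    fix S assume S: "S \<in> disc_faces F R"
    \<comment> \<open>The right side integrates over all of the piece on the sphere, not only over
      its boundary; at the additional regular points the conormal has its default value 0.\<close>
    have "indicator (sphere 0 R) x *\<^sub>R flux S x = indicator (S \<inter> sphere 0 R) x *\<^sub>R (X x \<bullet> outward_conormal S x)" for x
    proof (cases "x \<in> S \<and> x \<notin> surface_boundary S")
      case True
      then have "x \<in> regular_points S" by (simp add: surface_boundary_def)
      then show ?thesis by (simp add: flux_def outward_conormal_regular)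
    next
      case False
      then show ?thesis using disc_face_divergence(6)[OF S] by (auto simp: flux_def indicator_def)
    qed
    then show "(LINT x:sphere 0 R|len S. flux S x) = (LINT x:S \<inter> sphere 0 R|len S. X x \<bullet> outward_conormal S x)"
      unfolding set_lebesgue_integral_def by presburger
  qed
  finally show ?thesis .
qed

end

theorem theorem3p1:
  fixes F :: "(real^3) set" and R :: real and X :: "real^3 \<Rightarrow> real^3"
    and n :: "(real^3) set \<Rightarrow> real^3 \<Rightarrow> real^3"
  assumes "foam F" and "0 \<in> F" and "0 < R"
    and transversal: "\<forall>e\<in>edges F. \<forall>p\<in>e \<inter> sphere 0 R. transversal_at e (sphere 0 R) p"
    and finite_faces: "finite (disc_faces F R)"
    and face_pieces: "\<forall>S\<in>disc_faces F R. surface_with_corners S"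
    and normals: "\<forall>S\<in>disc_faces F R. unit_normal_field S (n S)"
    and smooth: "smooth_upto X (cball 0 R)"
  shows "(\<Sum>S\<in>disc_faces F R. surface_integral S (surface_div S (tangential_part (n S) X))) =
         (\<Sum>S\<in>disc_faces F R.
            LINT x:S \<inter> sphere 0 R|arc_length_measure (surface_boundary S).
              X x \<bullet> outward_conormal S x)"
proof -
  \<comment> \<open>The field is replaced by its smooth extension \<open>g\<close>, which agrees
    with \<open>X\<close> on the closed ball. The pieces lie in this ball, and the divergence is
    formed within them, so both sides of the identity are unchanged.\<close>
  obtain U g where g: "open U" "cball 0 R \<subseteq> U" "smooth_on g U" "\<And>x. x \<in> cball 0 R \<Longrightarrow> g x = X x"
    using smooth by (auto simp: smooth_upto_def)
  interpret foam_disc F R n g U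
    by unfold_locales (use assms(1) finite_faces face_pieces normals g(1,2) smooth_on_C1[OF g(3)] in auto)
  have gX: "g x = X x" if "S \<in> disc_faces F R" "x \<in> S" for S x
    using g(4) disc_face_subset(2)[OF that(1)] that(2) by blast
  have "surface_integral S (surface_div S (tangential_part (n S) g)) = surface_integral S (surface_div S (tangential_part (n S) X))"
    if S: "S \<in> disc_faces F R" for S
  proof -
    have "indicator (regular_points S) x *\<^sub>R surface_div S (tangential_part (n S) g) x =
        indicator (regular_points S) x *\<^sub>R surface_div S (tangential_part (n S) X) x" for x
    proof (cases "x \<in> regular_points S")
      case True
      then have "x \<in> S" using regular_points_subset by blast
      then have "surface_div S (tangential_part (n S) g) x = surface_div S (tangential_part (n S) X) x"
        by (intro surface_div_cong) (simp_all add: tangential_part_def gX[OF S])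
      then show ?thesis by simp
    qed simp
    then show ?thesis unfolding surface_integral_def set_lebesgue_integral_def by presburger
  qed
  moreover have "(LINT x:S \<inter> sphere 0 R|len S. g x \<bullet> outward_conormal S x) = (LINT x:S \<inter> sphere 0 R|len S. X x \<bullet> outward_conormal S x)"
    if S: "S \<in> disc_faces F R" for S
  proof -
    have "indicator (S \<inter> sphere 0 R) x *\<^sub>R (g x \<bullet> outward_conormal S x) = indicator (S \<inter> sphere 0 R) x *\<^sub>R (X x \<bullet> outward_conormal S x)" for x
      using gX[OF S, of x] by (simp add: indicator_def)
    then show ?thesis unfolding set_lebesgue_integral_def by presburger
  qed
  ultimately show ?thesis using disc_divergence by simp
qed

end
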